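(* Let $P\subset\mathbb{R}^n$ be a convex polytope of dimension $n$ containing the origin in its interior. Then, as $R\to\infty$, $$\omega_n\operatorname{Vol}_P\big(B_P(R)\big)=c_0(P)R^n+c_1(P)R^{n-1}+o(R^{n-1}),$$ where $$c_0(P)=\frac{|\operatorname{Flags}(P)|}{(n!)^2}\qquad\text{and}\qquad c_1(P)=\frac{n}{(n!)^2}\sum_{f\in\operatorname{Flags}(P)}\log\Big(1-\big\langle (rf)_{n-1},f_0\big\rangle\Big).$$ Here the facet $(rf)_{n-1}$ of $P$ is identified with the associated vertex of the polar polytope $P^\circ$, and $f_0$ is regarded as a point of $\mathbb{R}^n$.
   Context: For a convex body $K\subset\mathbb{R}^n$ (compact, convex, nonempty interior) and $x\in\operatorname{int}K$, let $K^x:=(K-x)^\circ=\{\xi:\langle\xi,y-x\rangle\le 1\ \text{for all } y\in K\}$. The forward Funk metric ball of radius $R>0$ centered at $x\in\operatorname{int}K$ is $B_K(x,R):=x+(1-e^{-R})(K-x)$, and $B_K(R):=B_K(0,R)$. The Holmes--Thompson volume of the Funk geometry on $K$ is $\operatorname{Vol}_K(U):=\frac{1}{\omega_n}\int_U|K^x|\,dx$ for Borel $U\subset\operatorname{int}K$, where $|\cdot|$ is Lebesgue measure and $\omega_n$ is the volume of the Euclidean unit ball in $\mathbb{R}^n$. A flag of $P$ is a sequence $f=(f_0,\dots,f_n)$ of faces of $P$ with $\dim f_i=i$ and $f_i\subset f_{i+1}$ (so $f_n=P$; put $f_{-1}=\emptyset$); $\operatorname{Flags}(P)$ is the set of flags.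 For $i\in\{0,\dots,n-1\}$ and a flag $f$, $r_if$ denotes the unique flag that differs from $f$ exactly in its $i$-dimensional face: by the diamond property there are exactly two $i$-dimensional faces $G$ with $f_{i-1}\subset G\subset f_{i+1}$, and $r_i$ replaces $f_i$ by the other one. The complete flip is $r:=r_{n-1}\circ\cdots\circ r_0$ (so $r_0$ is applied first). A facet $F$ of $P$ corresponds to the vertex $q$ of $P^\circ=\{\xi:\langle\xi,y\rangle\le1\ \forall y\in P\}$ with $F=\{y\in P:\langle q,y\rangle=1\}$. *)

theory Defs
  imports "HOL-Analysis.Analysis" "HOL-Library.Landau_Symbols"
begin

definition polar :: "'a::real_inner set \<Rightarrow> 'a set" where
  "polar K = {\<xi>. \<forall>y\<in>K. \<xi> \<bullet> y \<le> 1}"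

definition polar_at :: "'a::real_inner set \<Rightarrow> 'a \<Rightarrow> 'a set" where
  "polar_at K x = polar ((\<lambda>y. y - x) ` K)"

definition funk_ball :: "'a::real_vector set \<Rightarrow> 'a \<Rightarrow> real \<Rightarrow> 'a set" where
  "funk_ball K x R = (\<lambda>y. x + (1 - exp (- R)) *\<^sub>R (y - x)) ` K"

text \<open>The Holmes-Thompson volume of the Funk geometry. It is extended-real valued, since it
  may be infinite (for instance on the whole interior of \<^term>\<open>K\<close>). It is meant for Borel
  subsets of the interior of the convex body \<^term>\<open>K\<close>.\<close>

definition funk_vol :: "'a::euclidean_space set \<Rightarrow> 'a set \<Rightarrow> ennreal" where
  "funk_vol K U =
     (\<integral>\<^sup>+x\<in>U. emeasure lborel (polar_at K x) \<partial>lborel) / emeasure lborel (ball (0::'a) 1)"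

text \<open>A flag is the list of its faces, ordered by dimension: \<^term>\<open>f ! i\<close> has dimension
  \<^term>\<open>i\<close>. The improper face \<^term>\<open>P\<close> is included as the last entry.\<close>

definition flags :: "(real^'n) set \<Rightarrow> (real^'n) set list set" where
  "flags P = {f. length f = Suc CARD('n) \<and>
     (\<forall>i\<le>CARD('n). f ! i face_of P \<and> aff_dim (f ! i) = int i) \<and>
     (\<forall>i<CARD('n). f ! i \<subseteq> f ! Suc i)}"

text \<open>Existence and uniqueness of the flag described below, for \<open>i < CARD('n)\<close> and a
  full-dimensional polytope \<^term>\<open>P\<close>, is the diamond property of the face lattice.\<close>

definition flag_flip :: "(real^'n) set \<Rightarrow> nat \<Rightarrow> (real^'n) set list \<Rightarrow> (real^'n) set list" where
  "flag_flip P i f =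
     (THE g. g \<in> flags P \<and> g ! i \<noteq> f ! i \<and> (\<forall>j\<le>CARD('n). j \<noteq> i \<longrightarrow> g ! j = f ! j))"

text \<open>\<^const>\<open>fold\<close> runs through the list from the left, so the flip in dimension 0 comes first.\<close>

definition complete_flip :: "(real^'n) set \<Rightarrow> (real^'n) set list \<Rightarrow> (real^'n) set list" where
  "complete_flip P f = fold (flag_flip P) [0..<CARD('n)] f"

definition facet_vertex :: "'a::euclidean_space set \<Rightarrow> 'a set \<Rightarrow> 'a" where
  "facet_vertex P F = (THE q. q extreme_point_of polar P \<and> F = {y\<in>P. q \<bullet> y = 1})"

end

theory Submission
  imports Defs "HOL-Real_Asymp.Real_Asymp"
begin

text \<open>The volume is first written as a finite sum of explicit integrals, one for each pair of flags, and
these integrals are then expanded.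

Every nonempty face \<open>E\<close> gets a point \<open>p\<^sub>E\<close> of its relative interior (\<open>face_center\<close>, the origin for \<open>E = P\<close>)
and every proper face \<open>F\<close> a functional \<open>b\<^sub>F \<le> 1\<close> on \<open>P\<close> that takes the value 1 exactly on \<open>F\<close>
(\<open>face_normal\<close>, zero for \<open>F = {}\<close>). The cones spanned by the points \<open>p\<close> along a flag tile the
space, and so do the cones spanned by the functionals \<open>b\<close> along a flag; that they cover is
\<open>primal_cover\<close> and \<open>dual_cover\<close>, that they do not overlap is \<open>chain_combination_unique\<close>. For \<open>x\<close>
in the ball, the polar body at \<open>x\<close> is therefore cut into the simplices with vertices \<open>0\<close> and
\<open>b / (1 - b \<bullet> x)\<close>, which makes its volume an explicit function of \<open>x\<close> (\<open>emeasure_polar_at\<close>). This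
function is integrated over the simplices that make up the ball, each of which is parametrised by
\<open>real^'n\<close> with the softmax map. With \<open>l = 1 - exp (- R)\<close>, \<open>z\<close> extended by \<open>z\<^sub>n = 0\<close> and the slacks
\<open>A\<^sub>i\<^sub>k = 1 - b \<bullet> p\<close> of \<open>p\<close> at \<open>f\<^sub>i\<close> and \<open>b\<close> at \<open>g\<^sub>k\<^sub>-\<^sub>1\<close>, the volume is \<open>l\<^sup>n / n!\<close> times the sum over
all pairs of flags \<open>f, g\<close> of the determinant of the numbers \<open>p \<bullet> b\<close>, in absolute value, times the
integral of the product over \<open>k \<le> n\<close> of
\<open>exp (- z\<^sub>k) / (\<Sum>i\<le>n. exp (- z\<^sub>i) * (exp (- R) + l * A\<^sub>i\<^sub>k))\<close> (\<open>funk_volume_sum\<close>).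

A slack \<open>A\<^sub>i\<^sub>k\<close> is nonnegative and vanishes exactly if \<open>f\<^sub>i \<subseteq> g\<^sub>k\<^sub>-\<^sub>1\<close>. If \<open>f = g\<close>, the matrix is lower
triangular, and up to negligible terms the integrand is a product of functions of one gap each,
the gaps being \<open>z\<^sub>k\<^sub>+\<^sub>1 - z\<^sub>k\<close> for \<open>k < n\<close> and \<open>R + z\<^sub>0\<close>. These \<open>n + 1\<close> gaps add up to \<open>R\<close>, so the
integral is an iterated convolution at \<open>R\<close> of \<open>n + 1\<close> perturbed step functions; it has a leading
term in \<open>R\<^sup>n / n!\<close>, given by the heights of the steps, and a second term that only depends on the
total masses of the perturbations (\<open>conv_chain_asymp\<close>), which are logarithms of quotients of slacks
(\<open>step_kernel_logistic\<close>). Each dimension in which \<open>f\<close> and \<open>g\<close> differ replaces one step function by an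
integrable bump and thus costs a power of \<open>R\<close>. Adjacent flags contribute to \<open>R\<^sup>n\<^sup>-\<^sup>1\<close> a single
logarithm (\<open>step_kernel_bump\<close>), and flags that differ in two or more dimensions contribute
nothing. The determinant cancels the denominators in these contributions
(\<open>frame_vol_mult_slack\<close>), so that each pair \<open>f = g\<close> contributes exactly \<open>R\<^sup>n / n!\<close> to the leading
order. This gives \<open>c0\<close>.

In the next order, the logarithms of the slacks of \<open>f\<close> against itself cancel between the pair
\<open>(f, f)\<close> and the pairs of \<open>f\<close> with its neighbours, and
\<open>ln (A (f\<^sub>i, (r\<^sub>i f)\<^sub>i) / A (f\<^sub>i\<^sub>+\<^sub>1, (r\<^sub>i f)\<^sub>i))\<close>, summed over \<open>i < n\<close>, remains (\<open>flags_row_limit\<close>). In the sum over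
all flags, the \<open>i\<close>-th term may be reindexed by the bijection that carries out the flips in dimensions below
\<open>i\<close>; it leaves \<open>f\<^sub>i\<close> and \<open>f\<^sub>i\<^sub>+\<^sub>1\<close> alone and turns \<open>(r\<^sub>i f)\<^sub>i\<close> into the \<open>i\<close>-th face of the complete flip
\<open>h\<close> of \<open>f\<close>. On \<open>f\<^sub>i\<^sub>+\<^sub>1\<close>, the affine functions \<open>1 - b\<close> of \<open>h\<^sub>i\<close> and of the facet \<open>h\<^sub>n\<^sub>-\<^sub>1\<close> both vanish on the
facet \<open>h\<^sub>i\<close> of \<open>f\<^sub>i\<^sub>+\<^sub>1\<close> and are therefore proportional (\<open>slack_proportional\<close>). So \<open>h\<^sub>i\<close> may be
replaced by \<open>h\<^sub>n\<^sub>-\<^sub>1\<close> in the quotient, and the sum over \<open>i\<close> telescopes to the logarithm of the slack of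
\<open>f\<^sub>0\<close> against \<open>h\<^sub>n\<^sub>-\<^sub>1\<close> (\<open>sum_flip_step\<close>). This gives \<open>c1\<close>.\<close>

section \<open>Convolution of perturbed step functions\<close>

lemma integrable_exp_neg_abs:
  assumes "(c::real) > 0"
  shows "integrable lborel (\<lambda>y. exp (- c * \<bar>y\<bar>))"
proof -
  have *: "integrable lborel (\<lambda>y. exp (- c * y) * indicator {0..} y)"
  proof (rule integrableI_nn_integral_finite)
    have "(\<integral>\<^sup>+y. ennreal (exp (- c * y)) * indicator {0..} y \<partial>lborel) = 0 - (- exp (- c * 0) / c)"
    proof (rule nn_integral_FTC_atLeast)
      fix x :: real
      show "((\<lambda>x. - exp (- c * x) / c) has_real_derivative exp (- c * x)) (at x)"
        using assms by (auto intro!: derivative_eq_intros)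
      show "((\<lambda>x. - exp (- c * x) / c) \<longlongrightarrow> 0) at_top"
        using assms by real_asymp
    qed auto
    then show "(\<integral>\<^sup>+y. ennreal (exp (- c * y) * indicator {0..} y) \<partial>lborel) = ennreal (1 / c)"
      by (simp add: ennreal_mult' ennreal_indicator)
  qed auto
  have **: "integrable lborel (\<lambda>y. exp (- c * - y) * indicator {0..} (- y))"
    using lborel_integrable_real_affine[OF *, of "-1" 0] by simp
  show ?thesis
    by (rule Bochner_Integration.integrable_bound[OF Bochner_Integration.integrable_add[OF * **]])
       (auto simp: indicator_def abs_if)
qed

lemma one_plus_abs_power_le_exp:
  assumes "(c::real) > 0"
  shows "\<exists>K>0. \<forall>y::real. (1 + \<bar>y\<bar>) ^ a \<le> K * exp (c * \<bar>y\<bar>)"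
proof -
  define d where "d = max 1 (real a / c)"
  have d: "d \<ge> 1" "real a / d \<le> c"
    using assms by (auto simp: d_def field_simps max_def)
  show ?thesis
  proof (intro exI[of _ "d ^ a"] conjI allI)
    fix y :: real
    have "1 + \<bar>y\<bar> \<le> d * (1 + \<bar>y\<bar> / d)" using d by (simp add: field_simps)
    also have "\<dots> \<le> d * exp (\<bar>y\<bar> / d)" using d by (intro mult_left_mono exp_ge_add_one_self) auto
    finally have "(1 + \<bar>y\<bar>) ^ a \<le> (d * exp (\<bar>y\<bar> / d)) ^ a" by (intro power_mono) auto
    also have "\<dots> = d ^ a * exp (real a / d * \<bar>y\<bar>)"
      by (simp add: power_mult_distrib exp_of_nat_mult[symmetric])
    also have "\<dots> \<le> d ^ a * exp (c * \<bar>y\<bar>)"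
      using d mult_right_mono[OF d(2), of "\<bar>y\<bar>"] by (intro mult_left_mono) auto
    finally show "(1 + \<bar>y\<bar>) ^ a \<le> d ^ a * exp (c * \<bar>y\<bar>)" .
  qed (use d in auto)
qed

definition conv :: "(real \<Rightarrow> real) \<Rightarrow> (real \<Rightarrow> real) \<Rightarrow> real \<Rightarrow> real" where
  "conv F \<phi> x = (LINT y|lborel. F (x - y) * \<phi> y)"

text \<open>A perturbation of \<open>\<alpha>\<close> times the Heaviside function; \<open>m\<close> is the total mass of the perturbation. The
two leading terms of an iterated convolution depend on the kernels only through \<open>\<alpha>\<close> and \<open>m\<close>. The
decay rate 1/4 is that of the slowest kernel that occurs (\<open>majorant\<close>).\<close>

definition step_kernel :: "(real \<Rightarrow> real) \<Rightarrow> real \<Rightarrow> real \<Rightarrow> bool" where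
  "step_kernel \<phi> \<alpha> m \<longleftrightarrow> \<phi> \<in> borel_measurable borel \<and>
     (\<exists>C. \<forall>y. \<bar>\<phi> y - \<alpha> * indicator {0<..} y\<bar> \<le> C * exp (- (1/4) * \<bar>y\<bar>)) \<and>
     m = (LINT y|lborel. \<phi> y - \<alpha> * indicator {0<..} y)"

text \<open>The induction hypothesis for iterated convolutions. The second term of the expansion is asked of
the antiderivative of \<open>F\<close> and not of \<open>F\<close>, because it is the antiderivative that is met in the
convolution with a step, and because a step kernel, where the induction starts, has a second term
only after integration. The exponential bound is there for the integrals over the negative axis; its
rate is below that of \<open>step_kernel\<close>, so that products of both remain integrable.\<close>

definition two_term_growth :: "(real \<Rightarrow> real) \<Rightarrow> nat \<Rightarrow> real \<Rightarrow> real \<Rightarrow> bool" where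
  "two_term_growth F a c0 c1 \<longleftrightarrow> F \<in> borel_measurable borel \<and>
     (\<exists>C. \<forall>x. \<bar>F x\<bar> \<le> C * exp (x / 8)) \<and>
     ((\<lambda>x. F x / x ^ a) \<longlongrightarrow> c0 / fact a) at_top \<and>
     ((\<lambda>x. ((LINT t|lborel. indicator {..<x} t * F t) - c0 * x ^ (a + 1) / fact (a + 1)) / x ^ a) \<longlongrightarrow> c1 / fact a) at_top"

lemma two_term_growth_poly_bound:
  assumes "two_term_growth F a c0 c1"
  shows "\<exists>K. \<forall>x. \<bar>F x\<bar> \<le> K * (1 + \<bar>x\<bar>) ^ a"
proof -
  obtain C where C: "\<And>x. \<bar>F x\<bar> \<le> C * exp (x / 8)" using assms unfolding two_term_growth_def by blast
  have C0: "C \<ge> 0" using C[of 0] by simp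
  define B where "B = \<bar>c0 / fact a\<bar> + 1"
  have "((\<lambda>x. \<bar>F x / x ^ a\<bar>) \<longlongrightarrow> \<bar>c0 / fact a\<bar>) at_top"
    using assms unfolding two_term_growth_def by (intro tendsto_rabs) blast
  then have "eventually (\<lambda>x. \<bar>F x / x ^ a\<bar> < B) at_top"
    unfolding B_def by (rule order_tendstoD) simp
  with eventually_ge_at_top[of 1] have "eventually (\<lambda>x. \<bar>F x\<bar> \<le> B * (1 + \<bar>x\<bar>) ^ a) at_top"
  proof eventually_elim
    case (elim x)
    then have "\<bar>F x\<bar> \<le> B * x ^ a" by (simp add: field_simps)
    also have "\<dots> \<le> B * (1 + \<bar>x\<bar>) ^ a"
      using elim by (intro mult_left_mono power_mono) (auto simp: B_def)
    finally show ?case .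
  qed
  then obtain X where X: "\<And>x. x \<ge> X \<Longrightarrow> \<bar>F x\<bar> \<le> B * (1 + \<bar>x\<bar>) ^ a"
    by (auto simp: eventually_at_top_linorder)
  have "\<bar>F x\<bar> \<le> (B + C * exp (X / 8)) * (1 + \<bar>x\<bar>) ^ a" for x
  proof (cases "x \<ge> X")
    case True
    then show ?thesis using X[OF True] C0 by (intro order_trans[OF X[OF True]] mult_right_mono) auto
  next
    case False
    have "\<bar>F x\<bar> \<le> C * exp (X / 8)"
      using False C0 by (intro order_trans[OF C[of x]] mult_left_mono) auto
    also have "\<dots> \<le> C * exp (X / 8) * (1 + \<bar>x\<bar>) ^ a"
      using C0 mult_left_mono[OF one_le_power[of "1 + \<bar>x\<bar>" a], of "C * exp (X / 8)"] by simp
    also have "\<dots> \<le> (B + C * exp (X / 8)) * (1 + \<bar>x\<bar>) ^ a"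
      by (intro mult_right_mono) (auto simp: B_def)
    finally show ?thesis .
  qed
  then show ?thesis by blast
qed

text \<open>After the substitution \<open>t = x * u\<close> the normalised integrand converges for \<open>0 < u \<le> 1\<close>. It is
dominated because \<open>\<rho>\<close> is bounded by a multiple of \<open>(1 + x) ^ a\<close>: by the limit for large \<open>x\<close>, and by
the weaker power bound on the remaining bounded interval.\<close>

lemma tendsto_integral_of_power_growth:
  fixes \<rho> :: "real \<Rightarrow> real"
  assumes [measurable]: "\<rho> \<in> borel_measurable borel"
    and K: "\<And>x. x \<ge> 0 \<Longrightarrow> \<bar>\<rho> x\<bar> \<le> K * (1 + \<bar>x\<bar>) ^ (a + 1)"
    and lim: "((\<lambda>x. \<rho> x / x ^ a) \<longlongrightarrow> L) at_top"
  shows "((\<lambda>x. (LINT t|lborel. indicator {0..x} t * \<rho> t) / x ^ (a + 1)) \<longlongrightarrow> L / real (a + 1)) at_top"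
proof -
  have "eventually (\<lambda>x. \<bar>\<rho> x / x ^ a\<bar> < \<bar>L\<bar> + 1) at_top"
    by (rule order_tendstoD[OF tendsto_rabs[OF lim]]) simp
  with eventually_ge_at_top[of 1] have "eventually (\<lambda>x. x \<ge> 1 \<and> \<bar>\<rho> x\<bar> \<le> (\<bar>L\<bar> + 1) * x ^ a) at_top"
    by eventually_elim (simp add: field_simps)
  then obtain X where X: "X \<ge> 1" "\<And>x. x \<ge> X \<Longrightarrow> \<bar>\<rho> x\<bar> \<le> (\<bar>L\<bar> + 1) * x ^ a"
    by (auto simp: eventually_at_top_linorder) 
  define K' where "K' = \<bar>L\<bar> + 1 + \<bar>K\<bar> * (1 + X) ^ (a + 1)"
  have K': "\<bar>\<rho> x\<bar> \<le> K' * (1 + x) ^ a" if "x \<ge> 0" for x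
  proof (cases "x \<ge> X")
    case True
    have "\<bar>\<rho> x\<bar> \<le> (\<bar>L\<bar> + 1) * (1 + x) ^ a"
      using that by (intro order_trans[OF X(2)[OF True]] mult_left_mono power_mono) auto
    also have "\<dots> \<le> K' * (1 + x) ^ a" using that X(1) by (intro mult_right_mono) (auto simp: K'_def)
    finally show ?thesis .
  next
    case False
    have "\<bar>\<rho> x\<bar> \<le> \<bar>K\<bar> * (1 + \<bar>x\<bar>) ^ (a + 1)"
      using K[OF that] by (rule order_trans) (intro mult_right_mono, auto)
    also have "\<dots> \<le> \<bar>K\<bar> * (1 + X) ^ (a + 1)" using False that by (intro mult_left_mono power_mono) auto
    also have "\<dots> \<le> K'" by (simp add: K'_def)
    also have "\<dots> \<le> K' * (1 + x) ^ a"
      using that X(1) mult_left_mono[OF one_le_power[of "1 + x" a], of K'] by (simp add: K'_def)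
    finally show ?thesis .
  qed
  have K'0: "K' \<ge> 0" using K'[of 0] by simp
  have A: "((\<lambda>x. LINT u|lborel. indicator {0..1} u * (\<rho> (x * u) / x ^ a)) \<longlongrightarrow> (LINT u|lborel. indicator {0..1} u * (L * u ^ a))) at_top"
  proof (rule integral_dominated_convergence_at_top)
    show "integrable lborel (\<lambda>u. K' * 2 ^ a * indicator {0..1::real} u)" by simp
    show "\<forall>\<^sub>F x in at_top. AE u in lborel. norm (indicator {0..1} u * (\<rho> (x * u) / x ^ a)) \<le> K' * 2 ^ a * indicator {0..1} u"
      using eventually_ge_at_top[of 1]
    proof eventually_elim
      case (elim x)
      have "norm (indicator {0..1} u * (\<rho> (x * u) / x ^ a)) \<le> K' * 2 ^ a * indicator {0..1} u" for u
      proof (cases "u \<in> {0..1}")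
        case True
        have "\<bar>\<rho> (x * u)\<bar> \<le> K' * (1 + x * u) ^ a" using True elim by (intro K') auto
        also have "\<dots> \<le> K' * (2 * x) ^ a"
        proof -
          have "x * u \<le> x * 1" using True elim by (intro mult_left_mono) auto
          then have "1 + x * u \<le> 2 * x" using elim by linarith
          then show ?thesis using True elim K'0 by (intro mult_left_mono power_mono) auto
        qed
        finally show ?thesis using True elim by (simp add: field_simps power_mult_distrib)
      qed auto
      then show ?case by simp
    qed
    show "AE u in lborel. ((\<lambda>x. indicator {0..1} u * (\<rho> (x * u) / x ^ a)) \<longlongrightarrow> indicator {0..1} u * (L * u ^ a)) at_top"
    proof (rule AE_mp[OF AE_lborel_singleton[of 0]], rule AE_I2, rule impI)
      fix u :: real assume u: "u \<noteq> 0"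
      show "((\<lambda>x. indicator {0..1} u * (\<rho> (x * u) / x ^ a)) \<longlongrightarrow> indicator {0..1} u * (L * u ^ a)) at_top"
      proof (cases "u \<in> {0..1}")
        case True
        then have "u > 0" using u by auto
        then have f: "filterlim (\<lambda>x. x * u) at_top at_top" by real_asymp
        have "((\<lambda>x. \<rho> (x * u) / (x * u) ^ a * u ^ a) \<longlongrightarrow> L * u ^ a) at_top"
          by (intro tendsto_mult tendsto_const filterlim_compose[OF lim f])
        also have "(\<lambda>x. \<rho> (x * u) / (x * u) ^ a * u ^ a) = (\<lambda>x. \<rho> (x * u) / x ^ a)"
          using u by (auto simp: power_mult_distrib fun_eq_iff)
        finally show ?thesis using True by simp
      qed simp
    qed
  qed measurable
  have B: "(LINT u|lborel. indicator {0..1} u * (L * u ^ a)) = L / real (a + 1)"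
  proof -
    have "(LINT u|lborel. indicator {0..1} u * (L * u ^ a)) = (LINT u|lborel. L * (u ^ a * indicator {0..1} u))"
      by (intro Bochner_Integration.integral_cong) auto
    also have "\<dots> = L / real (a + 1)"
      using integral_power[of 0 1 a] by (subst Bochner_Integration.integral_mult_right_zero) simp
    finally show ?thesis .
  qed
  have E: "eventually (\<lambda>x. (LINT u|lborel. indicator {0..1} u * (\<rho> (x * u) / x ^ a)) =
      (LINT t|lborel. indicator {0..x} t * \<rho> t) / x ^ (a + 1)) at_top"
    using eventually_gt_at_top[of 0]
  proof eventually_elim
    case (elim x)
    have "(LINT t|lborel. indicator {0..x} t * \<rho> t) = x * (LINT u|lborel. indicator {0..x} (0 + x * u) * \<rho> (0 + x * u))"
      using elim by (subst lborel_integral_real_affine[of x _ 0]) auto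
    also have "(LINT u|lborel. indicator {0..x} (0 + x * u) * \<rho> (0 + x * u)) = (LINT u|lborel. x ^ a * (indicator {0..1} u * (\<rho> (x * u) / x ^ a)))"
      using elim by (intro Bochner_Integration.integral_cong) (auto simp: indicator_def zero_le_mult_iff)
    finally show ?case using elim by simp
  qed
  show ?thesis using A unfolding B tendsto_cong[OF E] .
qed

text \<open>The base case: the integral of the kernel up to \<open>x\<close> is \<open>\<alpha> * x\<close> plus the integral of the
perturbation up to \<open>x\<close>, which tends to \<open>m\<close>.\<close>

lemma two_term_growth_step_kernel:
  assumes "step_kernel \<phi> \<alpha> m"
  shows "two_term_growth \<phi> 0 \<alpha> m"
proof -
  have [measurable]: "\<phi> \<in> borel_measurable borel" using assms by (simp add: step_kernel_def)
  define \<psi> where "\<psi> = (\<lambda>y. \<phi> y - \<alpha> * indicator {0<..} y)"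
  obtain C where C: "\<And>y. \<bar>\<psi> y\<bar> \<le> C * exp (- (1/4) * \<bar>y\<bar>)" and m: "m = (LINT y|lborel. \<psi> y)"
    using assms by (auto simp: step_kernel_def \<psi>_def)
  have [measurable]: "\<psi> \<in> borel_measurable borel" by (simp add: \<psi>_def)
  have C0: "C \<ge> 0" using C[of 0] by simp
  have int: "integrable lborel (\<lambda>y. C * exp (- (1/4) * \<bar>y\<bar>))"
    using integrable_exp_neg_abs[of "1/4"] by simp
  have int\<psi>: "integrable lborel \<psi>"
    by (rule Bochner_Integration.integrable_bound[OF int]) (use C C0 in auto)
  have \<phi>: "\<phi> y = \<alpha> * indicator {0<..} y + \<psi> y" for y by (simp add: \<psi>_def)
  show ?thesis unfolding two_term_growth_def
  proof (intro conjI)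
    show "\<exists>C. \<forall>x. \<bar>\<phi> x\<bar> \<le> C * exp (x / 8)"
    proof (intro exI[of _ "\<bar>\<alpha>\<bar> + C"] allI)
      fix x
      have "\<bar>\<phi> x\<bar> \<le> \<bar>\<alpha>\<bar> * indicator {0<..} x + C * exp (- (1/4) * \<bar>x\<bar>)"
        unfolding \<phi> using C[of x] by (auto simp: indicator_def)
      also have "\<dots> \<le> \<bar>\<alpha>\<bar> * exp (x / 8) + C * exp (x / 8)"
        using C0 by (intro add_mono mult_left_mono) (auto simp: indicator_def)
      finally show "\<bar>\<phi> x\<bar> \<le> (\<bar>\<alpha>\<bar> + C) * exp (x / 8)" by (simp add: algebra_simps)
    qed
    have "(\<psi> \<longlongrightarrow> 0) at_top"
    proof (rule Lim_null_comparison)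
      show "\<forall>\<^sub>F x in at_top. norm (\<psi> x) \<le> C * exp (- (1/4) * \<bar>x\<bar>)" using C by simp
      show "((\<lambda>x. C * exp (- (1 / 4) * \<bar>x\<bar>)) \<longlongrightarrow> 0) at_top" by real_asymp
    qed
    then have "((\<lambda>x. \<alpha> + \<psi> x) \<longlongrightarrow> \<alpha> + 0) at_top" by (intro tendsto_intros)
    moreover have "\<forall>\<^sub>F x in at_top. \<alpha> + \<psi> x = \<phi> x"
      using eventually_gt_at_top[of 0] by eventually_elim (simp add: \<phi>)
    ultimately show "((\<lambda>x. \<phi> x / x ^ 0) \<longlongrightarrow> \<alpha> / fact 0) at_top"
      by (simp add: tendsto_cong)
    have "((\<lambda>x. LINT t|lborel. indicator {..<x} t * \<psi> t) \<longlongrightarrow> (LINT t|lborel. \<psi> t)) at_top"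
    proof (rule integral_dominated_convergence_at_top[OF _ _ int])
      show "AE t in lborel. ((\<lambda>x. indicator {..<x} t * \<psi> t) \<longlongrightarrow> \<psi> t) at_top"
      proof (rule AE_I2, rule tendsto_eventually)
        fix t show "\<forall>\<^sub>F x in at_top. indicator {..<x} t * \<psi> t = \<psi> t"
          using eventually_gt_at_top[of t] by eventually_elim simp
      qed
      show "\<forall>\<^sub>F x in at_top. AE t in lborel. norm (indicator {..<x} t * \<psi> t) \<le> C * exp (- (1/4) * \<bar>t\<bar>)"
        using C C0 by (auto simp: indicator_def)
    qed measurable
    moreover have "\<forall>\<^sub>F x in at_top. (LINT t|lborel. indicator {..<x} t * \<psi> t) =
        ((LINT t|lborel. indicator {..<x} t * \<phi> t) - \<alpha> * x ^ (0 + 1) / fact (0 + 1)) / x ^ 0"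
      using eventually_gt_at_top[of 0]
    proof eventually_elim
      case (elim x)
      have "(LINT t|lborel. indicator {..<x} t * \<phi> t) = (LINT t|lborel. indicator {..<x} t * \<psi> t + \<alpha> * indicator {0<..<x} t)"
        by (intro Bochner_Integration.integral_cong) (auto simp: \<phi> indicator_def)
      also have "\<dots> = (LINT t|lborel. indicator {..<x} t * \<psi> t) + \<alpha> * x"
        using elim integrable_mult_indicator[OF _ int\<psi>, of "{..<x}"] by (subst Bochner_Integration.integral_add) auto
      finally show ?case by simp
    qed
    ultimately show "((\<lambda>x. ((LINT t|lborel. indicator {..<x} t * \<phi> t) - \<alpha> * x ^ (0 + 1) / fact (0 + 1)) / x ^ 0) \<longlongrightarrow> m / fact 0) at_top"
      by (simp add: m tendsto_cong)
  qed simp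
qed

text \<open>The step of \<open>\<phi>\<close> turns \<open>F\<close> into \<open>\<alpha>\<close> times its antiderivative, for which two terms are known. The
convolution of \<open>F\<close> with the perturbation is of the order of \<open>F\<close> itself and contributes only its
leading term, in which the perturbation counts with its mass.\<close>

lemma
  assumes F: "two_term_growth F a c0 c1" and \<phi>: "step_kernel \<phi> \<alpha> m"
  shows conv_asymp: "((\<lambda>x. (conv F \<phi> x - \<alpha> * c0 * x ^ (a + 1) / fact (a + 1)) / x ^ a) \<longlongrightarrow> (\<alpha> * c1 + m * c0) / fact a) at_top"
    and conv_exp_bound: "\<exists>C. \<forall>x. \<bar>conv F \<phi> x\<bar> \<le> C * exp (x / 8)"
    and conv_integrable: "integrable lborel (\<lambda>y. F (x - y) * \<phi> y)"
proof -
  have [measurable]: "\<phi> \<in> borel_measurable borel" using \<phi> by (simp add: step_kernel_def)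
  have [measurable]: "F \<in> borel_measurable borel" using F by (simp add: two_term_growth_def)
  define \<psi> where "\<psi> = (\<lambda>y. \<phi> y - \<alpha> * indicator {0<..} y)"
  obtain C where C: "\<And>y. \<bar>\<psi> y\<bar> \<le> C * exp (- (1/4) * \<bar>y\<bar>)" and m: "m = (LINT y|lborel. \<psi> y)"
    using \<phi> by (auto simp: step_kernel_def \<psi>_def)
  have [measurable]: "\<psi> \<in> borel_measurable borel" by (simp add: \<psi>_def)
  have C0: "C \<ge> 0" using C[of 0] by simp
  have \<phi>eq: "\<phi> y = \<alpha> * indicator {0<..} y + \<psi> y" for y by (simp add: \<psi>_def)
  obtain B where B: "\<And>x. \<bar>F x\<bar> \<le> B * exp (x / 8)" using F unfolding two_term_growth_def by blast
  have B0: "B \<ge> 0" using B[of 0] by simp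
  define w where "w = (\<lambda>y::real. exp (- (1/8) * \<bar>y\<bar>))"
  have intw: "integrable lborel w" unfolding w_def by (rule integrable_exp_neg_abs) simp
  have b1: "\<bar>F (x - y) * indicator {0<..} y\<bar> \<le> B * exp (x / 8) * w y" for x y
  proof (cases "y > 0")
    case True
    then have "exp ((x - y) / 8) = exp (x / 8) * w y" by (simp add: w_def mult_exp_exp diff_divide_distrib)
    then show ?thesis using B[of "x - y"] True by (simp add: mult.assoc)
  qed (use B0 in \<open>simp add: w_def\<close>)
  have b2: "\<bar>F (x - y) * \<psi> y\<bar> \<le> B * C * exp (x / 8) * w y" for x y
  proof -
    have "\<bar>F (x - y) * \<psi> y\<bar> \<le> (B * exp ((x - y) / 8)) * (C * exp (- (1/4) * \<bar>y\<bar>))"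
      unfolding abs_mult using B C B0 by (intro mult_mono) auto
    also have "\<dots> = B * C * exp (x / 8) * exp (- y / 8 - (1/4) * \<bar>y\<bar>)"
      by (simp add: mult_exp_exp diff_divide_distrib)
    also have "\<dots> \<le> B * C * exp (x / 8) * w y"
      using B0 C0 unfolding w_def by (intro mult_left_mono) auto
    finally show ?thesis .
  qed
  have i1: "integrable lborel (\<lambda>y. F (x - y) * indicator {0<..} y)" for x
    by (rule Bochner_Integration.integrable_bound[of _ "\<lambda>y. B * exp (x / 8) * w y"])
       (use b1[of x] intw in \<open>auto intro!: AE_I2 intro: order_trans[OF _ abs_ge_self]\<close>)
  have i2: "integrable lborel (\<lambda>y. F (x - y) * \<psi> y)" for x
    by (rule Bochner_Integration.integrable_bound[of _ "\<lambda>y. B * C * exp (x / 8) * w y"])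
       (use b2[of x] intw in \<open>auto intro!: AE_I2 intro: order_trans[OF _ abs_ge_self]\<close>)
  have eq: "F (x - y) * \<phi> y = \<alpha> * (F (x - y) * indicator {0<..} y) + F (x - y) * \<psi> y" for x y
    by (simp add: \<phi>eq algebra_simps)
  have i: "integrable lborel (\<lambda>y. F (x - y) * \<phi> y)" for x
    unfolding eq using i1 i2 by simp
  show "integrable lborel (\<lambda>y. F (x - y) * \<phi> y)" by (rule i)
  define G where "G = (\<lambda>x. LINT t|lborel. indicator {..<x} t * F t)"
  have G: "(LINT y|lborel. F (x - y) * indicator {0<..} y) = G x" for x
    unfolding G_def
    by (subst lborel_integral_real_affine[of "-1" _ x])
       (auto intro!: Bochner_Integration.integral_cong simp: indicator_def)
  have conv: "conv F \<phi> x = \<alpha> * G x + conv F \<psi> x" for x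
    unfolding conv_def eq using i1 i2 by (simp add: G)
  show "\<exists>C. \<forall>x. \<bar>conv F \<phi> x\<bar> \<le> C * exp (x / 8)"
  proof (intro exI[of _ "(\<bar>\<alpha>\<bar> * B + B * C) * (LINT y|lborel. w y)"] allI)
    fix x
    have "norm (conv F \<phi> x) \<le> (LINT y|lborel. (\<bar>\<alpha>\<bar> * B + B * C) * exp (x / 8) * w y)"
      unfolding conv_def
    proof (rule Bochner_Integration.integral_norm_bound_integral)
      fix y
      have "\<bar>F (x - y) * \<phi> y\<bar> \<le> \<bar>\<alpha>\<bar> * \<bar>F (x - y) * indicator {0<..} y\<bar> + \<bar>F (x - y) * \<psi> y\<bar>"
        unfolding eq by (metis abs_mult abs_triangle_ineq)
      also have "\<dots> \<le> \<bar>\<alpha>\<bar> * (B * exp (x / 8) * w y) + B * C * exp (x / 8) * w y"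
        using b1 b2 by (intro add_mono mult_left_mono) auto
      finally show "norm (F (x - y) * \<phi> y) \<le> (\<bar>\<alpha>\<bar> * B + B * C) * exp (x / 8) * w y"
        by (simp add: algebra_simps)
    qed (use i intw in auto)
    then show "\<bar>conv F \<phi> x\<bar> \<le> (\<bar>\<alpha>\<bar> * B + B * C) * (LINT y|lborel. w y) * exp (x / 8)"
      by (simp add: mult_ac)
  qed
  obtain K where K: "\<And>x. \<bar>F x\<bar> \<le> K * (1 + \<bar>x\<bar>) ^ a" using two_term_growth_poly_bound[OF F] by blast
  have K0: "K \<ge> 0" using K[of 0] by simp
  obtain M where M: "M > 0" "\<And>y::real. (1 + \<bar>y\<bar>) ^ a \<le> M * exp (1/8 * \<bar>y\<bar>)"
    using one_plus_abs_power_le_exp[of "1/8" a] by auto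
  have limF: "((\<lambda>x. F x / x ^ a) \<longlongrightarrow> c0 / fact a) at_top" using F unfolding two_term_growth_def by blast
  have "((\<lambda>x. LINT y|lborel. F (x - y) * \<psi> y / x ^ a) \<longlongrightarrow> (LINT y|lborel. c0 / fact a * \<psi> y)) at_top"
  proof (rule integral_dominated_convergence_at_top)
    show "integrable lborel (\<lambda>y. K * C * 2 ^ a * M * w y)" using intw by simp
    show "\<forall>\<^sub>F x in at_top. AE y in lborel. norm (F (x - y) * \<psi> y / x ^ a) \<le> K * C * 2 ^ a * M * w y"
      using eventually_ge_at_top[of 1]
    proof eventually_elim
      case (elim x)
      have "norm (F (x - y) * \<psi> y / x ^ a) \<le> K * C * 2 ^ a * M * w y" for y
      proof -
        have "\<bar>F (x - y)\<bar> \<le> K * (1 + \<bar>x - y\<bar>) ^ a" by (rule K)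
        also have "\<dots> \<le> K * ((2 * x) * (1 + \<bar>y\<bar>)) ^ a"
        proof (intro mult_left_mono power_mono)
          have "\<bar>y\<bar> \<le> x * \<bar>y\<bar>" using mult_right_mono[of 1 x "\<bar>y\<bar>"] elim by simp
          then have "1 + x + \<bar>y\<bar> \<le> (2 * x) * (1 + \<bar>y\<bar>)" using elim by (simp add: algebra_simps)
          then show "1 + \<bar>x - y\<bar> \<le> (2 * x) * (1 + \<bar>y\<bar>)" using elim by linarith
        qed (use K0 in auto)
        also have "\<dots> = K * 2 ^ a * x ^ a * (1 + \<bar>y\<bar>) ^ a" by (simp add: power_mult_distrib)
        also have "\<dots> \<le> K * 2 ^ a * x ^ a * (M * exp (1/8 * \<bar>y\<bar>))"
          using K0 elim by (intro mult_left_mono M) auto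
        finally have "\<bar>F (x - y)\<bar> * \<bar>\<psi> y\<bar> \<le> (K * 2 ^ a * x ^ a * (M * exp (1/8 * \<bar>y\<bar>))) * (C * exp (- (1/4) * \<bar>y\<bar>))"
          using C K0 M elim by (intro mult_mono) auto
        also have "\<dots> = K * C * 2 ^ a * M * x ^ a * (exp (1/8 * \<bar>y\<bar>) * exp (- (1/4) * \<bar>y\<bar>))" by simp
        also have "exp (1/8 * \<bar>y\<bar>) * exp (- (1/4) * \<bar>y\<bar>) = w y" by (simp add: w_def mult_exp_exp)
        finally show ?thesis using elim by (simp add: abs_mult field_simps)
      qed
      then show ?case by simp
    qed
    show "AE y in lborel. ((\<lambda>x. F (x - y) * \<psi> y / x ^ a) \<longlongrightarrow> c0 / fact a * \<psi> y) at_top"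
    proof (rule AE_I2)
      fix y
      have "filterlim (\<lambda>x::real. x - y) at_top at_top" by real_asymp
      moreover have "((\<lambda>x::real. ((x - y) / x) ^ a) \<longlongrightarrow> 1 ^ a) at_top"
        by (intro tendsto_power) real_asymp
      ultimately have "((\<lambda>x. F (x - y) / (x - y) ^ a * ((x - y) / x) ^ a * \<psi> y) \<longlongrightarrow> c0 / fact a * 1 ^ a * \<psi> y) at_top"
        by (intro tendsto_mult tendsto_const filterlim_compose[OF limF])
      moreover have "\<forall>\<^sub>F x in at_top. F (x - y) / (x - y) ^ a * ((x - y) / x) ^ a * \<psi> y = F (x - y) * \<psi> y / x ^ a"
        using eventually_gt_at_top[of y] by eventually_elim (simp add: field_simps power_divide)
      ultimately show "((\<lambda>x. F (x - y) * \<psi> y / x ^ a) \<longlongrightarrow> c0 / fact a * \<psi> y) at_top"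
        by (simp add: tendsto_cong)
    qed
  qed measurable
  then have lim\<psi>: "((\<lambda>x. conv F \<psi> x / x ^ a) \<longlongrightarrow> c0 / fact a * m) at_top"
    by (simp add: conv_def m)
  have limG: "((\<lambda>x. (G x - c0 * x ^ (a + 1) / fact (a + 1)) / x ^ a) \<longlongrightarrow> c1 / fact a) at_top"
    using F unfolding two_term_growth_def G_def by blast
  have "((\<lambda>x. \<alpha> * ((G x - c0 * x ^ (a + 1) / fact (a + 1)) / x ^ a) + conv F \<psi> x / x ^ a) \<longlongrightarrow> \<alpha> * (c1 / fact a) + c0 / fact a * m) at_top"
    by (intro tendsto_add tendsto_mult tendsto_const limG lim\<psi>)
  also have "(\<lambda>x. \<alpha> * ((G x - c0 * x ^ (a + 1) / fact (a + 1)) / x ^ a) + conv F \<psi> x / x ^ a) =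
      (\<lambda>x. (conv F \<phi> x - \<alpha> * c0 * x ^ (a + 1) / fact (a + 1)) / x ^ a)"
    unfolding conv by (rule ext) (simp add: diff_divide_distrib add_divide_distrib right_diff_distrib)
  also have "\<alpha> * (c1 / fact a) + c0 / fact a * m = (\<alpha> * c1 + m * c0) / fact a"
    by (simp add: add_divide_distrib)
  finally show "((\<lambda>x. (conv F \<phi> x - \<alpha> * c0 * x ^ (a + 1) / fact (a + 1)) / x ^ a) \<longlongrightarrow> (\<alpha> * c1 + m * c0) / fact a) at_top" .
qed

lemma two_term_growth_conv:
  assumes F: "two_term_growth F a c0 c1" and \<phi>: "step_kernel \<phi> \<alpha> m"
  shows "two_term_growth (conv F \<phi>) (a + 1) (\<alpha> * c0) (\<alpha> * c1 + m * c0)"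
proof -
  have [measurable]: "\<phi> \<in> borel_measurable borel" using \<phi> by (simp add: step_kernel_def)
  have [measurable]: "F \<in> borel_measurable borel" using F by (simp add: two_term_growth_def)
  have [measurable]: "conv F \<phi> \<in> borel_measurable borel" unfolding conv_def by measurable
  define H where "H = conv F \<phi>"
  have [measurable]: "H \<in> borel_measurable borel" by (simp add: H_def)
  define L where "L = (\<alpha> * c1 + m * c0) / fact a"
  define \<rho> where "\<rho> = (\<lambda>x. H x - \<alpha> * c0 * x ^ (a + 1) / fact (a + 1))"
  have [measurable]: "\<rho> \<in> borel_measurable borel" by (simp add: \<rho>_def)
  have \<rho>: "((\<lambda>x. \<rho> x / x ^ a) \<longlongrightarrow> L) at_top"
    using conv_asymp[OF F \<phi>] by (simp add: \<rho>_def L_def H_def)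
  obtain C where C: "\<And>x. \<bar>H x\<bar> \<le> C * exp (x / 8)" using conv_exp_bound[OF F \<phi>] by (auto simp: H_def)
  have C0: "C \<ge> 0" using C[of 0] by simp
  have lim1: "((\<lambda>x. H x / x ^ (a + 1)) \<longlongrightarrow> \<alpha> * c0 / fact (a + 1)) at_top"
  proof -
    have A: "((\<lambda>x. \<rho> x / x ^ a * (1 / x) + \<alpha> * c0 / fact (a + 1)) \<longlongrightarrow> L * 0 + \<alpha> * c0 / fact (a + 1)) at_top"
      by (intro tendsto_intros \<rho>) real_asymp
    have E: "\<forall>\<^sub>F x in at_top. \<rho> x / x ^ a * (1 / x) + \<alpha> * c0 / fact (a + 1) = H x / x ^ (a + 1)"
      using eventually_gt_at_top[of 0] by eventually_elim (simp add: \<rho>_def field_simps)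
    show ?thesis using Lim_transform_eventually[OF A E] by simp
  qed
  have intm: "integrable lborel (\<lambda>t. indicator {..0} t * H t)"
  proof (rule Bochner_Integration.integrable_bound)
    show "integrable lborel (\<lambda>t. C * exp (- (1/8) * \<bar>t\<bar>))" using integrable_exp_neg_abs[of "1/8"] by simp
    show "AE t in lborel. norm (indicator {..0} t * H t) \<le> norm (C * exp (- (1/8) * \<bar>t\<bar>))"
    proof (rule AE_I2)
      fix t show "norm (indicator {..0} t * H t) \<le> norm (C * exp (- (1/8) * \<bar>t\<bar>))"
        using C[of t] C0 by (auto simp: indicator_def)
    qed
  qed measurable
  have intloc: "integrable lborel (\<lambda>t. indicator {0..x} t * H t)" for x
  proof (rule Bochner_Integration.integrable_bound)
    show "integrable lborel (\<lambda>t. indicator {0..x} t * (C * exp (x / 8)))"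
      by (intro integrable_mult_left) (auto intro: integrable_real_indicator simp: emeasure_lborel_Icc_eq)
    show "AE t in lborel. norm (indicator {0..x} t * H t) \<le> norm (indicator {0..x} t * (C * exp (x / 8)))"
    proof (rule AE_I2)
      fix t
      have "\<bar>H t\<bar> \<le> C * exp (x / 8)" if "t \<le> x"
        using that C0 by (intro order_trans[OF C[of t]] mult_left_mono) auto
      then show "norm (indicator {0..x} t * H t) \<le> norm (indicator {0..x} t * (C * exp (x / 8)))"
        using C0 by (auto simp: indicator_def)
    qed
  qed measurable
  have intpow: "integrable lborel (\<lambda>t. indicator {0..x} t * (\<alpha> * c0 * t ^ (a + 1) / fact (a + 1)))" for x
  proof -
    have "integrable lborel (\<lambda>t. (\<alpha> * c0 / fact (a + 1)) * (t ^ (a + 1) * indicator {0..x} t))"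
      by (intro integrable_mult_right borel_integrable_atLeastAtMost) auto
    then show ?thesis by (simp add: mult_ac)
  qed
  have lim2: "((\<lambda>x. ((LINT t|lborel. indicator {..<x} t * H t) - \<alpha> * c0 * x ^ (a + 1 + 1) / fact (a + 1 + 1)) / x ^ (a + 1)) \<longlongrightarrow> (\<alpha> * c1 + m * c0) / fact (a + 1)) at_top"
  proof -
    have "\<exists>K. \<forall>x\<ge>0. \<bar>\<rho> x\<bar> \<le> K * (1 + \<bar>x\<bar>) ^ (a + 1)"
    proof -
      have "\<forall>\<^sub>F x in at_top. \<bar>H x / x ^ (a + 1)\<bar> < \<bar>\<alpha> * c0 / fact (a + 1)\<bar> + 1"
        by (rule order_tendstoD[OF tendsto_rabs[OF lim1]]) simp
      with eventually_ge_at_top[of 1] have "\<forall>\<^sub>F x in at_top. 1 \<le> x \<and> \<bar>H x\<bar> \<le> (\<bar>\<alpha> * c0 / fact (a + 1)\<bar> + 1) * x ^ (a + 1)"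
        by eventually_elim (simp add: field_simps)
      then obtain X where X: "X \<ge> 1" "\<And>x. x \<ge> X \<Longrightarrow> \<bar>H x\<bar> \<le> (\<bar>\<alpha> * c0 / fact (a + 1)\<bar> + 1) * x ^ (a + 1)"
        by (auto simp: eventually_at_top_linorder)
      define D where "D = \<bar>\<alpha> * c0 / fact (a + 1)\<bar>"
      have D0: "D \<ge> 0" by (simp add: D_def)
      have "\<bar>H x\<bar> \<le> (D + 1 + C * exp (X / 8)) * (1 + x) ^ (a + 1)" if "x \<ge> 0" for x
      proof (cases "x \<ge> X")
        case True
        have "\<bar>H x\<bar> \<le> (D + 1) * x ^ (a + 1)" using X(2)[OF True] by (simp add: D_def)
        also have "\<dots> \<le> (D + 1 + C * exp (X / 8)) * (1 + x) ^ (a + 1)"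
          using that D0 C0 by (intro mult_mono power_mono) auto
        finally show ?thesis .
      next
        case False
        have "\<bar>H x\<bar> \<le> C * exp (X / 8) * 1"
          using False C0 by (auto intro!: order_trans[OF C[of x]] mult_left_mono)
        also have "\<dots> \<le> (D + 1 + C * exp (X / 8)) * (1 + x) ^ (a + 1)"
          using that D0 C0 by (intro mult_mono one_le_power) auto
        finally show ?thesis .
      qed
      moreover have "\<bar>\<alpha> * c0 * x ^ (a + 1) / fact (a + 1)\<bar> \<le> D * (1 + x) ^ (a + 1)" if "x \<ge> 0" for x
      proof -
        have "\<bar>\<alpha> * c0 * x ^ (a + 1) / fact (a + 1)\<bar> = D * x ^ (a + 1)"
          using that by (simp add: D_def abs_mult)
        also have "\<dots> \<le> D * (1 + x) ^ (a + 1)" using that D0 by (intro mult_left_mono power_mono) auto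
        finally show ?thesis .
      qed
      ultimately have "\<bar>\<rho> x\<bar> \<le> (D + 1 + C * exp (X / 8) + D) * (1 + \<bar>x\<bar>) ^ (a + 1)" if "x \<ge> 0" for x
        using that unfolding \<rho>_def by (smt (verit) distrib_right)
      then show ?thesis by blast
    qed
    then obtain K where K: "\<And>x. x \<ge> 0 \<Longrightarrow> \<bar>\<rho> x\<bar> \<le> K * (1 + \<bar>x\<bar>) ^ (a + 1)" by blast
    have "((\<lambda>x. (LINT t|lborel. indicator {0..x} t * \<rho> t) / x ^ (a + 1)) \<longlongrightarrow> L / real (a + 1)) at_top"
      by (rule tendsto_integral_of_power_growth[OF _ K \<rho>]) simp_all
    moreover have "((\<lambda>x. (LINT t|lborel. indicator {..0} t * H t) / x ^ (a + 1)) \<longlongrightarrow> 0) at_top"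
      by (intro tendsto_divide_0[OF tendsto_const] filterlim_at_top_imp_at_infinity filterlim_pow_at_top filterlim_ident) simp
    ultimately have A: "((\<lambda>x. (LINT t|lborel. indicator {0..x} t * \<rho> t) / x ^ (a + 1) + (LINT t|lborel. indicator {..0} t * H t) / x ^ (a + 1)) \<longlongrightarrow> L / real (a + 1) + 0) at_top"
      by (rule tendsto_add)
    have V: "L / real (a + 1) + 0 = (\<alpha> * c1 + m * c0) / fact (a + 1)"
      by (simp add: L_def)
    have E: "\<forall>\<^sub>F x in at_top. (LINT t|lborel. indicator {0..x} t * \<rho> t) / x ^ (a + 1) + (LINT t|lborel. indicator {..0} t * H t) / x ^ (a + 1)
        = ((LINT t|lborel. indicator {..<x} t * H t) - \<alpha> * c0 * x ^ (a + 1 + 1) / fact (a + 1 + 1)) / x ^ (a + 1)"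
      using eventually_gt_at_top[of 0]
    proof eventually_elim
      case (elim x)
      have "(LINT t|lborel. indicator {..<x} t * H t) = (LINT t|lborel. indicator {..0} t * H t + indicator {0..x} t * H t)"
      proof (rule integral_cong_AE)
        show "AE t in lborel. indicator {..<x} t * H t = indicator {..0} t * H t + indicator {0..x} t * H t"
          using AE_lborel_singleton[of 0] AE_lborel_singleton[of x]
          by eventually_elim (use elim in \<open>auto simp: indicator_def\<close>)
      qed measurable
      also have "\<dots> = (LINT t|lborel. indicator {..0} t * H t) + (LINT t|lborel. indicator {0..x} t * H t)"
        using intm intloc by simp
      finally have 1: "(LINT t|lborel. indicator {..<x} t * H t) = \<dots>" .
      have "(LINT t|lborel. indicator {0..x} t * \<rho> t) = (LINT t|lborel. indicator {0..x} t * H t - indicator {0..x} t * (\<alpha> * c0 * t ^ (a + 1) / fact (a + 1)))"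
        by (intro Bochner_Integration.integral_cong) (auto simp: \<rho>_def algebra_simps)
      also have "\<dots> = (LINT t|lborel. indicator {0..x} t * H t) - (LINT t|lborel. (\<alpha> * c0 / fact (a + 1)) * (t ^ (a + 1) * indicator {0..x} t))"
        using intloc intpow by (subst Bochner_Integration.integral_diff) (auto simp: mult_ac)
      also have "(LINT t|lborel. (\<alpha> * c0 / fact (a + 1)) * (t ^ (a + 1) * indicator {0..x} t)) = \<alpha> * c0 / fact (a + 1) * (x ^ (a + 2) / real (a + 2))"
        using integral_power[of 0 x "a + 1"] elim by (subst Bochner_Integration.integral_mult_right_zero) simp
      also have "\<dots> = \<alpha> * c0 * x ^ (a + 1 + 1) / fact (a + 1 + 1)"
        by (simp add: field_simps)
      finally show ?case using 1 by (simp add: add_divide_distrib[symmetric])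
    qed
    show ?thesis using Lim_transform_eventually[OF A[unfolded V] E] .
  qed
  show ?thesis unfolding two_term_growth_def using lim1 lim2 C H_def by auto
qed

fun conv_chain :: "(real \<Rightarrow> real) \<Rightarrow> (nat \<Rightarrow> real \<Rightarrow> real) \<Rightarrow> nat \<Rightarrow> real \<Rightarrow> real" where
  "conv_chain \<kappa> \<phi> 0 = \<kappa>"
| "conv_chain \<kappa> \<phi> (Suc k) = conv (conv_chain \<kappa> \<phi> k) (\<phi> k)"

lemma sum_prod_remove_insert:
  fixes m \<alpha> :: "'a \<Rightarrow> real"
  assumes "finite I" "k \<notin> I"
  shows "(\<Sum>i\<in>insert k I. m i * (\<Prod>j\<in>insert k I - {i}. \<alpha> j)) =
      \<alpha> k * (\<Sum>i\<in>I. m i * (\<Prod>j\<in>I - {i}. \<alpha> j)) + m k * (\<Prod>j\<in>I. \<alpha> j)"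
proof -
  have "(\<Prod>j\<in>insert k I - {i}. \<alpha> j) = \<alpha> k * (\<Prod>j\<in>I - {i}. \<alpha> j)" if "i \<in> I" for i
  proof -
    have "insert k I - {i} = insert k (I - {i})" using that assms by auto
    then show ?thesis using assms by simp
  qed
  moreover have "insert k I - {k} = I" using assms by auto
  ultimately show ?thesis using assms by (simp add: sum_distrib_left mult_ac)
qed

text \<open>The kernel with index \<open>n\<close> is the one that the chain starts from, so the kernels that have been used
after \<open>k\<close> convolutions are those with indices in \<open>insert n {..<k}\<close>.\<close>

lemma two_term_growth_conv_chain:
  assumes "step_kernel \<kappa> (\<alpha> n) (m n)" "\<And>k. k < n \<Longrightarrow> step_kernel (\<phi> k) (\<alpha> k) (m k)" "k \<le> n"
  shows "two_term_growth (conv_chain \<kappa> \<phi> k) k (\<Prod>j\<in>insert n {..<k}. \<alpha> j)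
           (\<Sum>i\<in>insert n {..<k}. m i * (\<Prod>j\<in>insert n {..<k} - {i}. \<alpha> j))"
  using assms(3)
proof (induction k)
  case 0
  then show ?case using two_term_growth_step_kernel[OF assms(1)] by simp
next
  case (Suc k)
  define I where "I = insert n {..<k}"
  have I: "finite I" "k \<notin> I" "insert n {..<Suc k} = insert k I" using Suc.prems by (auto simp: I_def)
  have "two_term_growth (conv_chain \<kappa> \<phi> k) k (\<Prod>j\<in>I. \<alpha> j) (\<Sum>i\<in>I. m i * (\<Prod>j\<in>I - {i}. \<alpha> j))"
    using Suc by (simp add: I_def)
  from two_term_growth_conv[OF this assms(2)[of k]] Suc.prems
  have "two_term_growth (conv_chain \<kappa> \<phi> (Suc k)) (Suc k) (\<alpha> k * (\<Prod>j\<in>I. \<alpha> j))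
     (\<alpha> k * (\<Sum>i\<in>I. m i * (\<Prod>j\<in>I - {i}. \<alpha> j)) + m k * (\<Prod>j\<in>I. \<alpha> j))" by simp
  then show ?case unfolding I(3) sum_prod_remove_insert[OF I(1,2)] using I(1,2) by simp
qed

text \<open>The last convolution is expanded by \<open>conv_asymp\<close> and not by \<open>two_term_growth_conv\<close>, and so two terms are
obtained for the chain itself.\<close>

lemma conv_chain_asymp:
  assumes "step_kernel \<kappa> (\<alpha> n) (m n)" "\<And>k. k < n \<Longrightarrow> step_kernel (\<phi> k) (\<alpha> k) (m k)" "n > 0"
  shows "((\<lambda>R. (conv_chain \<kappa> \<phi> n R - (\<Prod>j\<le>n. \<alpha> j) * R ^ n / fact n) / R ^ (n - 1)) \<longlongrightarrow>
            (\<Sum>i\<le>n. m i * (\<Prod>j\<in>{..n} - {i}. \<alpha> j)) / fact (n - 1)) at_top"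
proof -
  obtain k where k: "n = Suc k" using assms(3) gr0_conv_Suc by blast
  define I where "I = insert n {..<k}"
  have I: "finite I" "k \<notin> I" "{..n} = insert k I" by (auto simp: I_def k)
  have "two_term_growth (conv_chain \<kappa> \<phi> k) k (\<Prod>j\<in>I. \<alpha> j) (\<Sum>i\<in>I. m i * (\<Prod>j\<in>I - {i}. \<alpha> j))"
    unfolding I_def by (rule two_term_growth_conv_chain) (use assms k in auto)
  from conv_asymp[OF this assms(2)[of k]] k
  have "((\<lambda>R. (conv_chain \<kappa> \<phi> n R - \<alpha> k * (\<Prod>j\<in>I. \<alpha> j) * R ^ n / fact n) / R ^ (n - 1)) \<longlongrightarrow>
            (\<alpha> k * (\<Sum>i\<in>I. m i * (\<Prod>j\<in>I - {i}. \<alpha> j)) + m k * (\<Prod>j\<in>I. \<alpha> j)) / fact (n - 1)) at_top" by simp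
  then show ?thesis unfolding I(3) sum_prod_remove_insert[OF I(1,2)] using I(1,2) by simp
qed

section \<open>Coordinates indexed by a linearly ordered copy of the index type\<close>

text \<open>A copy of a finite index type that carries a linear order. Triangular matrices need the order, and
vectors indexed by this type correspond to families indexed by \<open>0, \<dots>, CARD('n) - 1\<close>.\<close>

typedef ('a::finite) idx = "{..<CARD('a)}"
  morphisms nat_of_idx idx_of_nat
  by (rule exI[of _ 0]) (simp add: card_gt_0_iff)

instantiation idx :: (finite) linorder
begin
definition less_eq_idx :: "'a idx \<Rightarrow> 'a idx \<Rightarrow> bool" where "i \<le> j \<longleftrightarrow> nat_of_idx i \<le> nat_of_idx j"
definition less_idx :: "'a idx \<Rightarrow> 'a idx \<Rightarrow> bool" where "i < j \<longleftrightarrow> nat_of_idx i < nat_of_idx j"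
instance
  by standard (auto simp: less_eq_idx_def less_idx_def nat_of_idx_inject)
end

lemma bij_betw_nat_of_idx: "bij_betw (nat_of_idx :: 'a::finite idx \<Rightarrow> nat) UNIV {..<CARD('a)}"
  unfolding bij_betw_def
  using type_definition.Rep_range[OF type_definition_idx] nat_of_idx_inject by (auto simp: inj_on_def)

instance idx :: (finite) finite
  by standard (use bij_betw_finite[OF bij_betw_nat_of_idx] in auto)

instance idx :: (finite) wellorder
proof
  fix P :: "'a idx \<Rightarrow> bool" and i
  assume step: "\<And>x. (\<And>y. y < x \<Longrightarrow> P y) \<Longrightarrow> P x"
  show "P i"
    by (induction "nat_of_idx i" arbitrary: i rule: less_induct) (auto intro: step simp: less_idx_def)
qed

lemma card_idx [simp]: "CARD('a::finite idx) = CARD('a)"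
  using bij_betw_same_card[OF bij_betw_nat_of_idx[where 'a='a]] by simp

lemma nat_of_idx_less [simp]: "nat_of_idx (i :: 'a::finite idx) < CARD('a)"
  using nat_of_idx[of i] by simp

lemma nat_of_idx_of_nat [simp]: "k < CARD('a) \<Longrightarrow> nat_of_idx (idx_of_nat k :: 'a::finite idx) = k"
  by (simp add: idx_of_nat_inverse)

lemma sum_idx: "(\<Sum>i\<in>UNIV. F (nat_of_idx (i :: 'a::finite idx))) = (\<Sum>k<CARD('a). F k)"
  by (rule sum.reindex_bij_betw[OF bij_betw_nat_of_idx])

lemma prod_idx: "(\<Prod>i\<in>UNIV. F (nat_of_idx (i :: 'a::finite idx))) = (\<Prod>k<CARD('a). F k)"
  by (rule prod.reindex_bij_betw[OF bij_betw_nat_of_idx])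

text \<open>An arbitrary bijection: any permutation of the coordinates preserves Lebesgue measure and inner
products.\<close>

definition idx_coord :: "'a::finite idx \<Rightarrow> 'a" where
  "idx_coord = (SOME e. bij e)"

lemma bij_idx_coord: "bij (idx_coord :: 'a::finite idx \<Rightarrow> 'a)"
proof -
  have "\<exists>e :: 'a idx \<Rightarrow> 'a. bij e"
    using finite_same_card_bij[of "UNIV :: 'a idx set" "UNIV :: 'a set"] by simp
  then show ?thesis unfolding idx_coord_def by (rule someI_ex)
qed

definition sort_coords :: "real^'n \<Rightarrow> real^('n::finite idx)" where
  "sort_coords x = (\<chi> i. x $ idx_coord i)"

definition unsort_coords :: "real^('n::finite idx) \<Rightarrow> real^'n" where
  "unsort_coords x = (\<chi> i. x $ inv idx_coord i)"

lemma inv_idx_coord [simp]: "inv idx_coord (idx_coord i) = i" "idx_coord (inv idx_coord j) = j"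
  by (rule inv_f_f[OF bij_is_inj[OF bij_idx_coord]], rule surj_f_inv_f[OF bij_is_surj[OF bij_idx_coord]])

lemma sort_unsort [simp]: "sort_coords (unsort_coords x) = x" "unsort_coords (sort_coords y) = y"
  by (simp_all add: sort_coords_def unsort_coords_def vec_eq_iff)

lemma linear_sort_coords: "linear sort_coords"
  by (auto intro!: linearI simp: sort_coords_def vec_eq_iff)

lemma inner_sort_coords: "sort_coords x \<bullet> sort_coords y = x \<bullet> y"
  unfolding sort_coords_def inner_vec_def
  using sum.reindex_bij_betw[OF bij_idx_coord, of "\<lambda>i. x $ i \<bullet> y $ i"] by simp

lemma measurable_unsort_coords [measurable]: "unsort_coords \<in> borel_measurable borel"
  unfolding unsort_coords_def by (intro borel_measurable_continuous_onI continuous_intros)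

lemma lborel_distr_unsort_coords: "distr lborel borel unsort_coords = (lborel :: (real^'n::finite) measure)"
proof (rule lborel_eqI[symmetric])
  fix l u :: "real^'n"
  assume le: "\<And>b. b \<in> Basis \<Longrightarrow> l \<bullet> b \<le> u \<bullet> b"
  have le': "sort_coords l \<bullet> b \<le> sort_coords u \<bullet> b" if b: "b \<in> Basis" for b
  proof -
    obtain i where "b = axis i 1" using b by (auto simp: Basis_vec_def)
    moreover have "axis (idx_coord i) (1::real) \<in> Basis" by (simp add: axis_in_Basis_iff)
    ultimately show ?thesis using le[of "axis (idx_coord i) 1"] by (simp add: inner_axis sort_coords_def)
  qed
  have eq: "unsort_coords -` box l u = box (sort_coords l) (sort_coords u)"
  proof -
    have "(\<forall>i. l $ i < x $ inv idx_coord i \<and> x $ inv idx_coord i < u $ i) \<longleftrightarrow>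
      (\<forall>i. l $ idx_coord i < x $ i \<and> x $ i < u $ idx_coord i)" for x
    proof (intro iffI allI)
      fix i assume "\<forall>i. l $ i < x $ inv idx_coord i \<and> x $ inv idx_coord i < u $ i"
      from this[rule_format, of "idx_coord i"] show "l $ idx_coord i < x $ i \<and> x $ i < u $ idx_coord i"
        by simp
    next
      fix j assume "\<forall>i. l $ idx_coord i < x $ i \<and> x $ i < u $ idx_coord i"
      from this[rule_format, of "inv idx_coord j"] show "l $ j < x $ inv idx_coord j \<and> x $ inv idx_coord j < u $ j"
        by simp
    qed
    then have "unsort_coords x \<in> box l u \<longleftrightarrow> x \<in> box (sort_coords l) (sort_coords u)" for x
      by (simp add: mem_box_cart unsort_coords_def sort_coords_def)
    then show ?thesis by auto
  qed
  have "emeasure (distr lborel borel unsort_coords) (box l u) = emeasure lborel (box (sort_coords l) (sort_coords u))"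
    by (simp add: emeasure_distr eq)
  also have "\<dots> = (\<Prod>b\<in>Basis. (sort_coords u - sort_coords l) \<bullet> b)"
    using le' by (simp add: emeasure_lborel_box_eq inner_diff_left)
  also have "(\<Prod>b\<in>Basis. (sort_coords u - sort_coords l) \<bullet> b) = (\<Prod>i\<in>UNIV. (sort_coords u - sort_coords l) $ i)"
    unfolding Basis_vec_def by (subst prod.UNION_disjoint) (auto simp: inner_axis axis_eq_axis)
  also have "\<dots> = (\<Prod>i\<in>UNIV. (u - l) $ i)"
    using prod.reindex_bij_betw[OF bij_idx_coord, of "\<lambda>i. (u - l) $ i"] by (simp add: sort_coords_def)
  also have "\<dots> = (\<Prod>b\<in>Basis. (u - l) \<bullet> b)"
    unfolding Basis_vec_def by (subst prod.UNION_disjoint) (auto simp: inner_axis axis_eq_axis)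
  finally show "emeasure (distr lborel borel unsort_coords) (box l u) = (\<Prod>b\<in>Basis. (u - l) \<bullet> b)" .
qed simp

lemma nn_integral_unsort_coords:
  fixes h :: "real^'n::finite \<Rightarrow> ennreal"
  assumes [measurable]: "h \<in> borel_measurable borel"
  shows "(\<integral>\<^sup>+x. h x \<partial>lborel) = (\<integral>\<^sup>+v. h (unsort_coords v) \<partial>lborel)"
  by (subst lborel_distr_unsort_coords[symmetric], subst nn_integral_distr) auto

lemma borel_measurable_vec_lambda:
  assumes "\<And>i. f i \<in> borel_measurable M"
  shows "(\<lambda>x. (\<chi> i. f i x) :: real^'m) \<in> borel_measurable M"
proof (rule borel_measurable_euclidean_space[THEN iffD2], rule ballI)
  fix b :: "real^'m" assume "b \<in> Basis"
  then obtain i where "b = axis i 1" by (auto simp: Basis_vec_def)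
  then show "(\<lambda>x. (\<chi> i. f i x) \<bullet> b) \<in> borel_measurable M"
    using assms[of i] by (simp add: inner_axis)
qed

lemma lborel_distr_PiM_idx:
  "distr (\<Pi>\<^sub>M k\<in>{..<CARD('n)}. lborel) borel (\<lambda>f. \<chi> i. f (nat_of_idx i)) = (lborel :: (real^('n::finite idx)) measure)"
proof (rule lborel_eqI[symmetric])
  interpret product_sigma_finite "\<lambda>_::nat. lborel :: real measure" by standard
  let ?n = "CARD('n)" and ?V = "\<lambda>f. (\<chi> i. f (nat_of_idx i)) :: real^('n idx)"
  have [measurable]: "?V \<in> (\<Pi>\<^sub>M k\<in>{..<?n}. lborel) \<rightarrow>\<^sub>M borel"
    by (rule borel_measurable_vec_lambda) measurable
  fix l u :: "real^'n idx"
  assume le: "\<And>b. b \<in> Basis \<Longrightarrow> l \<bullet> b \<le> u \<bullet> b"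
  have le': "l $ i \<le> u $ i" for i
    using le[of "axis i 1"] by (simp add: inner_axis axis_in_Basis_iff)
  have eq: "?V -` box l u \<inter> space (\<Pi>\<^sub>M k\<in>{..<?n}. lborel) = Pi\<^sub>E {..<?n} (\<lambda>k. {l $ idx_of_nat k <..< u $ idx_of_nat k})"
  proof -
    have 1: "l $ i < f (nat_of_idx i) \<and> f (nat_of_idx i) < u $ i"
      if "\<And>k. k < ?n \<Longrightarrow> f k \<in> {l $ idx_of_nat k <..< u $ idx_of_nat k}" for f and i :: "'n idx"
      using that[of "nat_of_idx i"] by (simp add: nat_of_idx_inverse)
    have 2: "f k \<in> {l $ idx_of_nat k <..< u $ idx_of_nat k}"
      if "\<And>i. l $ i < f (nat_of_idx i) \<and> f (nat_of_idx i) < u $ i" "k < ?n" for f k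
      using that(1)[of "idx_of_nat k"] that(2) by simp
    show ?thesis
    proof (intro equalityI subsetI)
      fix f assume "f \<in> ?V -` box l u \<inter> space (\<Pi>\<^sub>M k\<in>{..<?n}. lborel)"
      then have f: "\<And>i. l $ i < f (nat_of_idx i) \<and> f (nat_of_idx i) < u $ i" and e: "f \<in> extensional {..<?n}"
        by (simp_all add: mem_box_cart space_PiM PiE_def)
      then show "f \<in> Pi\<^sub>E {..<?n} (\<lambda>k. {l $ idx_of_nat k <..< u $ idx_of_nat k})"
        by (intro PiE_I 2[OF f] extensional_arb[OF e]) auto
    next
      fix f assume f: "f \<in> Pi\<^sub>E {..<?n} (\<lambda>k. {l $ idx_of_nat k <..< u $ idx_of_nat k})"
      then have "l $ i < f (nat_of_idx i) \<and> f (nat_of_idx i) < u $ i" for i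
        by (intro 1 PiE_mem[OF f]) auto
      then show "f \<in> ?V -` box l u \<inter> space (\<Pi>\<^sub>M k\<in>{..<?n}. lborel)"
        using f by (simp add: mem_box_cart space_PiM PiE_def)
    qed
  qed
  have "emeasure (distr (\<Pi>\<^sub>M k\<in>{..<?n}. lborel) borel ?V) (box l u) = (\<Prod>k<?n. emeasure lborel {l $ idx_of_nat k <..< u $ idx_of_nat k})"
    by (subst emeasure_distr, measurable, subst eq, rule emeasure_PiM) auto
  also have "\<dots> = (\<Prod>k<?n. ennreal (u $ idx_of_nat k - l $ idx_of_nat k))"
    by (intro prod.cong refl emeasure_lborel_Ioo le')
  also have "\<dots> = (\<Prod>i\<in>UNIV. ennreal ((u - l) $ i))"
    unfolding prod_idx[where 'a='n, of "\<lambda>k. ennreal (u $ idx_of_nat k - l $ idx_of_nat k)", symmetric]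
    by (simp add: nat_of_idx_inverse)
  also have "\<dots> = ennreal (\<Prod>i\<in>UNIV. (u - l) $ i)" by (rule prod_ennreal) (simp add: le')
  also have "(\<Prod>i\<in>UNIV. (u - l) $ i) = (\<Prod>b\<in>Basis. (u - l) \<bullet> b)"
    unfolding Basis_vec_def by (subst prod.UNION_disjoint) (auto simp: inner_axis axis_eq_axis)
  finally show "emeasure (distr (\<Pi>\<^sub>M k\<in>{..<?n}. lborel) borel ?V) (box l u) = (\<Prod>b\<in>Basis. (u - l) \<bullet> b)" .
qed simp

text \<open>The matrix is diagonalised by \<open>Q\<close>. Its column \<open>k\<close> is the vector of ones, an eigenvector with
eigenvalue \<open>1 - \<sigma>\<close>, and its other columns are vectors orthogonal to \<open>s\<close>, which are fixed.\<close>

lemma det_identity_minus_rank_one: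
  fixes s :: "real^'m"
  assumes "\<And>i. s $ i > 0"
  shows "det (\<chi> i j. (if i = j then 1 else 0) - s $ j) = 1 - (\<Sum>i\<in>UNIV. s $ i)"
proof -
  \<comment> \<open>Any index will do.\<close>
  define k :: 'm where "k = undefined"
  define \<sigma> where "\<sigma> = (\<Sum>i\<in>UNIV. s $ i)"
  have \<sigma>: "\<sigma> > 0" unfolding \<sigma>_def using assms by (intro sum_pos) auto
  define A :: "real^'m^'m" where "A = (\<chi> i j. (if i = j then 1 else 0) - s $ j)"
  define Q :: "real^'m^'m" where "Q = (\<chi> i j. if j = k then 1 else if i = j then 1 else if i = k then - s $ j / s $ k else 0)"
  define D :: "real^'m^'m" where "D = (\<chi> i j. if i = j then if j = k then 1 - \<sigma> else 1 else 0)"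
  have sQ: "(\<Sum>l\<in>UNIV. s $ l * Q $ l $ j) = (if j = k then \<sigma> else 0)" for j
  proof (cases "j = k")
    case False
    have "(\<Sum>l\<in>UNIV. s $ l * Q $ l $ j) = (\<Sum>l\<in>{j, k}. s $ l * Q $ l $ j)"
      using False by (intro sum.mono_neutral_right) (auto simp: Q_def)
    also have "\<dots> = 0" using False assms[of k] by (simp add: Q_def)
    finally show ?thesis using False by simp
  qed (simp add: Q_def \<sigma>_def)
  have "A ** Q = Q ** D"
  proof -
    have "(A ** Q) $ i $ j = (Q ** D) $ i $ j" for i j
    proof -
      have "(A ** Q) $ i $ j = (\<Sum>l\<in>UNIV. (if i = l then 1 else 0) * Q $ l $ j) - (\<Sum>l\<in>UNIV. s $ l * Q $ l $ j)"
        by (simp add: matrix_matrix_mult_def A_def left_diff_distrib sum_subtractf)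
      also have "\<dots> = Q $ i $ j - (if j = k then \<sigma> else 0)" by (simp add: sQ if_distrib[of "\<lambda>x. x * _"] cong: if_cong)
      also have "\<dots> = Q $ i $ j * (if j = k then 1 - \<sigma> else 1)" by (simp add: Q_def)
      also have "\<dots> = (Q ** D) $ i $ j" by (simp add: matrix_matrix_mult_def D_def if_distrib cong: if_cong)
      finally show ?thesis .
    qed
    then show ?thesis by (simp add: vec_eq_iff)
  qed
  then have "det A * det Q = det Q * det D" unfolding det_mul[symmetric] by simp
  moreover have "det Q \<noteq> 0"
  proof -
    have "x = 0" if "Q *v x = 0" for x
    proof -
      have "(\<Sum>i\<in>UNIV. s $ i * (Q *v x) $ i) = (\<Sum>j\<in>UNIV. (\<Sum>i\<in>UNIV. s $ i * Q $ i $ j) * x $ j)"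
        unfolding matrix_vector_mult_def by (simp add: sum_distrib_left sum_distrib_right mult.assoc) (rule sum.swap)
      also have "\<dots> = \<sigma> * x $ k" by (simp add: sQ if_distrib[of "\<lambda>t. t * _"] cong: if_cong)
      finally have xk: "x $ k = 0" using that \<sigma> by simp
      have "x $ i = 0" for i
      proof (cases "i = k")
        case False
        have "(Q *v x) $ i = (\<Sum>j\<in>UNIV. Q $ i $ j * x $ j)" by (simp add: matrix_vector_mult_def)
        also have "\<dots> = (\<Sum>j\<in>{i}. Q $ i $ j * x $ j)"
          using False xk by (intro sum.mono_neutral_right) (auto simp: Q_def)
        also have "\<dots> = x $ i" using False by (simp add: Q_def)
        finally have "(Q *v x) $ i = x $ i" .
        then show ?thesis using that by simp
      qed (simp add: xk)
      then show ?thesis by (simp add: vec_eq_iff)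
    qed
    then have "\<exists>B. B ** Q = mat 1" unfolding matrix_left_invertible_ker by blast
    then show ?thesis unfolding invertible_det_nz[symmetric] invertible_left_inverse .
  qed
  moreover have "det D = 1 - \<sigma>"
  proof -
    have "det D = (\<Prod>i\<in>UNIV. D $ i $ i)" by (rule det_diagonal) (simp add: D_def)
    also have "\<dots> = (\<Prod>i\<in>UNIV. if i = k then 1 - \<sigma> else 1)" by (simp add: D_def)
    also have "\<dots> = 1 - \<sigma>" by simp
    finally show ?thesis .
  qed
  ultimately show ?thesis by (simp add: A_def \<sigma>_def)
qed

section \<open>Integration over simplicial cones\<close>

text \<open>Only \<open>p 0, \<dots>, p (CARD('n) - 1)\<close> matter: they span the cone.\<close>

definition cone_map :: "(nat \<Rightarrow> real^'n) \<Rightarrow> real^('n::finite idx) \<Rightarrow> real^'n" where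
  "cone_map p s = (\<Sum>i\<in>UNIV. s $ i *\<^sub>R p (nat_of_idx i))"

definition frame_matrix :: "(nat \<Rightarrow> real^'n) \<Rightarrow> real^('n::finite idx)^('n idx)" where
  "frame_matrix p = (\<chi> i j. sort_coords (p (nat_of_idx j)) $ i)"

definition frame_vol :: "(nat \<Rightarrow> real^'n::finite) \<Rightarrow> real" where
  "frame_vol p = \<bar>det (frame_matrix p)\<bar>"

lemma sort_cone_map: "sort_coords (cone_map p s) = frame_matrix p *v s"
  by (simp add: vec_eq_iff cone_map_def sort_coords_def matrix_vector_mult_def frame_matrix_def mult.commute)

lemma cone_map_eq: "cone_map p s = unsort_coords (frame_matrix p *v s)"
  by (simp add: sort_cone_map[symmetric])

lemma frame_vol_nonneg: "frame_vol p \<ge> 0"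
  by (simp add: frame_vol_def)

text \<open>In the volume formula a frame of points and a frame of functionals always occur together. The product
of their volumes is a Gram determinant, in which the choice of coordinates has disappeared.\<close>

lemma frame_vol_mult:
  fixes p b :: "nat \<Rightarrow> real^'n::finite"
  shows
  "frame_vol p * frame_vol b = \<bar>det (\<chi> i j. p (nat_of_idx i) \<bullet> b (nat_of_idx j) :: real^('n::finite idx)^('n idx))\<bar>"
proof -
  have eq: "transpose (frame_matrix p) ** frame_matrix b = (\<chi> i j. p (nat_of_idx i) \<bullet> b (nat_of_idx j))"
    unfolding inner_sort_coords[of "p _", symmetric]
    by (simp add: vec_eq_iff matrix_matrix_mult_def transpose_def frame_matrix_def inner_vec_def)
  show ?thesis unfolding eq[symmetric] det_mul by (simp add: frame_vol_def abs_mult det_transpose)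
qed

lemma frame_vol_scale:
  "frame_vol (\<lambda>k. c k *\<^sub>R b k :: real^'n::finite) = (\<Prod>k<CARD('n). \<bar>c k\<bar>) * frame_vol b"
proof -
  have eq: "transpose (frame_matrix (\<lambda>k. c k *\<^sub>R b k)) = (\<chi> i. c (nat_of_idx i) *s (sort_coords (b (nat_of_idx i))))"
    by (simp add: vec_eq_iff transpose_def frame_matrix_def linear_cmul[OF linear_sort_coords])
  have "det (frame_matrix (\<lambda>k. c k *\<^sub>R b k)) = (\<Prod>i\<in>UNIV. c (nat_of_idx (i::'n idx))) * det (\<chi> i. sort_coords (b (nat_of_idx i)))"
    unfolding det_transpose[of "frame_matrix (\<lambda>k. c k *\<^sub>R b k)", symmetric] eq by (rule det_rows_mul)
  also have "(\<chi> i. sort_coords (b (nat_of_idx i))) = transpose (frame_matrix b)"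
    by (simp add: vec_eq_iff transpose_def frame_matrix_def)
  finally show ?thesis
    by (simp add: frame_vol_def abs_mult det_transpose abs_prod prod_idx)
qed

lemma inj_cone_map:
  assumes "frame_vol p \<noteq> 0"
  shows "inj (cone_map p)"
proof -
  have "inj ((*v) (frame_matrix p))"
    using assms by (simp add: frame_vol_def inj_matrix_vector_mult invertible_det_nz)
  then have "s = t" if "cone_map p s = cone_map p t" for s t
    using arg_cong[OF that, of sort_coords] by (simp add: sort_cone_map inj_eq)
  then show ?thesis by (rule injI)
qed

definition std_simplex_closed :: "(real^'m) set" where
  "std_simplex_closed = {s. (\<forall>i. s $ i \<ge> 0) \<and> (\<Sum>i\<in>UNIV. s $ i) \<le> 1}"

definition std_simplex_open :: "(real^'m) set" where
  "std_simplex_open = {s. (\<forall>i. s $ i > 0) \<and> (\<Sum>i\<in>UNIV. s $ i) < 1}"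

lemma std_simplex_closed_eq: "std_simplex_closed = (convex hull (insert 0 Basis) :: (real^'m) set)"
proof -
  have "(\<Sum>b\<in>Basis. x \<bullet> b) = (\<Sum>i\<in>UNIV. x $ i)" for x :: "real^'m"
    unfolding Basis_vec_def by (subst sum.UNION_disjoint) (auto simp: inner_axis axis_eq_axis)
  then show ?thesis
    unfolding std_simplex std_simplex_closed_def by (auto simp: Basis_vec_def inner_axis)
qed

lemma compact_std_simplex_closed: "compact std_simplex_closed"
  unfolding std_simplex_closed_eq by (intro finite_imp_compact_convex_hull) auto

lemma open_std_simplex_open: "open (std_simplex_open :: (real^'m) set)"
proof -
  have eq: "(std_simplex_open :: (real^'m) set) = (\<Inter>i. {s. s $ i > 0}) \<inter> {s. (\<Sum>i\<in>UNIV. s $ i) < 1}"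
    by (auto simp: std_simplex_open_def)
  show ?thesis
    unfolding eq by (intro open_INT open_Int open_Collect_less continuous_intros ballI finite)
qed

lemma emeasure_cone_map_image:
  assumes "compact A"
  shows "emeasure lborel (cone_map p ` A) = ennreal (frame_vol p * measure lebesgue A)"
    and "cone_map p ` A \<in> sets borel"
proof -
  let ?L = "(*v) (frame_matrix p)"
  have cont: "continuous_on A (cone_map p)"
    unfolding cone_map_def by (intro continuous_intros)
  show m: "cone_map p ` A \<in> sets borel"
    using compact_continuous_image[OF cont assms] by (simp add: borel_compact)
  have c: "compact (?L ` A)" using assms
    by (intro compact_continuous_image) (auto intro: matrix_vector_mult_linear_continuous_on)
  have "emeasure lborel (cone_map p ` A) = emeasure lborel (unsort_coords -` (cone_map p ` A))"
    using m by (subst lborel_distr_unsort_coords[symmetric], subst emeasure_distr) auto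
  also have "unsort_coords -` (cone_map p ` A) = ?L ` A"
    unfolding cone_map_eq by (auto simp: image_iff) (metis sort_unsort(1))
  also have "emeasure lborel (?L ` A) = emeasure lebesgue (?L ` A)"
    using c by (simp add: borel_compact)
  also have "\<dots> = ennreal (measure lebesgue (?L ` A))"
    using lmeasurable_compact[OF c] by (simp add: emeasure_eq_measure2)
  also have "measure lebesgue (?L ` A) = frame_vol p * measure lebesgue A"
    using assms measure_lebesgue_linear_transformation[of A ?L]
    by (simp add: compact_imp_bounded frame_vol_def lmeasurable_compact fmeasurableD)
  finally show "emeasure lborel (cone_map p ` A) = ennreal (frame_vol p * measure lebesgue A)" .
qed

lemma emeasure_cone_map_simplex:
  "emeasure lborel (cone_map (p :: nat \<Rightarrow> real^'n) ` std_simplex_closed) = ennreal (frame_vol p / fact CARD('n))"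
proof -
  have "measure lebesgue (std_simplex_closed :: (real^'n idx) set) = 1 / fact CARD('n)"
  proof (subst measure_completion)
    show "(std_simplex_closed :: (real^'n idx) set) \<in> sets lborel"
      by (simp add: borel_closed[OF compact_imp_closed[OF compact_std_simplex_closed]])
    show "measure lborel (std_simplex_closed :: (real^'n idx) set) = 1 / fact CARD('n)"
      using content_std_simplex[where 'a="real^'n idx"] by (simp add: std_simplex_closed_eq)
  qed
  then show ?thesis by (simp add: emeasure_cone_map_image compact_std_simplex_closed)
qed

lemma null_sets_cone_map_simplex_boundary:
  "cone_map (p :: nat \<Rightarrow> real^'n) ` (std_simplex_closed - std_simplex_open) \<in> null_sets lborel"
proof -
  let ?B = "std_simplex_closed - std_simplex_open :: (real^'n idx) set"
  have c: "compact ?B" by (intro compact_diff compact_std_simplex_closed open_std_simplex_open)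
  have "?B \<subseteq> (\<Union>i. {s. axis i 1 \<bullet> s = 0}) \<union> {s. (\<chi> i. 1) \<bullet> s = 1}"
  proof
    fix s :: "real^'n idx" assume s: "s \<in> ?B"
    then have s': "\<And>i. s $ i \<ge> 0" "(\<Sum>i\<in>UNIV. s $ i) \<le> 1" by (auto simp: std_simplex_closed_def)
    show "s \<in> (\<Union>i. {s. axis i 1 \<bullet> s = 0}) \<union> {s. (\<chi> i. 1) \<bullet> s = 1}"
    proof (rule ccontr)
      assume "s \<notin> (\<Union>i. {s. axis i 1 \<bullet> s = 0}) \<union> {s. (\<chi> i. 1) \<bullet> s = 1}"
      then have "s $ i \<noteq> 0" "(\<Sum>i\<in>UNIV. s $ i) \<noteq> 1" for i
        by (simp_all add: inner_axis' inner_vec_def[of "\<chi> i. 1"])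
      then have "s \<in> std_simplex_open" using s' by (simp add: std_simplex_open_def order_less_le)
      then show False using s by simp
    qed
  qed
  moreover have "negligible ((\<Union>i. {s::real^'n idx. axis i 1 \<bullet> s = 0}) \<union> {s. (\<chi> i. 1) \<bullet> s = 1})"
    by (intro negligible_Un negligible_Union) (auto intro!: negligible_hyperplane simp: axis_eq_0_iff)
  ultimately have "negligible ?B" by (rule negligible_subset[rotated])
  then have "measure lebesgue ?B = 0" by (simp add: negligible_imp_measure0)
  then show ?thesis using emeasure_cone_map_image[OF c, of p] by (simp add: null_sets_def)
qed

lemma std_simplex_open_eq_UN:
  "(std_simplex_open :: (real^'m) set) =
     (\<Union>n. {s. (\<forall>i. s $ i \<ge> 1 / real (Suc n)) \<and> (\<Sum>i\<in>UNIV. s $ i) \<le> 1 - 1 / real (Suc n)})" (is "_ = ?R")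
proof (intro equalityI subsetI)
  fix s :: "real^'m" assume s: "s \<in> std_simplex_open"
  define m where "m = Min (insert (1 - (\<Sum>i\<in>UNIV. s $ i)) (range (\<lambda>i. s $ i)))"
  have "m > 0" using s unfolding m_def by (subst Min_gr_iff) (auto simp: std_simplex_open_def)
  then obtain n where n: "1 / real (Suc n) < m" using nat_approx_posE by blast
  have m: "m \<le> s $ i" for i unfolding m_def by (intro Min_le) auto
  have "1 / real (Suc n) \<le> s $ i" for i using n m[of i] by linarith
  moreover have "m \<le> 1 - (\<Sum>i\<in>UNIV. s $ i)" unfolding m_def by (intro Min_le) auto
  then have "(\<Sum>i\<in>UNIV. s $ i) \<le> 1 - 1 / real (Suc n)" using n by linarith
  ultimately show "s \<in> ?R" by blast
next
  fix s assume "s \<in> ?R"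
  then obtain n where n: "\<And>i. s $ i \<ge> 1 / real (Suc n)" "(\<Sum>i\<in>UNIV. s $ i) \<le> 1 - 1 / real (Suc n)" by blast
  have p: "1 / real (Suc n) > 0" by simp
  have "s $ i > 0" for i using n(1)[of i] p by linarith
  moreover have "(\<Sum>i\<in>UNIV. s $ i) < 1" using n(2) p by linarith
  ultimately show "s \<in> std_simplex_open" by (simp add: std_simplex_open_def)
qed

text \<open>The open simplex is a countable union of compact sets, so its image is a Borel set even if the
frame is degenerate.\<close>

lemma cone_map_open_simplex_borel:
  "cone_map p ` std_simplex_open \<in> sets borel"
  unfolding std_simplex_open_eq_UN image_UN
proof (intro sets.countable_UN image_subsetI emeasure_cone_map_image(2))
  fix n :: nat
  let ?S = "{s::real^'a idx. (\<forall>i. s $ i \<ge> 1 / real (Suc n)) \<and> (\<Sum>i\<in>UNIV. s $ i) \<le> 1 - 1 / real (Suc n)}"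
  have sub: "?S \<subseteq> std_simplex_closed"
  proof
    fix s assume "s \<in> ?S"
    then have s: "\<And>i. 1 / real (Suc n) \<le> s $ i" "(\<Sum>i\<in>UNIV. s $ i) \<le> 1 - 1 / real (Suc n)" by simp_all
    have p: "0 \<le> 1 / real (Suc n)" by simp
    have "0 \<le> s $ i" for i using s(1)[of i] p by linarith
    moreover have "(\<Sum>i\<in>UNIV. s $ i) \<le> 1" using s(2) p by linarith
    ultimately show "s \<in> std_simplex_closed" by (simp add: std_simplex_closed_def)
  qed
  have cl: "closed ?S"
    by (intro closed_Collect_conj closed_Collect_all closed_Collect_le continuous_intros)
  show "compact ?S"
    using compact_Int_closed[OF compact_std_simplex_closed cl] by (simp only: Int_absorb1[OF sub])
qed

text \<open>A parametrisation of the open standard simplex by the whole space. The barycentric coordinates,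
including the one of the vertex \<open>0\<close>, are proportional to the numbers \<open>exp (- z $ i)\<close> and \<open>1\<close>.\<close>

definition softmax :: "real^'m \<Rightarrow> real^'m" where
  "softmax z = (\<chi> i. exp (- z $ i) / (1 + (\<Sum>j\<in>UNIV. exp (- z $ j))))"

lemma sum_exp_pos: "1 + (\<Sum>j\<in>UNIV. exp (- z $ j)) > (0::real)"
  by (intro add_pos_nonneg sum_nonneg) auto

lemma sum_exp_nonzero: "1 + (\<Sum>j\<in>UNIV. exp (- z $ j)) \<noteq> (0::real)"
  using sum_exp_pos[of z] by linarith

lemma softmax_pos: "softmax z $ i > 0"
  by (simp add: softmax_def sum_exp_pos)

lemma one_minus_sum_softmax: "1 - (\<Sum>i\<in>UNIV. softmax z $ i) = 1 / (1 + (\<Sum>j\<in>UNIV. exp (- z $ j)))"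
  using sum_exp_pos[of z] by (simp add: softmax_def sum_divide_distrib[symmetric] divide_simps)

lemma softmax_ratio: "exp (- z $ i) = softmax z $ i / (1 - (\<Sum>i\<in>UNIV. softmax z $ i))"
  unfolding one_minus_sum_softmax using sum_exp_pos[of z] by (simp add: softmax_def)

lemma inj_softmax: "inj softmax"
proof (rule injI)
  fix z w :: "real^'m" assume eq: "softmax z = softmax w"
  have "exp (- z $ i) = exp (- w $ i)" for i by (simp only: softmax_ratio eq)
  then show "z = w" by (simp add: vec_eq_iff)
qed

lemma range_softmax: "range softmax = std_simplex_open"
proof (intro equalityI subsetI)
  fix s :: "real^'m" assume "s \<in> range softmax"
  then obtain z where s: "s = softmax z" by blast
  have "1 - (\<Sum>i\<in>UNIV. s $ i) > 0" unfolding s one_minus_sum_softmax using sum_exp_pos[of z] by simp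
  then show "s \<in> std_simplex_open" using softmax_pos[of z] by (simp add: std_simplex_open_def s)
next
  fix s :: "real^'m" assume "s \<in> std_simplex_open"
  then have s: "\<And>i. s $ i > 0" "(\<Sum>i\<in>UNIV. s $ i) < 1" by (auto simp: std_simplex_open_def)
  define t where "t = 1 - (\<Sum>i\<in>UNIV. s $ i)"
  have t: "t > 0" using s by (simp add: t_def)
  define z :: "real^'m" where "z = (\<chi> i. - ln (s $ i / t))"
  have e: "exp (- z $ i) = s $ i / t" for i using s t by (simp add: z_def)
  have "1 + (\<Sum>j\<in>UNIV. exp (- z $ j)) = 1 / t"
    unfolding e using t by (simp add: sum_divide_distrib[symmetric] divide_simps) (simp add: t_def)
  then have "softmax z = s" using t by (simp add: softmax_def e vec_eq_iff)
  then show "s \<in> range softmax" by blast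
qed

lemma softmax_has_derivative:
  fixes z :: "real^'m"
  shows "(softmax has_derivative (\<lambda>w. \<chi> i. softmax z $ i * ((\<Sum>j\<in>UNIV. softmax z $ j * w $ j) - w $ i))) (at z within S)"
proof (subst has_derivative_componentwise_within, rule ballI)
  fix b :: "real^'m" assume "b \<in> Basis"
  then obtain i where b: "b = axis i 1" by (auto simp: Basis_vec_def)
  define D where "D = 1 + (\<Sum>j\<in>UNIV. exp (- z $ j))"
  have D: "D > 0" unfolding D_def by (rule sum_exp_pos)
  have nth: "((\<lambda>x. x $ j) has_derivative (\<lambda>w. w $ j)) (at z within S)" for j
    by (rule bounded_linear.has_derivative[OF bounded_linear_vec_nth has_derivative_ident])
  have e: "((\<lambda>x. exp (- x $ j)) has_derivative (\<lambda>w. exp (- z $ j) * - w $ j)) (at z within S)" for j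
    by (auto intro!: derivative_eq_intros nth)
  have "((\<lambda>x. exp (- x $ i) / (1 + (\<Sum>j\<in>UNIV. exp (- x $ j)))) has_derivative
      (\<lambda>w. (exp (- z $ i) * - w $ i * D - exp (- z $ i) * (0 + (\<Sum>j\<in>UNIV. exp (- z $ j) * - w $ j))) / (D * D))) (at z within S)"
    unfolding D_def using D
    by (intro has_derivative_divide' has_derivative_add has_derivative_const has_derivative_sum e) (simp add: D_def)
  moreover have "(exp (- z $ i) * - w $ i * D - exp (- z $ i) * (0 + (\<Sum>j\<in>UNIV. exp (- z $ j) * - w $ j))) / (D * D)
      = softmax z $ i * ((\<Sum>j\<in>UNIV. softmax z $ j * w $ j) - w $ i)" for w
  proof -
    have 1: "(\<Sum>j\<in>UNIV. softmax z $ j * w $ j) = (\<Sum>j\<in>UNIV. exp (- z $ j) * w $ j) / D"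
      by (simp add: softmax_def D_def sum_divide_distrib)
    have 2: "softmax z $ i = exp (- z $ i) / D" by (simp add: softmax_def D_def)
    show ?thesis unfolding 1 2 using D by (simp add: field_simps sum_negf)
  qed
  ultimately show "((\<lambda>x. softmax x \<bullet> b) has_derivative
      (\<lambda>x. (\<chi> i. softmax z $ i * ((\<Sum>j\<in>UNIV. softmax z $ j * x $ j) - x $ i)) \<bullet> b)) (at z within S)"
    by (simp add: b inner_axis softmax_def)
qed

definition softmax_jacobian :: "real^'m \<Rightarrow> real" where
  "softmax_jacobian z = (\<Prod>i\<in>UNIV. softmax z $ i) * (1 - (\<Sum>i\<in>UNIV. softmax z $ i))"

lemma abs_det_softmax_derivative:
  "\<bar>det (matrix (\<lambda>w. \<chi> i. softmax z $ i * ((\<Sum>j\<in>UNIV. softmax z $ j * w $ j) - w $ i)))\<bar> = softmax_jacobian z"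
proof -
  define s where "s = softmax z"
  have s: "s $ i > 0" for i unfolding s_def by (rule softmax_pos)
  have "matrix (\<lambda>w. \<chi> i. s $ i * ((\<Sum>j\<in>UNIV. s $ j * w $ j) - w $ i)) =
     (\<chi> i. (- s $ i) *s (\<chi> j. (if i = j then 1 else 0) - s $ j))"
  proof -
    have "(\<Sum>l\<in>UNIV. s $ l * axis j 1 $ l) = s $ j" for j
      by (simp add: axis_def if_distrib[of "\<lambda>x. _ * x"] cong: if_cong)
    then show ?thesis by (simp add: matrix_def vec_eq_iff axis_def algebra_simps)
  qed
  then have "det (matrix (\<lambda>w. \<chi> i. s $ i * ((\<Sum>j\<in>UNIV. s $ j * w $ j) - w $ i))) =
     (\<Prod>i\<in>UNIV. - s $ i) * (1 - (\<Sum>i\<in>UNIV. s $ i))"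
    by (simp only: det_rows_mul det_identity_minus_rank_one[OF s])
  moreover have "1 - (\<Sum>i\<in>UNIV. s $ i) \<ge> 0"
    unfolding s_def one_minus_sum_softmax using sum_exp_pos[of z] by simp
  moreover have "\<bar>\<Prod>i\<in>UNIV. - s $ i\<bar> = (\<Prod>i\<in>UNIV. s $ i)"
    using s by (simp add: abs_prod less_imp_le)
  ultimately show ?thesis by (simp add: softmax_jacobian_def s_def abs_mult)
qed

text \<open>Translates statements about absolutely integrable functions, for which the change of variables
theorem is available, into statements about nonnegative integrals.\<close>

lemma absolutely_integrable_on_iff_nn_integral:
  fixes u :: "'a::euclidean_space \<Rightarrow> real"
  assumes [measurable]: "A \<in> sets borel" "u \<in> borel_measurable borel" and nonneg: "\<And>x. u x \<ge> 0"
  shows "u absolutely_integrable_on A \<and> integral A u = b \<longleftrightarrow>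
    b \<ge> 0 \<and> (\<integral>\<^sup>+x. ennreal (u x) * indicator A x \<partial>lborel) = ennreal b"
proof -
  have iff: "u absolutely_integrable_on A \<longleftrightarrow> set_integrable lborel A u"
    unfolding set_integrable_def by (rule integrable_completion) measurable
  have eq: "(\<integral>\<^sup>+x. ennreal (u x) * indicator A x \<partial>lborel) = (\<integral>\<^sup>+x. ennreal (indicator A x *\<^sub>R u x) \<partial>lborel)"
    by (intro nn_integral_cong) (simp add: indicator_def)
  show ?thesis
  proof
    assume L: "u absolutely_integrable_on A \<and> integral A u = b"
    then have i: "set_integrable lborel A u" by (simp add: iff)
    have "(\<integral>\<^sup>+x. ennreal (indicator A x *\<^sub>R u x) \<partial>lborel) = ennreal (LINT x:A|lborel. u x)"
      unfolding set_lebesgue_integral_def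
      using i nonneg by (intro nn_integral_eq_integral) (auto simp: set_integrable_def)
    moreover have "(LINT x:A|lborel. u x) = b" using set_borel_integral_eq_integral(2)[OF i] L by simp
    moreover have "(LINT x:A|lborel. u x) \<ge> 0" unfolding set_lebesgue_integral_def using nonneg by simp
    ultimately show "b \<ge> 0 \<and> (\<integral>\<^sup>+x. ennreal (u x) * indicator A x \<partial>lborel) = ennreal b" by (simp add: eq)
  next
    assume R: "b \<ge> 0 \<and> (\<integral>\<^sup>+x. ennreal (u x) * indicator A x \<partial>lborel) = ennreal b"
    then have e: "(\<integral>\<^sup>+x. ennreal (indicator A x *\<^sub>R u x) \<partial>lborel) = ennreal b" by (simp add: eq)
    have i: "set_integrable lborel A u" unfolding set_integrable_def
      by (rule integrableI_nn_integral_finite[OF _ _ e]) (use nonneg in auto)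
    have "(LINT x:A|lborel. u x) = b" unfolding set_lebesgue_integral_def
      using e R nonneg by (subst integral_eq_nn_integral) auto
    then show "u absolutely_integrable_on A \<and> integral A u = b"
      using set_borel_integral_eq_integral(2)[OF i] i by (simp add: iff)
  qed
qed

lemma softmax_measurable [measurable]: "softmax \<in> borel_measurable borel"
  unfolding softmax_def
  by (intro borel_measurable_continuous_onI continuous_intros) (auto simp: sum_exp_nonzero)

lemma cone_map_measurable [measurable]: "cone_map p \<in> borel_measurable borel"
  unfolding cone_map_def by (intro borel_measurable_continuous_onI continuous_intros)

lemma softmax_jacobian_measurable [measurable]: "softmax_jacobian \<in> borel_measurable borel"
  unfolding softmax_jacobian_def softmax_def
  by (intro borel_measurable_continuous_onI continuous_intros) (auto simp: sum_exp_nonzero)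

lemma softmax_jacobian_nonneg: "softmax_jacobian z \<ge> 0"
  using sum_exp_pos[of z] unfolding softmax_jacobian_def one_minus_sum_softmax
  by (intro mult_nonneg_nonneg prod_nonneg) (auto intro: less_imp_le softmax_pos)

lemma nn_integral_cone_simplex:
  fixes p :: "nat \<Rightarrow> real^'n" and h :: "real^'n \<Rightarrow> real"
  assumes p: "frame_vol p \<noteq> 0" and h [measurable]: "h \<in> borel_measurable borel" and nonneg: "\<And>x. h x \<ge> 0"
  shows "(\<integral>\<^sup>+x. ennreal (h x) * indicator (cone_map p ` std_simplex_open) x \<partial>lborel) =
    (\<integral>\<^sup>+z. ennreal (frame_vol p * softmax_jacobian z * h (cone_map p (softmax z))) \<partial>lborel)"
proof -
  define M where "M = frame_matrix p"
  define g where "g = (\<lambda>z. M *v softmax z)"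
  define u where "u = (\<lambda>v. h (unsort_coords v))"
  define D where "D = (\<lambda>z. frame_vol p * softmax_jacobian z * h (cone_map p (softmax z)))"
  have [measurable]: "u \<in> borel_measurable borel" "D \<in> borel_measurable borel"
    unfolding u_def D_def by measurable
  have g: "unsort_coords (g z) = cone_map p (softmax z)" for z by (simp add: g_def M_def cone_map_eq)
  have eq: "range g = unsort_coords -` (cone_map p ` std_simplex_open)"
  proof -
    have "range g = sort_coords ` cone_map p ` std_simplex_open"
      unfolding range_softmax[symmetric] image_image sort_cone_map g_def M_def ..
    also have "\<dots> = unsort_coords -` (cone_map p ` std_simplex_open)"
      by (auto simp: image_iff) (metis sort_unsort(1))
    finally show ?thesis .
  qed
  have borel: "range g \<in> sets borel"
    using measurable_sets[OF measurable_unsort_coords cone_map_open_simplex_borel[of p]] by (simp add: eq)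
  have inj: "inj g"
  proof (rule injI)
    fix z w assume "g z = g w"
    then have "cone_map p (softmax z) = cone_map p (softmax w)" by (simp add: g[symmetric])
    then show "z = w" by (rule injD[OF inj_softmax, OF injD[OF inj_cone_map[OF p]]])
  qed
  define g' where "g' = (\<lambda>z w. M *v (\<chi> i. softmax z $ i * ((\<Sum>j\<in>UNIV. softmax z $ j * w $ j) - w $ i)))"
  have der: "(g has_derivative g' z) (at z within UNIV)" for z
    unfolding g_def g'_def
    by (rule bounded_linear.has_derivative[OF matrix_vector_mul_bounded_linear softmax_has_derivative])
  have det: "\<bar>det (matrix (g' z))\<bar> = frame_vol p * softmax_jacobian z" for z
  proof -
    have lin: "linear (\<lambda>w. \<chi> i. softmax z $ i * ((\<Sum>j\<in>UNIV. softmax z $ j * w $ j) - w $ i))"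
      by (rule has_derivative_linear[OF softmax_has_derivative])
    have "matrix (g' z) = M ** matrix (\<lambda>w. \<chi> i. softmax z $ i * ((\<Sum>j\<in>UNIV. softmax z $ j * w $ j) - w $ i))"
      unfolding g'_def using matrix_compose[OF lin matrix_vector_mul_linear[of M]] by (simp add: o_def)
    then show ?thesis
      by (simp add: det_mul abs_mult abs_det_softmax_derivative frame_vol_def M_def)
  qed
  \<comment> \<open>The change of variables theorem is about vector-valued functions, hence the detour through \<open>real^1\<close>.\<close>
  have "(\<lambda>z. \<bar>det (matrix (g' z))\<bar> *\<^sub>R (vec (u (g z)) :: real^1)) absolutely_integrable_on UNIV \<and>
        integral UNIV (\<lambda>z. \<bar>det (matrix (g' z))\<bar> *\<^sub>R (vec (u (g z)) :: real^1)) = vec b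
     \<longleftrightarrow> (\<lambda>v. vec (u v) :: real^1) absolutely_integrable_on (range g) \<and> integral (range g) (\<lambda>v. vec (u v) :: real^1) = vec b" for b
    by (rule has_absolute_integral_change_of_variables[OF _ der inj]) simp
  moreover have "\<bar>det (matrix (g' z))\<bar> *\<^sub>R (vec (u (g z)) :: real^1) = vec (D z)" for z
    by (simp add: det D_def u_def g vec_eq_iff)
  ultimately have "D absolutely_integrable_on UNIV \<and> integral UNIV D = b \<longleftrightarrow>
      u absolutely_integrable_on range g \<and> integral (range g) u = b" for b
    by (simp add: absolutely_integrable_on_1_iff integral_on_1_eq vec_eq_iff)
  then have key: "b \<ge> 0 \<and> (\<integral>\<^sup>+z. ennreal (D z) \<partial>lborel) = ennreal b \<longleftrightarrow>
      b \<ge> 0 \<and> (\<integral>\<^sup>+v. ennreal (u v) * indicator (range g) v \<partial>lborel) = ennreal b" for b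
    using absolutely_integrable_on_iff_nn_integral[OF borel, of u b] absolutely_integrable_on_iff_nn_integral[of UNIV D b] nonneg
    by (simp add: u_def D_def frame_vol_nonneg softmax_jacobian_nonneg)
  have "(\<integral>\<^sup>+z. ennreal (D z) \<partial>lborel) = (\<integral>\<^sup>+v. ennreal (u v) * indicator (range g) v \<partial>lborel)" (is "?a = ?b")
  proof (cases "?a = top")
    case False
    then show ?thesis using key[of "enn2real ?a"] by (simp add: less_top)
  next
    case True
    then show ?thesis using key[of "enn2real ?b"] by (cases "?b = top") (auto simp: less_top)
  qed
  also have "?b = (\<integral>\<^sup>+v. ennreal (h (unsort_coords v)) * indicator (cone_map p ` std_simplex_open) (unsort_coords v) \<partial>lborel)"
    by (intro nn_integral_cong) (simp add: u_def eq indicator_def)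
  also have "\<dots> = (\<integral>\<^sup>+x. ennreal (h x) * indicator (cone_map p ` std_simplex_open) x \<partial>lborel)"
    using cone_map_open_simplex_borel[of p] by (subst nn_integral_unsort_coords) auto
  finally show ?thesis by (simp add: D_def)
qed

section \<open>Integrals of products of functions of consecutive gaps\<close>

text \<open>Extended by \<open>0\<close> at \<open>CARD('n)\<close>, so that the numbers \<open>exp (- level z i)\<close> for \<open>i \<le> CARD('n)\<close> are
homogeneous barycentric coordinates of \<open>softmax z\<close>.\<close>

definition level :: "real^('n::finite idx) \<Rightarrow> nat \<Rightarrow> real" where
  "level z k = (if k < CARD('n) then z $ idx_of_nat k else 0)"

text \<open>The gap with index \<open>CARD('n)\<close> is chosen such that all gaps add up to \<open>R\<close>. Hence the integral of a
product of functions of one gap each is an iterated convolution, evaluated at \<open>R\<close>.\<close>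

definition gap :: "real \<Rightarrow> real^('n::finite idx) \<Rightarrow> nat \<Rightarrow> real" where
  "gap R z k = (if k < CARD('n) then level z (Suc k) - level z k else R + level z 0)"

lemma level_nat_of_idx [simp]: "level z (nat_of_idx i) = z $ i"
  by (simp add: level_def nat_of_idx_inverse)

lemma level_measurable [measurable]: "(\<lambda>z. level z k) \<in> borel_measurable borel"
  unfolding level_def by (cases "k < CARD('a)") (auto intro!: borel_measurable_continuous_onI continuous_intros)

lemma gap_measurable [measurable]: "(\<lambda>z. gap R z k) \<in> borel_measurable borel"
  unfolding gap_def by measurable

text \<open>The nonnegative counterpart of \<open>conv_chain\<close>, to which Fubini's theorem applies before anything is
known to be integrable.\<close>

fun nn_conv_chain :: "(real \<Rightarrow> real) \<Rightarrow> (nat \<Rightarrow> real \<Rightarrow> real) \<Rightarrow> nat \<Rightarrow> real \<Rightarrow> ennreal" where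
  "nn_conv_chain \<kappa> \<phi> 0 x = ennreal (\<kappa> x)"
| "nn_conv_chain \<kappa> \<phi> (Suc k) x = (\<integral>\<^sup>+y. nn_conv_chain \<kappa> \<phi> k (x - y) * ennreal (\<phi> k y) \<partial>lborel)"

lemma nn_conv_chain_measurable:
  assumes [measurable]: "\<kappa> \<in> borel_measurable borel" "\<And>k. k < n \<Longrightarrow> \<phi> k \<in> borel_measurable borel"
  shows "k \<le> n \<Longrightarrow> nn_conv_chain \<kappa> \<phi> k \<in> borel_measurable borel"
proof (induction k)
  case 0
  have "nn_conv_chain \<kappa> \<phi> 0 = (\<lambda>x. ennreal (\<kappa> x))" by (rule ext) simp
  then show ?case by simp
next
  case (Suc k)
  have [measurable]: "nn_conv_chain \<kappa> \<phi> k \<in> borel_measurable borel" "\<phi> k \<in> borel_measurable borel"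
    using Suc by auto
  show ?case by simp
qed

lemma nn_conv_chain_eq:
  assumes "step_kernel \<kappa> (\<alpha> n) (m n)" "\<And>k. k < n \<Longrightarrow> step_kernel (\<phi> k) (\<alpha> k) (m k)"
    and nonneg: "\<And>x. \<kappa> x \<ge> 0" "\<And>k x. k < n \<Longrightarrow> \<phi> k x \<ge> 0"
  shows "k \<le> n \<Longrightarrow> nn_conv_chain \<kappa> \<phi> k x = ennreal (conv_chain \<kappa> \<phi> k x) \<and> conv_chain \<kappa> \<phi> k x \<ge> 0"
proof (induction k arbitrary: x)
  case (Suc k)
  have IH: "nn_conv_chain \<kappa> \<phi> k y = ennreal (conv_chain \<kappa> \<phi> k y)" "conv_chain \<kappa> \<phi> k y \<ge> 0" for y
    using Suc by auto
  have nn: "\<phi> k y \<ge> 0" for y using nonneg(2)[of k] Suc.prems by simp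
  have lg: "two_term_growth (conv_chain \<kappa> \<phi> k) k (\<Prod>j\<in>insert n {..<k}. \<alpha> j)
           (\<Sum>i\<in>insert n {..<k}. m i * (\<Prod>j\<in>insert n {..<k} - {i}. \<alpha> j))"
    by (rule two_term_growth_conv_chain) (use assms Suc.prems in auto)
  have i: "integrable lborel (\<lambda>y. conv_chain \<kappa> \<phi> k (x - y) * \<phi> k y)"
    by (rule conv_integrable[OF lg assms(2)]) (use Suc.prems in auto)
  have "nn_conv_chain \<kappa> \<phi> (Suc k) x = (\<integral>\<^sup>+y. ennreal (conv_chain \<kappa> \<phi> k (x - y) * \<phi> k y) \<partial>lborel)"
    by (simp add: IH nn ennreal_mult)
  also have "\<dots> = ennreal (conv_chain \<kappa> \<phi> (Suc k) x)"
    using IH nn i by (subst nn_integral_eq_integral) (auto simp: conv_def)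
  finally show ?case using IH nn by (auto simp: conv_def intro!: integral_nonneg)
qed (use nonneg in simp)

text \<open>Fubini's theorem, one coordinate at a time. The value \<open>t\<close> of the coordinate above those that are
integrated out is kept as a parameter; in the end it is \<open>level z CARD('n) = 0\<close>.\<close>

lemma nn_integral_chain_PiM:
  assumes [measurable]: "\<kappa> \<in> borel_measurable borel" and m: "\<And>k. k < N \<Longrightarrow> \<phi> k \<in> borel_measurable borel"
  shows "n \<le> N \<Longrightarrow> (\<integral>\<^sup>+z. ennreal (\<kappa> (R + (z(n := t)) 0)) * (\<Prod>k<n. ennreal (\<phi> k ((z(n := t)) (Suc k) - (z(n := t)) k))) \<partial>(\<Pi>\<^sub>M k\<in>{..<n}. lborel))
    = nn_conv_chain \<kappa> \<phi> n (R + t)"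
proof (induction n arbitrary: t)
  case 0
  then show ?case by (simp add: PiM_empty nn_integral_count_space_finite)
next
  case (Suc n)
  interpret product_sigma_finite "\<lambda>_::nat. lborel :: real measure" by standard
  have phi [measurable]: "\<phi> k \<in> borel_measurable borel" if "k < Suc n" for k using m[of k] that Suc.prems by auto
  have [measurable]: "(\<lambda>z. z k) \<in> borel_measurable (\<Pi>\<^sub>M k\<in>{..<Suc n}. lborel)" if "k < Suc n" for k
    using measurable_component_singleton[of k "{..<Suc n}" "\<lambda>_. lborel :: real measure"] that by simp
  have upd: "(\<lambda>z. (z(j := y)) k) \<in> borel_measurable (\<Pi>\<^sub>M k\<in>{..<j}. lborel)" if "k \<le> j" for j k :: nat and y :: real
  proof (cases "k = j")
    case False
    then have "k < j" using that by simp
    then show ?thesis using measurable_component_singleton[of k "{..<j}" "\<lambda>_. lborel :: real measure"] False by simp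
  qed simp
  have mk: "(\<lambda>z. ennreal (\<kappa> (R + (z(j := y)) 0))) \<in> borel_measurable (\<Pi>\<^sub>M k\<in>{..<j}. lborel)" for j :: nat and y :: real
    by (rule measurable_compose[OF measurable_compose[OF borel_measurable_add[OF borel_measurable_const upd] assms(1)] measurable_ennreal]) simp
  have mp: "(\<lambda>z. \<Prod>k<j. ennreal (\<phi> k ((z(j := y)) (Suc k) - (z(j := y)) k))) \<in> borel_measurable (\<Pi>\<^sub>M k\<in>{..<j}. lborel)"
    if "j \<le> Suc n" for j :: nat and y :: real
  proof (intro borel_measurable_prod_ennreal measurable_compose[OF _ measurable_ennreal])
    fix k assume "k \<in> {..<j}"
    then show "(\<lambda>z. \<phi> k ((z(j := y)) (Suc k) - (z(j := y)) k)) \<in> borel_measurable (\<Pi>\<^sub>M k\<in>{..<j}. lborel)"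
      using that by (intro measurable_compose[OF borel_measurable_diff[OF upd upd] phi]) auto
  qed
  have [measurable]: "nn_conv_chain \<kappa> \<phi> n \<in> borel_measurable borel"
    by (rule nn_conv_chain_measurable[of _ n]) (use phi in auto)
  define f where "f = (\<lambda>z. ennreal (\<kappa> (R + (z(Suc n := t)) 0)) * (\<Prod>k<Suc n. ennreal (\<phi> k ((z(Suc n := t)) (Suc k) - (z(Suc n := t)) k))))"
  have [measurable]: "f \<in> borel_measurable (\<Pi>\<^sub>M k\<in>{..<Suc n}. lborel)"
    unfolding f_def
    by (intro borel_measurable_times_ennreal mk mp) simp
  have "(\<integral>\<^sup>+z. f z \<partial>(\<Pi>\<^sub>M k\<in>{..<Suc n}. lborel)) = (\<integral>\<^sup>+y. (\<integral>\<^sup>+z. f (z(n := y)) \<partial>(\<Pi>\<^sub>M k\<in>{..<n}. lborel)) \<partial>lborel)"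
    unfolding lessThan_Suc by (rule product_nn_integral_insert_rev) (auto simp: lessThan_Suc[symmetric])
  also have "\<dots> = (\<integral>\<^sup>+y. nn_conv_chain \<kappa> \<phi> n (R + y) * ennreal (\<phi> n (t - y)) \<partial>lborel)"
  proof (rule nn_integral_cong)
    fix y :: real
    have f: "f (z(n := y)) = ennreal (\<kappa> (R + (z(n := y)) 0)) * (\<Prod>k<n. ennreal (\<phi> k ((z(n := y)) (Suc k) - (z(n := y)) k))) * ennreal (\<phi> n (t - y))" for z
    proof -
      have "(\<Prod>k<n. ennreal (\<phi> k ((z(n := y, Suc n := t)) (Suc k) - (z(n := y, Suc n := t)) k))) =
          (\<Prod>k<n. ennreal (\<phi> k ((z(n := y)) (Suc k) - (z(n := y)) k)))"
        by (intro prod.cong) auto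
      then show ?thesis by (simp add: f_def mult.assoc del: fun_upd_apply) simp
    qed
    have "(\<integral>\<^sup>+z. f (z(n := y)) \<partial>(\<Pi>\<^sub>M k\<in>{..<n}. lborel)) =
      (\<integral>\<^sup>+z. ennreal (\<kappa> (R + (z(n := y)) 0)) * (\<Prod>k<n. ennreal (\<phi> k ((z(n := y)) (Suc k) - (z(n := y)) k))) \<partial>(\<Pi>\<^sub>M k\<in>{..<n}. lborel)) * ennreal (\<phi> n (t - y))"
      unfolding f
      by (rule nn_integral_multc)
         (intro borel_measurable_times_ennreal mk mp, simp)
    then show "(\<integral>\<^sup>+z. f (z(n := y)) \<partial>(\<Pi>\<^sub>M k\<in>{..<n}. lborel)) = nn_conv_chain \<kappa> \<phi> n (R + y) * ennreal (\<phi> n (t - y))"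
      using Suc.IH Suc.prems by simp
  qed
  also have "\<dots> = nn_conv_chain \<kappa> \<phi> (Suc n) (R + t)"
    by (subst nn_integral_real_affine[of _ "-1" t]) (auto simp: algebra_simps)
  finally show ?case by (simp add: f_def)
qed

lemma nn_integral_gap_prod:
  fixes \<Phi> :: "nat \<Rightarrow> real \<Rightarrow> real"
  assumes \<Phi>: "\<And>k. k \<le> CARD('n) \<Longrightarrow> step_kernel (\<Phi> k) (\<alpha> k) (m k)" and nonneg: "\<And>k x. k \<le> CARD('n) \<Longrightarrow> \<Phi> k x \<ge> 0"
  shows "(\<integral>\<^sup>+z. ennreal (\<Prod>k\<le>CARD('n). \<Phi> k (gap R (z :: real^('n::finite idx)) k)) \<partial>lborel)
    = ennreal (conv_chain (\<Phi> CARD('n)) \<Phi> CARD('n) R)"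
    and "conv_chain (\<Phi> CARD('n)) \<Phi> CARD('n) R \<ge> 0"
proof -
  let ?n = "CARD('n)"
  let ?V = "\<lambda>f. (\<chi> i. f (nat_of_idx i)) :: real^('n idx)"
  have npos: "?n > 0" by simp
  have mb: "\<And>k. k \<le> ?n \<Longrightarrow> \<Phi> k \<in> borel_measurable borel" using \<Phi> by (simp add: step_kernel_def)
  have [measurable]: "?V \<in> (\<Pi>\<^sub>M k\<in>{..<?n}. lborel) \<rightarrow>\<^sub>M borel"
    by (rule borel_measurable_vec_lambda) measurable
  have [measurable]: "(\<lambda>z::real^('n idx). \<Prod>k\<le>?n. \<Phi> k (gap R z k)) \<in> borel_measurable borel"
    by (intro borel_measurable_prod measurable_compose[OF gap_measurable mb]) auto
  have lev: "level (?V f) k = (f(?n := 0)) k" if "k \<le> ?n" for f k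
    using that by (auto simp: level_def)
  have "(\<integral>\<^sup>+z. ennreal (\<Prod>k\<le>?n. \<Phi> k (gap R (z :: real^('n idx)) k)) \<partial>lborel)
    = (\<integral>\<^sup>+f. ennreal (\<Prod>k\<le>?n. \<Phi> k (gap R (?V f) k)) \<partial>(\<Pi>\<^sub>M k\<in>{..<?n}. lborel))"
    by (subst lborel_distr_PiM_idx[symmetric], subst nn_integral_distr) auto
  also have "\<dots> = (\<integral>\<^sup>+f. ennreal (\<Phi> ?n (R + (f(?n := 0)) 0)) * (\<Prod>k<?n. ennreal (\<Phi> k ((f(?n := 0)) (Suc k) - (f(?n := 0)) k))) \<partial>(\<Pi>\<^sub>M k\<in>{..<?n}. lborel))"
  proof (rule nn_integral_cong)
    fix f :: "nat \<Rightarrow> real"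
    have 1: "(\<Prod>k<?n. \<Phi> k (gap R (?V f) k)) = (\<Prod>k<?n. \<Phi> k ((f(?n := 0)) (Suc k) - (f(?n := 0)) k))"
      by (intro prod.cong refl) (simp add: gap_def lev del: fun_upd_apply)
    have 2: "\<Phi> ?n (gap R (?V f) ?n) = \<Phi> ?n (R + (f(?n := 0)) 0)"
      by (simp add: gap_def lev del: fun_upd_apply)
    have "(\<Prod>k\<le>?n. \<Phi> k (gap R (?V f) k)) = \<Phi> ?n (R + (f(?n := 0)) 0) * (\<Prod>k<?n. \<Phi> k ((f(?n := 0)) (Suc k) - (f(?n := 0)) k))"
      unfolding lessThan_Suc_atMost[symmetric] lessThan_Suc
      by (subst prod.insert) (simp_all only: 1 2 finite_lessThan lessThan_iff less_irrefl not_False_eq_True)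
    then show "ennreal (\<Prod>k\<le>?n. \<Phi> k (gap R (?V f) k)) = ennreal (\<Phi> ?n (R + (f(?n := 0)) 0)) * (\<Prod>k<?n. ennreal (\<Phi> k ((f(?n := 0)) (Suc k) - (f(?n := 0)) k)))"
      using nonneg prod_ennreal[of "{..<?n}" "\<lambda>k. \<Phi> k ((f(?n := 0)) (Suc k) - (f(?n := 0)) k)"]
      by (simp add: ennreal_mult' prod_nonneg less_imp_le del: fun_upd_apply)
  qed
  also have "\<dots> = nn_conv_chain (\<Phi> ?n) \<Phi> ?n (R + 0)"
    by (rule nn_integral_chain_PiM[of _ ?n]) (use mb in auto)
  also have "\<dots> = ennreal (conv_chain (\<Phi> ?n) \<Phi> ?n R)"
    using nn_conv_chain_eq[of "\<Phi> ?n" \<alpha> ?n m \<Phi> ?n R] \<Phi> nonneg by auto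
  finally show "(\<integral>\<^sup>+z. ennreal (\<Prod>k\<le>?n. \<Phi> k (gap R (z :: real^('n idx)) k)) \<partial>lborel) = ennreal (conv_chain (\<Phi> ?n) \<Phi> ?n R)" .
  show "conv_chain (\<Phi> ?n) \<Phi> ?n R \<ge> 0"
    using nn_conv_chain_eq[of "\<Phi> ?n" \<alpha> ?n m \<Phi> ?n R] \<Phi> nonneg by auto
qed

lemma
  fixes \<Phi> :: "nat \<Rightarrow> real \<Rightarrow> real"
  assumes \<Phi>: "\<And>k. k \<le> CARD('n) \<Longrightarrow> step_kernel (\<Phi> k) (\<alpha> k) (m k)" and nonneg: "\<And>k x. k \<le> CARD('n) \<Longrightarrow> \<Phi> k x \<ge> 0"
  shows gap_prod_integrable: "integrable lborel (\<lambda>z :: real^('n::finite idx). \<Prod>k\<le>CARD('n). \<Phi> k (gap R z k))"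
    and gap_prod_integral_asymp:
      "((\<lambda>R. ((LINT z|lborel. (\<Prod>k\<le>CARD('n). \<Phi> k (gap R (z :: real^('n::finite idx)) k))) - (\<Prod>j\<le>CARD('n). \<alpha> j) * R ^ CARD('n) / fact CARD('n)) / R ^ (CARD('n) - 1)) \<longlongrightarrow>
            (\<Sum>i\<le>CARD('n). m i * (\<Prod>j\<in>{..CARD('n)} - {i}. \<alpha> j)) / fact (CARD('n) - 1)) at_top"
proof -
  let ?n = "CARD('n)"
  have mb: "\<And>k. k \<le> ?n \<Longrightarrow> \<Phi> k \<in> borel_measurable borel" using \<Phi> by (simp add: step_kernel_def)
  have meas: "(\<lambda>z::real^('n idx). \<Prod>k\<le>?n. \<Phi> k (gap R z k)) \<in> borel_measurable lborel" for R
    by (intro borel_measurable_prod measurable_compose[OF _ mb]) auto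
  have nn: "(\<Prod>k\<le>?n. \<Phi> k (gap R z k)) \<ge> 0" for R and z :: "real^('n idx)" using nonneg by (intro prod_nonneg) auto
  show "integrable lborel (\<lambda>z :: real^('n::finite idx). \<Prod>k\<le>?n. \<Phi> k (gap R z k))"
    using nn by (intro integrableI_nn_integral_finite[OF meas _ nn_integral_gap_prod(1)[OF \<Phi> nonneg]]) auto
  have "(LINT z|lborel. (\<Prod>k\<le>?n. \<Phi> k (gap R (z :: real^('n idx)) k))) = conv_chain (\<Phi> ?n) \<Phi> ?n R" for R
  proof -
    have "(LINT z|lborel. (\<Prod>k\<le>?n. \<Phi> k (gap R (z :: real^('n idx)) k))) = enn2real (\<integral>\<^sup>+z. ennreal (\<Prod>k\<le>?n. \<Phi> k (gap R (z :: real^('n idx)) k)) \<partial>lborel)"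
      by (rule integral_eq_nn_integral[OF meas]) (simp add: nn)
    also have "\<dots> = conv_chain (\<Phi> ?n) \<Phi> ?n R"
      using nn_integral_gap_prod[where R = R and \<Phi> = \<Phi> and 'n = 'n, OF \<Phi> nonneg] by simp
    finally show ?thesis .
  qed
  then show "((\<lambda>R. ((LINT z|lborel. (\<Prod>k\<le>?n. \<Phi> k (gap R (z :: real^('n idx)) k))) - (\<Prod>j\<le>?n. \<alpha> j) * R ^ ?n / fact ?n) / R ^ (?n - 1)) \<longlongrightarrow>
            (\<Sum>i\<le>?n. m i * (\<Prod>j\<in>{..?n} - {i}. \<alpha> j)) / fact (?n - 1)) at_top"
    using conv_chain_asymp[of "\<Phi> ?n" \<alpha> ?n m \<Phi>] \<Phi> by simp
qed

section \<open>Logistic kernels and bumps\<close>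

lemma step_kernelI:
  assumes "\<phi> \<in> borel_measurable borel" "\<And>y. \<bar>\<phi> y - \<alpha> * indicator {0<..} y\<bar> \<le> C * exp (- (1/4) * \<bar>y\<bar>)"
    "(LINT y|lborel. \<phi> y - \<alpha> * indicator {0<..} y) = m"
  shows "step_kernel \<phi> \<alpha> m"
  using assms unfolding step_kernel_def by blast

lemma step_kernel_integrable:
  assumes "step_kernel \<phi> \<alpha> m"
  shows "integrable lborel (\<lambda>y. \<phi> y - \<alpha> * indicator {0<..} y)"
proof -
  have [measurable]: "\<phi> \<in> borel_measurable borel" using assms by (simp add: step_kernel_def)
  obtain C where C: "\<And>y. \<bar>\<phi> y - \<alpha> * indicator {0<..} y\<bar> \<le> C * exp (- (1/4) * \<bar>y\<bar>)"
    using assms by (auto simp: step_kernel_def)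
  have "integrable lborel (\<lambda>y. C * exp (- (1/4) * \<bar>y\<bar>))"
    using integrable_exp_neg_abs[of "1/4"] by simp
  then show ?thesis
  proof (rule Bochner_Integration.integrable_bound)
    show "AE y in lborel. norm (\<phi> y - \<alpha> * indicator {0<..} y) \<le> norm (C * exp (- (1/4) * \<bar>y\<bar>))"
      using C by (intro AE_I2) (auto intro: order_trans[OF _ abs_ge_self])
  qed measurable
qed

lemma integral_real_line_FTC:
  fixes F f :: "real \<Rightarrow> real"
  assumes "\<And>x. (F has_real_derivative f x) (at x)" "\<And>x. isCont f x" "integrable lborel f"
    "(F \<longlongrightarrow> A) at_bot" "(F \<longlongrightarrow> B) at_top"
  shows "(LINT x|lborel. f x) = B - A"
proof -
  have "(LBINT x=-\<infinity>..\<infinity>. f x) = B - A"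
  proof (rule interval_integral_FTC_integrable)
    show "(F has_vector_derivative f x) (at x)" for x
      using assms(1) by (simp add: has_real_derivative_iff_has_vector_derivative)
    show "set_integrable lborel (einterval (-\<infinity>) \<infinity>) f" using assms(3) by (simp add: set_integrable_def)
    show "((F \<circ> real_of_ereal) \<longlongrightarrow> A) (at_right (- \<infinity>))" using assms(4) by (simp add: ereal_tendsto_simps)
    show "((F \<circ> real_of_ereal) \<longlongrightarrow> B) (at_left \<infinity>)" using assms(5) by (simp add: ereal_tendsto_simps)
  qed (use assms in auto)
  then show ?thesis
    by (simp add: interval_lebesgue_integral_def set_lebesgue_integral_def)
qed

text \<open>At the gap \<open>y = z\<^sub>k\<^sub>+\<^sub>1 - z\<^sub>k\<close> this is \<open>exp (- z\<^sub>k) / (a * exp (- z\<^sub>k) + c * exp (- z\<^sub>k\<^sub>+\<^sub>1))\<close>.\<close>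

definition logistic :: "real \<Rightarrow> real \<Rightarrow> real \<Rightarrow> real" where
  "logistic a c y = 1 / (a + c * exp (- y))"

lemma logistic_pos: "a > 0 \<Longrightarrow> c > 0 \<Longrightarrow> logistic a c y > 0"
  by (simp add: logistic_def add_pos_pos)

lemma logistic_measurable [measurable]: "logistic a c \<in> borel_measurable borel"
  unfolding logistic_def by measurable

lemma logistic_step_bound:
  assumes "a > 0" "c > 0"
  shows "\<bar>logistic a c y - 1 / a * indicator {0<..} y\<bar> \<le> (c / a\<^sup>2 + 1 / c) * exp (- (1/4) * \<bar>y\<bar>)"
proof (cases "y > 0")
  case True
  have "logistic a c y - 1 / a = - (c * exp (- y)) / (a * (a + c * exp (- y)))"
    using assms by (simp add: logistic_def divide_simps add_pos_pos less_imp_neq[symmetric])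
  then have "\<bar>logistic a c y - 1 / a\<bar> = (c * exp (- y)) / (a * (a + c * exp (- y)))"
    using assms by (simp add: abs_mult add_pos_pos)
  also have "\<dots> \<le> (c * exp (- y)) / (a * a)"
    using assms by (intro divide_left_mono mult_left_mono) (auto intro!: mult_pos_pos add_pos_pos)
  also have "\<dots> = c / a\<^sup>2 * exp (- y)" by (simp add: power2_eq_square)
  also have "\<dots> \<le> (c / a\<^sup>2 + 1 / c) * exp (- (1/4) * \<bar>y\<bar>)"
    using assms True by (intro mult_mono) auto
  finally show ?thesis using True by simp
next
  case False
  have "logistic a c y \<le> 1 / (c * exp (- y))"
    unfolding logistic_def using assms by (intro divide_left_mono) (auto intro!: mult_pos_pos add_pos_pos)
  also have "\<dots> = 1 / c * exp y" by (simp add: exp_minus field_simps)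
  also have "\<dots> \<le> (c / a\<^sup>2 + 1 / c) * exp (- (1/4) * \<bar>y\<bar>)"
    using assms False by (intro mult_mono) auto
  finally show ?thesis using False logistic_pos[OF assms, of y] by simp
qed

text \<open>The mass of the perturbation is found by comparison with \<open>logistic 1 1\<close>, whose perturbation is odd
and has mass zero. The difference is continuous, with an elementary antiderivative.\<close>

lemma step_kernel_logistic:
  assumes "a > 0" "c > 0"
  shows "step_kernel (logistic a c) (1 / a) ((ln a - ln c) / a)"
proof -
  have 1: "step_kernel (logistic a c) (1 / a) (LINT y|lborel. logistic a c y - 1 / a * indicator {0<..} y)" if "a > 0" "c > 0" for a c
    using logistic_step_bound[OF that] by (intro step_kernelI) auto
  have H: "(LINT y|lborel. logistic 1 1 y - 1 / 1 * indicator {0<..} y) = 0" (is "?I = 0")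
  proof -
    have "?I = (LINT y|lborel. logistic 1 1 (- y) - 1 / 1 * indicator {0<..} (- y))"
      by (subst lborel_integral_real_affine[of "-1" _ 0]) simp_all
    also have "\<dots> = (LINT y|lborel. - (logistic 1 1 y - 1 / 1 * indicator {0<..} y))"
    proof (rule integral_cong_AE)
      have e: "logistic 1 1 (- y) = 1 - logistic 1 1 y" for y
        by (simp add: logistic_def exp_minus field_simps add_pos_pos less_imp_neq[symmetric])
      show "AE y in lborel. logistic 1 1 (- y) - 1 / 1 * indicator {0<..} (- y) = - (logistic 1 1 y - 1 / 1 * indicator {0<..} y)"
        using AE_lborel_singleton[of 0] by eventually_elim (auto simp: e indicator_def)
    qed measurable
    also have "\<dots> = - ?I" by (rule Bochner_Integration.integral_minus)
    finally show ?thesis by simp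
  qed
  define f where "f = (\<lambda>y. logistic a c y - 1 / a * logistic 1 1 y)"
  have i: "integrable lborel (\<lambda>y. logistic a c y - 1 / a * indicator {0<..} y)"
    "integrable lborel (\<lambda>y. logistic 1 1 y - 1 / 1 * indicator {0<..} y)"
    using step_kernel_integrable[OF 1[of a c]] step_kernel_integrable[OF 1[of 1 1]] assms by auto
  have f: "f = (\<lambda>y. (logistic a c y - 1 / a * indicator {0<..} y) - 1 / a * (logistic 1 1 y - 1 / 1 * indicator {0<..} y))"
    by (auto simp: f_def algebra_simps)
  have int_f: "integrable lborel f" unfolding f by (intro Bochner_Integration.integrable_diff integrable_mult_right i)
  define F where "F = (\<lambda>y. (ln (a * exp y + c) - ln (exp y + 1)) / a)"
  have "(LINT y|lborel. f y) = ln a / a - ln c / a"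
  proof (rule integral_real_line_FTC[of F, OF _ _ int_f])
    fix y
    have p: "a * exp y + c > 0" "exp y + 1 > 0" "a + c * exp (- y) > 0" "1 + exp (- y) > 0"
      using assms by (auto intro!: add_pos_pos)
    have e: "logistic a c y = exp y / (a * exp y + c)" "logistic 1 1 y = exp y / (exp y + 1)"
      using p by (auto simp: logistic_def exp_minus field_simps)
    have "f y = (a * exp y / (a * exp y + c) - exp y / (exp y + 1)) / a"
      using assms by (simp add: f_def e diff_divide_distrib)
    then show "(F has_real_derivative f y) (at y)"
      unfolding F_def using p assms
      by (auto intro!: derivative_eq_intros simp: mult.commute)
    show "isCont f y" unfolding f_def logistic_def using p by (intro continuous_intros) auto
    have "((\<lambda>y. ln (a * exp y + c) - ln (exp y + 1)) \<longlongrightarrow> ln c) at_bot" using assms by real_asymp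
    then show "(F \<longlongrightarrow> ln c / a) at_bot" unfolding F_def using assms by (intro tendsto_divide tendsto_const) auto
    have "((\<lambda>y. ln (a * exp y + c) - ln (exp y + 1)) \<longlongrightarrow> ln a) at_top" using assms by real_asymp
    then show "(F \<longlongrightarrow> ln a / a) at_top" unfolding F_def using assms by (intro tendsto_divide tendsto_const) auto
  qed
  moreover have "(LINT y|lborel. f y) = (LINT y|lborel. logistic a c y - 1 / a * indicator {0<..} y) - 1 / a * ?I"
    unfolding f using i by (subst Bochner_Integration.integral_diff) (auto simp del: times_divide_eq_left)
  ultimately have "(LINT y|lborel. logistic a c y - 1 / a * indicator {0<..} y) = (ln a - ln c) / a"
    using H by (simp add: diff_divide_distrib)
  then show ?thesis using 1[OF assms] by simp
qed

text \<open>The part of the factors with indices \<open>j\<close> and \<open>Suc j\<close> that depends on the gap between them, for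
flags that differ in dimension \<open>j\<close>. It decays on both sides, so it is a step kernel without a step.\<close>

definition bump :: "real \<Rightarrow> real \<Rightarrow> real \<Rightarrow> real \<Rightarrow> real \<Rightarrow> real" where
  "bump a c \<alpha> \<beta> y = logistic a c y * (1 / (\<alpha> + \<beta> * exp y))"

text \<open>Partial fractions in \<open>exp y\<close> give an antiderivative if the two denominators are not proportional.\<close>

lemma step_kernel_bump:
  assumes "a > 0" "c > 0" "\<alpha> > 0" "\<beta> > 0" "\<beta> * c \<noteq> \<alpha> * a"
  shows "step_kernel (bump a c \<alpha> \<beta>) 0 (ln (\<beta> * c / (\<alpha> * a)) / (\<beta> * c - \<alpha> * a))"
proof (rule step_kernelI)
  show m: "bump a c \<alpha> \<beta> \<in> borel_measurable borel" unfolding bump_def by measurable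
  have p: "a * exp y + c > 0" "a + c * exp (- y) > 0" "\<alpha> + \<beta> * exp y > 0" for y
    using assms by (auto intro!: add_pos_pos mult_pos_pos)
  define K where "K = (1 / a) * (1 / \<beta>) + (1 / c) * (1 / \<alpha>)"
  have b: "\<bar>bump a c \<alpha> \<beta> y\<bar> \<le> K * exp (- (1/4) * \<bar>y\<bar>)" for y
  proof (cases "y > 0")
    case True
    have "logistic a c y \<le> 1 / a"
      unfolding logistic_def using assms p by (intro divide_left_mono) (auto intro!: mult_pos_pos add_pos_pos)
    moreover have "1 / (\<alpha> + \<beta> * exp y) \<le> 1 / (\<beta> * exp y)"
      using assms p by (intro divide_left_mono) (auto intro!: mult_pos_pos add_pos_pos)
    ultimately have "bump a c \<alpha> \<beta> y \<le> 1 / a * (1 / (\<beta> * exp y))"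
      unfolding bump_def using assms p[of y] by (intro mult_mono) (auto intro: less_imp_le)
    also have "\<dots> = (1 / a) * (1 / \<beta>) * exp (- y)" by (simp add: exp_minus field_simps)
    also have "\<dots> \<le> K * exp (- (1/4) * \<bar>y\<bar>)" unfolding K_def
      using assms True by (intro mult_mono) auto
    finally show ?thesis using logistic_pos[OF assms(1,2), of y] p(3)[of y] by (simp add: bump_def abs_mult)
  next
    case False
    have "logistic a c y \<le> 1 / (c * exp (- y))"
      unfolding logistic_def using assms p by (intro divide_left_mono) (auto intro!: mult_pos_pos add_pos_pos)
    moreover have "1 / (\<alpha> + \<beta> * exp y) \<le> 1 / \<alpha>"
      using assms p by (intro divide_left_mono) (auto intro!: mult_pos_pos add_pos_pos)
    ultimately have "bump a c \<alpha> \<beta> y \<le> 1 / (c * exp (- y)) * (1 / \<alpha>)"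
      unfolding bump_def using assms p[of y] by (intro mult_mono) (auto intro: less_imp_le)
    also have "\<dots> = (1 / c) * (1 / \<alpha>) * exp y" by (simp add: exp_minus field_simps)
    also have "\<dots> \<le> K * exp (- (1/4) * \<bar>y\<bar>)" unfolding K_def
      using assms False by (intro mult_mono) auto
    finally show ?thesis using logistic_pos[OF assms(1,2), of y] p(3)[of y] by (simp add: bump_def abs_mult)
  qed
  then show "\<bar>bump a c \<alpha> \<beta> y - 0 * indicator {0<..} y\<bar> \<le> K * exp (- (1/4) * \<bar>y\<bar>)" for y by simp
  have "step_kernel (bump a c \<alpha> \<beta>) 0 (LINT y|lborel. bump a c \<alpha> \<beta> y - 0 * indicator {0<..} y)"
    using b by (intro step_kernelI[OF m]) auto
  from step_kernel_integrable[OF this] have i: "integrable lborel (bump a c \<alpha> \<beta>)" by simp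
  define q where "q = \<beta> * c - \<alpha> * a"
  have q: "q \<noteq> 0" using assms by (simp add: q_def)
  define F where "F = (\<lambda>y. (ln (\<alpha> + \<beta> * exp y) - ln (a * exp y + c)) / q)"
  have "(LINT y|lborel. bump a c \<alpha> \<beta> y) = (ln \<beta> - ln a) / q - (ln \<alpha> - ln c) / q"
  proof (rule integral_real_line_FTC[of F, OF _ _ i])
    fix y
    have e: "logistic a c y = exp y / (a * exp y + c)"
      using p[of y] by (auto simp: logistic_def exp_minus field_simps)
    have "bump a c \<alpha> \<beta> y = (\<beta> * exp y / (\<alpha> + \<beta> * exp y) - a * exp y / (a * exp y + c)) / q"
      unfolding bump_def e using p[of y] q
      by (simp add: divide_simps less_imp_neq[symmetric]) (simp add: q_def algebra_simps)
    then show "(F has_real_derivative bump a c \<alpha> \<beta> y) (at y)"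
      unfolding F_def using p[of y] q
      by (auto intro!: derivative_eq_intros simp: mult.commute)
    show "isCont (bump a c \<alpha> \<beta>) y" unfolding bump_def logistic_def using p[of y] by (intro continuous_intros) auto
    show "(F \<longlongrightarrow> (ln \<alpha> - ln c) / q) at_bot"
    proof -
      have "((\<lambda>y. ln (\<alpha> + \<beta> * exp y) - ln (a * exp y + c)) \<longlongrightarrow> ln \<alpha> - ln c) at_bot"
        using assms by real_asymp
      then show ?thesis unfolding F_def using q by (intro tendsto_divide tendsto_const)
    qed
    show "(F \<longlongrightarrow> (ln \<beta> - ln a) / q) at_top" 
    proof -
      have "((\<lambda>y. ln (\<alpha> + \<beta> * exp y) - ln (a * exp y + c)) \<longlongrightarrow> ln \<beta> - ln a) at_top"
        using assms by real_asymp
      then show ?thesis unfolding F_def using q by (intro tendsto_divide tendsto_const)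
    qed
  qed
  then show "(LINT y|lborel. bump a c \<alpha> \<beta> y - 0 * indicator {0<..} y) = ln (\<beta> * c / (\<alpha> * a)) / (\<beta> * c - \<alpha> * a)"
    using assms by (simp add: q_def ln_mult ln_div diff_divide_distrib add_divide_distrib)
qed

lemma step_kernel_exp_neg_abs: "\<exists>m. step_kernel (\<lambda>y. exp (- (1/4) * \<bar>y\<bar>)) 0 m"
  by (rule exI, rule step_kernelI[where C=1]) auto

lemma step_kernel_min_exp: "\<exists>m. step_kernel (\<lambda>y. min 1 (exp (y / 2))) 1 m"
  by (rule exI, rule step_kernelI[where C=1]) (auto simp: indicator_def min_def)

section \<open>Gap monomials of lower order\<close>

lemma sum_gap_upto:
  fixes z :: "real^('n::finite idx)"
  assumes "k \<le> i" "i \<le> CARD('n)"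
  shows "(\<Sum>m\<in>{k..<i}. gap R z m) = level z i - level z k"
proof -
  have "(\<Sum>m\<in>{k..<i}. gap R z m) = (\<Sum>m\<in>{k..<i}. level z (Suc m) - level z m)"
    using assms by (intro sum.cong) (auto simp: gap_def)
  then show ?thesis using sum_Suc_diff'[OF assms(1), of "level z"] by simp
qed

text \<open>All gaps add up to \<open>R\<close>, so the gaps outside \<open>{i..<k}\<close> add up to the complement of \<open>sum_gap_upto\<close>.\<close>

lemma sum_gap_around:
  fixes z :: "real^('n::finite idx)"
  assumes "i \<le> k" "k \<le> CARD('n)"
  shows "(\<Sum>m\<in>{..<i} \<union> {k..CARD('n)}. gap R z m) = R + level z i - level z k"
proof -
  have "{..<i} \<union> {k..CARD('n)} = {0..<i} \<union> {k..<CARD('n)} \<union> {CARD('n)}" using assms by auto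
  moreover have "(\<Sum>m\<in>{0..<i} \<union> {k..<CARD('n)} \<union> {CARD('n)}. gap R z m) =
     (\<Sum>m\<in>{0..<i}. gap R z m) + (\<Sum>m\<in>{k..<CARD('n)}. gap R z m) + gap R z CARD('n)"
    using assms by (subst sum.union_disjoint; (subst sum.union_disjoint)?) auto
  ultimately show ?thesis
    using sum_gap_upto[of 0 i R z] sum_gap_upto[of k "CARD('n)" R z] assms by (simp add: gap_def level_def)
qed

text \<open>A bound for the dependence on the gap with index \<open>k\<close>: a kernel without a step for \<open>k \<in> T\<close>, and with a
step of height 1 otherwise. Two indices in \<open>T\<close> suffice to lose two powers of \<open>R\<close>.\<close>

definition majorant :: "nat set \<Rightarrow> nat \<Rightarrow> real \<Rightarrow> real" where
  "majorant T k y = (if k \<in> T then exp (- (1/4) * \<bar>y\<bar>) else min 1 (exp (y / 2)))"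

lemma majorant_nonneg: "majorant T k y \<ge> 0"
  by (simp add: majorant_def)

lemma step_kernel_majorant:
  "\<exists>m. \<forall>k. step_kernel (majorant T k) (if k \<in> T then 0 else 1) (m k)"
proof -
  have "\<exists>m. step_kernel (majorant T k) (if k \<in> T then 0 else 1) m" for k
  proof (cases "k \<in> T")
    case True
    then have "majorant T k = (\<lambda>y. exp (- (1/4) * \<bar>y\<bar>))" by (simp add: majorant_def fun_eq_iff)
    then show ?thesis using True step_kernel_exp_neg_abs by simp
  next
    case False
    then have "majorant T k = (\<lambda>y. min 1 (exp (y / 2)))" by (simp add: majorant_def fun_eq_iff)
    then show ?thesis using False step_kernel_min_exp by simp
  qed
  then show ?thesis by metis
qed

lemma majorant_integrable:
  "integrable lborel (\<lambda>z :: real^('n::finite idx). \<Prod>k\<le>CARD('n). majorant T k (gap R z k))"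
proof -
  obtain m where "\<And>k. step_kernel (majorant T k) (if k \<in> T then 0 else 1) (m k)" using step_kernel_majorant by blast
  then show ?thesis by (rule gap_prod_integrable) (rule majorant_nonneg)
qed

text \<open>Every product in the first two coefficients leaves out at most one index, so it contains a step of height 0.\<close>

lemma majorant_integral_small:
  assumes "card (T \<inter> {..CARD('n)}) \<ge> 2"
  shows "((\<lambda>R. (LINT z|lborel. (\<Prod>k\<le>CARD('n). majorant T k (gap R (z :: real^('n::finite idx)) k))) / R ^ (CARD('n) - 1)) \<longlongrightarrow> 0) at_top"
proof -
  obtain m where m: "\<And>k. step_kernel (majorant T k) (if k \<in> T then 0 else 1) (m k)" using step_kernel_majorant by blast
  define \<alpha> :: "nat \<Rightarrow> real" where "\<alpha> = (\<lambda>k. if k \<in> T then 0 else 1)"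
  have ex: "\<exists>j\<in>{..CARD('n)} - {i}. \<alpha> j = 0" for i
  proof (rule ccontr)
    assume "\<not> ?thesis"
    then have "T \<inter> {..CARD('n)} \<subseteq> {i}"
      by (metis (no_types, lifting) DiffI IntE \<alpha>_def subsetI)
    then have "card (T \<inter> {..CARD('n)}) \<le> card {i}" by (intro card_mono) auto
    then show False using assms by simp
  qed
  have 0: "(\<Prod>j\<in>{..CARD('n)} - {i}. \<alpha> j) = 0" for i
    using ex[of i] by (intro prod_zero) auto
  have 1: "(\<Prod>j\<le>CARD('n). \<alpha> j) = 0" using ex[of 0] by (intro prod_zero) auto
  have "((\<lambda>R. ((LINT z|lborel. (\<Prod>k\<le>CARD('n). majorant T k (gap R (z :: real^('n::finite idx)) k))) - (\<Prod>j\<le>CARD('n). \<alpha> j) * R ^ CARD('n) / fact CARD('n)) / R ^ (CARD('n) - 1)) \<longlongrightarrow>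
            (\<Sum>i\<le>CARD('n). m i * (\<Prod>j\<in>{..CARD('n)} - {i}. \<alpha> j)) / fact (CARD('n) - 1)) at_top"
    by (rule gap_prod_integral_asymp) (use m majorant_nonneg in \<open>auto simp: \<alpha>_def\<close>)
  then show ?thesis by (simp add: 0 1)
qed

text \<open>A bound for the \<open>k\<close>-th factor of the integrand. If \<open>k - 1 \<in> D\<close>, then this factor also decays in the
preceding gap.\<close>

definition envelope :: "nat set \<Rightarrow> real \<Rightarrow> real^('n::finite idx) \<Rightarrow> nat \<Rightarrow> real" where
  "envelope D R z k = min 1 (exp (gap R z k / 2)) *
     (if k \<in> Suc ` D then min 1 (exp (- gap R z (k - 1) / 2)) else 1)"

lemma envelope_pos: "envelope D R z k > 0"
  by (simp add: envelope_def)

text \<open>A term of a denominator that is left out is, relative to the denominator, of the size of a monomial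
\<open>exp (- (\<Sum>m\<in>S. y\<^sub>m))\<close> in the gaps \<open>y\<^sub>m\<close>. It is harmless if \<open>S\<close> and \<open>D\<close> together contain two
indices. The sum runs over all such monomials.\<close>

definition gap_error :: "nat set \<Rightarrow> real \<Rightarrow> real^('n::finite idx) \<Rightarrow> real" where
  "gap_error D R z = (\<Sum>S | S \<subseteq> {..CARD('n)} \<and> card (S \<union> D) \<ge> 2. exp (- (\<Sum>m\<in>S. gap R z m)))"

text \<open>The decay of the factor \<open>Suc k\<close> in the gap \<open>k \<in> D\<close> is moved to the factor \<open>k\<close>, which then decays on
both sides.\<close>

lemma prod_envelope:
  fixes z :: "real^('n::finite idx)"
  assumes "D \<subseteq> {..<CARD('n)}"
  shows "(\<Prod>k\<le>CARD('n). envelope D R z k) =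
    (\<Prod>k\<le>CARD('n). if k \<in> D then exp (- \<bar>gap R z k\<bar> / 2) else min 1 (exp (gap R z k / 2)))"
proof -
  let ?N = "{..CARD('n)}"
  have fin: "finite D" using assms finite_subset by blast
  have "(\<Prod>k\<in>?N. if k \<in> Suc ` D then min 1 (exp (- gap R z (k - 1) / 2)) else 1) =
      (\<Prod>k\<in>Suc ` D. min 1 (exp (- gap R z (k - 1) / 2)))"
    using assms by (subst prod.inter_restrict[symmetric]) (auto intro!: prod.cong)
  also have "\<dots> = (\<Prod>k\<in>D. min 1 (exp (- gap R z k / 2)))"
    by (subst prod.reindex) auto
  also have "\<dots> = (\<Prod>k\<in>?N. if k \<in> D then min 1 (exp (- gap R z k / 2)) else 1)"
    using assms by (subst prod.inter_restrict[symmetric]) (auto intro!: prod.cong)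
  finally have "(\<Prod>k\<le>CARD('n). envelope D R z k) =
      (\<Prod>k\<in>?N. min 1 (exp (gap R z k / 2)) * (if k \<in> D then min 1 (exp (- gap R z k / 2)) else 1))"
    by (simp add: envelope_def prod.distrib)
  also have "\<dots> = (\<Prod>k\<in>?N. if k \<in> D then exp (- \<bar>gap R z k\<bar> / 2) else min 1 (exp (gap R z k / 2)))"
    by (intro prod.cong) (auto simp: min_def abs_if)
  finally show ?thesis .
qed

text \<open>The fourth root of a monomial is weak enough to be absorbed: in each gap \<open>y\<close> that occurs in it, the
bound \<open>min 1 (exp (y / 2))\<close> is turned into \<open>exp (- \<bar>y\<bar> / 4)\<close>, and for an index in \<open>D\<close> the
two-sided decay survives.\<close>

lemma prod_envelope_le_majorant:
  fixes z :: "real^('n::finite idx)"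
  assumes D: "D \<subseteq> {..<CARD('n)}" and S: "S \<subseteq> {..CARD('n)}"
  shows "(\<Prod>k\<le>CARD('n). envelope D R z k) * exp (- (\<Sum>m\<in>S. gap R z m) / 4)
    \<le> (\<Prod>k\<le>CARD('n). majorant (S \<union> D) k (gap R z k))"
proof -
  let ?N = "{..CARD('n)}"
  have fin: "finite S" using S finite_subset by blast
  have "exp (- (\<Sum>m\<in>S. gap R z m) / 4) = (\<Prod>m\<in>S. exp (- gap R z m / 4))"
    using fin by (simp add: exp_sum[symmetric] sum_negf sum_divide_distrib)
  also have "\<dots> = (\<Prod>k\<in>?N. if k \<in> S then exp (- gap R z k / 4) else 1)"
    using S by (subst prod.inter_restrict[symmetric]) (auto intro!: prod.cong)
  finally have "(\<Prod>k\<le>CARD('n). envelope D R z k) * exp (- (\<Sum>m\<in>S. gap R z m) / 4) =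
     (\<Prod>k\<in>?N. (if k \<in> D then exp (- \<bar>gap R z k\<bar> / 2) else min 1 (exp (gap R z k / 2))) * (if k \<in> S then exp (- gap R z k / 4) else 1))"
    unfolding prod_envelope[OF D] by (simp add: prod.distrib)
  also have "\<dots> \<le> (\<Prod>k\<in>?N. majorant (S \<union> D) k (gap R z k))"
  proof (intro prod_mono conjI)
    fix k
    define y where "y = gap R z k"
    have "exp (- \<bar>y\<bar> / 2) * exp (- y / 4) \<le> exp (- (1/4) * \<bar>y\<bar>)" by (simp add: mult_exp_exp)
    moreover have "min 1 (exp (y / 2)) * exp (- y / 4) \<le> exp (- (1/4) * \<bar>y\<bar>)"
      by (cases "y > 0") (auto simp: min_def mult_exp_exp)
    ultimately show "(if k \<in> D then exp (- \<bar>gap R z k\<bar> / 2) else min 1 (exp (gap R z k / 2))) * (if k \<in> S then exp (- gap R z k / 4) else 1)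
        \<le> majorant (S \<union> D) k (gap R z k)"
      by (auto simp: majorant_def y_def)
  qed (auto intro!: mult_nonneg_nonneg)
  finally show ?thesis .
qed

lemma envelope_measurable [measurable]: "(\<lambda>z. envelope D R z k) \<in> borel_measurable borel"
  unfolding envelope_def by measurable

lemma prod_envelope_bound_integral:
  fixes w :: "real \<Rightarrow> real^('n::finite idx) \<Rightarrow> real"
  assumes D: "D \<subseteq> {..<CARD('n)}"
    and w: "\<And>R. w R \<in> borel_measurable borel" "\<And>R z. R \<ge> 1 \<Longrightarrow> \<bar>w R z\<bar> \<le> C * (\<Prod>k\<le>CARD('n). envelope D R z k)"
    and "R \<ge> 1"
  shows "integrable lborel (w R)"
proof -
  have C: "C \<ge> 0"
  proof -
    have "0 \<le> C * (\<Prod>k\<le>CARD('n). envelope D 1 (0::real^('n idx)) k)" using w(2)[of 1 0] by linarith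
    moreover have "(\<Prod>k\<le>CARD('n). envelope D 1 (0::real^('n idx)) k) > 0" by (intro prod_pos) (auto simp: envelope_pos)
    ultimately show ?thesis by (simp add: zero_le_mult_iff)
  qed
  have "integrable lborel (\<lambda>z :: real^('n idx). C * (\<Prod>k\<le>CARD('n). majorant ({} \<union> D) k (gap R z k)))"
    by (intro integrable_mult_right majorant_integrable)
  then show ?thesis
  proof (rule Bochner_Integration.integrable_bound)
    show "AE z in lborel. norm (w R z) \<le> norm (C * (\<Prod>k\<le>CARD('n). majorant ({} \<union> D) k (gap R z k)))"
    proof (rule AE_I2)
      fix z
      have "\<bar>w R z\<bar> \<le> C * (\<Prod>k\<le>CARD('n). envelope D R z k)" using w(2) assms by blast
      also have "\<dots> \<le> C * (\<Prod>k\<le>CARD('n). majorant ({} \<union> D) k (gap R z k))"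
        using prod_envelope_le_majorant[OF D, of "{}" R z] C by (intro mult_left_mono) auto
      finally show "norm (w R z) \<le> norm (C * (\<Prod>k\<le>CARD('n). majorant ({} \<union> D) k (gap R z k)))"
        by (simp add: C abs_mult prod_nonneg majorant_nonneg)
    qed
  qed (use w in simp)
qed

text \<open>As \<open>min 1 (exp (- t)) \<le> exp (- t / 4)\<close>, each monomial may be replaced by its fourth root. Then
\<open>prod_envelope_le_majorant\<close> applies with a set \<open>S \<union> D\<close> of at least two indices.\<close>

lemma gap_error_integral_small:
  fixes w :: "real \<Rightarrow> real^('n::finite idx) \<Rightarrow> real"
  assumes D: "D \<subseteq> {..<CARD('n)}"
    and w: "\<And>R. w R \<in> borel_measurable borel"
      "\<And>R z. R \<ge> 1 \<Longrightarrow> \<bar>w R z\<bar> \<le> C * (\<Prod>k\<le>CARD('n). envelope D R z k) * min 1 (gap_error D R z)"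
  shows "((\<lambda>R. (LINT z|lborel. w R z) / R ^ (CARD('n) - 1)) \<longlongrightarrow> 0) at_top"
proof -
  define \<S> where "\<S> = {S. S \<subseteq> {..CARD('n)} \<and> card (S \<union> D) \<ge> 2}"
  have fin: "finite \<S>" unfolding \<S>_def by (rule finite_subset[of _ "Pow {..CARD('n)}"]) auto
  have pos: "(\<Prod>k\<le>CARD('n). envelope D R z k) > 0" for R and z :: "real^('n idx)" by (intro prod_pos) (auto simp: envelope_pos)
  define h where "h = (\<lambda>R z :: real^('n idx). \<bar>C\<bar> * (\<Sum>S\<in>\<S>. \<Prod>k\<le>CARD('n). majorant (S \<union> D) k (gap R z k)))"
  have hint: "integrable lborel (h R)" for R
    unfolding h_def by (intro integrable_mult_right Bochner_Integration.integrable_sum majorant_integrable)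
  have bound: "\<bar>w R z\<bar> \<le> h R z" if "R \<ge> 1" for R z
  proof -
    have "min 1 (gap_error D R z) \<le> (\<Sum>S\<in>\<S>. exp (- (\<Sum>m\<in>S. gap R z m) / 4))"
    proof -
      have 1: "min 1 (\<Sum>S\<in>\<S>. f S) \<le> (\<Sum>S\<in>\<S>. min 1 (f S))" if "\<And>S. f S \<ge> 0" for f :: "nat set \<Rightarrow> real"
      proof (cases "\<exists>S\<in>\<S>. f S \<ge> 1")
        case True
        then obtain S where S: "S \<in> \<S>" "f S \<ge> 1" by blast
        have "min 1 (f S) \<le> (\<Sum>S\<in>\<S>. min 1 (f S))" using S that by (intro member_le_sum[OF S(1) _ fin]) auto
        then show ?thesis using S by auto
      next
        case False
        then have "(\<Sum>S\<in>\<S>. min 1 (f S)) = (\<Sum>S\<in>\<S>. f S)" by (intro sum.cong) auto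
        then show ?thesis by simp
      qed
      have 2: "min 1 (exp (- y)) \<le> exp (- y / 4)" for y :: real by (auto simp: min_def)
      have "min 1 (gap_error D R z) \<le> (\<Sum>S\<in>\<S>. min 1 (exp (- (\<Sum>m\<in>S. gap R z m))))"
        unfolding gap_error_def \<S>_def[symmetric] by (rule 1) simp
      also have "\<dots> \<le> (\<Sum>S\<in>\<S>. exp (- (\<Sum>m\<in>S. gap R z m) / 4))" by (intro sum_mono 2)
      finally show ?thesis .
    qed
    then have "\<bar>C\<bar> * (\<Prod>k\<le>CARD('n). envelope D R z k) * min 1 (gap_error D R z)
        \<le> \<bar>C\<bar> * (\<Prod>k\<le>CARD('n). envelope D R z k) * (\<Sum>S\<in>\<S>. exp (- (\<Sum>m\<in>S. gap R z m) / 4))"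
      using pos[of R z] by (intro mult_left_mono) auto
    also have "\<dots> = \<bar>C\<bar> * (\<Sum>S\<in>\<S>. (\<Prod>k\<le>CARD('n). envelope D R z k) * exp (- (\<Sum>m\<in>S. gap R z m) / 4))"
      by (simp add: sum_distrib_left mult.assoc)
    also have "\<dots> \<le> h R z" unfolding h_def
      using prod_envelope_le_majorant[OF D] by (intro mult_left_mono sum_mono) (auto simp: \<S>_def)
    finally have "\<bar>C\<bar> * (\<Prod>k\<le>CARD('n). envelope D R z k) * min 1 (gap_error D R z) \<le> h R z" .
    moreover have "C * (\<Prod>k\<le>CARD('n). envelope D R z k) * min 1 (gap_error D R z) \<le> \<bar>C\<bar> * (\<Prod>k\<le>CARD('n). envelope D R z k) * min 1 (gap_error D R z)"
      using pos[of R z] by (intro mult_right_mono) (auto simp: gap_error_def intro: sum_nonneg)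
    ultimately show ?thesis using w(2)[OF that, of z] by linarith
  qed
  have lim: "((\<lambda>R. (LINT z|lborel. h R z) / R ^ (CARD('n) - 1)) \<longlongrightarrow> 0) at_top"
  proof -
    have "((\<lambda>R. \<bar>C\<bar> * (\<Sum>S\<in>\<S>. (LINT z|lborel. (\<Prod>k\<le>CARD('n). majorant (S \<union> D) k (gap R (z::real^('n idx)) k))) / R ^ (CARD('n) - 1))) \<longlongrightarrow> \<bar>C\<bar> * (\<Sum>S\<in>\<S>. 0)) at_top"
    proof (intro tendsto_mult tendsto_const tendsto_sum majorant_integral_small)
      fix S assume "S \<in> \<S>"
      then have "(S \<union> D) \<inter> {..CARD('n)} = S \<union> D" "card (S \<union> D) \<ge> 2" using D by (auto simp: \<S>_def)
      then show "2 \<le> card ((S \<union> D) \<inter> {..CARD('n)})" by simp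
    qed
    moreover have "\<bar>C\<bar> * (\<Sum>S\<in>\<S>. (LINT z|lborel. (\<Prod>k\<le>CARD('n). majorant (S \<union> D) k (gap R (z::real^('n idx)) k))) / R ^ (CARD('n) - 1))
        = (LINT z|lborel. h R z) / R ^ (CARD('n) - 1)" for R
      unfolding h_def by (simp add: Bochner_Integration.integral_sum majorant_integrable sum_divide_distrib[symmetric])
    ultimately show ?thesis by simp
  qed
  show ?thesis
  proof (rule Lim_null_comparison[OF _ lim])
    show "\<forall>\<^sub>F R in at_top. norm ((LINT z|lborel. w R z) / R ^ (CARD('n) - 1)) \<le> (LINT z|lborel. h R z) / R ^ (CARD('n) - 1)"
      using eventually_ge_at_top[of 1]
    proof eventually_elim
      case (elim R)
      have "norm (LINT z|lborel. w R z) \<le> (LINT z|lborel. h R z)"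
      proof (rule Bochner_Integration.integral_norm_bound_integral[OF _ hint])
        show "integrable lborel (w R)"
        proof (rule Bochner_Integration.integrable_bound[OF hint])
          show "AE z in lborel. norm (w R z) \<le> norm (h R z)"
            using bound[OF elim] by (intro AE_I2) (auto intro: order_trans[OF _ abs_ge_self])
        qed (use w in simp)
      qed (use bound[OF elim] in simp)
      then show ?case using elim by (simp add: divide_right_mono)
    qed
  qed
qed

section \<open>Asymptotics of the integral attached to a matrix of slacks\<close>

text \<open>If \<open>A i k = 1 - b \<bullet> p\<close>, then this is the slack \<open>1 - b \<bullet> (l *\<^sub>R p)\<close> of the contracted point, for the
radius \<open>l = 1 - exp (- R)\<close>.\<close>

definition entry :: "(nat \<Rightarrow> nat \<Rightarrow> real) \<Rightarrow> real \<Rightarrow> nat \<Rightarrow> nat \<Rightarrow> real" where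
  "entry A R i k = exp (- R) + (1 - exp (- R)) * A i k"

definition row_form :: "(nat \<Rightarrow> nat \<Rightarrow> real) \<Rightarrow> real \<Rightarrow> real^('n::finite idx) \<Rightarrow> nat \<Rightarrow> real" where
  "row_form A R z k = (\<Sum>i\<le>CARD('n). exp (- level z i) * entry A R i k)"

definition ratio :: "(nat \<Rightarrow> nat \<Rightarrow> real) \<Rightarrow> real \<Rightarrow> real^('n::finite idx) \<Rightarrow> nat \<Rightarrow> real" where
  "ratio A R z k = exp (- level z k) / row_form A R z k"

lemma ratio_measurable [measurable]: "(\<lambda>z. ratio A R z k) \<in> borel_measurable borel"
  unfolding ratio_def row_form_def by measurable

lemma positive_entries_bounded_below:
  fixes A :: "nat \<Rightarrow> nat \<Rightarrow> real"
  shows "\<exists>c>0. c \<le> 1 \<and> (\<forall>i\<le>n. \<forall>k\<le>n. A i k > 0 \<longrightarrow> A i k \<ge> c)"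
proof -
  define X where "X = insert 1 ((\<lambda>(i, k). A i k) ` {(i, k). i \<le> n \<and> k \<le> n \<and> A i k > 0})"
  have "finite {(i, k). i \<le> n \<and> k \<le> n \<and> A i k > 0}"
    by (rule finite_subset[of _ "{..n} \<times> {..n}"]) auto
  then have fin: "finite X" by (simp add: X_def)
  have "Min X > 0" using fin by (subst Min_gr_iff) (auto simp: X_def)
  moreover have "Min X \<le> x" if "x \<in> X" for x using fin that by simp
  ultimately show ?thesis by (intro exI[of _ "Min X"]) (auto simp: X_def)
qed

lemma entries_bounded:
  fixes A :: "nat \<Rightarrow> nat \<Rightarrow> real"
  shows "\<exists>B\<ge>1. \<forall>i\<le>n. \<forall>k\<le>n. \<bar>A i k\<bar> \<le> B \<and> \<bar>1 - A i k\<bar> \<le> B"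
proof -
  define B where "B = 1 + (\<Sum>i\<le>n. \<Sum>k\<le>n. \<bar>A i k\<bar>)"
  have "\<bar>A i k\<bar> \<le> (\<Sum>i\<le>n. \<Sum>k\<le>n. \<bar>A i k\<bar>)" if "i \<le> n" "k \<le> n" for i k
  proof -
    have "\<bar>A i k\<bar> \<le> (\<Sum>k\<le>n. \<bar>A i k\<bar>)" using that by (intro member_le_sum) auto
    also have "\<dots> \<le> (\<Sum>i\<le>n. \<Sum>k\<le>n. \<bar>A i k\<bar>)"
      using that by (intro member_le_sum[of i "{..n}" "\<lambda>i. \<Sum>k\<le>n. \<bar>A i k\<bar>"]) (auto intro: sum_nonneg)
    finally show ?thesis .
  qed
  moreover have "(\<Sum>i\<le>n. \<Sum>k\<le>n. \<bar>A i k\<bar>) \<ge> 0" by (intro sum_nonneg) auto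
  ultimately show ?thesis unfolding B_def
    by (intro exI[of _ B]) (force simp: B_def)
qed

lemma le_mult_of_le_squares:
  fixes x K m1 m2 :: real
  assumes "x \<ge> 0" "K \<ge> 0" "m1 \<ge> 0" "m2 \<ge> 0" "x \<le> K * m1\<^sup>2" "x \<le> K * m2\<^sup>2"
  shows "x \<le> K * (m1 * m2)"
proof (rule power2_le_imp_le)
  have "x\<^sup>2 \<le> (K * m1\<^sup>2) * (K * m2\<^sup>2)"
    unfolding power2_eq_square[of x] using assms by (intro mult_mono) auto
  then show "x\<^sup>2 \<le> (K * (m1 * m2))\<^sup>2" by (simp add: power2_eq_square mult_ac)
qed (use assms in auto)

lemma min_exp_half_square: "(min 1 (exp (y / 2)))\<^sup>2 = min 1 (exp (y::real))"
  by (auto simp: min_def power2_eq_square mult_exp_exp)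

lemma min_exp_le_half: "min 1 (exp (y::real)) \<le> min 1 (exp (y / 2))"
  by (auto simp: min_def)

text \<open>In the application, \<open>A\<close> consists of the slacks of a pair of flags, and \<open>D\<close> of the dimensions in which the two
flags differ. The type of \<open>N\<close> fixes the dimension.\<close>

context
  fixes A :: "nat \<Rightarrow> nat \<Rightarrow> real" and D :: "nat set" and N :: "'n::finite itself"
  assumes D: "D \<subseteq> {..<CARD('n)}"
    and nonneg: "\<And>i k. i \<le> CARD('n) \<Longrightarrow> k \<le> CARD('n) \<Longrightarrow> A i k \<ge> 0"
    and pos: "\<And>i k. k \<le> i \<Longrightarrow> i \<le> CARD('n) \<Longrightarrow> A i k > 0"
    and pos_D: "\<And>j. j \<in> D \<Longrightarrow> A j (Suc j) > 0"
begin

lemma entry_nonneg: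
  assumes "R \<ge> 0" "i \<le> CARD('n)" "k \<le> CARD('n)"
  shows "entry A R i k \<ge> exp (- R)"
  unfolding entry_def using nonneg[OF assms(2,3)] assms(1) by simp

lemma entry_ge:
  assumes "R \<ge> 0" "0 < c" "c \<le> 1" "c \<le> A i k"
  shows "c \<le> entry A R i k"
proof -
  have "c = exp (- R) * c + (1 - exp (- R)) * c" by (simp add: algebra_simps)
  also have "\<dots> \<le> exp (- R) * 1 + (1 - exp (- R)) * A i k"
    using assms by (intro add_mono mult_left_mono) auto
  finally show ?thesis by (simp add: entry_def)
qed

lemma term_le_row_form:
  fixes z :: "real^'n idx"
  assumes "R \<ge> 0" "i \<le> CARD('n)" "k \<le> CARD('n)"
  shows "exp (- level z i) * entry A R i k \<le> row_form A R z k"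
  unfolding row_form_def
proof (rule member_le_sum[of i "{..CARD('n)}" "\<lambda>i. exp (- level z i) * entry A R i k"])
  fix j assume "j \<in> {..CARD('n)} - {i}"
  then show "0 \<le> exp (- level z j) * entry A R j k"
    using order_trans[OF exp_ge_zero entry_nonneg[OF assms(1) _ assms(3), of j]] by simp
qed (use assms in auto)

lemma row_form_pos:
  fixes z :: "real^'n idx"
  assumes "R \<ge> 0" "k \<le> CARD('n)"
  shows "row_form A R z k > 0"
proof -
  have "0 < exp (- level z k) * entry A R k k"
    using entry_nonneg[OF assms(1,2,2)] by (intro mult_pos_pos) (auto intro: less_le_trans[OF exp_gt_zero])
  then show ?thesis using term_le_row_form[OF assms(1,2,2), of z] by linarith
qed

lemma ratio_pos:
  fixes z :: "real^'n idx"
  assumes "R \<ge> 0" "k \<le> CARD('n)"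
  shows "ratio A R z k > 0"
  unfolding ratio_def using row_form_pos[OF assms, of z] by simp

text \<open>The two factors of an envelope are square roots of the bounds in the hypotheses. So two bounds that hold separately
can be combined to a bound by a product, by taking their geometric mean.\<close>

lemma envelope_bound:
  fixes z :: "real^'n idx"
  assumes "x \<ge> 0" "K \<ge> 0" "x \<le> K" "x \<le> K * exp (gap R z k)"
    and "k \<in> Suc ` D \<Longrightarrow> x \<le> K * exp (- gap R z (k - 1))"
  shows "x \<le> K * envelope D R z k"
proof (cases "k \<in> Suc ` D")
  case True
  have 1: "x \<le> K * (min 1 (exp (gap R z k / 2)))\<^sup>2"
    using assms(3,4) unfolding min_exp_half_square by (simp add: min_def)
  have 2: "x \<le> K * (min 1 (exp (- gap R z (k - 1) / 2)))\<^sup>2"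
    using assms(3) assms(5)[OF True] unfolding min_exp_half_square by (simp add: min_def)
  show ?thesis using le_mult_of_le_squares[OF assms(1,2) _ _ 1 2] True by (simp add: envelope_def)
next
  case False
  have "x \<le> K * min 1 (exp (gap R z k))" using assms(3,4) by (simp add: min_def)
  also have "\<dots> \<le> K * min 1 (exp (gap R z k / 2))" using assms(2) by (intro mult_left_mono min_exp_le_half)
  finally show ?thesis using False by (simp add: envelope_def)
qed

text \<open>The denominator is at least any one of its terms: the term with index \<open>k\<close> yields the constant, the
next one the decay in the gap \<open>k\<close>, and for \<open>k - 1 \<in> D\<close> the preceding one the decay in the gap
\<open>k - 1\<close>. For \<open>k = CARD('n)\<close>, the term after the last one is the term with index \<open>0\<close>, whose
coefficient is at least \<open>exp (- R)\<close>.\<close>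

lemma ratio_le_envelope:
  assumes c: "c > 0" "c \<le> 1" "\<And>i k. i \<le> CARD('n) \<Longrightarrow> k \<le> CARD('n) \<Longrightarrow> A i k > 0 \<Longrightarrow> A i k \<ge> c"
    and R: "R \<ge> 0" and k: "k \<le> CARD('n)"
  shows "ratio A R (z :: real^'n idx) k \<le> (1 / c) * envelope D R z k"
proof (rule envelope_bound)
  have key: "ratio A R z k \<le> (1 / e) * exp (level z i - level z k)" if "i \<le> CARD('n)" "e > 0" "entry A R i k \<ge> e" for i e
  proof -
    have "exp (- level z i) * e \<le> row_form A R z k"
      using that by (intro order_trans[OF _ term_le_row_form[OF R that(1) k]] mult_left_mono) auto
    then have "ratio A R z k \<le> exp (- level z k) / (exp (- level z i) * e)"
      unfolding ratio_def using that row_form_pos[OF R k, of z] by (intro divide_left_mono) auto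
    also have "\<dots> = (1 / e) * (exp (- level z k) / exp (- level z i))" by simp
    also have "exp (- level z k) / exp (- level z i) = exp (level z i - level z k)" by (simp add: exp_diff[symmetric])
    finally show ?thesis .
  qed
  have e: "entry A R i k \<ge> c" if "k \<le> i" "i \<le> CARD('n)" for i
    using that pos[OF that] k c by (intro entry_ge R) auto
  show "ratio A R z k \<ge> 0" using ratio_pos[OF R k, of z] by simp
  show "1 / c \<ge> 0" using c by simp
  show "ratio A R z k \<le> 1 / c" using key[OF k c(1) e[OF order_refl k]] by simp
  show "ratio A R z k \<le> 1 / c * exp (gap R z k)"
  proof (cases "k < CARD('n)")
    case True
    then show ?thesis using key[of "Suc k" c] e[of "Suc k"] c by (simp add: gap_def)
  next
    case False
    then have kn: "k = CARD('n)" using k by simp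
    have "ratio A R z k \<le> 1 / exp (- R) * exp (level z 0 - level z k)"
      by (rule key) (use entry_nonneg[OF R _ k, of 0] in auto)
    also have "\<dots> = exp (gap R z k)" using kn by (simp add: gap_def level_def exp_minus exp_add field_simps)
    also have "\<dots> \<le> 1 / c * exp (gap R z k)" using c by (simp add: field_simps)
    finally show ?thesis .
  qed
  show "ratio A R z k \<le> 1 / c * exp (- gap R z (k - 1))" if kD: "k \<in> Suc ` D"
  proof -
    obtain j where j: "k = Suc j" "j \<in> D" using kD by blast
    have jn: "j < CARD('n)" using j D by auto
    have "entry A R j k \<ge> c" using pos_D[OF j(2)] j jn k c by (intro entry_ge R) auto
    from key[OF _ c(1) this] jn j show ?thesis by (simp add: gap_def)
  qed
qed

lemma prod_le_envelope:
  assumes c: "c > 0" and u: "\<And>k. k \<le> CARD('n) \<Longrightarrow> 0 \<le> u k \<and> u k \<le> (1 / c) * envelope D R (z :: real^'n idx) k"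
  shows "\<bar>\<Prod>k\<le>CARD('n). u k\<bar> \<le> (1 / c) ^ (CARD('n) + 1) * (\<Prod>k\<le>CARD('n). envelope D R z k)"
proof -
  have "(\<Prod>k\<le>CARD('n). u k) \<le> (\<Prod>k\<le>CARD('n). (1 / c) * envelope D R z k)"
    using u by (intro prod_mono) auto
  also have "\<dots> = (1 / c) ^ (CARD('n) + 1) * (\<Prod>k\<le>CARD('n). envelope D R z k)"
    by (simp only: prod.distrib prod_constant card_atMost Suc_eq_plus1)
  finally show ?thesis using u by (simp add: abs_prod)
qed

lemma ratio_between_envelope:
  fixes z :: "real^'n idx"
  assumes "c > 0" "c \<le> 1" "\<And>i k. i \<le> CARD('n) \<Longrightarrow> k \<le> CARD('n) \<Longrightarrow> A i k > 0 \<Longrightarrow> A i k \<ge> c" "R \<ge> 0" "k \<le> CARD('n)"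
  shows "0 \<le> ratio A R z k \<and> ratio A R z k \<le> (1 / c) * envelope D R z k"
  using ratio_le_envelope[OF assms, of z] ratio_pos[OF assms(4,5), of z] by simp

text \<open>If \<open>D\<close> has two elements, the empty set is among the monomials of \<open>gap_error\<close>, so an error
estimate applies to the integrand itself.\<close>

lemma ratio_prod_integral_small:
  assumes "card D \<ge> 2"
  shows "((\<lambda>R. (LINT z|lborel. (\<Prod>k\<le>CARD('n). ratio A R (z :: real^'n idx) k)) / R ^ (CARD('n) - 1)) \<longlongrightarrow> 0) at_top"
proof -
  obtain c where c: "c > 0" "c \<le> 1" "\<And>i k. i \<le> CARD('n) \<Longrightarrow> k \<le> CARD('n) \<Longrightarrow> A i k > 0 \<Longrightarrow> A i k \<ge> c"
    using positive_entries_bounded_below[of "CARD('n)" A] by blast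
  show ?thesis
  proof (rule gap_error_integral_small[OF D, where C = "(1 / c) ^ (CARD('n) + 1)"])
    show "(\<lambda>z :: real^'n idx. \<Prod>k\<le>CARD('n). ratio A R z k) \<in> borel_measurable borel" for R by measurable
    fix R :: real and z :: "real^'n idx" assume R: "R \<ge> 1"
    have "gap_error D R z \<ge> exp (- (\<Sum>m\<in>{}. gap R z m))"
      unfolding gap_error_def using assms
      by (intro member_le_sum[where f = "\<lambda>S. exp (- (\<Sum>m\<in>S. gap R z m))"]) auto
    then have 1: "min 1 (gap_error D R z) = 1" by simp
    show "\<bar>\<Prod>k\<le>CARD('n). ratio A R z k\<bar> \<le> (1 / c) ^ (CARD('n) + 1) * (\<Prod>k\<le>CARD('n). envelope D R z k) * min 1 (gap_error D R z)"
      using prod_le_envelope[OF c(1) ratio_between_envelope[OF c], of R z] R unfolding 1 by simp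
  qed
qed

lemma ratio_prod_integrable:
  assumes "R \<ge> 1"
  shows "integrable lborel (\<lambda>z :: real^'n idx. \<Prod>k\<le>CARD('n). ratio A R z k)"
proof -
  obtain c where c: "c > 0" "c \<le> 1" "\<And>i k. i \<le> CARD('n) \<Longrightarrow> k \<le> CARD('n) \<Longrightarrow> A i k > 0 \<Longrightarrow> A i k \<ge> c"
    using positive_entries_bounded_below[of "CARD('n)" A] by blast
  show ?thesis
  proof (rule prod_envelope_bound_integral[OF D _ _ assms, where C = "(1 / c) ^ (CARD('n) + 1)"])
    show "(\<lambda>z :: real^'n idx. \<Prod>k\<le>CARD('n). ratio A R z k) \<in> borel_measurable borel" for R by measurable
    fix R :: real and z :: "real^'n idx" assume R: "R \<ge> 1"
    show "\<bar>\<Prod>k\<le>CARD('n). ratio A R z k\<bar> \<le> (1 / c) ^ (CARD('n) + 1) * (\<Prod>k\<le>CARD('n). envelope D R z k)"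
      using prod_le_envelope[OF c(1) ratio_between_envelope[OF c], of R z] R by simp
  qed
qed

text \<open>The value 1 at \<open>CARD('n)\<close> is the coefficient of \<open>exp (- gap R z CARD('n)) = exp (- R) * exp (- level z 0)\<close>: an
entry of the last column that is zero in \<open>A\<close> is \<open>exp (- R)\<close> after contraction.\<close>

definition next_entry :: "nat \<Rightarrow> real" where
  "next_entry k = (if k < CARD('n) then A (Suc k) k else 1)"

text \<open>Keeps from the denominator the terms with indices \<open>k\<close> and \<open>Suc k\<close>, or \<open>k - 1\<close> and \<open>k\<close> if
\<open>k - 1 \<in> D\<close>; these depend on one gap only. In the second case the factor \<open>logistic 1 1\<close>, close to
1 except where the integrand is negligible, restores the decay in the gap \<open>k\<close>.\<close>

definition model :: "real \<Rightarrow> real^'n idx \<Rightarrow> nat \<Rightarrow> real" where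
  "model R z k = (if k \<in> Suc ` D
     then 1 / (A k k + A (k - 1) k * exp (gap R z (k - 1))) * logistic 1 1 (gap R z k)
     else logistic (A k k) (next_entry k) (gap R z k))"

lemma model_measurable [measurable]: "(\<lambda>z. model R z k) \<in> borel_measurable borel"
  unfolding model_def by measurable

lemma next_entry_pos: "next_entry k > 0"
  using pos[of k "Suc k"] by (simp add: next_entry_def)

lemma model_pos:
  assumes "k \<le> CARD('n)"
  shows "model R z k > 0"
proof -
  have "A (k - 1) k > 0" if "k \<in> Suc ` D" using that pos_D by auto
  then show ?thesis
    using pos[OF order_refl assms] next_entry_pos[of k]
    by (auto simp: model_def intro!: mult_pos_pos logistic_pos divide_pos_pos add_pos_pos)
qed

lemma logistic_le: "a \<ge> c \<Longrightarrow> b \<ge> c \<Longrightarrow> c > 0 \<Longrightarrow> logistic a b y \<le> 1 / c" "a \<ge> c \<Longrightarrow> b \<ge> c \<Longrightarrow> c > 0 \<Longrightarrow> logistic a b y \<le> 1 / c * exp y"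
proof -
  assume a: "a \<ge> c" "b \<ge> c" "c > 0"
  have "c \<le> a + b * exp (- y)" using a by (intro order_trans[OF a(1)]) (auto intro: mult_nonneg_nonneg)
  then show "logistic a b y \<le> 1 / c" unfolding logistic_def using a by (intro divide_left_mono) (auto intro!: mult_pos_pos add_pos_pos)
  have "c * exp (- y) \<le> a + b * exp (- y)" using a by (intro order_trans[OF mult_right_mono[OF a(2)]]) auto
  then have "logistic a b y \<le> 1 / (c * exp (- y))"
    unfolding logistic_def using a by (intro divide_left_mono) (auto intro!: mult_pos_pos add_pos_pos)
  then show "logistic a b y \<le> 1 / c * exp y" by (simp add: exp_minus field_simps)
qed

lemma model_le_envelope:
  assumes c: "c > 0" "c \<le> 1" "\<And>i k. i \<le> CARD('n) \<Longrightarrow> k \<le> CARD('n) \<Longrightarrow> A i k > 0 \<Longrightarrow> A i k \<ge> c"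
    and k: "k \<le> CARD('n)"
  shows "model R z k \<le> (1 / c) * envelope D R z k"
proof (cases "k \<in> Suc ` D")
  case False
  have "next_entry k \<ge> c" using c pos[of k "Suc k"] by (auto simp: next_entry_def)
  moreover have "A k k \<ge> c" using c(3)[OF k k] pos[OF order_refl k] by blast
  ultimately show ?thesis
    using False model_pos[OF k, of R z] logistic_le[of c "A k k" "next_entry k" "gap R z k"] c
    by (intro envelope_bound) (auto simp: model_def)
next
  case True
  then obtain j where j: "k = Suc j" "j \<in> D" by blast
  have Ak: "A k k \<ge> c" using c(3)[OF k k] pos[OF order_refl k] by blast
  have Aj: "A j k \<ge> c" using c(3)[of j k] pos_D[OF j(2)] j k by auto
  define y where "y = gap R z j"
  have "1 / (A k k + A j k * exp y) = logistic (A k k) (A j k) (- y)" by (simp add: logistic_def)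
  then have "1 / (A k k + A j k * exp y) \<le> (1 / c) * min 1 (exp (- y))"
    using logistic_le[OF Ak Aj c(1), of "- y"] by (simp add: min_def)
  also have "\<dots> \<le> (1 / c) * min 1 (exp (- y / 2))" using c min_exp_le_half[of "- y"] by (intro mult_left_mono) auto
  finally have 1: "1 / (A k k + A j k * exp y) \<le> (1 / c) * min 1 (exp (- y / 2))" .
  have "logistic 1 1 (gap R z k) \<le> min 1 (exp (gap R z k))"
    using logistic_le[of 1 1 1 "gap R z k"] by simp
  also have "\<dots> \<le> min 1 (exp (gap R z k / 2))" by (rule min_exp_le_half)
  finally have 2: "logistic 1 1 (gap R z k) \<le> min 1 (exp (gap R z k / 2))" .
  have "model R z k = 1 / (A k k + A j k * exp y) * logistic 1 1 (gap R z k)"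
    using True j by (simp add: model_def y_def)
  also have "\<dots> \<le> ((1 / c) * min 1 (exp (- y / 2))) * min 1 (exp (gap R z k / 2))"
    using 1 2 c logistic_pos[of 1 1 "gap R z k"] by (intro mult_mono) (auto intro: less_imp_le)
  also have "\<dots> = (1 / c) * envelope D R z k" using True j by (simp add: envelope_def y_def)
  finally show ?thesis .
qed

text \<open>Equal or adjacent flags: above the diagonal, at most one slack is positive, and it is next to the diagonal.\<close>

context
  assumes card_D: "card D \<le> 1"
    and zero: "\<And>i k. i < k \<Longrightarrow> k \<le> CARD('n) \<Longrightarrow> \<not> (k = Suc i \<and> i \<in> D) \<Longrightarrow> A i k = 0"
begin

lemma exp_le_gap_error:
  fixes z :: "real^'n idx"
  assumes "S \<subseteq> {..CARD('n)}" "card (S \<union> D) \<ge> 2"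
  shows "exp (- (\<Sum>m\<in>S. gap R z m)) \<le> gap_error D R z"
  unfolding gap_error_def
  using assms by (intro member_le_sum[where f = "\<lambda>S. exp (- (\<Sum>m\<in>S. gap R z m))"]) auto

lemma finite_D: "finite D"
  using D finite_subset by blast

lemma card_ge_2I: "finite S \<Longrightarrow> i \<in> S \<Longrightarrow> j \<in> S \<Longrightarrow> i \<noteq> j \<Longrightarrow> card S \<ge> 2"
  using card_mono[of S "{i, j}"] by auto

text \<open>A term of index \<open>i \<le> k\<close> whose slack vanishes has the coefficient \<open>exp (- R)\<close>; relative to the term of
index \<open>k\<close> it is the monomial in the gaps outside \<open>{i..<k}\<close>.\<close>

lemma around_error:
  fixes z :: "real^'n idx"
  assumes "i \<le> k" "k \<le> CARD('n)" "card ({..<i} \<union> {k..CARD('n)} \<union> D) \<ge> 2"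
  shows "exp (- R) * exp (- level z i) \<le> exp (- level z k) * gap_error D R z"
proof -
  have "exp (- R) * exp (- level z i) = exp (- level z k) * exp (- (\<Sum>m\<in>{..<i} \<union> {k..CARD('n)}. gap R z m))"
    unfolding sum_gap_around[OF assms(1,2)] by (simp add: mult_exp_exp)
  also have "\<dots> \<le> exp (- level z k) * gap_error D R z"
    using assms by (intro mult_left_mono exp_le_gap_error) auto
  finally show ?thesis .
qed

text \<open>Relative to the term of index \<open>k\<close>, the one of index \<open>i \<ge> k\<close> is the monomial in the gaps in \<open>{k..<i}\<close>.\<close>

lemma upto_error:
  fixes z :: "real^'n idx"
  assumes "k \<le> i" "i \<le> CARD('n)" "card ({k..<i} \<union> D) \<ge> 2"
  shows "exp (- level z i) \<le> exp (- level z k) * gap_error D R z"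
proof -
  have "exp (- level z i) = exp (- level z k) * exp (- (\<Sum>m\<in>{k..<i}. gap R z m))"
    unfolding sum_gap_upto[OF assms(1,2)] by (simp add: mult_exp_exp)
  also have "\<dots> \<le> exp (- level z k) * gap_error D R z"
    using assms by (intro mult_left_mono exp_le_gap_error) auto
  finally show ?thesis .
qed

lemma eps_error: "exp (- R) \<le> gap_error D R (z :: real^'n idx)"
proof -
  have "(\<Sum>m\<le>CARD('n). gap R z m) = R" using sum_gap_around[of 0 0 R z] by (simp add: atLeast0AtMost)
  moreover have "card ({..CARD('n)} \<union> D) \<ge> 2"
    by (rule card_ge_2I[of _ 0 "CARD('n)"]) (auto simp: finite_D)
  ultimately show ?thesis using exp_le_gap_error[of "{..CARD('n)}" R z] by simp
qed

lemma gap_error_nonneg: "gap_error D R z \<ge> 0"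
  unfolding gap_error_def by (intro sum_nonneg) auto

text \<open>Every term of the denominator that the model drops or alters is bounded by \<open>gap_error\<close> times the
model: by \<open>far_low\<close> below the diagonal index \<open>k\<close>, by \<open>far_high\<close> above it, and by \<open>near\<close> where only
the contraction changes the coefficient. The bounds \<open>c\<close> and \<open>B\<close> of the entries enter through the
factor \<open>B / c\<close>, once for each of the \<open>CARD('n) + 1\<close> terms.\<close>

lemma ratio_model_error:
  assumes c: "c > 0" "c \<le> 1" "\<And>i k. i \<le> CARD('n) \<Longrightarrow> k \<le> CARD('n) \<Longrightarrow> A i k > 0 \<Longrightarrow> A i k \<ge> c"
    and B: "B \<ge> 1" "\<And>i k. i \<le> CARD('n) \<Longrightarrow> k \<le> CARD('n) \<Longrightarrow> \<bar>A i k\<bar> \<le> B \<and> \<bar>1 - A i k\<bar> \<le> B"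
    and R: "R \<ge> 0" and k: "k \<le> CARD('n)"
  shows "\<bar>row_form A R z k - exp (- level z k) / model R z k\<bar>
     \<le> (real (CARD('n) + 1) * (B / c) + 1) * gap_error D R z * (exp (- level z k) / model R z k)"
proof -
  define n where "n = CARD('n)"
  define s where "s = (\<lambda>i. exp (- level z i))"
  define err where "err = gap_error D R z"
  define \<epsilon> where "\<epsilon> = exp (- R)"
  have n: "n > 0" by (simp add: n_def)
  have kn: "k \<le> n" using k by (simp add: n_def)
  have s: "s i > 0" for i by (simp add: s_def)
  have err0: "err \<ge> 0" unfolding err_def by (rule gap_error_nonneg)
  have \<epsilon>: "\<epsilon> > 0" "\<epsilon> \<le> 1" "\<epsilon> \<le> err" using R eps_error[of R z] by (auto simp: \<epsilon>_def err_def)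
  have Akk: "A k k \<ge> c" using c(3)[OF k k] pos[OF order_refl k] by blast
  have E1: "\<epsilon> * s i \<le> s k * err" if "i \<le> k" "card ({..<i} \<union> {k..n} \<union> D) \<ge> 2" for i
    using around_error[OF that(1) k, of R z] that(2) by (simp add: \<epsilon>_def s_def err_def n_def)
  have E2: "s i \<le> s k * err" if "k \<le> i" "i \<le> n" "card ({k..<i} \<union> D) \<ge> 2" for i
    using upto_error[OF that(1), of z R] that(2,3) by (simp add: s_def err_def n_def)
  have entry_diff: "entry A R i k - A i k = \<epsilon> * (1 - A i k)" for i by (simp add: entry_def \<epsilon>_def algebra_simps)
  have entry_le: "\<bar>entry A R i k\<bar> \<le> B" if "i \<le> n" for i
  proof -
    have "\<bar>A i k\<bar> \<le> B" using B(2)[of i k] that kn by (simp add: n_def)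
    then have "\<bar>entry A R i k\<bar> \<le> \<epsilon> * B + (1 - \<epsilon>) * B"
      unfolding entry_def \<epsilon>_def[symmetric] using \<epsilon> B(1)
      by (intro order_trans[OF abs_triangle_ineq] add_mono) (auto simp: abs_mult intro: mult_left_mono)
    then show ?thesis by (simp add: algebra_simps)
  qed
  have diff_le: "\<bar>entry A R i k - A i k\<bar> \<le> B * \<epsilon>" if "i \<le> n" for i
    unfolding entry_diff using B(2)[of i k] that kn \<epsilon> by (simp add: n_def abs_mult mult.commute mult_right_mono)
  have sum_bound: "\<bar>row_form A R z k - (\<Sum>i\<le>n. s i * b i)\<bar> \<le> real (n + 1) * (B / c) * err * M"
    if "\<And>i. i \<le> n \<Longrightarrow> \<bar>s i * (entry A R i k - b i)\<bar> \<le> (B / c) * err * M" for b M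
  proof -
    have "row_form A R z k - (\<Sum>i\<le>n. s i * b i) = (\<Sum>i\<le>n. s i * (entry A R i k - b i))"
      by (simp add: row_form_def s_def n_def sum_subtractf right_diff_distrib)
    also have "\<bar>\<dots>\<bar> \<le> (\<Sum>i\<le>n. (B / c) * err * M)"
      using that by (intro order_trans[OF sum_abs] sum_mono) auto
    finally show ?thesis by (simp add: mult.assoc)
  qed
  have from_sk: "B * (s k * err) \<le> (B / c) * err * M" if "c * s k \<le> M" for M
  proof -
    have "B * err / c * (c * s k) \<le> B * err / c * M" using that c B err0 by (intro mult_left_mono) auto
    then show ?thesis using c by (simp add: field_simps)
  qed
  have from_eps: "B * \<epsilon> * s i \<le> (B / c) * err * M" if "c * s i \<le> M" for M i
  proof -
    have "B * \<epsilon> * s i \<le> B * err * s i" using \<epsilon> B s[of i] by (intro mult_right_mono mult_left_mono) auto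
    also have "\<dots> = B * err / c * (c * s i)" using c by simp
    also have "\<dots> \<le> B * err / c * M" using that c B err0 by (intro mult_left_mono) auto
    finally show ?thesis by simp
  qed
  have far_low: "\<bar>s i * (entry A R i k - 0)\<bar> \<le> (B / c) * err * M"
    if "i < k" "A i k = 0" "card ({..<i} \<union> {k..n} \<union> D) \<ge> 2" "c * s k \<le> M" for i M
  proof -
    have "entry A R i k = \<epsilon>" using that by (simp add: entry_def \<epsilon>_def)
    then have "\<bar>s i * (entry A R i k - 0)\<bar> = \<epsilon> * s i" using s[of i] \<epsilon> by (simp add: abs_mult)
    also have "\<dots> \<le> s k * err" using E1[of i] that by simp
    also have "\<dots> \<le> B * (s k * err)" using B(1) s[of k] err0 mult_right_mono[OF B(1), of "s k * err"] by simp
    also have "\<dots> \<le> (B / c) * err * M" by (rule from_sk[OF that(4)])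
    finally show ?thesis .
  qed
  have far_high: "\<bar>s i * (entry A R i k - 0)\<bar> \<le> (B / c) * err * M"
    if "k < i" "i \<le> n" "card ({k..<i} \<union> D) \<ge> 2" "c * s k \<le> M" for i M
  proof -
    have "\<bar>s i * (entry A R i k - 0)\<bar> \<le> s i * B" using s[of i] entry_le[OF that(2)] by (simp add: abs_mult)
    also have "\<dots> \<le> (s k * err) * B" using E2[of i] that B by (intro mult_right_mono) auto
    also have "\<dots> = B * (s k * err)" by simp
    also have "\<dots> \<le> (B / c) * err * M" by (rule from_sk[OF that(4)])
    finally show ?thesis .
  qed
  have near: "\<bar>s i * (entry A R i k - A i k)\<bar> \<le> (B / c) * err * M" if "i \<le> n" "c * s i \<le> M" for i M
  proof -
    have "\<bar>s i * (entry A R i k - A i k)\<bar> \<le> s i * (B * \<epsilon>)"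
      using s[of i] diff_le[OF that(1)] by (simp add: abs_mult)
    also have "\<dots> = B * \<epsilon> * s i" by simp
    also have "\<dots> \<le> (B / c) * err * M" by (rule from_eps[OF that(2)])
    finally show ?thesis .
  qed
  define L where "L = s k / model R z k"
  have L: "L > 0" unfolding L_def using s model_pos[OF k] by simp
  have "\<bar>row_form A R z k - L\<bar> \<le> (real (n + 1) * (B / c) + 1) * err * L"
  proof (cases "k \<in> Suc ` D")
    case False
    have L_eq: "L = A k k * s k + next_entry k * (s k * exp (- gap R z k))"
      using False by (simp add: L_def model_def logistic_def algebra_simps)
    have ck: "c * s k \<le> L" 
    proof -
      have "c * s k \<le> A k k * s k" using Akk s[of k] by (intro mult_right_mono) auto
      also have "\<dots> \<le> L" unfolding L_eq using s[of k] next_entry_pos[of k] by simp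
      finally show ?thesis .
    qed
    have "\<bar>row_form A R z k - L\<bar> \<le> real (n + 1) * (B / c) * err * L"
    proof (cases "k < n")
      case True
      have sk1: "s k * exp (- gap R z k) = s (Suc k)" using True by (simp add: s_def gap_def n_def mult_exp_exp)
      have L_eq': "L = (\<Sum>i\<le>n. s i * (if i = k \<or> i = Suc k then A i k else 0))"
      proof -
        have "(\<Sum>i\<le>n. s i * (if i = k \<or> i = Suc k then A i k else 0)) = (\<Sum>i\<in>{k, Suc k}. s i * (if i = k \<or> i = Suc k then A i k else 0))"
          using True by (intro sum.mono_neutral_right) auto
        also have "\<dots> = L" using True by (simp add: L_eq sk1 next_entry_def n_def mult.commute)
        finally show ?thesis by simp
      qed
      have ck1: "c * s (Suc k) \<le> L"
      proof -
        have "A (Suc k) k \<ge> c" using c(3)[of "Suc k" k] pos[of k "Suc k"] True by (simp add: n_def)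
        then have "c * s (Suc k) \<le> next_entry k * s (Suc k)" using True s[of "Suc k"] by (simp add: next_entry_def n_def)
        also have "\<dots> \<le> L" unfolding L_eq sk1 using s[of k] Akk c by simp
        finally show ?thesis .
      qed
      show ?thesis unfolding L_eq'
      proof (rule sum_bound, unfold L_eq'[symmetric])
        fix i assume i: "i \<le> n"
        consider "i < k" | "i = k" | "i = Suc k" | "i > Suc k" by linarith
        then show "\<bar>s i * (entry A R i k - (if i = k \<or> i = Suc k then A i k else 0))\<bar> \<le> (B / c) * err * L"
        proof cases
          case 1
          have "A i k = 0" using zero[of i k] 1 False kn by (auto simp: n_def)
          moreover have "card ({..<i} \<union> {k..n} \<union> D) \<ge> 2"
            by (rule card_ge_2I[of _ k n]) (use True finite_D in auto)
          ultimately show ?thesis using far_low[OF 1 _ _ ck] 1 by simp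
        next
          case 2
          then show ?thesis using near[of k, OF kn ck] by simp
        next
          case 3
          then show ?thesis using near[of "Suc k", OF _ ck1] True by simp
        next
          case 4
          have "card ({k..<i} \<union> D) \<ge> 2"
            by (rule card_ge_2I[of _ k "Suc k"]) (use 4 finite_D in auto)
          then show ?thesis using far_high[of i, OF _ i _ ck] 4 by simp
        qed
      qed
    next
      case False': False
      then have kn': "k = n" using kn by simp
      have sk1: "s k * exp (- gap R z k) = \<epsilon> * s 0"
        using kn' by (simp add: s_def gap_def n_def \<epsilon>_def level_def mult_exp_exp)
      have L_eq': "L = (\<Sum>i\<le>n. s i * (if i = n then A n n else if i = 0 then \<epsilon> else 0))"
      proof -
        have "(\<Sum>i\<le>n. s i * (if i = n then A n n else if i = 0 then \<epsilon> else 0)) = (\<Sum>i\<in>{0, n}. s i * (if i = n then A n n else if i = 0 then \<epsilon> else 0))"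
          using n by (intro sum.mono_neutral_right) auto
        also have "\<dots> = A n n * s n + 1 * (\<epsilon> * s 0)" using n by (simp add: mult.commute)
        also have "\<dots> = L" unfolding L_eq sk1 using kn' by (simp add: next_entry_def n_def)
        finally show ?thesis by simp
      qed
      show ?thesis unfolding L_eq'
      proof (rule sum_bound, unfold L_eq'[symmetric])
        fix i assume i: "i \<le> n"
        consider "i = 0" | "0 < i" "i < n" | "i = n" using i by linarith
        then show "\<bar>s i * (entry A R i k - (if i = n then A n n else if i = 0 then \<epsilon> else 0))\<bar> \<le> (B / c) * err * L"
        proof cases
          case 1
          have "A 0 k = 0" using zero[of 0 k] False kn' n by (auto simp: n_def)
          then have "entry A R i k = \<epsilon>" using 1 by (simp add: entry_def \<epsilon>_def)
          then show ?thesis using 1 n B c err0 L by simp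
        next
          case 2
          have "A i k = 0" using zero[of i k] 2 False kn' by (auto simp: n_def)
          moreover have "card ({..<i} \<union> {k..n} \<union> D) \<ge> 2"
            by (rule card_ge_2I[of _ 0 n]) (use 2 kn' finite_D in auto)
          ultimately show ?thesis using far_low[of i, OF _ _ _ ck] 2 kn' by simp
        next
          case 3
          then show ?thesis using near[of k, OF kn ck] kn' by simp
        qed
      qed
    qed
    also have "\<dots> \<le> (real (n + 1) * (B / c) + 1) * err * L"
      using err0 L by (intro mult_right_mono) auto
    finally show ?thesis .
  next
    case True
    then obtain j where j: "k = Suc j" "j \<in> D" by blast
    define b where "b = A k k * s k + A j k * s j"
    have Ajk: "A j k \<ge> c" using c(3)[of j k] pos_D[OF j(2)] j k by auto
    have sj: "s k * exp (gap R z j) = s j" using j kn by (simp add: s_def gap_def n_def mult_exp_exp)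
    have b0: "b > 0" unfolding b_def using s Akk Ajk c by (intro add_pos_pos mult_pos_pos) auto
    have L_eq: "L = b * (1 + exp (- gap R z k))"
    proof -
      have "L = (A k k * s k + A j k * (s k * exp (gap R z j))) * (1 + exp (- gap R z k))"
        using True j by (simp add: L_def model_def logistic_def algebra_simps)
      then show ?thesis by (simp add: sj b_def)
    qed
    have bL: "b \<le> L" unfolding L_eq using b0 by simp
    have ck: "c * s k \<le> b"
    proof -
      have "c * s k \<le> A k k * s k" using Akk s[of k] by (intro mult_right_mono) auto
      then show ?thesis unfolding b_def using Ajk c s[of j] mult_nonneg_nonneg[of "A j k" "s j"] by linarith
    qed
    have cj: "c * s j \<le> b"
    proof -
      have "c * s j \<le> A j k * s j" using Ajk s[of j] by (intro mult_right_mono) auto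
      then show ?thesis unfolding b_def using Akk c s[of k] mult_nonneg_nonneg[of "A k k" "s k"] by linarith
    qed
    have b_eq: "b = (\<Sum>i\<le>n. s i * (if i = j \<or> i = k then A i k else 0))"
    proof -
      have "(\<Sum>i\<le>n. s i * (if i = j \<or> i = k then A i k else 0)) = (\<Sum>i\<in>{j, k}. s i * (if i = j \<or> i = k then A i k else 0))"
        using j kn by (intro sum.mono_neutral_right) auto
      also have "\<dots> = b" using j by (simp add: b_def mult.commute)
      finally show ?thesis by simp
    qed
    have "\<bar>row_form A R z k - b\<bar> \<le> real (n + 1) * (B / c) * err * b"
      unfolding b_eq
    proof (rule sum_bound, unfold b_eq[symmetric])
      fix i assume i: "i \<le> n"
      consider "i < j" | "i = j" | "i = k" | "i > k" using j by linarith
      then show "\<bar>s i * (entry A R i k - (if i = j \<or> i = k then A i k else 0))\<bar> \<le> (B / c) * err * b"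
      proof cases
        case 1
        have "A i k = 0" using zero[of i k] 1 j kn by (auto simp: n_def)
        moreover have "card ({..<i} \<union> {k..n} \<union> D) \<ge> 2"
          by (rule card_ge_2I[of _ k j]) (use j kn finite_D in auto)
        ultimately show ?thesis using far_low[of i, OF _ _ _ ck] 1 j by simp
      next
        case 2
        then show ?thesis using near[of j, OF _ cj] i by simp
      next
        case 3
        then show ?thesis using near[of k, OF kn ck] by simp
      next
        case 4
        have "card ({k..<i} \<union> D) \<ge> 2"
          by (rule card_ge_2I[of _ k j]) (use 4 j finite_D in auto)
        then show ?thesis using far_high[of i, OF _ i _ ck] 4 j by simp
      qed
    qed
    also have "\<dots> \<le> real (n + 1) * (B / c) * err * L"
      using bL err0 B c by (intro mult_left_mono) auto
    finally have 1: "\<bar>row_form A R z k - b\<bar> \<le> real (n + 1) * (B / c) * err * L" .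
    have "exp (- gap R z k) \<le> err"
    proof -
      have "card ({k} \<union> D) \<ge> 2" by (rule card_ge_2I[of _ k j]) (use j finite_D in auto)
      then show ?thesis using exp_le_gap_error[of "{k}" R z] k by (simp add: err_def)
    qed
    then have "\<bar>b - L\<bar> \<le> err * L"
    proof -
      assume e: "exp (- gap R z k) \<le> err"
      have "\<bar>b - L\<bar> = exp (- gap R z k) * b" using b0 by (simp add: L_eq algebra_simps)
      also have "\<dots> \<le> err * L" using e b0 bL err0 by (intro mult_mono) auto
      finally show ?thesis .
    qed
    then show ?thesis using 1 by (simp add: distrib_right) 
  qed
  then show ?thesis by (simp add: n_def err_def L_def s_def)
qed

lemma ratio_model_diff:
  assumes c: "c > 0" "c \<le> 1" "\<And>i k. i \<le> CARD('n) \<Longrightarrow> k \<le> CARD('n) \<Longrightarrow> A i k > 0 \<Longrightarrow> A i k \<ge> c"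
    and B: "B \<ge> 1" "\<And>i k. i \<le> CARD('n) \<Longrightarrow> k \<le> CARD('n) \<Longrightarrow> \<bar>A i k\<bar> \<le> B \<and> \<bar>1 - A i k\<bar> \<le> B"
    and R: "R \<ge> 0" and k: "k \<le> CARD('n)"
  shows "\<bar>ratio A R z k - model R z k\<bar>
    \<le> ((1 / c) * envelope D R z k) * ((real (CARD('n) + 1) * (B / c) + 2) * min 1 (gap_error D R z))"
proof -
  define C where "C = real (CARD('n) + 1) * (B / c) + 1"
  have C: "C \<ge> 1" using B c by (simp add: C_def)
  define V where "V = (1 / c) * envelope D R z k"
  define u where "u = ratio A R z k"
  define v where "v = model R z k"
  define r where "r = row_form A R z k"
  define t where "t = exp (- level z k)"
  have pos: "u > 0" "v > 0" "r > 0" "t > 0"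
    using ratio_pos[OF R k] model_pos[OF k] row_form_pos[OF R k] by (auto simp: u_def v_def r_def t_def)
  have uv: "u \<le> V" "v \<le> V"
    using ratio_le_envelope[OF c R k, of z] model_le_envelope[OF c k, of R z] by (auto simp: u_def v_def V_def)
  have err0: "gap_error D R z \<ge> 0" by (rule gap_error_nonneg)
  have "\<bar>u - v\<bar> = u * (\<bar>r - t / v\<bar> * v / t)"
  proof -
    have "u - v = - (u * ((r - t / v) * v / t))" using pos by (simp add: u_def ratio_def r_def[symmetric] t_def[symmetric] field_simps)
    then show ?thesis using pos by (simp add: abs_mult)
  qed
  also have "\<dots> \<le> u * ((C * gap_error D R z * (t / v)) * v / t)"
    using ratio_model_error[OF c B R k, of z] pos unfolding C_def r_def t_def v_def
    by (intro mult_left_mono divide_right_mono mult_right_mono) auto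
  also have "\<dots> = u * (C * gap_error D R z)" using pos by simp
  also have "\<dots> \<le> V * (C * gap_error D R z)" using uv C err0 by (intro mult_right_mono) auto
  finally have 1: "\<bar>u - v\<bar> \<le> V * (C * gap_error D R z)" .
  have 2: "\<bar>u - v\<bar> \<le> V * 1" using uv pos by auto
  have V: "V > 0" using uv pos by linarith
  have "\<bar>u - v\<bar> \<le> V * ((C + 1) * min 1 (gap_error D R z))"
  proof (cases "gap_error D R z \<le> 1")
    case True
    have "V * (C * gap_error D R z) \<le> V * ((C + 1) * gap_error D R z)" using V err0 by (intro mult_left_mono mult_right_mono) auto
    then show ?thesis using 1 True by (simp add: min_def)
  next
    case False
    have "V * 1 \<le> V * ((C + 1) * 1)" using V C by (intro mult_left_mono) auto
    then show ?thesis using 2 False by (simp add: min_def)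
  qed
  then show ?thesis by (simp add: u_def v_def V_def C_def add.assoc)
qed

lemma model_prod_integrable:
  assumes "R \<ge> 1"
  shows "integrable lborel (\<lambda>z :: real^'n idx. \<Prod>k\<le>CARD('n). model R z k)"
proof -
  obtain c where c: "c > 0" "c \<le> 1" "\<And>i k. i \<le> CARD('n) \<Longrightarrow> k \<le> CARD('n) \<Longrightarrow> A i k > 0 \<Longrightarrow> A i k \<ge> c"
    using positive_entries_bounded_below[of "CARD('n)" A] by blast
  show ?thesis
    by (rule prod_envelope_bound_integral[OF D _ _ assms, where C = "(1 / c) ^ (CARD('n) + 1)"], measurable)
       (intro prod_le_envelope c conjI model_le_envelope[OF c] less_imp_le[OF model_pos])
qed

lemma ratio_model_integral_small:
  "((\<lambda>R. ((LINT z|lborel. (\<Prod>k\<le>CARD('n). ratio A R (z :: real^'n idx) k)) - (LINT z|lborel. (\<Prod>k\<le>CARD('n). model R (z :: real^'n idx) k)))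
      / R ^ (CARD('n) - 1)) \<longlongrightarrow> 0) at_top"
proof -
  obtain c where c: "c > 0" "c \<le> 1" "\<And>i k. i \<le> CARD('n) \<Longrightarrow> k \<le> CARD('n) \<Longrightarrow> A i k > 0 \<Longrightarrow> A i k \<ge> c"
    using positive_entries_bounded_below[of "CARD('n)" A] by blast
  obtain B where B: "B \<ge> 1" "\<And>i k. i \<le> CARD('n) \<Longrightarrow> k \<le> CARD('n) \<Longrightarrow> \<bar>A i k\<bar> \<le> B \<and> \<bar>1 - A i k\<bar> \<le> B"
    using entries_bounded[of "CARD('n)" A] by blast
  define C where "C = real (CARD('n) + 1) * (B / c) + 2"
  have C: "C \<ge> 0" using B c by (simp add: C_def)
  have lim: "((\<lambda>R. (LINT z|lborel. (\<Prod>k\<le>CARD('n). ratio A R (z :: real^'n idx) k) - (\<Prod>k\<le>CARD('n). model R z k)) / R ^ (CARD('n) - 1)) \<longlongrightarrow> 0) at_top"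
  proof (rule gap_error_integral_small[OF D, where C = "(1 / c) ^ (CARD('n) + 1) * (real (CARD('n) + 1) * C)"])
    show "(\<lambda>z :: real^'n idx. (\<Prod>k\<le>CARD('n). ratio A R z k) - (\<Prod>k\<le>CARD('n). model R z k)) \<in> borel_measurable borel" for R by measurable
    fix R :: real and z :: "real^'n idx" assume R: "R \<ge> 1"
    define V where "V = (\<lambda>k. (1 / c) * envelope D R z k)"
    define m where "m = min 1 (gap_error D R z)"
    have V: "V k > 0" for k using c by (simp add: V_def envelope_pos)
    have PV: "(\<Prod>k\<le>CARD('n). V k) = (1 / c) ^ (CARD('n) + 1) * (\<Prod>k\<le>CARD('n). envelope D R z k)"
      unfolding V_def by (simp only: prod.distrib prod_constant card_atMost Suc_eq_plus1)
    have PV0: "(\<Prod>k\<le>CARD('n). V k) > 0" using V by (intro prod_pos) auto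
    have b: "norm (ratio A R z k / V k) \<le> 1" "norm (model R z k / V k) \<le> 1"
      "norm (ratio A R z k / V k - model R z k / V k) \<le> C * m" if "k \<le> CARD('n)" for k
    proof -
      have "ratio A R z k \<le> V k" "model R z k \<le> V k"
        using ratio_le_envelope[OF c _ that, of R z] model_le_envelope[OF c that, of R z] R by (simp_all add: V_def)
      then show "norm (ratio A R z k / V k) \<le> 1" "norm (model R z k / V k) \<le> 1"
        using ratio_pos[of R k z] model_pos[OF that, of R z] R V[of k] that by simp_all
      have "\<bar>ratio A R z k - model R z k\<bar> \<le> V k * (C * m)"
        using ratio_model_diff[OF c B _ that, of R z] R by (simp add: V_def C_def m_def)
      then show "norm (ratio A R z k / V k - model R z k / V k) \<le> C * m"
        using V[of k] by (simp add: diff_divide_distrib[symmetric] pos_divide_le_eq mult.commute)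
    qed
    have "norm ((\<Prod>k\<le>CARD('n). ratio A R z k / V k) - (\<Prod>k\<le>CARD('n). model R z k / V k))
        \<le> (\<Sum>k\<le>CARD('n). norm (ratio A R z k / V k - model R z k / V k))"
      by (rule norm_prod_diff) (use b in auto)
    also have "\<dots> \<le> (\<Sum>k\<le>CARD('n). C * m)" by (intro sum_mono b) auto
    also have "\<dots> = real (CARD('n) + 1) * C * m" by simp
    finally have "\<bar>(\<Prod>k\<le>CARD('n). ratio A R z k) - (\<Prod>k\<le>CARD('n). model R z k)\<bar> / (\<Prod>k\<le>CARD('n). V k) \<le> real (CARD('n) + 1) * C * m"
      using PV0 by (simp add: prod_dividef diff_divide_distrib[symmetric])
    then have "\<bar>(\<Prod>k\<le>CARD('n). ratio A R z k) - (\<Prod>k\<le>CARD('n). model R z k)\<bar>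
        \<le> real (CARD('n) + 1) * C * m * (\<Prod>k\<le>CARD('n). V k)"
      by (simp only: pos_divide_le_eq[OF PV0])
    then show "\<bar>(\<Prod>k\<le>CARD('n). ratio A R z k) - (\<Prod>k\<le>CARD('n). model R z k)\<bar>
        \<le> (1 / c) ^ (CARD('n) + 1) * (real (CARD('n) + 1) * C) * (\<Prod>k\<le>CARD('n). envelope D R z k) * min 1 (gap_error D R z)"
      by (simp only: PV m_def mult_ac)
  qed
  have "eventually (\<lambda>R. (LINT z|lborel. (\<Prod>k\<le>CARD('n). ratio A R (z :: real^'n idx) k) - (\<Prod>k\<le>CARD('n). model R z k)) / R ^ (CARD('n) - 1) =
     ((LINT z|lborel. (\<Prod>k\<le>CARD('n). ratio A R (z :: real^'n idx) k)) - (LINT z|lborel. (\<Prod>k\<le>CARD('n). model R (z :: real^'n idx) k))) / R ^ (CARD('n) - 1)) at_top"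
    using eventually_ge_at_top[of 1]
    by eventually_elim (simp add: Bochner_Integration.integral_diff ratio_prod_integrable model_prod_integrable)
  from Lim_transform_eventually[OF lim this] show ?thesis .
qed

lemma ratio_prod_integral_asymp_diagonal:
  assumes "D = {}"
  shows "((\<lambda>R. ((LINT z|lborel. (\<Prod>k\<le>CARD('n). ratio A R (z :: real^'n idx) k)) - (\<Prod>k\<le>CARD('n). 1 / A k k) * R ^ CARD('n) / fact CARD('n)) / R ^ (CARD('n) - 1))
    \<longlongrightarrow> (\<Prod>k\<le>CARD('n). 1 / A k k) * (\<Sum>k\<le>CARD('n). ln (A k k) - ln (next_entry k)) / fact (CARD('n) - 1)) at_top"
proof -
  define \<alpha> where "\<alpha> = (\<lambda>k. 1 / A k k)"
  define m where "m = (\<lambda>k. (ln (A k k) - ln (next_entry k)) / A k k)"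
  have "step_kernel (logistic (A k k) (next_entry k)) (\<alpha> k) (m k)" if "k \<le> CARD('n)" for k
    unfolding \<alpha>_def m_def using pos[OF order_refl that] next_entry_pos[of k] by (rule step_kernel_logistic)
  then have "((\<lambda>R. ((LINT z|lborel. (\<Prod>k\<le>CARD('n). logistic (A k k) (next_entry k) (gap R (z :: real^'n idx) k))) - (\<Prod>j\<le>CARD('n). \<alpha> j) * R ^ CARD('n) / fact CARD('n)) / R ^ (CARD('n) - 1)) \<longlongrightarrow>
            (\<Sum>i\<le>CARD('n). m i * (\<Prod>j\<in>{..CARD('n)} - {i}. \<alpha> j)) / fact (CARD('n) - 1)) at_top"
    by (rule gap_prod_integral_asymp)
       (use pos next_entry_pos in \<open>auto intro!: less_imp_le logistic_pos\<close>)
  moreover have "(\<lambda>R. (LINT z|lborel. (\<Prod>k\<le>CARD('n). logistic (A k k) (next_entry k) (gap R (z :: real^'n idx) k)))) =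
     (\<lambda>R. (LINT z|lborel. (\<Prod>k\<le>CARD('n). model R (z :: real^'n idx) k)))"
    unfolding model_def by (simp add: assms)
  moreover have "(\<Sum>i\<le>CARD('n). m i * (\<Prod>j\<in>{..CARD('n)} - {i}. \<alpha> j)) = (\<Prod>k\<le>CARD('n). \<alpha> k) * (\<Sum>k\<le>CARD('n). ln (A k k) - ln (next_entry k))"
  proof -
    have "m i * (\<Prod>j\<in>{..CARD('n)} - {i}. \<alpha> j) = (\<Prod>k\<le>CARD('n). \<alpha> k) * (ln (A i i) - ln (next_entry i))" if "i \<le> CARD('n)" for i
      using that by (subst prod.remove[of "{..CARD('n)}" i]) (auto simp: m_def \<alpha>_def)
    then show ?thesis by (simp add: sum_distrib_left)
  qed
  ultimately have M: "((\<lambda>R. ((LINT z|lborel. (\<Prod>k\<le>CARD('n). model R (z :: real^'n idx) k)) - (\<Prod>k\<le>CARD('n). \<alpha> k) * R ^ CARD('n) / fact CARD('n)) / R ^ (CARD('n) - 1))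
    \<longlongrightarrow> (\<Prod>k\<le>CARD('n). \<alpha> k) * (\<Sum>k\<le>CARD('n). ln (A k k) - ln (next_entry k)) / fact (CARD('n) - 1)) at_top"
    by (simp add: fun_eq_iff)
  show ?thesis
    using tendsto_add[OF ratio_model_integral_small M] by (simp add: add_divide_distrib[symmetric] \<alpha>_def)
qed

text \<open>With the factors regrouped by gaps, the kernel of the gap \<open>j\<close> is a bump, whose step has height 0, and
the kernel of the gap \<open>Suc j\<close> is \<open>logistic 1 1\<close>. So the leading term vanishes, and in the second
one only the mass of the bump remains.\<close>

lemma ratio_prod_integral_asymp_adjacent:
  assumes "D = {j}" and ne: "A j (Suc j) * A (Suc j) j \<noteq> A (Suc j) (Suc j) * A j j"
  shows "((\<lambda>R. (LINT z|lborel. (\<Prod>k\<le>CARD('n). ratio A R (z :: real^'n idx) k)) / R ^ (CARD('n) - 1))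
    \<longlongrightarrow> ln (A j (Suc j) * A (Suc j) j / (A (Suc j) (Suc j) * A j j)) / (A j (Suc j) * A (Suc j) j - A (Suc j) (Suc j) * A j j)
        * (\<Prod>k\<in>{..CARD('n)} - {j, Suc j}. 1 / A k k) / fact (CARD('n) - 1)) at_top"
proof -
  have jn: "j < CARD('n)" using D assms(1) by auto
  have ne': "next_entry j = A (Suc j) j" using jn by (simp add: next_entry_def)
  define \<Phi> where "\<Phi> = (\<lambda>k. if k = j then bump (A j j) (A (Suc j) j) (A (Suc j) (Suc j)) (A j (Suc j))
     else if k = Suc j then logistic 1 1 else logistic (A k k) (next_entry k))"
  define \<alpha> where "\<alpha> = (\<lambda>k. if k = j then 0 else if k = Suc j then 1 else 1 / A k k)"
  define mj where "mj = ln (A j (Suc j) * A (Suc j) j / (A (Suc j) (Suc j) * A j j)) / (A j (Suc j) * A (Suc j) j - A (Suc j) (Suc j) * A j j)"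
  define m where "m = (\<lambda>k. if k = j then mj else if k = Suc j then 0 else (ln (A k k) - ln (next_entry k)) / A k k)"
  have p: "A j j > 0" "A (Suc j) j > 0" "A (Suc j) (Suc j) > 0" "A j (Suc j) > 0"
    using pos[of j j] pos[of j "Suc j"] pos[of "Suc j" "Suc j"] pos_D[of j] jn assms(1) by auto
  have ker: "step_kernel (\<Phi> k) (\<alpha> k) (m k)" if "k \<le> CARD('n)" for k
  proof -
    consider "k = j" | "k = Suc j" | "k \<noteq> j" "k \<noteq> Suc j" by blast
    then show ?thesis
    proof cases
      case 1
      then show ?thesis using step_kernel_bump[OF p ne] by (simp add: \<Phi>_def \<alpha>_def m_def mj_def)
    next
      case 2
      then show ?thesis using step_kernel_logistic[of 1 1] by (simp add: \<Phi>_def \<alpha>_def m_def)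
    next
      case 3
      then show ?thesis using step_kernel_logistic[OF pos[OF order_refl that] next_entry_pos[of k]] by (simp add: \<Phi>_def \<alpha>_def m_def)
    qed
  qed
  have nn: "\<Phi> k y \<ge> 0" if "k \<le> CARD('n)" for k y
    using p pos[OF order_refl that] next_entry_pos[of k]
    by (auto simp: \<Phi>_def bump_def intro!: less_imp_le logistic_pos mult_pos_pos divide_pos_pos add_pos_pos)
  have "((\<lambda>R. ((LINT z|lborel. (\<Prod>k\<le>CARD('n). \<Phi> k (gap R (z :: real^'n idx) k))) - (\<Prod>j\<le>CARD('n). \<alpha> j) * R ^ CARD('n) / fact CARD('n)) / R ^ (CARD('n) - 1)) \<longlongrightarrow>
            (\<Sum>i\<le>CARD('n). m i * (\<Prod>j\<in>{..CARD('n)} - {i}. \<alpha> j)) / fact (CARD('n) - 1)) at_top"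
    by (rule gap_prod_integral_asymp[OF ker nn])
  moreover have "(\<Prod>j\<le>CARD('n). \<alpha> j) = 0" using jn by (intro prod_zero) (auto simp: \<alpha>_def intro!: bexI[of _ j])
  moreover have "(\<Sum>i\<le>CARD('n). m i * (\<Prod>j\<in>{..CARD('n)} - {i}. \<alpha> j)) = mj * (\<Prod>k\<in>{..CARD('n)} - {j, Suc j}. 1 / A k k)"
  proof -
    have "(\<Sum>i\<le>CARD('n). m i * (\<Prod>j\<in>{..CARD('n)} - {i}. \<alpha> j)) = (\<Sum>i\<in>{j}. m i * (\<Prod>j\<in>{..CARD('n)} - {i}. \<alpha> j))"
    proof (rule sum.mono_neutral_right)
      show "\<forall>i\<in>{..CARD('n)} - {j}. m i * (\<Prod>j\<in>{..CARD('n)} - {i}. \<alpha> j) = 0"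
      proof
        fix i assume "i \<in> {..CARD('n)} - {j}"
        then have "(\<Prod>j\<in>{..CARD('n)} - {i}. \<alpha> j) = 0" using jn by (intro prod_zero) (auto simp: \<alpha>_def intro!: bexI[of _ j])
        then show "m i * (\<Prod>j\<in>{..CARD('n)} - {i}. \<alpha> j) = 0" by simp
      qed
    qed (use jn in auto)
    also have "\<dots> = mj * (\<Prod>k\<in>{..CARD('n)} - {j}. \<alpha> k)" by (simp add: m_def)
    also have "(\<Prod>k\<in>{..CARD('n)} - {j}. \<alpha> k) = \<alpha> (Suc j) * (\<Prod>k\<in>{..CARD('n)} - {j} - {Suc j}. \<alpha> k)"
      using jn by (intro prod.remove) auto
    also have "{..CARD('n)} - {j} - {Suc j} = {..CARD('n)} - {j, Suc j}" by auto
    also have "\<alpha> (Suc j) * (\<Prod>k\<in>{..CARD('n)} - {j, Suc j}. \<alpha> k) = (\<Prod>k\<in>{..CARD('n)} - {j, Suc j}. 1 / A k k)"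
      by (auto simp: \<alpha>_def intro!: prod.cong)
    finally show ?thesis .
  qed
  moreover have "(\<Prod>k\<le>CARD('n). \<Phi> k (gap R (z :: real^'n idx) k)) = (\<Prod>k\<le>CARD('n). model R z k)" for R z
  proof -
    have split: "(\<Prod>k\<le>CARD('n). F k) = F j * F (Suc j) * (\<Prod>k\<in>{..CARD('n)} - {j} - {Suc j}. F k)" for F :: "nat \<Rightarrow> real"
      using jn by (simp add: prod.remove[of "{..CARD('n)}" j] prod.remove[of "{..CARD('n)} - {j}" "Suc j"])
    have "(\<Prod>k\<in>{..CARD('n)} - {j} - {Suc j}. \<Phi> k (gap R z k)) = (\<Prod>k\<in>{..CARD('n)} - {j} - {Suc j}. model R z k)"
      unfolding model_def by (intro prod.cong) (auto simp: \<Phi>_def assms(1))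
    moreover have "\<Phi> j (gap R z j) * \<Phi> (Suc j) (gap R z (Suc j)) = model R z j * model R z (Suc j)"
      unfolding model_def by (simp add: \<Phi>_def assms(1) bump_def ne')
    ultimately show ?thesis unfolding split by simp
  qed
  ultimately have M: "((\<lambda>R. (LINT z|lborel. (\<Prod>k\<le>CARD('n). model R (z :: real^'n idx) k)) / R ^ (CARD('n) - 1))
    \<longlongrightarrow> mj * (\<Prod>k\<in>{..CARD('n)} - {j, Suc j}. 1 / A k k) / fact (CARD('n) - 1)) at_top" by simp
  show ?thesis
    using tendsto_add[OF ratio_model_integral_small M] by (simp add: add_divide_distrib[symmetric] mj_def)
qed

end
end

section \<open>Normals, centers and slacks of the faces of a polytope\<close>

text \<open>A positive combination along a chain determines the chain. The functional \<open>test (e m)\<close> returns the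
sum of the coefficients on a combination along a chain with the top element \<open>e m\<close>, and on any other
combination at most the sum, with equality only if its top element is below \<open>e m\<close>. By symmetry the
sums and the top elements agree. The functional of the next element of the chain then compares the top coefficients,
and the top terms can be removed.\<close>

lemma chain_combination_unique:
  fixes vec test :: "'f \<Rightarrow> 'a::real_inner" and s t :: "nat \<Rightarrow> real"
  assumes le1: "\<And>E F. E \<in> X \<Longrightarrow> F \<in> X \<Longrightarrow> test F \<bullet> vec E \<le> 1"
    and eq1: "\<And>E F. E \<in> X \<Longrightarrow> F \<in> X \<Longrightarrow> test F \<bullet> vec E = 1 \<longleftrightarrow> le E F"
    and antisym: "\<And>E F. E \<in> X \<Longrightarrow> F \<in> X \<Longrightarrow> le E F \<Longrightarrow> le F E \<Longrightarrow> E = F"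
    and e: "\<And>i. i < m \<Longrightarrow> e i \<in> X" "\<And>i j. i \<le> j \<Longrightarrow> j < m \<Longrightarrow> le (e i) (e j)" "\<And>i j. i < j \<Longrightarrow> j < m \<Longrightarrow> \<not> le (e j) (e i)"
    and e': "\<And>i. i < m \<Longrightarrow> e' i \<in> X" "\<And>i j. i \<le> j \<Longrightarrow> j < m \<Longrightarrow> le (e' i) (e' j)" "\<And>i j. i < j \<Longrightarrow> j < m \<Longrightarrow> \<not> le (e' j) (e' i)"
    and s: "\<And>i. i < m \<Longrightarrow> s i > 0" and t: "\<And>i. i < m \<Longrightarrow> t i > 0"
    and eq: "(\<Sum>i<m. s i *\<^sub>R vec (e i)) = (\<Sum>i<m. t i *\<^sub>R vec (e' i))"
  shows "\<forall>i<m. e i = e' i"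
  using e e' s t eq
proof (induction m)
  case (Suc m)
  have top: "(\<Sum>i<Suc m. s i) \<le> (\<Sum>i<Suc m. t i) \<and> ((\<Sum>i<Suc m. s i) = (\<Sum>i<Suc m. t i) \<longrightarrow> le (e' m) (e m))"
    if e: "\<And>i. i < Suc m \<Longrightarrow> e i \<in> X" "\<And>i j. i \<le> j \<Longrightarrow> j < Suc m \<Longrightarrow> le (e i) (e j)"
      and e': "\<And>i. i < Suc m \<Longrightarrow> e' i \<in> X" and t: "\<And>i. i < Suc m \<Longrightarrow> t i > 0"
      and eq: "(\<Sum>i<Suc m. s i *\<^sub>R vec (e i)) = (\<Sum>i<Suc m. t i *\<^sub>R vec (e' i))" for e e' s t
  proof -
    have "(\<Sum>i<Suc m. s i) = (\<Sum>i<Suc m. s i * (test (e m) \<bullet> vec (e i)))"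
      using e eq1 by (intro sum.cong) auto
    also have "\<dots> = test (e m) \<bullet> (\<Sum>i<Suc m. s i *\<^sub>R vec (e i))" by (simp add: inner_sum_right inner_add_right)
    also have "\<dots> = (\<Sum>i<Suc m. t i * (test (e m) \<bullet> vec (e' i)))" unfolding eq by (simp add: inner_sum_right inner_add_right)
    finally have s_eq: "(\<Sum>i<Suc m. s i) = (\<Sum>i<Suc m. t i * (test (e m) \<bullet> vec (e' i)))" .
    have le: "t i * (test (e m) \<bullet> vec (e' i)) \<le> t i" if "i < Suc m" for i
      using le1[OF e'[OF that] e(1)[of m]] t[OF that] mult_left_mono[of "test (e m) \<bullet> vec (e' i)" 1 "t i"] by simp
    have 1: "(\<Sum>i<Suc m. s i) \<le> (\<Sum>i<Suc m. t i)" unfolding s_eq using le by (intro sum_mono) auto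
    have "le (e' m) (e m)" if "(\<Sum>i<Suc m. s i) = (\<Sum>i<Suc m. t i)"
    proof (rule ccontr)
      assume "\<not> le (e' m) (e m)"
      then have "test (e m) \<bullet> vec (e' m) < 1" using le1[of "e' m" "e m"] eq1[of "e' m" "e m"] e e' by (simp add: order_less_le)
      then have "t m * (test (e m) \<bullet> vec (e' m)) < t m" using t[of m] by simp
      then have "(\<Sum>i<Suc m. t i * (test (e m) \<bullet> vec (e' i))) < (\<Sum>i<Suc m. t i)"
        using le by (intro sum_strict_mono_ex1) (auto intro!: bexI[of _ m])
      then show False using that s_eq by simp
    qed
    then show ?thesis using 1 by blast
  qed
  have st: "(\<Sum>i<Suc m. s i) = (\<Sum>i<Suc m. t i)"
    using top[of e e' t s] top[of e' e s t] Suc.prems by (auto intro: antisym)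
  have em: "e m = e' m"
    using top[of e e' t s] top[of e' e s t] Suc.prems st by (intro antisym) auto
  have last: "t m \<le> s m"
    if e: "\<And>i. i < Suc m \<Longrightarrow> e i \<in> X" "\<And>i j. i \<le> j \<Longrightarrow> j < Suc m \<Longrightarrow> le (e i) (e j)" "\<And>i j. i < j \<Longrightarrow> j < Suc m \<Longrightarrow> \<not> le (e j) (e i)"
      and e': "\<And>i. i < Suc m \<Longrightarrow> e' i \<in> X" and t: "\<And>i. i < Suc m \<Longrightarrow> t i > 0" and st: "(\<Sum>i<Suc m. s i) = (\<Sum>i<Suc m. t i)"
      and em: "e m = e' m"
      and eq: "(\<Sum>i<Suc m. s i *\<^sub>R vec (e i)) = (\<Sum>i<Suc m. t i *\<^sub>R vec (e' i))" for e e' s t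
  proof (cases m)
    case 0
    then show ?thesis using st by simp
  next
    case (Suc l)
    define T where "T = test (e l)"
    define c where "c = T \<bullet> vec (e m)"
    have c: "c < 1" using le1[of "e m" "e l"] eq1[of "e m" "e l"] e(1)[of m] e(1)[of l] e(3)[of l m] Suc
      by (simp add: c_def T_def order_less_le)
    have "(\<Sum>i<m. s i) + s m * c = (\<Sum>i<m. s i * (T \<bullet> vec (e i))) + s m * c"
    proof -
      have "T \<bullet> vec (e i) = 1" if "i < m" for i
        using eq1[of "e i" "e l"] e(1)[of i] e(1)[of l] e(2)[of i l] that Suc by (simp add: T_def)
      then show ?thesis by simp
    qed
    also have "\<dots> = T \<bullet> (\<Sum>i<Suc m. s i *\<^sub>R vec (e i))" by (simp add: inner_sum_right inner_add_right c_def)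
    also have "\<dots> = (\<Sum>i<m. t i * (T \<bullet> vec (e' i))) + t m * c" unfolding eq by (simp add: inner_sum_right inner_add_right c_def em)
    also have "\<dots> \<le> (\<Sum>i<m. t i) + t m * c"
    proof -
      have "t i * (T \<bullet> vec (e' i)) \<le> t i" if "i < m" for i
        using le1[of "e' i" "e l"] e'[of i] e(1)[of l] t[of i] that Suc mult_left_mono[of "T \<bullet> vec (e' i)" 1 "t i"] by (simp add: T_def)
      then show ?thesis by (intro add_right_mono sum_mono) auto
    qed
    finally have "(\<Sum>i<m. s i) + s m * c \<le> (\<Sum>i<m. t i) + t m * c" .
    moreover have "(\<Sum>i<m. s i) + s m = (\<Sum>i<m. t i) + t m" using st by simp
    ultimately have "(t m - s m) * (1 - c) \<le> 0" by (simp add: algebra_simps)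
    then show ?thesis using c by (simp add: mult_le_0_iff)
  qed
  have "s m = t m"
    using last[of e e' t s] last[of e' e s t] Suc.prems st em by (intro order_antisym) auto
  then have "(\<Sum>i<m. s i *\<^sub>R vec (e i)) = (\<Sum>i<m. t i *\<^sub>R vec (e' i))" using Suc.prems em by simp
  then have "\<forall>i<m. e i = e' i" using Suc.prems by (intro Suc.IH) auto
  then show ?case using em less_Suc_eq by auto
qed simp

lemma affine_vanish_extend:
  fixes E :: "'a::euclidean_space set"
  assumes "convex E" "G face_of E" "aff_dim E = aff_dim G + 1" "q \<in> E" "q \<notin> G"
    and "\<And>y. y \<in> G \<Longrightarrow> c + \<xi> \<bullet> y = 0" "c + \<xi> \<bullet> q = 0" "y \<in> E"
  shows "c + \<xi> \<bullet> y = 0"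
proof -
  have "q \<notin> affine hull G" using face_of_imp_eq_affine_Int[OF assms(1,2)] assms(4,5) by blast
  then have "aff_dim (insert q G) = aff_dim E" using assms(3) by (simp add: aff_dim_insert)
  moreover have "insert q G \<subseteq> E" using face_of_imp_subset[OF assms(2)] assms(4) by blast
  ultimately have "affine hull (insert q G) = affine hull E"
    by (intro affine_dim_equal hull_mono) (simp_all add: aff_dim_affine_hull)
  moreover have "affine hull (insert q G) \<subseteq> {y. \<xi> \<bullet> y = - c}"
    using assms(6,7) by (intro hull_minimal affine_hyperplane) (auto simp: eq_neg_iff_add_eq_0 add.commute)
  ultimately have "y \<in> {y. \<xi> \<bullet> y = - c}" using hull_inc[OF assms(8), of affine] by blast
  then show ?thesis by simp
qed

text \<open>For a facet this is the associated vertex of the polar polytope; for a smaller face, any functional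
that exposes it will do. Zero for the empty face makes all slacks against it equal to 1.\<close>

definition face_normal :: "'a::euclidean_space set \<Rightarrow> 'a set \<Rightarrow> 'a" where
  "face_normal P E = (if E = {} then 0 else SOME b. (\<forall>y\<in>P. b \<bullet> y \<le> 1) \<and> {y \<in> P. b \<bullet> y = 1} = E)"

text \<open>The origin is the center of the whole polytope, so that the simplices spanned by \<open>0\<close> and the centers
of the proper faces of a flag cover the polytope.\<close>

definition face_center :: "'a::euclidean_space set \<Rightarrow> 'a set \<Rightarrow> 'a" where
  "face_center P E = (if E = P then 0 else SOME p. p \<in> rel_interior E)"

definition slack :: "'a::euclidean_space set \<Rightarrow> 'a set \<Rightarrow> 'a set \<Rightarrow> real" where
  "slack P E F = 1 - face_normal P F \<bullet> face_center P E"

locale origin_polytope =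
  fixes P :: "'a::euclidean_space set"
  assumes polytope: "polytope P" and origin: "0 \<in> interior P"
begin

lemma convex: "convex P" and compact: "compact P" and polyhedron: "polyhedron P"
  using polytope by (auto simp: polytope_imp_convex polytope_imp_compact polytope_imp_polyhedron)

lemma zero_in: "0 \<in> P"
  using origin interior_subset by blast

lemma aff_dim_P: "aff_dim P = int DIM('a)"
  using origin aff_dim_nonempty_interior[of P] by auto

lemma zero_functional:
  assumes "\<And>y. y \<in> P \<Longrightarrow> a \<bullet> y \<le> 0"
  shows "a = 0"
proof -
  obtain e where e: "e > 0" "ball 0 e \<subseteq> P" using origin by (auto simp: mem_interior)
  show ?thesis
  proof (rule ccontr)
    assume a: "a \<noteq> 0"
    have "(e / (2 * norm a)) *\<^sub>R a \<in> ball 0 e" using e a by simp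
    then have "a \<bullet> ((e / (2 * norm a)) *\<^sub>R a) \<le> 0" using e assms by blast
    moreover have "a \<bullet> a > 0" using a by simp
    ultimately show False using e a by (simp add: mult_le_0_iff divide_le_0_iff)
  qed
qed

lemma face_normal:
  assumes "E face_of P" "E \<noteq> P"
  shows "\<And>y. y \<in> P \<Longrightarrow> face_normal P E \<bullet> y \<le> 1" and "{y \<in> P. face_normal P E \<bullet> y = 1} = E"
proof -
  have "(\<forall>y\<in>P. face_normal P E \<bullet> y \<le> 1) \<and> {y \<in> P. face_normal P E \<bullet> y = 1} = E"
  proof (cases "E = {}")
    case True
    then show ?thesis by (simp add: face_normal_def)
  next
    case False
    have "E exposed_face_of P" using assms exposed_face_of_polyhedron[OF polyhedron] by blast
    then obtain a b where ab: "P \<subseteq> {x. a \<bullet> x \<le> b}" "E = P \<inter> {x. a \<bullet> x = b}" unfolding exposed_face_of_def by blast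
    have "b \<ge> 0" using ab(1) zero_in by auto
    moreover have "b \<noteq> 0"
    proof
      assume "b = 0"
      then have "a = 0" using ab(1) by (intro zero_functional) auto
      then show False using ab assms \<open>b = 0\<close> by auto
    qed
    ultimately have b: "b > 0" by simp
    have "\<exists>b. (\<forall>y\<in>P. b \<bullet> y \<le> 1) \<and> {y \<in> P. b \<bullet> y = 1} = E"
    proof (intro exI[of _ "a /\<^sub>R b"] conjI ballI)
      fix y assume "y \<in> P" then show "(a /\<^sub>R b) \<bullet> y \<le> 1" using ab(1) b by (auto simp: field_simps)
    next
      show "{y \<in> P. (a /\<^sub>R b) \<bullet> y = 1} = E" using ab(2) b by (auto simp: field_simps)
    qed
    from someI_ex[OF this] False show ?thesis by (simp add: face_normal_def)
  qed
  then show "\<And>y. y \<in> P \<Longrightarrow> face_normal P E \<bullet> y \<le> 1" and "{y \<in> P. face_normal P E \<bullet> y = 1} = E" by blast+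
qed

lemma face_center_rel_interior:
  assumes "E face_of P" "E \<noteq> {}"
  shows "face_center P E \<in> rel_interior E"
proof (cases "E = P")
  case True
  then show ?thesis using origin interior_subset_rel_interior by (auto simp: face_center_def)
next
  case False
  have "rel_interior E \<noteq> {}" using assms rel_interior_eq_empty face_of_imp_convex by blast
  then show ?thesis using False by (auto simp: face_center_def intro: someI)
qed

lemma face_center_in: "E face_of P \<Longrightarrow> E \<noteq> {} \<Longrightarrow> face_center P E \<in> E"
  using face_center_rel_interior rel_interior_subset by blast

lemma slack_nonneg:
  assumes "E face_of P" "E \<noteq> {}" "F face_of P" "F \<noteq> P"
  shows "slack P E F \<ge> 0"
  using face_normal(1)[OF assms(3,4), of "face_center P E"] face_center_in[OF assms(1,2)] face_of_imp_subset[OF assms(1)]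
  by (auto simp: slack_def)

lemma slack_eq_0_iff:
  assumes "E face_of P" "E \<noteq> {}" "F face_of P" "F \<noteq> P"
  shows "slack P E F = 0 \<longleftrightarrow> E \<subseteq> F"
proof -
  have p: "face_center P E \<in> E" "face_center P E \<in> P" using face_center_in[OF assms(1,2)] face_of_imp_subset[OF assms(1)] by auto
  have "slack P E F = 0 \<longleftrightarrow> face_center P E \<in> F"
    using face_normal(2)[OF assms(3,4)] p by (auto simp: slack_def)
  also have "\<dots> \<longleftrightarrow> E \<subseteq> F"
    using p face_center_rel_interior[OF assms(1,2)] subset_of_face_of[OF assms(3), of E] face_of_imp_subset[OF assms(1)] by auto
  finally show ?thesis .
qed

lemma slack_pos:
  assumes "E face_of P" "E \<noteq> {}" "F face_of P" "F \<noteq> P" "\<not> E \<subseteq> F"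
  shows "slack P E F > 0"
  using slack_nonneg[OF assms(1-4)] slack_eq_0_iff[OF assms(1-4)] assms(5) by linarith

lemma slack_P: "slack P P F = 1"
  by (simp add: slack_def face_center_def)

lemma face_normal_empty: "face_normal P {} = 0"
  by (simp add: face_normal_def)

lemma slack_empty: "slack P E {} = 1"
  by (simp add: slack_def face_normal_empty)

lemma face_of_full_dim: "E face_of P \<Longrightarrow> aff_dim E = int DIM('a) \<Longrightarrow> E = P"
  using face_of_aff_dim_lt[OF convex, of E] aff_dim_P by fastforce

lemma subset_face_of_face: "G face_of P \<Longrightarrow> E face_of P \<Longrightarrow> G \<subseteq> E \<Longrightarrow> G face_of E"
  using face_of_face[of E P G] by blast

lemma face_subset_aff_dim_less:
  assumes "G face_of P" "E face_of P" "G \<subseteq> E" "G \<noteq> E"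
  shows "aff_dim G < aff_dim E"
  by (rule face_of_aff_dim_lt[OF face_of_imp_convex[OF assms(2)] subset_face_of_face[OF assms(1-3)] assms(4)])

lemma face_subset_aff_dim_eq:
  assumes "G face_of P" "E face_of P" "G \<subseteq> E" "aff_dim G = aff_dim E"
  shows "G = E"
  using face_subset_aff_dim_less[OF assms(1-3)] assms(4) by auto

text \<open>On a face \<open>E\<close> that is two dimensions above \<open>G\<close>, the affine functions vanishing on \<open>G\<close> form a plane, and those
of \<open>E1\<close> and \<open>E2\<close> are a basis. The coefficients are read off at the centers of \<open>E1\<close> and \<open>E2\<close>.\<close>

lemma slack_combination:
  assumes F: "G face_of P" "E1 face_of P" "E2 face_of P" "E face_of P" "F face_of P" "F \<noteq> P"
    and sub: "G \<subseteq> E1" "G \<subseteq> E2" "E1 \<subseteq> E" "E2 \<subseteq> E" "G \<subseteq> F" "E1 \<noteq> E2"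
    and dim: "aff_dim E1 = aff_dim G + 1" "aff_dim E2 = aff_dim G + 1" "aff_dim E = aff_dim G + 2"
    and y: "y \<in> E"
  shows "1 - face_normal P F \<bullet> y =
    slack P E2 F / slack P E2 E1 * (1 - face_normal P E1 \<bullet> y) + slack P E1 F / slack P E1 E2 * (1 - face_normal P E2 \<bullet> y)"
proof -
  have ne: "E1 \<noteq> {}" "E2 \<noteq> {}" using dim aff_dim_geq[of G] by auto
  have nP: "E1 \<noteq> P" "E2 \<noteq> P" using dim aff_dim_P aff_dim_le_DIM[of E] by auto
  have n12: "\<not> E1 \<subseteq> E2" "\<not> E2 \<subseteq> E1"
    using face_subset_aff_dim_eq[of E1 E2] face_subset_aff_dim_eq[of E2 E1] F sub dim by auto
  have p: "slack P E1 E2 > 0" "slack P E2 E1 > 0"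
    using slack_pos F ne nP n12 by auto
  have z: "slack P E1 E1 = 0" "slack P E2 E2 = 0" using slack_eq_0_iff F ne nP by auto
  define \<mu> where "\<mu> = slack P E2 F / slack P E2 E1"
  define \<nu> where "\<nu> = slack P E1 F / slack P E1 E2"
  define c where "c = 1 - \<mu> - \<nu>"
  define \<xi> where "\<xi> = \<mu> *\<^sub>R face_normal P E1 + \<nu> *\<^sub>R face_normal P E2 - face_normal P F"
  have val: "c + \<xi> \<bullet> x = (1 - face_normal P F \<bullet> x) - \<mu> * (1 - face_normal P E1 \<bullet> x) - \<nu> * (1 - face_normal P E2 \<bullet> x)" for x
    by (simp add: c_def \<xi>_def inner_add_left inner_diff_left algebra_simps)
  have v1: "face_normal P E1 \<bullet> x = 1" if "x \<in> E1" for x using face_normal(2)[OF F(2) nP(1)] that by blast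
  have v2: "face_normal P E2 \<bullet> x = 1" if "x \<in> E2" for x using face_normal(2)[OF F(3) nP(2)] that by blast
  have v: "face_normal P F \<bullet> x = 1" if "x \<in> F" for x using face_normal(2)[OF F(5,6)] that by blast
  have G0: "c + \<xi> \<bullet> x = 0" if "x \<in> G" for x
  proof -
    have "face_normal P E1 \<bullet> x = 1" "face_normal P E2 \<bullet> x = 1" "face_normal P F \<bullet> x = 1"
      using v1 v2 v that sub by blast+
    then show ?thesis unfolding val by simp
  qed
  have c1: "face_center P E1 \<in> E1" "face_center P E1 \<notin> G"
    using face_center_in[OF F(2) ne(1)] slack_pos[OF F(2) ne(1) F(3) nP(2) n12(1)] v2 sub(2) unfolding slack_def by fastforce+
  have E1: "c + \<xi> \<bullet> x = 0" if "x \<in> E1" for x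
  proof (rule affine_vanish_extend[OF _ _ dim(1) c1 G0 _ that])
    show "convex E1" "G face_of E1" using F sub by (blast intro: face_of_imp_convex subset_face_of_face)+
    show "c + \<xi> \<bullet> face_center P E1 = 0"
      unfolding val slack_def[symmetric] using p z by (simp add: \<nu>_def)
  qed
  have c2: "face_center P E2 \<in> E2" "face_center P E2 \<notin> E1"
    using face_center_in[OF F(3) ne(2)] slack_pos[OF F(3) ne(2) F(2) nP(1) n12(2)] v1 unfolding slack_def by fastforce+
  have "c + \<xi> \<bullet> y = 0"
  proof (rule affine_vanish_extend[OF _ _ _ _ c2(2) E1 _ y])
    show "convex E" "E1 face_of E" using F sub by (blast intro: face_of_imp_convex subset_face_of_face)+
    show "aff_dim E = aff_dim E1 + 1" using dim by simp
    show "face_center P E2 \<in> E" using c2 sub by blast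
    show "c + \<xi> \<bullet> face_center P E2 = 0"
      unfolding val slack_def[symmetric] using p z by (simp add: \<mu>_def)
  qed
  then show ?thesis unfolding val \<mu>_def \<nu>_def by simp
qed

text \<open>Affine functions on \<open>E\<close> that vanish on a facet of \<open>E\<close> are multiples of each other.\<close>

lemma slack_proportional:
  assumes F: "G face_of P" "E face_of P" "F face_of P" "G \<noteq> P" "F \<noteq> P"
    and sub: "G \<subseteq> E" "G \<subseteq> F" and dim: "aff_dim E = aff_dim G + 1"
    and y: "y \<in> E"
  shows "(1 - face_normal P F \<bullet> y) * slack P E G = slack P E F * (1 - face_normal P G \<bullet> y)"
proof -
  have ne: "E \<noteq> {}" using dim aff_dim_geq[of G] by auto
  have nEG: "\<not> E \<subseteq> G" using sub dim by auto
  have p: "slack P E G > 0" using slack_pos[OF F(2) ne F(1,4) nEG] .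
  define c where "c = slack P E G - slack P E F"
  define \<xi> where "\<xi> = slack P E F *\<^sub>R face_normal P G - slack P E G *\<^sub>R face_normal P F"
  have val: "c + \<xi> \<bullet> x = (1 - face_normal P F \<bullet> x) * slack P E G - slack P E F * (1 - face_normal P G \<bullet> x)" for x
    by (simp add: c_def \<xi>_def inner_diff_left algebra_simps)
  have v1: "face_normal P G \<bullet> x = 1" if "x \<in> G" for x using face_normal(2)[OF F(1,4)] that by blast
  have v: "face_normal P F \<bullet> x = 1" if "x \<in> F" for x using face_normal(2)[OF F(3,5)] that by blast
  have "c + \<xi> \<bullet> y = 0"
  proof (rule affine_vanish_extend[OF _ _ dim _ _ _ _ y])
    show "convex E" "G face_of E" using F sub by (blast intro: face_of_imp_convex subset_face_of_face)+
    show "face_center P E \<in> E" by (rule face_center_in[OF F(2) ne])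
    show "face_center P E \<notin> G" using p v1 unfolding slack_def by fastforce
    show "c + \<xi> \<bullet> x = 0" if "x \<in> G" for x
    proof -
      have "face_normal P F \<bullet> x = 1" using v that sub by blast
      then show ?thesis unfolding val using v1[OF that] by simp
    qed
    show "c + \<xi> \<bullet> face_center P E = 0" unfolding val slack_def by simp
  qed
  then show ?thesis unfolding val by simp
qed

text \<open>At the center of a third face \<open>E3\<close>, the slack against \<open>E3\<close> itself would by \<open>slack_combination\<close> be a
sum of positive numbers.\<close>

lemma diamond_unique:
  assumes F: "G face_of P" "E1 face_of P" "E2 face_of P" "E3 face_of P" "E face_of P"
    and sub: "G \<subseteq> E1" "G \<subseteq> E2" "G \<subseteq> E3" "E1 \<subseteq> E" "E2 \<subseteq> E" "E3 \<subseteq> E"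
    and dim: "aff_dim E1 = aff_dim G + 1" "aff_dim E2 = aff_dim G + 1" "aff_dim E3 = aff_dim G + 1" "aff_dim E = aff_dim G + 2"
    and ne: "E1 \<noteq> E2" "E1 \<noteq> E3"
  shows "E2 = E3"
proof (rule ccontr)
  assume n23: "E2 \<noteq> E3"
  have ne': "E1 \<noteq> {}" "E2 \<noteq> {}" "E3 \<noteq> {}" using dim aff_dim_geq[of G] by auto
  have nP: "E1 \<noteq> P" "E2 \<noteq> P" "E3 \<noteq> P" using dim aff_dim_P aff_dim_le_DIM[of E] by auto
  have n: "\<not> E1 \<subseteq> E3" "\<not> E2 \<subseteq> E3" "\<not> E3 \<subseteq> E1" "\<not> E3 \<subseteq> E2" "\<not> E1 \<subseteq> E2" "\<not> E2 \<subseteq> E1"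
    using face_subset_aff_dim_eq F dim ne n23 by metis+
  have "face_center P E3 \<in> E" using face_center_in[OF F(4) ne'(3)] sub by blast
  from slack_combination[OF F(1,2,3,5,4) nP(3) sub(1,2,4,5,3) ne(1) dim(1,2,4) this]
  have "slack P E3 E3 = slack P E2 E3 / slack P E2 E1 * slack P E3 E1 + slack P E1 E3 / slack P E1 E2 * slack P E3 E2"
    by (simp add: slack_def)
  moreover have "slack P E3 E3 = 0" using slack_eq_0_iff F ne' nP by auto
  moreover have "slack P E2 E3 / slack P E2 E1 * slack P E3 E1 > 0" "slack P E1 E3 / slack P E1 E2 * slack P E3 E2 > 0"
    using slack_pos F ne' nP n by (auto intro!: mult_pos_pos divide_pos_pos)
  ultimately show False by linarith
qed

text \<open>A nonempty proper face of \<open>E\<close> is the intersection of the facets of \<open>E\<close> that contain it, so one facet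
is not enough. If \<open>G\<close> is empty, then \<open>E\<close> is a segment and cannot have a single vertex.\<close>

lemma diamond_exists:
  assumes F: "G face_of P" "E1 face_of P" "E face_of P"
    and sub: "G \<subseteq> E1" "E1 \<subseteq> E"
    and dim: "aff_dim E1 = aff_dim G + 1" "aff_dim E = aff_dim G + 2"
  shows "\<exists>E2. E2 face_of P \<and> G \<subseteq> E2 \<and> E2 \<subseteq> E \<and> aff_dim E2 = aff_dim G + 1 \<and> E2 \<noteq> E1"
proof (rule ccontr)
  assume no: "\<not> ?thesis"
  have pE: "polytope E" using face_of_polytope_polytope[OF polytope F(3)] .
  have GE: "G face_of E" by (rule subset_face_of_face[OF F(1,3) order_trans[OF sub]])
  show False
  proof (cases "G = {}")
    case False
    have "\<And>F. F facet_of E \<Longrightarrow> G \<subseteq> F \<Longrightarrow> F = E1"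
    proof -
      fix F assume F': "F facet_of E" "G \<subseteq> F"
      then have "F face_of P" "F \<subseteq> E" "aff_dim F = aff_dim G + 1" "G \<subseteq> F"
        using face_of_trans[OF facet_of_imp_face_of[OF F'(1)] F(3)] facet_of_imp_subset[OF F'(1)] dim by (auto simp: facet_of_def)
      then show "F = E1" using no by blast
    qed
    moreover have "G \<noteq> E" using dim by auto
    ultimately have "E1 \<subseteq> G"
      using face_of_polyhedron[OF polytope_imp_polyhedron[OF pE] GE False] by blast
    then have "E1 = G" using sub by auto
    then show False using dim by simp
  next
    case True
    then have d: "aff_dim E1 = 0" "aff_dim E = 1" using dim by auto
    obtain a where a: "E1 = {a}" using d aff_dim_eq_0 by blast
    have "v = a" if "v extreme_point_of E" for v
    proof -
      have "{v} face_of P" using that F face_of_singleton face_of_trans by blast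
      moreover have "v \<in> E" using that by (simp add: extreme_point_of_def)
      ultimately have "{v} = E1" using no True by auto
      then show ?thesis using a by simp
    qed
    then have "{v. v extreme_point_of E} \<subseteq> {a}" by blast
    moreover have "E = convex hull {v. v extreme_point_of E}"
      using Krein_Milman_Minkowski polytope_imp_compact[OF pE] polytope_imp_convex[OF pE] by blast
    ultimately have "E \<subseteq> {a}" by (metis convex_hull_singleton hull_mono)
    then have "aff_dim E \<le> 0" using aff_dim_subset[of E "{a}"] by simp
    then show False using d by simp
  qed
qed

lemma face_between:
  assumes "G face_of P" "E' face_of P" "G \<subseteq> E'" "G \<noteq> E'"
  shows "\<exists>E. E face_of P \<and> G \<subseteq> E \<and> E \<subseteq> E' \<and> aff_dim E = aff_dim G + 1"
  using assms
proof (induction "nat (aff_dim E' - aff_dim G)" arbitrary: E' rule: less_induct)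
  case less
  have lt: "aff_dim G < aff_dim E'" using face_subset_aff_dim_less less.prems by blast
  show ?case
  proof (cases "aff_dim E' = aff_dim G + 1")
    case True
    then show ?thesis using less.prems by blast
  next
    case False
    have pE: "polytope E'" using face_of_polytope_polytope[OF polytope less.prems(2)] .
    have "\<exists>F. F facet_of E' \<and> G \<subseteq> F"
    proof (cases "G = {}")
      case True
      then have "aff_dim E' > 0" using False lt by simp
      then show ?thesis using polytope_facet_exists[OF pE] True by blast
    next
      case False
      have "G face_of E'" by (rule subset_face_of_face[OF less.prems(1-3)])
      then show ?thesis using face_of_polyhedron_subset_facet[OF polytope_imp_polyhedron[OF pE]] False less.prems by metis
    qed
    then obtain F where F: "F facet_of E'" "G \<subseteq> F" by blast
    then have FP: "F face_of P" "F \<subseteq> E'" "aff_dim F = aff_dim E' - 1"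
      using face_of_trans[OF facet_of_imp_face_of[OF F(1)] less.prems(2)] facet_of_imp_subset[OF F(1)] by (auto simp: facet_of_def)
    have "G \<noteq> F" using FP False by auto
    then obtain E where "E face_of P" "G \<subseteq> E" "E \<subseteq> F" "aff_dim E = aff_dim G + 1"
      using less.hyps[of F] FP F less.prems lt by auto
    then show ?thesis using FP by blast
  qed
qed

end

section \<open>Cones over flags cover the space and its dual\<close>

context origin_polytope
begin

text \<open>The ray from the center of \<open>E\<close> through \<open>x\<close> leaves \<open>E\<close> through a facet, to which the induction
hypothesis applies.\<close>

lemma primal_cover:
  "E face_of P \<Longrightarrow> aff_dim E = int d \<Longrightarrow> x \<in> E \<Longrightarrow>
   \<exists>F s. (\<forall>i\<le>d. F i face_of P \<and> aff_dim (F i) = int i) \<and> (\<forall>i<d. F i \<subseteq> F (Suc i)) \<and> F d = E \<and>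
     (\<forall>i\<le>d. s i \<ge> 0) \<and> (\<Sum>i\<le>d. s i) = (1::real) \<and> x = (\<Sum>i\<le>d. s i *\<^sub>R face_center P (F i))"
proof (induction d arbitrary: E x)
  case 0
  then obtain a where a: "E = {a}" using aff_dim_eq_0[of E] by auto
  have "face_center P E = a" using face_center_in[OF 0(1)] a by auto
  then show ?case using 0 a by (intro exI[of _ "\<lambda>_. E"] exI[of _ "\<lambda>_. 1"]) auto
next
  case (Suc d)
  have pE: "polytope E" using face_of_polytope_polytope[OF polytope Suc.prems(1)] .
  have ne: "E \<noteq> {}" using Suc.prems by auto
  define p where "p = face_center P E"
  have p: "p \<in> rel_interior E" unfolding p_def by (rule face_center_rel_interior[OF Suc.prems(1) ne])
  have "\<exists>G y t. G facet_of E \<and> y \<in> G \<and> 0 \<le> t \<and> t \<le> 1 \<and> x = (1 - t) *\<^sub>R y + t *\<^sub>R p"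
  proof (cases "x = p")
    case True
    obtain G where "G facet_of E" using polytope_facet_exists[OF pE] Suc.prems by auto
    moreover then obtain y where "y \<in> G" by (auto simp: facet_of_def)
    ultimately show ?thesis using True by (intro exI[of _ G] exI[of _ y] exI[of _ 1]) auto
  next
    case False
    have aff: "p + (x - p) \<in> affine hull E" using Suc.prems(3) by (simp add: hull_inc)
    obtain r where r: "0 < r" "p + r *\<^sub>R (x - p) \<in> rel_frontier E"
      using ray_to_rel_frontier[OF polytope_imp_bounded[OF pE] p aff] False by auto
    define y where "y = p + r *\<^sub>R (x - p)"
    have "r \<ge> 1"
    proof (rule ccontr)
      assume "\<not> r \<ge> 1"
      then have "x - (1 - r) *\<^sub>R (x - p) \<in> rel_interior E"
        using r by (intro rel_interior_convex_shrink polytope_imp_convex pE p Suc.prems) auto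
      moreover have "x - (1 - r) *\<^sub>R (x - p) = p + r *\<^sub>R (x - p)" by (simp add: algebra_simps)
      ultimately show False using r(2) by (simp add: rel_frontier_def)
    qed
    obtain G where "G facet_of E" "y \<in> G"
      using r(2) rel_frontier_of_polyhedron[OF polytope_imp_polyhedron[OF pE]] by (auto simp: y_def)
    moreover have "x = (1 - (1 - 1 / r)) *\<^sub>R y + (1 - 1 / r) *\<^sub>R p"
      using r(1) by (simp add: y_def algebra_simps)
    ultimately show ?thesis using \<open>r \<ge> 1\<close> by (intro exI[of _ G] exI[of _ y] exI[of _ "1 - 1 / r"]) auto
  qed
  then obtain G y t where G: "G facet_of E" "y \<in> G" "0 \<le> t" "t \<le> 1" "x = (1 - t) *\<^sub>R y + t *\<^sub>R p" by blast
  have GP: "G face_of P" "G \<subseteq> E" "aff_dim G = int d"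
    using face_of_trans[OF facet_of_imp_face_of[OF G(1)] Suc.prems(1)] facet_of_imp_subset[OF G(1)] G(1) Suc.prems(2)
    by (auto simp: facet_of_def)
  obtain F s where Fs: "\<forall>i\<le>d. F i face_of P \<and> aff_dim (F i) = int i" "\<forall>i<d. F i \<subseteq> F (Suc i)" "F d = G"
     "\<forall>i\<le>d. s i \<ge> 0" "(\<Sum>i\<le>d. s i) = (1::real)" "y = (\<Sum>i\<le>d. s i *\<^sub>R face_center P (F i))"
    using Suc.IH[OF GP(1,3) G(2)] by blast
  define F' where "F' = F(Suc d := E)"
  define s' where "s' = (\<lambda>i. if i = Suc d then t else (1 - t) * s i)"
  have eq: "F' i = F i" "s' i = (1 - t) * s i" if "i \<le> d" for i using that by (auto simp: F'_def s'_def)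
  have eq': "F' (Suc d) = E" "s' (Suc d) = t" by (auto simp: F'_def s'_def)
  have "(\<Sum>i\<le>Suc d. s' i) = (1 - t) * (\<Sum>i\<le>d. s i) + t"
    by (simp add: eq' eq sum_distrib_left)
  moreover have "(\<Sum>i\<le>Suc d. s' i *\<^sub>R face_center P (F' i)) = x"
    unfolding G(5) Fs(6) by (simp add: eq' eq scaleR_sum_right p_def)
  moreover have "F' i face_of P \<and> aff_dim (F' i) = int i" if "i \<le> Suc d" for i
    using that Fs(1) Suc.prems eq' eq by (cases "i = Suc d") auto
  moreover have "F' i \<subseteq> F' (Suc i)" if "i < Suc d" for i
    using that Fs(2,3) GP eq' eq by (cases "i = d") auto
  moreover have "s' i \<ge> 0" if "i \<le> Suc d" for i
    using that Fs(4) G eq' eq by (cases "i = Suc d") auto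
  ultimately show ?case using Fs(5) eq' by (intro exI[of _ F'] exI[of _ s']) auto
qed

lemma convex_hull_extreme: "P = convex hull {v. v extreme_point_of P}"
  by (rule Krein_Milman_Minkowski[OF compact convex])

lemma extreme_points_le:
  assumes "\<And>v. v extreme_point_of P \<Longrightarrow> a \<bullet> v \<le> b" "y \<in> P"
  shows "a \<bullet> y \<le> b"
proof -
  have "convex hull {v. v extreme_point_of P} \<subseteq> {x. a \<bullet> x \<le> b}"
    using assms(1) by (intro hull_minimal convex_halfspace_le) auto
  then show ?thesis using assms(2) convex_hull_extreme by blast
qed

lemma supporting_face:
  assumes "\<And>y. y \<in> P \<Longrightarrow> a \<bullet> y \<le> b"
  shows "{y \<in> P. a \<bullet> y = b} face_of P"
  using face_of_Int_supporting_hyperplane_le[OF convex assms] by (simp add: Collect_conj_eq)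

text \<open>Subtract from \<open>\<xi>\<close> the largest multiple of the normal of \<open>E\<close> for which \<open>E\<close> still consists of maximisers. At this multiple
a vertex outside of \<open>E\<close> becomes a maximiser as well.\<close>

lemma dual_step:
  assumes E: "E face_of P" "E \<noteq> P" "E \<noteq> {}"
    and le: "\<And>y. y \<in> P \<Longrightarrow> \<xi> \<bullet> y \<le> \<sigma>" and eq: "\<And>y. y \<in> E \<Longrightarrow> \<xi> \<bullet> y = \<sigma>"
  shows "\<exists>t E1. t \<ge> 0 \<and> E1 face_of P \<and> E \<subseteq> E1 \<and> aff_dim E1 = aff_dim E + 1 \<and>
    (\<forall>y\<in>P. (\<xi> - t *\<^sub>R face_normal P E) \<bullet> y \<le> \<sigma> - t) \<and> (\<forall>y\<in>E1. (\<xi> - t *\<^sub>R face_normal P E) \<bullet> y = \<sigma> - t)"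
proof -
  define b where "b = face_normal P E"
  have b: "\<And>y. y \<in> P \<Longrightarrow> b \<bullet> y \<le> 1" "{y \<in> P. b \<bullet> y = 1} = E" using face_normal[OF E(1,2)] by (auto simp: b_def)
  define V where "V = {v. v extreme_point_of P} - E"
  have fin: "finite V" unfolding V_def using finite_polyhedron_extreme_points[OF polyhedron] by simp
  have Vne: "V \<noteq> {}"
  proof
    assume "V = {}"
    then have "convex hull {v. v extreme_point_of P} \<subseteq> E"
      using face_of_imp_convex[OF E(1)] by (intro hull_minimal) (auto simp: V_def)
    then show False using convex_hull_extreme E face_of_imp_subset by blast
  qed
  have VP: "v \<in> P" "1 - b \<bullet> v > 0" if "v \<in> V" for v
  proof -
    show "v \<in> P" using that by (auto simp: V_def extreme_point_of_def)
    then show "1 - b \<bullet> v > 0" using b(1)[of v] b(2) that by (force simp: V_def)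
  qed
  define t where "t = Min ((\<lambda>v. (\<sigma> - \<xi> \<bullet> v) / (1 - b \<bullet> v)) ` V)"
  have "t \<in> (\<lambda>v. (\<sigma> - \<xi> \<bullet> v) / (1 - b \<bullet> v)) ` V" unfolding t_def using fin Vne by (intro Min_in) auto
  then obtain v0 where v0: "v0 \<in> V" "t = (\<sigma> - \<xi> \<bullet> v0) / (1 - b \<bullet> v0)" by blast
  have t0: "t \<ge> 0" using v0 VP[OF v0(1)] le[of v0] by simp
  have tV: "t * (1 - b \<bullet> v) \<le> \<sigma> - \<xi> \<bullet> v" if "v \<in> V" for v
  proof -
    have "t \<le> (\<sigma> - \<xi> \<bullet> v) / (1 - b \<bullet> v)" unfolding t_def using fin that by (intro Min_le) auto
    then show ?thesis using VP[OF that] by (simp add: pos_le_divide_eq)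
  qed
  have le': "(\<xi> - t *\<^sub>R b) \<bullet> y \<le> \<sigma> - t" if "y \<in> P" for y
  proof (rule extreme_points_le[OF _ that])
    fix v assume v: "v extreme_point_of P"
    show "(\<xi> - t *\<^sub>R b) \<bullet> v \<le> \<sigma> - t"
    proof (cases "v \<in> E")
      case True
      then have "b \<bullet> v = 1" using b(2) by blast
      then show ?thesis using eq[OF True] by (simp add: inner_diff_left)
    next
      case False
      then have "v \<in> V" using v by (simp add: V_def)
      from tV[OF this] show ?thesis by (simp add: inner_diff_left algebra_simps)
    qed
  qed
  define E' where "E' = {y \<in> P. (\<xi> - t *\<^sub>R b) \<bullet> y = \<sigma> - t}"
  have E': "E' face_of P" unfolding E'_def by (rule supporting_face[OF le'])
  have sub: "E \<subseteq> E'"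
  proof
    fix y assume y: "y \<in> E"
    then have "b \<bullet> y = 1" "y \<in> P" using b(2) by blast+
    then show "y \<in> E'" using eq[OF y] by (simp add: E'_def inner_diff_left)
  qed
  have "v0 \<in> E'" using v0 VP[OF v0(1)] by (simp add: E'_def inner_diff_left field_simps)
  moreover have "v0 \<notin> E" using v0 by (simp add: V_def)
  ultimately have "E \<noteq> E'" by blast
  then obtain E1 where "E1 face_of P" "E \<subseteq> E1" "E1 \<subseteq> E'" "aff_dim E1 = aff_dim E + 1"
    using face_between[OF E(1) E' sub] by blast
  then show ?thesis using t0 le' by (intro exI[of _ t] exI[of _ E1]) (auto simp: E'_def b_def)
qed

lemma dual_cover:
  assumes "Suc d + k = DIM('a)" "E face_of P" "aff_dim E = int d"
    "\<And>y. y \<in> P \<Longrightarrow> \<xi> \<bullet> y \<le> \<sigma>" "\<And>y. y \<in> E \<Longrightarrow> \<xi> \<bullet> y = \<sigma>"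
  shows "\<exists>F t. (\<forall>i. d \<le> i \<and> i \<le> DIM('a) \<longrightarrow> F i face_of P \<and> aff_dim (F i) = int i) \<and>
     (\<forall>i. d \<le> i \<and> i < DIM('a) \<longrightarrow> F i \<subseteq> F (Suc i)) \<and> F d = E \<and>
     (\<forall>i. d \<le> i \<and> i < DIM('a) \<longrightarrow> t i \<ge> (0::real)) \<and> \<xi> = (\<Sum>i\<in>{d..<DIM('a)}. t i *\<^sub>R face_normal P (F i))"
  using assms
proof (induction k arbitrary: d E \<xi> \<sigma>)
  case (0 d E \<xi> \<sigma>)
  have "E \<noteq> P" "E \<noteq> {}" using 0 aff_dim_P by auto
  from dual_step[OF 0(2) this 0(4,5)] obtain t E1 where t: "t \<ge> 0" "E1 face_of P" "aff_dim E1 = aff_dim E + 1"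
    "\<forall>y\<in>E1. (\<xi> - t *\<^sub>R face_normal P E) \<bullet> y = \<sigma> - t" by blast
  have "E1 = P" using t 0 by (intro face_of_full_dim) auto
  then have v: "(\<xi> - t *\<^sub>R face_normal P E) \<bullet> y = \<sigma> - t" if "y \<in> P" for y using t that by blast
  have "\<sigma> - t = 0" using v[OF zero_in] by simp
  then have "\<xi> - t *\<^sub>R face_normal P E = 0" using v by (intro zero_functional) auto
  moreover have "{d..<DIM('a)} = {d}" using 0(1) by auto
  ultimately show ?case
    using 0 t aff_dim_P face_of_refl[OF convex] face_of_imp_subset[OF 0(2)]
    by (intro exI[of _ "\<lambda>i. if i = d then E else P"] exI[of _ "\<lambda>_. t"]) (auto simp: le_Suc_eq)
next
  case (Suc k d E \<xi> \<sigma>)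
  have "E \<noteq> P" "E \<noteq> {}" using Suc.prems aff_dim_P by auto
  from dual_step[OF Suc.prems(2) this Suc.prems(4,5)] obtain t E1 where t: "t \<ge> 0" "E1 face_of P" "E \<subseteq> E1" "aff_dim E1 = aff_dim E + 1"
    "\<And>y. y \<in> P \<Longrightarrow> (\<xi> - t *\<^sub>R face_normal P E) \<bullet> y \<le> \<sigma> - t"
    "\<And>y. y \<in> E1 \<Longrightarrow> (\<xi> - t *\<^sub>R face_normal P E) \<bullet> y = \<sigma> - t" by blast
  have d1: "aff_dim E1 = int (Suc d)" "Suc (Suc d) + k = DIM('a)" using t Suc.prems by auto
  obtain F s where F: "\<forall>i. Suc d \<le> i \<and> i \<le> DIM('a) \<longrightarrow> F i face_of P \<and> aff_dim (F i) = int i"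
     "\<forall>i. Suc d \<le> i \<and> i < DIM('a) \<longrightarrow> F i \<subseteq> F (Suc i)" "F (Suc d) = E1"
     "\<forall>i. Suc d \<le> i \<and> i < DIM('a) \<longrightarrow> s i \<ge> (0::real)"
     "\<xi> - t *\<^sub>R face_normal P E = (\<Sum>i\<in>{Suc d..<DIM('a)}. s i *\<^sub>R face_normal P (F i))"
    using Suc.IH[OF d1(2) t(2) d1(1) t(5,6)] by blast
  define F' where "F' = F(d := E)"
  define s' where "s' = s(d := t)"
  have eq: "F' i = F i" "s' i = s i" if "Suc d \<le> i" for i using that by (auto simp: F'_def s'_def)
  have eq': "F' d = E" "s' d = t" by (auto simp: F'_def s'_def)
  have "(\<Sum>i\<in>{d..<DIM('a)}. s' i *\<^sub>R face_normal P (F' i)) = s' d *\<^sub>R face_normal P (F' d) + (\<Sum>i\<in>{Suc d..<DIM('a)}. s' i *\<^sub>R face_normal P (F' i))"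
    using Suc.prems(1) by (intro sum.atLeast_Suc_lessThan) simp
  also have "(\<Sum>i\<in>{Suc d..<DIM('a)}. s' i *\<^sub>R face_normal P (F' i)) = (\<Sum>i\<in>{Suc d..<DIM('a)}. s i *\<^sub>R face_normal P (F i))"
    by (intro sum.cong) (auto simp: eq)
  also have "s' d *\<^sub>R face_normal P (F' d) + \<dots> = \<xi>" unfolding F(5)[symmetric] by (simp add: eq')
  finally have "\<xi> = (\<Sum>i\<in>{d..<DIM('a)}. s' i *\<^sub>R face_normal P (F' i))" by simp
  moreover have "F' i face_of P \<and> aff_dim (F' i) = int i" if "d \<le> i \<and> i \<le> DIM('a)" for i
    using that F(1) Suc.prems eq' eq[of i] by (cases "i = d") auto
  moreover have "F' i \<subseteq> F' (Suc i)" if "d \<le> i \<and> i < DIM('a)" for i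
    using that F(2,3) t(3) eq' eq[of i] eq[of "Suc i"] by (cases "i = d") auto
  moreover have "s' i \<ge> 0" if "d \<le> i \<and> i < DIM('a)" for i
    using that F(4) t(1) eq' eq[of i] by (cases "i = d") auto
  ultimately show ?case using eq' by (intro exI[of _ F'] exI[of _ s']) auto
qed

text \<open>The flag starts at a vertex at which \<open>\<xi>\<close> is maximal on \<open>P\<close>.\<close>

lemma dual_cover_all:
  "\<exists>F t. (\<forall>i\<le>DIM('a). F i face_of P \<and> aff_dim (F i) = int i) \<and> (\<forall>i<DIM('a). F i \<subseteq> F (Suc i)) \<and>
     (\<forall>i<DIM('a). t i \<ge> (0::real)) \<and> \<xi> = (\<Sum>i<DIM('a). t i *\<^sub>R face_normal P (F i))"
proof -
  have "continuous_on P (\<lambda>y. \<xi> \<bullet> y)" by (intro continuous_intros)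
  then obtain y0 where y0: "y0 \<in> P" "\<And>y. y \<in> P \<Longrightarrow> \<xi> \<bullet> y \<le> \<xi> \<bullet> y0"
    using continuous_attains_sup[OF compact] zero_in by blast
  define E where "E = {y \<in> P. \<xi> \<bullet> y = \<xi> \<bullet> y0}"
  have E: "E face_of P" unfolding E_def by (rule supporting_face[OF y0(2)])
  have pE: "polytope E" using face_of_polytope_polytope[OF polytope E] .
  have "y0 \<in> E" using y0 by (simp add: E_def)
  then obtain v where v: "v extreme_point_of E"
    using extreme_point_exists_convex[OF polytope_imp_compact[OF pE] polytope_imp_convex[OF pE]] by blast
  then have "{v} face_of P" using E face_of_singleton face_of_trans by blast
  moreover have "v \<in> E" using v by (simp add: extreme_point_of_def)
  ultimately have ex: "\<exists>F t. (\<forall>i. 0 \<le> i \<and> i \<le> DIM('a) \<longrightarrow> F i face_of P \<and> aff_dim (F i) = int i) \<and>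
     (\<forall>i. 0 \<le> i \<and> i < DIM('a) \<longrightarrow> F i \<subseteq> F (Suc i)) \<and> F 0 = {v} \<and>
     (\<forall>i. 0 \<le> i \<and> i < DIM('a) \<longrightarrow> t i \<ge> (0::real)) \<and> \<xi> = (\<Sum>i\<in>{0..<DIM('a)}. t i *\<^sub>R face_normal P (F i))"
    using y0(2) by (intro dual_cover[of _ "DIM('a) - 1" _ _ "\<xi> \<bullet> y0"]) (auto simp: E_def)
  obtain F t where "\<forall>i. 0 \<le> i \<and> i \<le> DIM('a) \<longrightarrow> F i face_of P \<and> aff_dim (F i) = int i"
     "\<forall>i. 0 \<le> i \<and> i < DIM('a) \<longrightarrow> F i \<subseteq> F (Suc i)"
     "\<forall>i. 0 \<le> i \<and> i < DIM('a) \<longrightarrow> t i \<ge> (0::real)" "\<xi> = (\<Sum>i\<in>{0..<DIM('a)}. t i *\<^sub>R face_normal P (F i))"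
    using ex by (elim exE conjE) (rule that)
  then show ?thesis by (intro exI[of _ F] exI[of _ t]) (simp add: atLeast0LessThan)
qed

end

section \<open>Flags and their flips\<close>

text \<open>Shifts the index such that the empty face comes first. In this way the columns of a slack matrix
include the empty face, as its rows include \<open>P\<close>.\<close>

definition lower_face :: "'a set list \<Rightarrow> nat \<Rightarrow> 'a set" where
  "lower_face f k = (if k = 0 then {} else f ! (k - 1))"

lemma lower_face_0 [simp]: "lower_face f 0 = {}" and lower_face_Suc [simp]: "lower_face f (Suc k) = f ! k"
  by (simp_all add: lower_face_def)

locale flag_polytope = origin_polytope P for P :: "(real^'n::finite) set"
begin

lemma flagI:
  assumes "\<And>i. i \<le> CARD('n) \<Longrightarrow> F i face_of P \<and> aff_dim (F i) = int i" "\<And>i. i < CARD('n) \<Longrightarrow> F i \<subseteq> F (Suc i)"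
  shows "map F [0..<Suc CARD('n)] \<in> flags P" "\<And>i. i \<le> CARD('n) \<Longrightarrow> map F [0..<Suc CARD('n)] ! i = F i"
proof -
  show nth: "map F [0..<Suc CARD('n)] ! i = F i" if "i \<le> CARD('n)" for i using that by (simp del: upt_Suc)
  show "map F [0..<Suc CARD('n)] \<in> flags P"
    unfolding flags_def using assms nth by (simp del: upt_Suc)
qed

lemma flagD:
  assumes "f \<in> flags P"
  shows "length f = Suc CARD('n)" "\<And>i. i \<le> CARD('n) \<Longrightarrow> f ! i face_of P" "\<And>i. i \<le> CARD('n) \<Longrightarrow> aff_dim (f ! i) = int i"
    "\<And>i. i < CARD('n) \<Longrightarrow> f ! i \<subseteq> f ! Suc i"
  using assms by (auto simp: flags_def)

lemma flag_mono:
  assumes "f \<in> flags P" "i \<le> j" "j \<le> CARD('n)"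
  shows "f ! i \<subseteq> f ! j"
  using assms(2,3)
proof (induction j rule: dec_induct)
  case (step j)
  then show ?case using flagD(4)[OF assms(1), of j] by auto
qed simp

lemma flag_top: "f \<in> flags P \<Longrightarrow> f ! CARD('n) = P"
  using flagD(2,3)[of f "CARD('n)"] by (intro face_of_full_dim) auto

lemma flag_nonempty: "f \<in> flags P \<Longrightarrow> i \<le> CARD('n) \<Longrightarrow> f ! i \<noteq> {}"
  using flagD(3)[of f i] by auto

lemma flag_proper: "f \<in> flags P \<Longrightarrow> i < CARD('n) \<Longrightarrow> f ! i \<noteq> P"
  using flagD(3)[of f i] aff_dim_P by auto

lemma flag_eqI:
  assumes "f \<in> flags P" "g \<in> flags P" "\<And>i. i < CARD('n) \<Longrightarrow> f ! i = g ! i"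
  shows "f = g"
proof (rule nth_equalityI)
  show "length f = length g" using flagD(1) assms by simp
  fix i assume "i < length f"
  then show "f ! i = g ! i" using assms flagD(1)[OF assms(1)] flag_top by (cases "i = CARD('n)") auto
qed

lemma flag_subset_iff_le:
  assumes "f \<in> flags P" "i \<le> CARD('n)" "j \<le> CARD('n)"
  shows "f ! i \<subseteq> f ! j \<longleftrightarrow> i \<le> j"
  using flag_mono[OF assms(1), of i j] aff_dim_subset[of "f ! i" "f ! j"] flagD(3)[OF assms(1)] assms by fastforce

lemma lower_face_flag:
  assumes "f \<in> flags P" "k \<le> CARD('n)"
  shows "lower_face f k face_of P" "lower_face f k \<noteq> P" "aff_dim (lower_face f k) = int k - 1"
    "lower_face f k \<subseteq> f ! k"
proof -
  show "lower_face f k face_of P" "aff_dim (lower_face f k) = int k - 1" 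
    using assms flagD(2,3)[OF assms(1), of "k - 1"] by (auto simp: lower_face_def)
  then show "lower_face f k \<noteq> P" using aff_dim_P assms(2) by auto
  show "lower_face f k \<subseteq> f ! k" using flag_mono[OF assms(1), of "k - 1" k] assms(2) by (simp add: lower_face_def)
qed

lemma finite_flags: "finite (flags P)"
proof (rule finite_subset)
  show "flags P \<subseteq> {f. set f \<subseteq> {F. F face_of P} \<and> length f = Suc CARD('n)}"
    using flagD by (auto simp: in_set_conv_nth less_Suc_eq_le)
  show "finite {f. set f \<subseteq> {F. F face_of P} \<and> length f = Suc CARD('n)}"
    by (intro finite_lists_length_eq finite_polytope_faces polytope)
qed

text \<open>The specification of \<open>flag_flip\<close> as a relation, for use in existence and uniqueness proofs.\<close>

definition flips_to :: "nat \<Rightarrow> (real^'n) set list \<Rightarrow> (real^'n) set list \<Rightarrow> bool" where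
  "flips_to i f g \<longleftrightarrow> g \<in> flags P \<and> g ! i \<noteq> f ! i \<and> (\<forall>j\<le>CARD('n). j \<noteq> i \<longrightarrow> g ! j = f ! j)"

lemma flips_to_unique:
  assumes f: "f \<in> flags P" and i: "i < CARD('n)" and "flips_to i f g" "flips_to i f h"
  shows "g = h"
proof (rule flag_eqI)
  show g: "g \<in> flags P" and h: "h \<in> flags P" using assms by (auto simp: flips_to_def)
  have eq: "g ! j = f ! j" "h ! j = f ! j" if "j \<le> CARD('n)" "j \<noteq> i" for j using assms that by (auto simp: flips_to_def)
  have low: "lower_face g i = lower_face f i" "lower_face h i = lower_face f i"
    using eq[of "i - 1"] i by (auto simp: lower_face_def)
  have "g ! i = h ! i"
  proof (rule diamond_unique)
    show "lower_face f i face_of P" "f ! i face_of P" "g ! i face_of P" "h ! i face_of P" "f ! Suc i face_of P"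
      using lower_face_flag(1)[OF f, of i] flagD(2)[OF f] flagD(2)[OF g] flagD(2)[OF h] i by auto
    show "lower_face f i \<subseteq> f ! i" "lower_face f i \<subseteq> g ! i" "lower_face f i \<subseteq> h ! i"
      using lower_face_flag(4)[OF f, of i] lower_face_flag(4)[OF g, of i] lower_face_flag(4)[OF h, of i] low i by auto
    show "f ! i \<subseteq> f ! Suc i" "g ! i \<subseteq> f ! Suc i" "h ! i \<subseteq> f ! Suc i"
      using flagD(4)[OF f i] flagD(4)[OF g i] flagD(4)[OF h i] eq[of "Suc i"] i by auto
    show "aff_dim (f ! i) = aff_dim (lower_face f i) + 1" "aff_dim (g ! i) = aff_dim (lower_face f i) + 1"
      "aff_dim (h ! i) = aff_dim (lower_face f i) + 1" "aff_dim (f ! Suc i) = aff_dim (lower_face f i) + 2"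
      using lower_face_flag(3)[OF f, of i] flagD(3)[OF f] flagD(3)[OF g] flagD(3)[OF h] i by auto
    show "f ! i \<noteq> g ! i" "f ! i \<noteq> h ! i" using assms by (auto simp: flips_to_def)
  qed
  then show "g ! j = h ! j" if "j < CARD('n)" for j using eq that by (cases "j = i") auto
qed

lemma flips_to_exists:
  assumes f: "f \<in> flags P" and i: "i < CARD('n)"
  shows "\<exists>g. flips_to i f g"
proof -
  have "\<exists>E2. E2 face_of P \<and> lower_face f i \<subseteq> E2 \<and> E2 \<subseteq> f ! Suc i \<and> aff_dim E2 = aff_dim (lower_face f i) + 1 \<and> E2 \<noteq> f ! i"
  proof (rule diamond_exists)
    show "lower_face f i face_of P" "f ! i face_of P" "f ! Suc i face_of P" "lower_face f i \<subseteq> f ! i"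
      using lower_face_flag[OF f, of i] flagD(2)[OF f] i by auto
    show "f ! i \<subseteq> f ! Suc i" using flagD(4)[OF f i] .
    show "aff_dim (f ! i) = aff_dim (lower_face f i) + 1" "aff_dim (f ! Suc i) = aff_dim (lower_face f i) + 2"
      using lower_face_flag(3)[OF f, of i] flagD(3)[OF f] i by auto
  qed
  then obtain E where E: "E face_of P" "lower_face f i \<subseteq> E" "E \<subseteq> f ! Suc i" "aff_dim E = int i" "E \<noteq> f ! i"
    using lower_face_flag(3)[OF f, of i] i by auto
  have "f[i := E] \<in> flags P"
    unfolding flags_def
  proof (intro CollectI conjI allI impI)
    show "length (f[i := E]) = Suc CARD('n)" using flagD(1)[OF f] by simp
    fix j assume j: "j \<le> CARD('n)"
    show "f[i := E] ! j face_of P" "aff_dim (f[i := E] ! j) = int j"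
      using j E flagD[OF f] i by (auto simp: nth_list_update)
  next
    fix j assume j: "j < CARD('n)"
    consider "j = i" | "Suc j = i" | "j \<noteq> i" "Suc j \<noteq> i" by blast
    then show "f[i := E] ! j \<subseteq> f[i := E] ! Suc j"
      using j E flagD(1,4)[OF f] i by cases (auto simp: nth_list_update lower_face_def)
  qed
  then have "flips_to i f (f[i := E])"
    using E i flagD(1)[OF f] by (auto simp: flips_to_def)
  then show ?thesis by blast
qed

lemma flag_flip:
  assumes f: "f \<in> flags P" and i: "i < CARD('n)"
  shows "flips_to i f (flag_flip P i f)"
proof -
  have "\<exists>!g. flips_to i f g" using flips_to_exists[OF assms] flips_to_unique[OF assms] by blast
  from theI'[OF this] show ?thesis unfolding flag_flip_def flips_to_def .
qed

lemma flag_flip_eq: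
  assumes "f \<in> flags P" "i < CARD('n)" "flips_to i f g"
  shows "flag_flip P i f = g"
  using flips_to_unique[OF assms(1,2) flag_flip[OF assms(1,2)] assms(3)] .

lemma flag_flip_flag: "f \<in> flags P \<Longrightarrow> i < CARD('n) \<Longrightarrow> flag_flip P i f \<in> flags P"
  and flag_flip_ne: "f \<in> flags P \<Longrightarrow> i < CARD('n) \<Longrightarrow> flag_flip P i f ! i \<noteq> f ! i"
  and flag_flip_other: "f \<in> flags P \<Longrightarrow> i < CARD('n) \<Longrightarrow> j \<le> CARD('n) \<Longrightarrow> j \<noteq> i \<Longrightarrow> flag_flip P i f ! j = f ! j"
  using flag_flip[of f i] by (auto simp: flips_to_def)

lemma flag_flip_flag_flip:
  assumes "f \<in> flags P" "i < CARD('n)"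
  shows "flag_flip P i (flag_flip P i f) = f"
  using assms flag_flip[OF assms] by (intro flag_flip_eq flag_flip_flag) (auto simp: flips_to_def)

lemma bij_betw_flag_flip:
  assumes "i < CARD('n)"
  shows "bij_betw (flag_flip P i) (flags P) (flags P)"
  by (rule bij_betwI[of _ _ _ "flag_flip P i"]) (use assms flag_flip_flag flag_flip_flag_flip in auto)

definition partial_flip :: "nat \<Rightarrow> (real^'n) set list \<Rightarrow> (real^'n) set list" where
  "partial_flip i f = fold (flag_flip P) [0..<i] f"

lemma partial_flip_0: "partial_flip 0 f = f" and partial_flip_Suc: "partial_flip (Suc i) f = flag_flip P i (partial_flip i f)"
  by (simp_all add: partial_flip_def)

lemma complete_flip_eq: "complete_flip P f = partial_flip CARD('n) f"
  by (simp add: complete_flip_def partial_flip_def)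

lemma bij_betw_partial_flip: "i \<le> CARD('n) \<Longrightarrow> bij_betw (partial_flip i) (flags P) (flags P)"
proof (induction i)
  case 0
  have eq: "partial_flip 0 = id" by (simp add: fun_eq_iff partial_flip_0)
  show ?case unfolding eq by (rule bij_betw_id)
next
  case (Suc i)
  have eq: "partial_flip (Suc i) = flag_flip P i \<circ> partial_flip i" by (simp add: fun_eq_iff partial_flip_Suc)
  show ?case
    unfolding eq using Suc.prems by (intro bij_betw_trans[OF Suc.IH bij_betw_flag_flip]) auto
qed

lemma partial_flip_flag: "f \<in> flags P \<Longrightarrow> i \<le> CARD('n) \<Longrightarrow> partial_flip i f \<in> flags P"
  using bij_betw_partial_flip[of i] by (auto simp: bij_betw_def)

lemma partial_flip_upper:
  assumes "f \<in> flags P" "i \<le> j" "j \<le> CARD('n)"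
  shows "partial_flip i f ! j = f ! j"
  using assms(2)
proof (induction i)
  case (Suc i)
  then show ?case using flag_flip_other[OF partial_flip_flag[OF assms(1), of i], of i j] assms(3) by (simp add: partial_flip_Suc)
qed (simp add: partial_flip_0)

lemma partial_flip_lower:
  assumes "f \<in> flags P" "j < i" "i \<le> CARD('n)"
  shows "partial_flip i f ! j = complete_flip P f ! j"
proof -
  have "partial_flip (i + k) f ! j = partial_flip i f ! j" if "i + k \<le> CARD('n)" for k
    using that
  proof (induction k)
    case (Suc k)
    then show ?case
      using flag_flip_other[OF partial_flip_flag[OF assms(1), of "i + k"], of "i + k" j] assms(2) by (simp add: partial_flip_Suc)
  qed simp
  from this[of "CARD('n) - i"] assms show ?thesis by (simp add: complete_flip_eq)
qed

lemma complete_flip_nth: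
  assumes "f \<in> flags P" "i < CARD('n)"
  shows "flag_flip P i (partial_flip i f) ! i = complete_flip P f ! i"
  using partial_flip_lower[OF assms(1), of i "Suc i"] assms(2) by (simp add: partial_flip_Suc)

lemma complete_flip_flag: "f \<in> flags P \<Longrightarrow> complete_flip P f \<in> flags P"
  by (simp add: complete_flip_eq partial_flip_flag)

lemma complete_flip_step:
  assumes f: "f \<in> flags P" and i: "i < CARD('n)"
  shows "complete_flip P f ! i \<subseteq> f ! Suc i" "complete_flip P f ! i \<noteq> f ! i" "lower_face (complete_flip P f) i \<subseteq> f ! i"
proof -
  have g: "partial_flip (Suc i) f \<in> flags P" "partial_flip i f \<in> flags P" using partial_flip_flag[OF f] i by auto
  show "complete_flip P f ! i \<subseteq> f ! Suc i"
    using flagD(4)[OF g(1) i] partial_flip_lower[OF f, of i "Suc i"] partial_flip_upper[OF f, of "Suc i" "Suc i"] i by simp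
  show "complete_flip P f ! i \<noteq> f ! i"
    using flag_flip_ne[OF g(2) i] complete_flip_nth[OF f i] partial_flip_upper[OF f, of i i] i by simp
  show "lower_face (complete_flip P f) i \<subseteq> f ! i"
    using lower_face_flag(4)[OF g(2), of i] partial_flip_lower[OF f, of "i - 1" i] partial_flip_upper[OF f, of i i] i
    by (auto simp: lower_face_def)
qed

text \<open>Otherwise take the first \<open>i\<close> for which \<open>h\<^sub>i\<close> contains the vertex, where \<open>h\<close> is the complete flip. Both
\<open>h\<^sub>i\<close> and \<open>f\<^sub>i\<close> contain \<open>h\<^sub>i\<^sub>-\<^sub>1\<close> and they are different, so their intersection is \<open>h\<^sub>i\<^sub>-\<^sub>1\<close>, by dimension, and it
contains the vertex already.\<close>

lemma vertex_notin_complete_flip: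
  assumes f: "f \<in> flags P" and i: "i < CARD('n)"
  shows "\<not> f ! 0 \<subseteq> complete_flip P f ! i"
  using i
proof (induction i)
  case 0
  have h: "complete_flip P f \<in> flags P" by (rule complete_flip_flag[OF f])
  show ?case
    using face_subset_aff_dim_eq[of "f ! 0" "complete_flip P f ! 0"] flagD(2,3)[OF f, of 0] flagD(2,3)[OF h, of 0]
      complete_flip_step(2)[OF f, of 0] by auto
next
  case (Suc i)
  define h where "h = complete_flip P f"
  have h: "h \<in> flags P" unfolding h_def by (rule complete_flip_flag[OF f])
  show ?case
  proof
    assume "f ! 0 \<subseteq> complete_flip P f ! Suc i"
    then have sub: "f ! 0 \<subseteq> h ! Suc i \<inter> f ! Suc i" using flag_mono[OF f, of 0 "Suc i"] Suc.prems by (auto simp: h_def)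
    have I: "(h ! Suc i \<inter> f ! Suc i) face_of P" using flagD(2)[OF f, of "Suc i"] flagD(2)[OF h, of "Suc i"] Suc.prems by (intro face_of_Int) auto
    have "h ! i \<subseteq> h ! Suc i \<inter> f ! Suc i"
      using flagD(4)[OF h, of i] complete_flip_step(1)[OF f, of i] Suc.prems by (auto simp: h_def)
    moreover have "aff_dim (h ! Suc i \<inter> f ! Suc i) < int (Suc i)"
    proof -
      have "h ! Suc i \<inter> f ! Suc i \<noteq> h ! Suc i"
      proof
        assume "h ! Suc i \<inter> f ! Suc i = h ! Suc i"
        then have "h ! Suc i = f ! Suc i"
          using face_subset_aff_dim_eq[of "h ! Suc i" "f ! Suc i"] flagD(2,3)[OF f, of "Suc i"] flagD(2,3)[OF h, of "Suc i"] Suc.prems by auto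
        then show False using complete_flip_step(2)[OF f, of "Suc i"] Suc.prems by (simp add: h_def)
      qed
      then show ?thesis
        using face_subset_aff_dim_less[OF I flagD(2)[OF h, of "Suc i"]] flagD(3)[OF h, of "Suc i"] Suc.prems by auto
    qed
    moreover have "aff_dim (h ! i) = int i" "h ! i face_of P" using flagD(2,3)[OF h, of i] Suc.prems by auto
    ultimately have "h ! i = h ! Suc i \<inter> f ! Suc i"
      using I face_subset_aff_dim_less[of "h ! i" "h ! Suc i \<inter> f ! Suc i"] by fastforce
    then show False using sub Suc by (auto simp: h_def)
  qed
qed

end

section \<open>The volume of the ball as a sum over pairs of flags\<close>

lemma cone_map_altdef:
  "cone_map p s = (\<Sum>k<CARD('n). s $ idx_of_nat k *\<^sub>R (p k :: real^'n::finite))"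
proof -
  show ?thesis
    using sum_idx[where 'a='n, of "\<lambda>k. s $ idx_of_nat k *\<^sub>R p k"] by (simp add: cone_map_def nat_of_idx_inverse)
qed

lemma cone_map_nat: "cone_map p (\<chi> i. s (nat_of_idx i)) = (\<Sum>k<CARD('n). s k *\<^sub>R (p k :: real^'n::finite))"
  unfolding cone_map_altdef by (intro sum.cong) auto

lemma inner_cone_map: "a \<bullet> cone_map p s = (\<Sum>i\<in>UNIV. s $ i * (a \<bullet> p (nat_of_idx i)))"
  by (simp add: cone_map_def inner_sum_right)

lemma std_simplex_open_subset: "std_simplex_open \<subseteq> std_simplex_closed"
  by (auto simp: std_simplex_open_def std_simplex_closed_def less_imp_le)

text \<open>The boundaries of the simplices are null sets, so disjoint interiors suffice.\<close>

lemma nn_integral_dissection: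
  fixes q :: "'i \<Rightarrow> nat \<Rightarrow> real^'n"
  assumes fin: "finite I" and K: "K = (\<Union>f\<in>I. cone_map (q f) ` std_simplex_closed)"
    and disj: "\<And>f g s t. f \<in> I \<Longrightarrow> g \<in> I \<Longrightarrow> s \<in> std_simplex_open \<Longrightarrow> t \<in> std_simplex_open \<Longrightarrow>
       cone_map (q f) s = cone_map (q g) t \<Longrightarrow> f = g"
    and h [measurable]: "h \<in> borel_measurable borel"
  shows "(\<integral>\<^sup>+x. h x * indicator K x \<partial>lborel) = (\<Sum>f\<in>I. \<integral>\<^sup>+x. h x * indicator (cone_map (q f) ` std_simplex_open) x \<partial>lborel)"
proof -
  let ?O = "\<lambda>f. cone_map (q f) ` std_simplex_open"
  have [measurable]: "?O f \<in> sets borel" for f by (rule cone_map_open_simplex_borel)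
  have dis: "disjoint_family_on ?O I"
    using disj by (auto simp: disjoint_family_on_def)
  define B where "B = (\<Union>f\<in>I. cone_map (q f) ` (std_simplex_closed - std_simplex_open))"
  have B: "B \<in> null_sets lborel"
    unfolding B_def using fin null_sets_cone_map_simplex_boundary by (intro null_sets.finite_UN) auto
  have "AE x in lborel. h x * indicator K x = (\<Sum>f\<in>I. h x * indicator (?O f) x)"
    using AE_not_in[OF B]
  proof eventually_elim
    fix x assume "x \<notin> B"
    then have "x \<in> K \<longleftrightarrow> x \<in> (\<Union>f\<in>I. ?O f)"
      unfolding K B_def using std_simplex_open_subset by fast
    then have "indicator K x = (indicator (\<Union>f\<in>I. ?O f) x :: ennreal)" by (simp add: indicator_def)
    also have "\<dots> = (\<Sum>f\<in>I. indicator (?O f) x)" using indicator_UN_disjoint[OF fin dis] by metis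
    finally show "h x * indicator K x = (\<Sum>f\<in>I. h x * indicator (?O f) x)" by (simp add: sum_distrib_left)
  qed
  then have "(\<integral>\<^sup>+x. h x * indicator K x \<partial>lborel) = (\<integral>\<^sup>+x. (\<Sum>f\<in>I. h x * indicator (?O f) x) \<partial>lborel)"
    by (rule nn_integral_cong_AE)
  also have "\<dots> = (\<Sum>f\<in>I. \<integral>\<^sup>+x. h x * indicator (?O f) x \<partial>lborel)"
    by (rule nn_integral_sum) measurable
  finally show ?thesis .
qed

lemma emeasure_dissection:
  fixes q :: "'i \<Rightarrow> nat \<Rightarrow> real^'n"
  assumes fin: "finite I" and K: "K = (\<Union>f\<in>I. cone_map (q f) ` std_simplex_closed)"
    and disj: "\<And>f g s t. f \<in> I \<Longrightarrow> g \<in> I \<Longrightarrow> s \<in> std_simplex_open \<Longrightarrow> t \<in> std_simplex_open \<Longrightarrow>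
       cone_map (q f) s = cone_map (q g) t \<Longrightarrow> f = g"
  shows "emeasure lborel K = ennreal (\<Sum>f\<in>I. frame_vol (q f) / fact CARD('n))"
proof -
  have closed: "cone_map (q f) ` std_simplex_closed \<in> sets borel" for f
    by (rule emeasure_cone_map_image(2)[OF compact_std_simplex_closed])
  then have Kb: "K \<in> sets borel" unfolding K using fin by (intro sets.finite_UN) auto
  have "emeasure lborel K = (\<integral>\<^sup>+x. 1 * indicator K x \<partial>lborel)" using Kb by simp
  also have "\<dots> = (\<Sum>f\<in>I. \<integral>\<^sup>+x. 1 * indicator (cone_map (q f) ` std_simplex_open) x \<partial>lborel)"
    by (rule nn_integral_dissection[OF fin K disj]) auto
  also have "\<dots> = (\<Sum>f\<in>I. ennreal (frame_vol (q f) / fact CARD('n)))"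
  proof (rule sum.cong[OF refl])
    fix f
    have "(\<integral>\<^sup>+x. 1 * indicator (cone_map (q f) ` std_simplex_open) x \<partial>lborel) = emeasure lborel (cone_map (q f) ` std_simplex_open)"
      using cone_map_open_simplex_borel[of "q f"] by simp
    also have "\<dots> = emeasure lborel (cone_map (q f) ` std_simplex_open \<union> cone_map (q f) ` (std_simplex_closed - std_simplex_open))"
      using cone_map_open_simplex_borel[of "q f"] null_sets_cone_map_simplex_boundary[of "q f"] by (intro emeasure_Un_null_set[symmetric]) auto
    also have "cone_map (q f) ` std_simplex_open \<union> cone_map (q f) ` (std_simplex_closed - std_simplex_open) = cone_map (q f) ` std_simplex_closed"
      using std_simplex_open_subset by blast
    finally show "(\<integral>\<^sup>+x. 1 * indicator (cone_map (q f) ` std_simplex_open) x \<partial>lborel) = ennreal (frame_vol (q f) / fact CARD('n))"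
      unfolding emeasure_cone_map_simplex .
  qed
  also have "\<dots> = ennreal (\<Sum>f\<in>I. frame_vol (q f) / fact CARD('n))"
    by (rule sum_ennreal) (simp add: frame_vol_nonneg)
  finally show ?thesis .
qed

context flag_polytope
begin

definition primal_frame :: "(real^'n) set list \<Rightarrow> nat \<Rightarrow> real^'n" where
  "primal_frame f k = face_center P (f ! k)"

definition dual_frame :: "(real^'n) set list \<Rightarrow> nat \<Rightarrow> real^'n" where
  "dual_frame f k = face_normal P (f ! k)"

lemma dual_frame_le: "f \<in> flags P \<Longrightarrow> k < CARD('n) \<Longrightarrow> y \<in> P \<Longrightarrow> dual_frame f k \<bullet> y \<le> 1"
  unfolding dual_frame_def by (rule face_normal(1)[OF flagD(2) flag_proper]) auto

lemma face_normal_eq_1: "F face_of P \<Longrightarrow> F \<noteq> P \<Longrightarrow> y \<in> F \<Longrightarrow> face_normal P F \<bullet> y = 1"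
  using face_normal(2)[of F] by blast

lemma proper_chain_test:
  assumes "E \<in> {E. E face_of P \<and> E \<noteq> {} \<and> E \<noteq> P}" "F \<in> {E. E face_of P \<and> E \<noteq> {} \<and> E \<noteq> P}"
  shows "face_normal P F \<bullet> face_center P E \<le> 1" "face_normal P F \<bullet> face_center P E = 1 \<longleftrightarrow> E \<subseteq> F"
  using slack_nonneg[of E F] slack_eq_0_iff[of E F] assms by (auto simp: slack_def)

lemma primal_frame_disjoint:
  assumes f: "f \<in> flags P" and g: "g \<in> flags P" and s: "\<And>k. k < CARD('n) \<Longrightarrow> s k > 0" and t: "\<And>k. k < CARD('n) \<Longrightarrow> t k > 0"
    and eq: "(\<Sum>k<CARD('n). s k *\<^sub>R primal_frame f k) = (\<Sum>k<CARD('n). t k *\<^sub>R primal_frame g k)"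
  shows "f = g"
proof (rule flag_eqI[OF f g])
  define X where "X = {E. E face_of P \<and> E \<noteq> {} \<and> E \<noteq> P}"
  have in_X: "h ! i \<in> X" if "h \<in> flags P" "i < CARD('n)" for h i
    using that flagD(2)[OF that(1), of i] flag_nonempty[OF that(1), of i] flag_proper[OF that] by (simp add: X_def)
  have chain: "h ! i \<subseteq> h ! j \<longleftrightarrow> i \<le> j" if "h \<in> flags P" "i < CARD('n)" "j < CARD('n)" for h i j
    using flag_subset_iff_le[OF that(1), of i j] that by simp
  have "\<forall>i<CARD('n). f ! i = g ! i"
  proof (rule chain_combination_unique[where X = X and test = "face_normal P" and vec = "face_center P" and le = "(\<subseteq>)" and s = s and t = t])
    show "(\<Sum>i<CARD('n). s i *\<^sub>R face_center P (f ! i)) = (\<Sum>i<CARD('n). t i *\<^sub>R face_center P (g ! i))"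
      using eq by (simp add: primal_frame_def)
    show "f ! i \<in> X" "g ! i \<in> X" "s i > 0" "t i > 0" if "i < CARD('n)" for i using in_X f g s t that by blast+
    show "f ! i \<subseteq> f ! j" "g ! i \<subseteq> g ! j" if "i \<le> j" "j < CARD('n)" for i j
      using chain[of _ i j] f g that by simp_all
    show "\<not> f ! j \<subseteq> f ! i" "\<not> g ! j \<subseteq> g ! i" if "i < j" "j < CARD('n)" for i j
      using chain[of _ j i] f g that by simp_all
    fix E F assume "E \<in> X" "F \<in> X"
    then show "face_normal P F \<bullet> face_center P E \<le> 1" "(face_normal P F \<bullet> face_center P E = 1) = (E \<subseteq> F)"
      using proper_chain_test[of E F] by (simp_all add: X_def)
    show "E = F" if "E \<subseteq> F" "F \<subseteq> E" using that by (rule subset_antisym)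
  qed
  then show "f ! i = g ! i" if "i < CARD('n)" for i using that by blast
qed

text \<open>Normals are ordered by reverse inclusion of the faces, so the flag has to be read backwards in
\<open>chain_combination_unique\<close>.\<close>

lemma dual_frame_disjoint:
  assumes f: "f \<in> flags P" and g: "g \<in> flags P" and s: "\<And>k. k < CARD('n) \<Longrightarrow> s k > 0" and t: "\<And>k. k < CARD('n) \<Longrightarrow> t k > 0"
    and eq: "(\<Sum>k<CARD('n). s k *\<^sub>R dual_frame f k) = (\<Sum>k<CARD('n). t k *\<^sub>R dual_frame g k)"
  shows "f = g"
proof (rule flag_eqI[OF f g])
  define X where "X = {E. E face_of P \<and> E \<noteq> {} \<and> E \<noteq> P}"
  define e where "e = (\<lambda>(h :: (real^'n) set list) i. h ! (CARD('n) - Suc i))"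
  have in_X: "e h i \<in> X" if "h \<in> flags P" "i < CARD('n)" for h i
    using that flagD(2)[OF that(1), of "CARD('n) - Suc i"] flag_nonempty[OF that(1), of "CARD('n) - Suc i"]
      flag_proper[OF that(1), of "CARD('n) - Suc i"] by (simp add: X_def e_def)
  have chain: "e h i \<subseteq> e h j \<longleftrightarrow> j \<le> i" if "h \<in> flags P" "i < CARD('n)" "j < CARD('n)" for h i j
    using flag_subset_iff_le[OF that(1), of "CARD('n) - Suc i" "CARD('n) - Suc j"] that by (auto simp: e_def)
  have "\<forall>i<CARD('n). e f i = e g i"
  proof (rule chain_combination_unique[where X = X and test = "face_center P" and vec = "face_normal P"
        and le = "(\<lambda>E F. F \<subseteq> E)" and s = "\<lambda>i. s (CARD('n) - Suc i)" and t = "\<lambda>i. t (CARD('n) - Suc i)"])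
    have "(\<Sum>i<CARD('n). r (CARD('n) - Suc i) *\<^sub>R face_normal P (e h i)) = (\<Sum>k<CARD('n). r k *\<^sub>R dual_frame h k)" for r h
      using sum.nat_diff_reindex[of "\<lambda>k. r k *\<^sub>R dual_frame h k" "CARD('n)"] by (simp add: e_def dual_frame_def)
    then show "(\<Sum>i<CARD('n). s (CARD('n) - Suc i) *\<^sub>R face_normal P (e f i)) = (\<Sum>i<CARD('n). t (CARD('n) - Suc i) *\<^sub>R face_normal P (e g i))"
      using eq by simp
    show "e f i \<in> X" "e g i \<in> X" "s (CARD('n) - Suc i) > 0" "t (CARD('n) - Suc i) > 0" if "i < CARD('n)" for i
      using in_X[OF f that] in_X[OF g that] that by (auto intro: s t)
    show "e f j \<subseteq> e f i" "e g j \<subseteq> e g i" if "i \<le> j" "j < CARD('n)" for i j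
      using chain[of _ j i] f g that by simp_all
    show "\<not> e f i \<subseteq> e f j" "\<not> e g i \<subseteq> e g j" if "i < j" "j < CARD('n)" for i j
      using chain[of _ i j] f g that by simp_all
    fix E F assume "E \<in> X" "F \<in> X"
    then show "face_center P F \<bullet> face_normal P E \<le> 1" "(face_center P F \<bullet> face_normal P E = 1) = (F \<subseteq> E)"
      using proper_chain_test[of F E] by (simp_all add: X_def inner_commute)
    show "E = F" if "F \<subseteq> E" "E \<subseteq> F" using that by blast
  qed
  then have "e f (CARD('n) - Suc i) = e g (CARD('n) - Suc i)" if "i < CARD('n)" for i using that by auto
  then show "f ! i = g ! i" if "i < CARD('n)" for i using that by (simp add: e_def)
qed

lemma scaled_polytope_dissection:
  "(*\<^sub>R) c ` P = (\<Union>f\<in>flags P. cone_map (\<lambda>k. c *\<^sub>R primal_frame f k) ` std_simplex_closed)"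
proof (intro equalityI subsetI)
  fix x assume "x \<in> (*\<^sub>R) c ` P"
  then obtain y where y: "y \<in> P" "x = c *\<^sub>R y" by blast
  have dP: "aff_dim P = int CARD('n)" using aff_dim_P by simp
  from primal_cover[OF face_of_refl[OF convex] dP y(1)] obtain F s where
    F: "\<forall>i\<le>CARD('n). F i face_of P \<and> aff_dim (F i) = int i" "\<forall>i<CARD('n). F i \<subseteq> F (Suc i)" "F CARD('n) = P"
    and s: "\<forall>i\<le>CARD('n). s i \<ge> 0" "(\<Sum>i\<le>CARD('n). s i) = (1::real)" and y_eq: "y = (\<Sum>i\<le>CARD('n). s i *\<^sub>R face_center P (F i))" by blast
  define f where "f = map F [0..<Suc CARD('n)]"
  have f: "f \<in> flags P" "\<And>i. i \<le> CARD('n) \<Longrightarrow> f ! i = F i" unfolding f_def using flagI[of F] F(1,2) by (auto simp del: upt_Suc)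
  have cP: "face_center P (F CARD('n)) = 0" using F by (simp add: face_center_def)
  have "{..CARD('n)} = insert CARD('n) {..<CARD('n)}" by auto
  then have y_eq': "y = (\<Sum>k<CARD('n). s k *\<^sub>R face_center P (F k))" and s1: "(\<Sum>k<CARD('n). s k) + s CARD('n) = 1"
    using y_eq s(2) cP by simp_all
  have "x = cone_map (\<lambda>k. c *\<^sub>R primal_frame f k) (\<chi> i. s (nat_of_idx i))"
    unfolding cone_map_nat y(2) y_eq' by (simp add: scaleR_sum_right primal_frame_def f(2) mult.commute)
  moreover have "(\<chi> i. s (nat_of_idx i)) \<in> (std_simplex_closed :: (real^'n idx) set)"
    using s(1) s1 sum_idx[where 'a='n, of s] less_imp_le[OF nat_of_idx_less] by (auto simp: std_simplex_closed_def)
  ultimately show "x \<in> (\<Union>f\<in>flags P. cone_map (\<lambda>k. c *\<^sub>R primal_frame f k) ` std_simplex_closed)" using f(1) by blast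
next
  fix x assume "x \<in> (\<Union>f\<in>flags P. cone_map (\<lambda>k. c *\<^sub>R primal_frame f k) ` std_simplex_closed)"
  then obtain f s where f: "f \<in> flags P" and s: "s \<in> std_simplex_closed" and x: "x = cone_map (\<lambda>k. c *\<^sub>R primal_frame f k) s" by blast
  have in_P: "primal_frame f k \<in> P" if "k < CARD('n)" for k
    using face_center_in[of "f ! k"] flagD(2)[OF f, of k] flag_nonempty[OF f, of k] face_of_imp_subset that
    unfolding primal_frame_def by fastforce
  \<comment> \<open>A point of the simplex is a convex combination of the centers and the origin, which takes the remaining weight.\<close>
  define u where "u = (\<lambda>j. case j of None \<Rightarrow> 1 - (\<Sum>i\<in>UNIV. s $ i) | Some i \<Rightarrow> s $ i)"
  define w where "w = (\<lambda>j. case j of None \<Rightarrow> 0 | Some i \<Rightarrow> primal_frame f (nat_of_idx (i :: 'n idx)))"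
  have "(\<Sum>j\<in>UNIV. u j *\<^sub>R w j) \<in> P"
  proof (rule convex_sum[OF _ convex])
    show "(\<Sum>j\<in>UNIV. u j) = 1" by (simp add: UNIV_option_conv sum.reindex u_def)
    show "u j \<ge> 0" for j using s by (auto simp: u_def std_simplex_closed_def split: option.splits)
    show "w j \<in> P" for j using in_P zero_in by (auto simp: w_def split: option.splits)
  qed simp
  also have "(\<Sum>j\<in>UNIV. u j *\<^sub>R w j) = cone_map (primal_frame f) s"
    by (simp add: UNIV_option_conv sum.reindex u_def w_def cone_map_def)
  finally have "cone_map (primal_frame f) s \<in> P" .
  moreover have "x = c *\<^sub>R cone_map (primal_frame f) s"
    unfolding x cone_map_def by (simp add: scaleR_sum_right mult.commute)
  ultimately show "x \<in> (*\<^sub>R) c ` P" by blast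
qed

text \<open>A combination \<open>\<xi>\<close> of the normals along a flag with nonnegative coefficients \<open>t\<^sub>k\<close> attains its
maximum on \<open>P\<close> at the vertex of the flag, where all these normals are 1. So \<open>\<xi>\<close> is in the polar
body at \<open>x\<close> if and only if \<open>\<Sum>k. t\<^sub>k * (1 - b\<^sub>k \<bullet> x) \<le> 1\<close>.\<close>

lemma polar_at_dissection:
  assumes x: "\<And>F. F face_of P \<Longrightarrow> F \<noteq> P \<Longrightarrow> face_normal P F \<bullet> x < 1"
  shows "polar_at P x = (\<Union>f\<in>flags P. cone_map (\<lambda>k. (1 / (1 - dual_frame f k \<bullet> x)) *\<^sub>R dual_frame f k) ` std_simplex_closed)"
proof -
  have pos: "1 - dual_frame f k \<bullet> x > 0" if "f \<in> flags P" "k < CARD('n)" for f k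
    using x[of "f ! k"] flagD(2)[OF that(1), of k] flag_proper[OF that] that(2) by (simp add: dual_frame_def)
  show ?thesis
  proof (intro equalityI subsetI)
    fix \<xi> assume xi: "\<xi> \<in> polar_at P x"
    obtain F t where F: "\<forall>i\<le>CARD('n). F i face_of P \<and> aff_dim (F i) = int i" "\<forall>i<CARD('n). F i \<subseteq> F (Suc i)"
      and t: "\<forall>i<CARD('n). t i \<ge> (0::real)" and xi_eq: "\<xi> = (\<Sum>i<CARD('n). t i *\<^sub>R face_normal P (F i))"
      using dual_cover_all[of \<xi>] by auto
    define f where "f = map F [0..<Suc CARD('n)]"
    have f: "f \<in> flags P" "\<And>i. i \<le> CARD('n) \<Longrightarrow> f ! i = F i" unfolding f_def using flagI[of F] F(1,2) by (auto simp del: upt_Suc)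
    have xi_eq': "\<xi> = (\<Sum>k<CARD('n). t k *\<^sub>R dual_frame f k)" unfolding xi_eq by (simp add: dual_frame_def f(2))
    define s where "s = (\<lambda>k. t k * (1 - dual_frame f k \<bullet> x))"
    define y where "y = face_center P (f ! 0)"
    have y: "y \<in> f ! 0" unfolding y_def using face_center_in flagD(2)[OF f(1), of 0] flag_nonempty[OF f(1), of 0] by auto
    then have yP: "y \<in> P" using flagD(2)[OF f(1), of 0] face_of_imp_subset by blast
    have "dual_frame f k \<bullet> y = 1" if "k < CARD('n)" for k
      using face_normal_eq_1[of "f ! k" y] y flag_mono[OF f(1), of 0 k] flagD(2)[OF f(1), of k] flag_proper[OF f(1) that] that
      by (auto simp: dual_frame_def)
    then have "\<xi> \<bullet> (y - x) = (\<Sum>k<CARD('n). s k)"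
      unfolding xi_eq' inner_sum_left s_def by (intro sum.cong) (auto simp: inner_diff_right right_diff_distrib)
    then have "(\<Sum>k<CARD('n). s k) \<le> 1" using xi yP by (auto simp: polar_at_def polar_def)
    moreover have "s k \<ge> 0" if "k < CARD('n)" for k using t pos[OF f(1) that] that by (simp add: s_def less_imp_le)
    ultimately have "(\<chi> i. s (nat_of_idx i)) \<in> (std_simplex_closed :: (real^'n idx) set)"
      using sum_idx[where 'a='n, of s] by (auto simp: std_simplex_closed_def)
    moreover have "\<xi> = cone_map (\<lambda>k. (1 / (1 - dual_frame f k \<bullet> x)) *\<^sub>R dual_frame f k) (\<chi> i. s (nat_of_idx i))"
      unfolding cone_map_nat xi_eq'
    proof (rule sum.cong[OF refl])
      fix k assume "k \<in> {..<CARD('n)}"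
      then show "t k *\<^sub>R dual_frame f k = s k *\<^sub>R (1 / (1 - dual_frame f k \<bullet> x)) *\<^sub>R dual_frame f k"
        using pos[OF f(1), of k] by (simp add: s_def)
    qed
    ultimately show "\<xi> \<in> (\<Union>f\<in>flags P. cone_map (\<lambda>k. (1 / (1 - dual_frame f k \<bullet> x)) *\<^sub>R dual_frame f k) ` std_simplex_closed)"
      using f(1) by blast
  next
    fix \<xi> assume "\<xi> \<in> (\<Union>f\<in>flags P. cone_map (\<lambda>k. (1 / (1 - dual_frame f k \<bullet> x)) *\<^sub>R dual_frame f k) ` std_simplex_closed)"
    then obtain f s where f: "f \<in> flags P" and s: "s \<in> std_simplex_closed"
      and xi: "\<xi> = cone_map (\<lambda>k. (1 / (1 - dual_frame f k \<bullet> x)) *\<^sub>R dual_frame f k) s" by blast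
    have "\<xi> \<bullet> (y - x) \<le> 1" if y: "y \<in> P" for y
    proof -
      have "\<xi> \<bullet> (y - x) = (\<Sum>i\<in>UNIV. s $ i * ((dual_frame f (nat_of_idx i) \<bullet> y - dual_frame f (nat_of_idx i) \<bullet> x) / (1 - dual_frame f (nat_of_idx i) \<bullet> x)))"
        unfolding xi cone_map_def inner_sum_left by (intro sum.cong) (auto simp: inner_diff_right right_diff_distrib diff_divide_distrib)
      also have "\<dots> \<le> (\<Sum>i\<in>UNIV. s $ i * 1)"
      proof (intro sum_mono mult_left_mono)
        fix i :: "'n idx"
        show "(dual_frame f (nat_of_idx i) \<bullet> y - dual_frame f (nat_of_idx i) \<bullet> x) / (1 - dual_frame f (nat_of_idx i) \<bullet> x) \<le> 1"
          using pos[OF f nat_of_idx_less[of i]] dual_frame_le[OF f nat_of_idx_less[of i] y] by (simp add: pos_divide_le_eq)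
        show "0 \<le> s $ i" using s by (simp add: std_simplex_closed_def)
      qed
      also have "\<dots> \<le> 1" using s by (simp add: std_simplex_closed_def)
      finally show ?thesis .
    qed
    then show "\<xi> \<in> polar_at P x" by (auto simp: polar_at_def polar_def)
  qed
qed

lemma emeasure_polar_at:
  assumes x: "\<And>F. F face_of P \<Longrightarrow> F \<noteq> P \<Longrightarrow> face_normal P F \<bullet> x < 1"
  shows "emeasure lborel (polar_at P x) =
    ennreal (\<Sum>g\<in>flags P. frame_vol (dual_frame g) / fact CARD('n) * (\<Prod>k<CARD('n). \<bar>1 / (1 - dual_frame g k \<bullet> x)\<bar>))"
proof -
  have pos: "1 - dual_frame f k \<bullet> x > 0" if "f \<in> flags P" "k < CARD('n)" for f k
    using x[of "f ! k"] flagD(2)[OF that(1), of k] flag_proper[OF that] that(2) by (simp add: dual_frame_def)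
  have "emeasure lborel (polar_at P x) =
    ennreal (\<Sum>g\<in>flags P. frame_vol (\<lambda>k. (1 / (1 - dual_frame g k \<bullet> x)) *\<^sub>R dual_frame g k) / fact CARD('n))"
  proof (rule emeasure_dissection[OF finite_flags polar_at_dissection[OF x]])
    fix f g and s t :: "real^'n idx"
    assume f: "f \<in> flags P" and g: "g \<in> flags P" and s: "s \<in> std_simplex_open" and t: "t \<in> std_simplex_open"
      and eq: "cone_map (\<lambda>k. (1 / (1 - dual_frame f k \<bullet> x)) *\<^sub>R dual_frame f k) s = cone_map (\<lambda>k. (1 / (1 - dual_frame g k \<bullet> x)) *\<^sub>R dual_frame g k) t"
    show "f = g"
    proof (rule dual_frame_disjoint[OF f g])
      show "(\<Sum>k<CARD('n). (s $ idx_of_nat k * (1 / (1 - dual_frame f k \<bullet> x))) *\<^sub>R dual_frame f k) =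
        (\<Sum>k<CARD('n). (t $ idx_of_nat k * (1 / (1 - dual_frame g k \<bullet> x))) *\<^sub>R dual_frame g k)"
        using eq unfolding cone_map_altdef scaleR_scaleR .
      show "s $ idx_of_nat k * (1 / (1 - dual_frame f k \<bullet> x)) > 0" "t $ idx_of_nat k * (1 / (1 - dual_frame g k \<bullet> x)) > 0"
        if "k < CARD('n)" for k
        using s t pos[OF f that] pos[OF g that] by (auto simp: std_simplex_open_def)
    qed
  qed auto
  then show ?thesis by (simp only: frame_vol_scale mult.commute times_divide_eq_left)
qed

definition slack_matrix :: "(real^'n) set list \<Rightarrow> (real^'n) set list \<Rightarrow> nat \<Rightarrow> nat \<Rightarrow> real" where
  "slack_matrix f g i k = slack P (f ! i) (lower_face g k)"

text \<open>In homogeneous coordinates, the linear form of the column \<open>Suc k\<close> is \<open>S\<close> times the slack of the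
point \<open>x\<close> against the \<open>k\<close>-th normal, where \<open>S\<close> is the sum of all coordinates. The column of the
empty face is \<open>S\<close> itself and supplies the barycentric coordinate of the vertex \<open>0\<close>.\<close>

lemma ratio_prod_eq:
  fixes z :: "real^'n idx" and R l :: real
  assumes f: "f \<in> flags P" and g: "g \<in> flags P" and l_def: "l = 1 - exp (- R)"
    and pos: "\<And>k. k < CARD('n) \<Longrightarrow> 1 - dual_frame g k \<bullet> cone_map (\<lambda>k. l *\<^sub>R primal_frame f k) (softmax z) \<ge> 0"
  shows "softmax_jacobian z * (\<Prod>k<CARD('n). \<bar>1 / (1 - dual_frame g k \<bullet> cone_map (\<lambda>k. l *\<^sub>R primal_frame f k) (softmax z))\<bar>) =
    (\<Prod>k\<le>CARD('n). ratio (slack_matrix f g) R z k)"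
proof -
  define S where "S = 1 + (\<Sum>j\<in>UNIV. exp (- z $ j))"
  have S: "S > 0" unfolding S_def by (rule sum_exp_pos)
  have levels: "(\<Sum>i\<le>CARD('n). exp (- level z i) * c i) = (\<Sum>i\<in>UNIV. exp (- z $ i) * c (nat_of_idx i)) + c CARD('n)" for c
  proof -
    have "(\<Sum>i\<le>CARD('n). exp (- level z i) * c i) = (\<Sum>i<CARD('n). exp (- level z i) * c i) + c CARD('n)"
      by (simp add: lessThan_Suc_atMost[symmetric] level_def)
    then show ?thesis using sum_idx[where 'a='n, of "\<lambda>i. exp (- level z i) * c i"] by simp
  qed
  have r0: "row_form (slack_matrix f g) R z 0 = S"
    unfolding row_form_def levels by (simp add: entry_def slack_matrix_def slack_empty S_def)
  have rk: "row_form (slack_matrix f g) R z (Suc k) = S * (1 - dual_frame g k \<bullet> cone_map (\<lambda>k. l *\<^sub>R primal_frame f k) (softmax z))" if "k < CARD('n)" for k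
  proof -
    have e: "entry (slack_matrix f g) R i (Suc k) = 1 - l * (dual_frame g k \<bullet> primal_frame f i)" for i
      by (simp add: entry_def slack_matrix_def slack_def dual_frame_def primal_frame_def l_def algebra_simps)
    have e': "entry (slack_matrix f g) R CARD('n) (Suc k) = 1"
      unfolding e primal_frame_def by (simp add: flag_top[OF f] face_center_def)
    have "row_form (slack_matrix f g) R z (Suc k) = S - (\<Sum>i\<in>UNIV. exp (- z $ i) * (l * (dual_frame g k \<bullet> primal_frame f (nat_of_idx i))))"
      unfolding row_form_def levels e' by (simp add: e S_def right_diff_distrib sum_subtractf)
    also have "(\<Sum>i\<in>UNIV. exp (- z $ i) * (l * (dual_frame g k \<bullet> primal_frame f (nat_of_idx i)))) =
      S * (dual_frame g k \<bullet> cone_map (\<lambda>k. l *\<^sub>R primal_frame f k) (softmax z))"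
      unfolding inner_cone_map sum_distrib_left using S
      by (intro sum.cong) (auto simp: softmax_def S_def)
    finally show ?thesis by (simp add: right_diff_distrib)
  qed
  have "(\<Prod>k\<le>CARD('n). ratio (slack_matrix f g) R z k) = (\<Prod>k\<le>CARD('n). exp (- level z k)) / (\<Prod>k\<le>CARD('n). row_form (slack_matrix f g) R z k)"
    by (simp add: ratio_def prod_dividef)
  also have "(\<Prod>k\<le>CARD('n). exp (- level z k)) = (\<Prod>i\<in>UNIV. exp (- z $ i))"
    using prod_idx[where 'a='n, of "\<lambda>k. exp (- level z k)"] by (simp add: lessThan_Suc_atMost[symmetric] level_def[of z "CARD('n)"])
  also have "(\<Prod>k\<le>CARD('n). row_form (slack_matrix f g) R z k) = S * (\<Prod>k<CARD('n). row_form (slack_matrix f g) R z (Suc k))"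
    by (simp only: lessThan_Suc_atMost[symmetric] prod.lessThan_Suc_shift r0)
  also have "(\<Prod>k<CARD('n). row_form (slack_matrix f g) R z (Suc k)) =
     S ^ CARD('n) * (\<Prod>k<CARD('n). 1 - dual_frame g k \<bullet> cone_map (\<lambda>k. l *\<^sub>R primal_frame f k) (softmax z))"
    by (simp add: rk prod.distrib)
  also have "(\<Prod>i\<in>UNIV. exp (- z $ i)) = (\<Prod>i\<in>UNIV. softmax z $ i * S)"
    using S by (intro prod.cong) (auto simp: softmax_def S_def)
  also have "\<dots> = (\<Prod>i\<in>UNIV. softmax z $ i) * S ^ CARD('n)" by (simp add: prod.distrib)
  finally have 1: "(\<Prod>k\<le>CARD('n). ratio (slack_matrix f g) R z k) =
    (\<Prod>i\<in>UNIV. softmax z $ i) * (1 / S) / (\<Prod>k<CARD('n). 1 - dual_frame g k \<bullet> cone_map (\<lambda>k. l *\<^sub>R primal_frame f k) (softmax z))"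
    using S by simp
  have 2: "softmax_jacobian z = (\<Prod>i\<in>UNIV. softmax z $ i) * (1 / S)"
    unfolding softmax_jacobian_def one_minus_sum_softmax S_def ..
  have 3: "(\<Prod>k<CARD('n). \<bar>1 / (1 - dual_frame g k \<bullet> cone_map (\<lambda>k. l *\<^sub>R primal_frame f k) (softmax z))\<bar>) =
    1 / (\<Prod>k<CARD('n). 1 - dual_frame g k \<bullet> cone_map (\<lambda>k. l *\<^sub>R primal_frame f k) (softmax z))"
    unfolding prod_dividef[symmetric] using pos by (simp add: prod_dividef)
  show ?thesis unfolding 1 2 3 by simp
qed

lemma funk_ball_eq: "funk_ball P 0 R = (*\<^sub>R) (1 - exp (- R)) ` P"
  by (simp add: funk_ball_def)

lemma ball_normal_less:
  assumes "R > 0" "x \<in> (*\<^sub>R) (1 - exp (- R)) ` P" "F face_of P" "F \<noteq> P"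
  shows "face_normal P F \<bullet> x < 1"
proof -
  obtain y where y: "y \<in> P" "x = (1 - exp (- R)) *\<^sub>R y" using assms by blast
  have "(1 - exp (- R)) * (face_normal P F \<bullet> y) \<le> (1 - exp (- R)) * 1"
    using face_normal(1)[OF assms(3,4) y(1)] assms(1) by (intro mult_left_mono) auto
  then show ?thesis using y by (simp add: order_le_less_trans)
qed

definition pair_integral :: "(real^'n) set list \<Rightarrow> (real^'n) set list \<Rightarrow> real \<Rightarrow> real" where
  "pair_integral f g R = (LINT z|lborel. (\<Prod>k\<le>CARD('n). ratio (slack_matrix f g) R (z :: real^'n idx) k))"

lemma funk_volume_sum:
  assumes R: "R > 0" and vol: "\<And>f. f \<in> flags P \<Longrightarrow> frame_vol (primal_frame f) \<noteq> 0"
    and int: "\<And>f g. f \<in> flags P \<Longrightarrow> g \<in> flags P \<Longrightarrow> integrable lborel (\<lambda>z :: real^'n idx. \<Prod>k\<le>CARD('n). ratio (slack_matrix f g) R z k)"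
    and nonneg: "\<And>f g. f \<in> flags P \<Longrightarrow> g \<in> flags P \<Longrightarrow> pair_integral f g R \<ge> 0"
  shows "measure lborel (ball (0::real^'n) 1) * enn2real (funk_vol P (funk_ball P 0 R)) =
    (1 - exp (- R)) ^ CARD('n) / fact CARD('n) *
      (\<Sum>f\<in>flags P. \<Sum>g\<in>flags P. frame_vol (primal_frame f) * frame_vol (dual_frame g) * pair_integral f g R)"
proof -
  define l where "l = 1 - exp (- R)"
  have l: "l > 0" using R by (simp add: l_def)
  define q where "q = (\<lambda>f k. l *\<^sub>R primal_frame f k)"
  define h where "h = (\<lambda>x. \<Sum>g\<in>flags P. frame_vol (dual_frame g) / fact CARD('n) * (\<Prod>k<CARD('n). \<bar>1 / (1 - dual_frame g k \<bullet> x)\<bar>))"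
  have h0: "h x \<ge> 0" for x unfolding h_def by (intro sum_nonneg mult_nonneg_nonneg prod_nonneg) (auto simp: frame_vol_nonneg)
  have [measurable]: "h \<in> borel_measurable borel" unfolding h_def by measurable
  have pos_vol: "frame_vol (q f) = l ^ CARD('n) * frame_vol (primal_frame f)" for f
    unfolding q_def frame_vol_scale using l by simp
  have dis: "f = g" if f: "f \<in> flags P" and g: "g \<in> flags P" and s: "s \<in> std_simplex_open" and t: "t \<in> std_simplex_open"
    and eq: "cone_map (q f) s = cone_map (q g) t" for f g s t
  proof (rule primal_frame_disjoint[OF f g])
    show "(\<Sum>k<CARD('n). (s $ idx_of_nat k * l) *\<^sub>R primal_frame f k) = (\<Sum>k<CARD('n). (t $ idx_of_nat k * l) *\<^sub>R primal_frame g k)"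
      using eq unfolding cone_map_altdef q_def scaleR_scaleR .
    show "s $ idx_of_nat k * l > 0" "t $ idx_of_nat k * l > 0" for k
      using s t l by (auto simp: std_simplex_open_def)
  qed
  define V where "V = (\<integral>\<^sup>+x\<in>funk_ball P 0 R. emeasure lborel (polar_at P x) \<partial>lborel)"
  have cover: "funk_ball P 0 R = (\<Union>f\<in>flags P. cone_map (q f) ` std_simplex_closed)"
    unfolding funk_ball_eq q_def l_def[symmetric] by (rule scaled_polytope_dissection)
  have "V = (\<integral>\<^sup>+x. ennreal (h x) * indicator (funk_ball P 0 R) x \<partial>lborel)"
    unfolding V_def
  proof (rule nn_integral_cong)
    fix x
    show "emeasure lborel (polar_at P x) * indicator (funk_ball P 0 R) x = ennreal (h x) * indicator (funk_ball P 0 R) x"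
      using emeasure_polar_at[of x] ball_normal_less[OF R, of x] by (cases "x \<in> funk_ball P 0 R") (auto simp: funk_ball_eq h_def)
  qed
  also have "\<dots> = (\<Sum>f\<in>flags P. \<integral>\<^sup>+x. ennreal (h x) * indicator (cone_map (q f) ` std_simplex_open) x \<partial>lborel)"
    by (rule nn_integral_dissection[OF finite_flags cover dis]) auto
  also have "\<dots> = (\<Sum>f\<in>flags P. ennreal (\<Sum>g\<in>flags P. l ^ CARD('n) / fact CARD('n) * (frame_vol (primal_frame f) * frame_vol (dual_frame g) * pair_integral f g R)))"
  proof (rule sum.cong[OF refl])
    fix f assume f: "f \<in> flags P"
    have in_ball: "cone_map (q f) (softmax z) \<in> funk_ball P 0 R" for z
      unfolding cover using f range_softmax std_simplex_open_subset by blast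
    have pt: "frame_vol (q f) * softmax_jacobian z * h (cone_map (q f) (softmax z)) =
      (\<Sum>g\<in>flags P. l ^ CARD('n) / fact CARD('n) * (frame_vol (primal_frame f) * frame_vol (dual_frame g)) * (\<Prod>k\<le>CARD('n). ratio (slack_matrix f g) R z k))" for z
      unfolding h_def sum_distrib_left
    proof (rule sum.cong[OF refl])
      fix g assume g: "g \<in> flags P"
      have "1 - dual_frame g k \<bullet> cone_map (q f) (softmax z) \<ge> 0" if "k < CARD('n)" for k
        using ball_normal_less[OF R in_ball[unfolded funk_ball_eq] flagD(2)[OF g] flag_proper[OF g that]] that by (simp add: dual_frame_def less_imp_le)
      from ratio_prod_eq[OF f g l_def this[unfolded q_def]]
      show "frame_vol (q f) * softmax_jacobian z * (frame_vol (dual_frame g) / fact CARD('n) * (\<Prod>k<CARD('n). \<bar>1 / (1 - dual_frame g k \<bullet> cone_map (q f) (softmax z))\<bar>)) =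
        l ^ CARD('n) / fact CARD('n) * (frame_vol (primal_frame f) * frame_vol (dual_frame g)) * (\<Prod>k\<le>CARD('n). ratio (slack_matrix f g) R z k)"
        unfolding pos_vol by (simp add: q_def)
    qed
    have "frame_vol (q f) \<noteq> 0" unfolding pos_vol using vol[OF f] l by simp
    then have "(\<integral>\<^sup>+x. ennreal (h x) * indicator (cone_map (q f) ` std_simplex_open) x \<partial>lborel) =
      (\<integral>\<^sup>+z. ennreal (frame_vol (q f) * softmax_jacobian z * h (cone_map (q f) (softmax z))) \<partial>lborel)"
      by (rule nn_integral_cone_simplex) (auto simp: h0)
    also have "\<dots> = ennreal (LINT z|lborel. frame_vol (q f) * softmax_jacobian z * h (cone_map (q f) (softmax z)))"
    proof (rule nn_integral_eq_integral)
      show "integrable lborel (\<lambda>z. frame_vol (q f) * softmax_jacobian z * h (cone_map (q f) (softmax z)))"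
        unfolding pt using int[OF f] by (intro Bochner_Integration.integrable_sum integrable_mult_right) auto
      show "AE z in lborel. 0 \<le> frame_vol (q f) * softmax_jacobian z * h (cone_map (q f) (softmax z))"
        by (simp add: frame_vol_nonneg softmax_jacobian_nonneg h0)
    qed
    also have "(LINT z|lborel. frame_vol (q f) * softmax_jacobian z * h (cone_map (q f) (softmax z))) =
      (\<Sum>g\<in>flags P. l ^ CARD('n) / fact CARD('n) * (frame_vol (primal_frame f) * frame_vol (dual_frame g)) * pair_integral f g R)"
      unfolding pt pair_integral_def using int[OF f] by (subst Bochner_Integration.integral_sum) auto
    finally show "(\<integral>\<^sup>+x. ennreal (h x) * indicator (cone_map (q f) ` std_simplex_open) x \<partial>lborel) =
      ennreal (\<Sum>g\<in>flags P. l ^ CARD('n) / fact CARD('n) * (frame_vol (primal_frame f) * frame_vol (dual_frame g) * pair_integral f g R))"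
      by (simp only: mult.assoc)
  qed
  also have "\<dots> = ennreal (\<Sum>f\<in>flags P. \<Sum>g\<in>flags P. l ^ CARD('n) / fact CARD('n) * (frame_vol (primal_frame f) * frame_vol (dual_frame g) * pair_integral f g R))"
  proof (rule sum_ennreal)
    fix f assume "f \<in> flags P"
    then show "0 \<le> (\<Sum>g\<in>flags P. l ^ CARD('n) / fact CARD('n) * (frame_vol (primal_frame f) * frame_vol (dual_frame g) * pair_integral f g R))"
      using nonneg l by (intro sum_nonneg mult_nonneg_nonneg divide_nonneg_nonneg frame_vol_nonneg) auto
  qed
  finally have V: "V = ennreal (\<Sum>f\<in>flags P. \<Sum>g\<in>flags P. l ^ CARD('n) / fact CARD('n) * (frame_vol (primal_frame f) * frame_vol (dual_frame g) * pair_integral f g R))" .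
  define W where "W = (\<Sum>f\<in>flags P. \<Sum>g\<in>flags P. l ^ CARD('n) / fact CARD('n) * (frame_vol (primal_frame f) * frame_vol (dual_frame g) * pair_integral f g R))"
  have W: "W \<ge> 0"
    unfolding W_def using nonneg l by (intro sum_nonneg mult_nonneg_nonneg divide_nonneg_nonneg frame_vol_nonneg) auto
  define \<omega> where "\<omega> = measure lborel (ball (0::real^'n) 1)"
  have om: "emeasure lborel (ball (0::real^'n) 1) = ennreal \<omega>"
    unfolding \<omega>_def using emeasure_bounded_finite[of "ball (0::real^'n) 1"] by (intro emeasure_eq_ennreal_measure) auto
  have "\<omega> > 0" unfolding \<omega>_def by (simp add: content_ball_pos)
  then have "funk_vol P (funk_ball P 0 R) = ennreal (W / \<omega>)"
    unfolding funk_vol_def V_def[symmetric] V W_def[symmetric] om using W by (simp add: divide_ennreal)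
  then have "\<omega> * enn2real (funk_vol P (funk_ball P 0 R)) = W" using W \<open>\<omega> > 0\<close> by simp
  then show ?thesis unfolding \<omega>_def W_def l_def by (simp only: sum_distrib_left)
qed

end

section \<open>Which pairs of flags count\<close>

text \<open>As the last row and the first column of \<open>A\<close> are constantly 1, the rows of the given matrix are partial sums
(\<open>MU\<close>) of the differences \<open>S\<close> of successive rows of \<open>A\<close>. The matrix of these differences has one entry above the
diagonal, which a column operation (\<open>ME\<close>) removes. Both operations are unipotent.\<close>

lemma det_one_minus_almost_triangular:
  fixes A :: "nat \<Rightarrow> nat \<Rightarrow> real"
  assumes a: "a < CARD('n::finite)" and A0: "\<And>i. i \<le> CARD('n) \<Longrightarrow> A i 0 = 1" and An: "\<And>k. k \<le> CARD('n) \<Longrightarrow> A CARD('n) k = 1"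
    and zero: "\<And>i k. i < k \<Longrightarrow> k \<le> CARD('n) \<Longrightarrow> \<not> (k = Suc i \<and> i = a) \<Longrightarrow> A i k = 0" and nz: "A a a \<noteq> 0"
  shows "det (\<chi> i j. 1 - A (nat_of_idx i) (Suc (nat_of_idx j)) :: real^('n idx)^('n idx)) =
    (A (Suc a) (Suc a) * A a a - A a (Suc a) * A (Suc a) a) * (\<Prod>k\<in>{..CARD('n)} - {a, Suc a}. A k k)"
proof -
  define r where "r = A a (Suc a) / A a a"
  define S where "S = (\<lambda>m k. A (Suc m) k - A m k)"
  define T where "T = (\<lambda>m j. S m (Suc j) - (if j = a then r * S m a else 0))"
  define MU where "MU = (\<chi> i m. if nat_of_idx i \<le> nat_of_idx m then 1 else 0 :: real^('n idx)^('n idx))"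
  define MT where "MT = (\<chi> m j. T (nat_of_idx m) (nat_of_idx j) :: real^('n idx)^('n idx))"
  define ME where "ME = (\<chi> l j. (if nat_of_idx l = nat_of_idx j then 1 else 0) + (if Suc (nat_of_idx l) = a \<and> nat_of_idx j = a then r else 0) :: real^('n idx)^('n idx))"
  have TE: "(MT ** ME) $ m $ j = S (nat_of_idx m) (Suc (nat_of_idx j))" for m j
  proof -
    let ?m = "nat_of_idx m" and ?j = "nat_of_idx j"
    have "(MT ** ME) $ m $ j = (\<Sum>l<CARD('n). T ?m l * ((if l = ?j then 1 else 0) + (if Suc l = a \<and> ?j = a then r else 0)))"
      unfolding matrix_matrix_mult_def MT_def ME_def
      using sum_idx[where 'a='n, of "\<lambda>l. T ?m l * ((if l = ?j then 1 else 0) + (if Suc l = a \<and> ?j = a then r else 0))"] by simp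
    also have "\<dots> = (\<Sum>l<CARD('n). if l = ?j then T ?m l else 0) + (\<Sum>l<CARD('n). if Suc l = a \<and> ?j = a then T ?m l * r else 0)"
      by (subst sum.distrib[symmetric]) (intro sum.cong, auto simp: distrib_left)
    also have "(\<Sum>l<CARD('n). if l = ?j then T ?m l else 0) = T ?m ?j" by simp
    also have "(\<Sum>l<CARD('n). if Suc l = a \<and> ?j = a then T ?m l * r else 0) = (if ?j = a then r * S ?m a else 0)"
    proof (cases "?j = a \<and> a > 0")
      case True
      then have "(\<Sum>l<CARD('n). if Suc l = a \<and> ?j = a then T ?m l * r else 0) = (\<Sum>l<CARD('n). if l = a - 1 then T ?m l * r else 0)"
        by (intro sum.cong) auto
      also have "\<dots> = T ?m (a - 1) * r" using a by simp
      also have "T ?m (a - 1) = S ?m a" using True by (auto simp: T_def)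
      finally show ?thesis using True by (simp add: mult.commute)
    next
      case False
      have "S ?m 0 = 0" using A0[of ?m] A0[of "Suc ?m"] nat_of_idx_less[of m] by (simp add: S_def)
      with False show ?thesis by (auto intro: sum.neutral)
    qed
    finally show ?thesis by (simp add: T_def)
  qed
  have "(MU ** (MT ** ME)) $ i $ j = 1 - A (nat_of_idx i) (Suc (nat_of_idx j))" for i j
  proof -
    let ?i = "nat_of_idx i" and ?k = "Suc (nat_of_idx j)"
    have "(MU ** (MT ** ME)) $ i $ j = (\<Sum>m\<in>UNIV. MU $ i $ m * (MT ** ME) $ m $ j)"
      by (simp add: matrix_matrix_mult_def)
    also have "\<dots> = (\<Sum>m<CARD('n). if ?i \<le> m then S m ?k else 0)"
      unfolding TE using sum_idx[where 'a='n, of "\<lambda>m. if ?i \<le> m then S m ?k else 0"] by (simp add: MU_def if_distrib[of "\<lambda>x. x * _"] cong: if_cong)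
    also have "\<dots> = (\<Sum>m=?i..<CARD('n). S m ?k)"
      by (rule sum.mono_neutral_cong_right) auto
    also have "\<dots> = A CARD('n) ?k - A ?i ?k"
      unfolding S_def using less_imp_le[OF nat_of_idx_less[of i]] by (intro sum_Suc_diff')
    finally show ?thesis using An[of ?k] nat_of_idx_less[of j] by simp
  qed
  then have M: "(\<chi> i j. 1 - A (nat_of_idx i) (Suc (nat_of_idx j)) :: real^('n idx)^('n idx)) = MU ** (MT ** ME)"
    by (simp add: vec_eq_iff)
  have "det MU = 1"
    by (subst det_upperdiagonal) (auto simp: MU_def less_idx_def)
  moreover have "det ME = 1"
  proof (subst det_upperdiagonal)
    show "ME $ i $ j = 0" if "i > j" for i j using that by (auto simp: ME_def less_idx_def)
    show "(\<Prod>i\<in>UNIV. ME $ i $ i) = 1" by (intro prod.neutral) (auto simp: ME_def)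
  qed
  moreover have "det MT = (\<Prod>j<CARD('n). T j j)"
  proof (subst det_lowerdiagonal)
    fix i j :: "'n idx" assume ij: "i < j"
    define m l where "m = nat_of_idx i" and "l = nat_of_idx j"
    have ml: "m < l" "l < CARD('n)" using ij by (auto simp: m_def l_def less_idx_def)
    have Saa: "S m a = (if Suc m = a then A a a else 0)" if "l = a"
      using zero[of m a] zero[of "Suc m" a] ml that a by (auto simp: S_def)
    have "A m (Suc l) = 0" using ml by (intro zero) auto
    moreover have "A (Suc m) (Suc l) = (if Suc m = a \<and> l = a then A a (Suc a) else 0)"
      using ml by (auto intro!: zero)
    ultimately have "S m (Suc l) = (if Suc m = a \<and> l = a then A a (Suc a) else 0)" by (simp add: S_def)
    then have "T m l = 0" using Saa nz by (auto simp: T_def r_def)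
    then show "MT $ i $ j = 0" by (simp add: MT_def m_def l_def)
  next
    show "(\<Prod>i\<in>UNIV. MT $ i $ i) = (\<Prod>j<CARD('n). T j j)"
      using prod_idx[where 'a='n, of "\<lambda>j. T j j"] by (simp add: MT_def)
  qed
  ultimately have "det (\<chi> i j. 1 - A (nat_of_idx i) (Suc (nat_of_idx j)) :: real^('n idx)^('n idx)) = (\<Prod>j<CARD('n). T j j)"
    unfolding M det_mul by simp
  also have "\<dots> = T a a * (\<Prod>j\<in>{..<CARD('n)} - {a}. T j j)" using a by (intro prod.remove) auto
  also have "(\<Prod>j\<in>{..<CARD('n)} - {a}. T j j) = (\<Prod>j\<in>{..<CARD('n)} - {a}. A (Suc j) (Suc j))"
    by (intro prod.cong) (auto simp: T_def S_def intro!: zero)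
  also have "\<dots> = (\<Prod>k\<in>{1..CARD('n)} - {Suc a}. A k k)"
    by (rule prod.reindex_bij_witness[of _ "\<lambda>k. k - 1" Suc]) auto
  also have "\<dots> = (\<Prod>k\<in>{..CARD('n)} - {Suc a}. A k k)"
    using A0[of 0] by (intro prod.mono_neutral_left) (auto simp: Suc_le_eq intro!: gr0I)
  also have "\<dots> = A a a * (\<Prod>k\<in>{..CARD('n)} - {Suc a} - {a}. A k k)" using a by (intro prod.remove) auto
  also have "{..CARD('n)} - {Suc a} - {a} = {..CARD('n)} - {a, Suc a}" by auto
  also have "T a a = A (Suc a) (Suc a) - r * A (Suc a) a"
    using nz by (simp add: T_def S_def r_def right_diff_distrib)
  finally show ?thesis using nz by (simp add: r_def algebra_simps)
qed

context flag_polytope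
begin

definition differences :: "(real^'n) set list \<Rightarrow> (real^'n) set list \<Rightarrow> nat set" where
  "differences f g = {i. i < CARD('n) \<and> f ! i \<noteq> g ! i}"

lemma differences_less: "differences f g \<subseteq> {..<CARD('n)}"
  by (auto simp: differences_def)

lemma slack_matrix_nonneg:
  assumes "f \<in> flags P" "g \<in> flags P" "i \<le> CARD('n)" "k \<le> CARD('n)"
  shows "slack_matrix f g i k \<ge> 0"
  unfolding slack_matrix_def using lower_face_flag[OF assms(2,4)] flagD(2)[OF assms(1,3)] flag_nonempty[OF assms(1,3)] by (intro slack_nonneg)

lemma slack_matrix_eq_0_iff:
  assumes "f \<in> flags P" "g \<in> flags P" "i \<le> CARD('n)" "k \<le> CARD('n)"
  shows "slack_matrix f g i k = 0 \<longleftrightarrow> f ! i \<subseteq> lower_face g k"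
  unfolding slack_matrix_def using lower_face_flag[OF assms(2,4)] flagD(2)[OF assms(1,3)] flag_nonempty[OF assms(1,3)] by (intro slack_eq_0_iff)

lemma slack_matrix_pos_iff:
  assumes "f \<in> flags P" "g \<in> flags P" "i \<le> CARD('n)" "k \<le> CARD('n)"
  shows "slack_matrix f g i k > 0 \<longleftrightarrow> \<not> f ! i \<subseteq> lower_face g k"
  using slack_matrix_nonneg[OF assms] slack_matrix_eq_0_iff[OF assms] by linarith

lemma slack_matrix_pos:
  assumes "f \<in> flags P" "g \<in> flags P" "k \<le> i" "i \<le> CARD('n)"
  shows "slack_matrix f g i k > 0"
proof -
  have "\<not> f ! i \<subseteq> lower_face g k"
    using aff_dim_subset[of "f ! i" "lower_face g k"] flagD(3)[OF assms(1,4)] lower_face_flag(3)[OF assms(2), of k] assms(3,4) by auto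
  then show ?thesis using slack_matrix_pos_iff assms by simp
qed

lemma slack_matrix_pos_differences:
  assumes "f \<in> flags P" "g \<in> flags P" "j \<in> differences f g"
  shows "slack_matrix f g j (Suc j) > 0"
proof -
  have "\<not> f ! j \<subseteq> g ! j"
    using face_subset_aff_dim_eq[of "f ! j" "g ! j"] flagD(2,3)[OF assms(1), of j] flagD(2,3)[OF assms(2), of j] assms(3) by (auto simp: differences_def)
  then show ?thesis using assms slack_matrix_pos_iff[OF assms(1,2), of j "Suc j"] by (simp add: differences_def)
qed

lemma slack_matrix_zero:
  assumes f: "f \<in> flags P" and g: "g \<in> flags P" and card: "card (differences f g) \<le> 1"
    and ik: "i < k" "k \<le> CARD('n)" "\<not> (k = Suc i \<and> i \<in> differences f g)"
  shows "slack_matrix f g i k = 0"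
proof -
  have fin: "finite (differences f g)" using differences_less finite_subset by blast
  have "f ! i \<subseteq> g ! (k - 1)"
  proof (cases "i \<in> differences f g")
    case False
    then have "f ! i = g ! i" using ik by (auto simp: differences_def)
    then show ?thesis using flag_mono[OF g, of i "k - 1"] ik by simp
  next
    case True
    then have "k - 1 \<notin> differences f g" using card fin ik card_le_Suc0_iff_eq[OF fin] by (metis One_nat_def Suc_pred' bot_nat_0.not_eq_extremum not_less_zero)
    then have "f ! (k - 1) = g ! (k - 1)" using ik by (auto simp: differences_def)
    then show ?thesis using flag_mono[OF f, of i "k - 1"] ik by simp
  qed
  then show ?thesis using slack_matrix_eq_0_iff[OF f g, of i k] ik by (simp add: lower_face_def)
qed

lemma slack_matrix_first: "slack_matrix f g i 0 = 1"
  by (simp add: slack_matrix_def slack_empty)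

lemma slack_matrix_last: "f \<in> flags P \<Longrightarrow> slack_matrix f g CARD('n) k = 1"
  by (simp add: slack_matrix_def flag_top slack_P)

lemma frame_vol_mult_slack:
  assumes f: "f \<in> flags P" and g: "g \<in> flags P" and a: "a < CARD('n)" and D: "differences f g \<subseteq> {a}"
  defines "A \<equiv> slack_matrix f g"
  shows "frame_vol (primal_frame f) * frame_vol (dual_frame g) =
    \<bar>A a (Suc a) * A (Suc a) a - A (Suc a) (Suc a) * A a a\<bar> * (\<Prod>k\<in>{..CARD('n)} - {a, Suc a}. A k k)"
proof -
  have card: "card (differences f g) \<le> 1" using card_mono[OF _ D] by simp
  have "(\<chi> i j. primal_frame f (nat_of_idx i) \<bullet> dual_frame g (nat_of_idx j) :: real^('n idx)^('n idx)) = (\<chi> i j. 1 - A (nat_of_idx i) (Suc (nat_of_idx j)))"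
    by (simp add: A_def slack_matrix_def slack_def primal_frame_def dual_frame_def vec_eq_iff inner_commute)
  then have "frame_vol (primal_frame f) * frame_vol (dual_frame g) = \<bar>det (\<chi> i j. 1 - A (nat_of_idx i) (Suc (nat_of_idx j)) :: real^('n idx)^('n idx))\<bar>"
    unfolding frame_vol_mult by simp
  also have "det (\<chi> i j. 1 - A (nat_of_idx i) (Suc (nat_of_idx j)) :: real^('n idx)^('n idx)) =
      (A (Suc a) (Suc a) * A a a - A a (Suc a) * A (Suc a) a) * (\<Prod>k\<in>{..CARD('n)} - {a, Suc a}. A k k)"
  proof (rule det_one_minus_almost_triangular[OF a])
    show "A i 0 = 1" "A CARD('n) k = 1" for i k unfolding A_def by (simp_all add: slack_matrix_first slack_matrix_last[OF f])
    show "A i k = 0" if "i < k" "k \<le> CARD('n)" "\<not> (k = Suc i \<and> i = a)" for i k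
      unfolding A_def using that D by (intro slack_matrix_zero[OF f g card]) auto
    show "A a a \<noteq> 0" unfolding A_def using slack_matrix_pos[OF f g, of a a] a by simp
  qed
  also have "\<bar>\<dots>\<bar> = \<bar>A (Suc a) (Suc a) * A a a - A a (Suc a) * A (Suc a) a\<bar> * (\<Prod>k\<in>{..CARD('n)} - {a, Suc a}. \<bar>A k k\<bar>)"
    by (simp add: abs_mult abs_prod)
  also have "(\<Prod>k\<in>{..CARD('n)} - {a, Suc a}. \<bar>A k k\<bar>) = (\<Prod>k\<in>{..CARD('n)} - {a, Suc a}. A k k)"
    unfolding A_def using slack_matrix_pos[OF f g] by (intro prod.cong) (auto intro!: abs_of_pos)
  finally show ?thesis by (simp add: abs_minus_commute)
qed

lemma differences_self: "differences f f = {}"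
  by (simp add: differences_def)

lemma frame_vol_mult_self:
  assumes f: "f \<in> flags P"
  shows "frame_vol (primal_frame f) * frame_vol (dual_frame f) = (\<Prod>k\<le>CARD('n). slack_matrix f f k k)"
proof -
  have 0: "0 < CARD('n)" by simp
  have z: "slack_matrix f f 0 (Suc 0) = 0" using slack_matrix_zero[OF f f, of 0 "Suc 0"] by (simp add: differences_self Suc_le_eq)
  have "frame_vol (primal_frame f) * frame_vol (dual_frame f) = slack_matrix f f (Suc 0) (Suc 0) * (\<Prod>k\<in>{..CARD('n)} - {0, Suc 0}. slack_matrix f f k k)"
    using frame_vol_mult_slack[OF f f 0] z slack_matrix_pos[OF f f, of "Suc 0" "Suc 0"] by (simp add: differences_self slack_matrix_first Suc_le_eq)
  also have "\<dots> = (\<Prod>k\<le>CARD('n). slack_matrix f f k k)"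
    by (simp add: prod.remove[of "{..CARD('n)}" 0] prod.remove[of "{..CARD('n)} - {0}" "Suc 0"] slack_matrix_first Suc_le_eq Diff_insert2[symmetric] insert_commute)
  finally show ?thesis .
qed

lemma frame_vol_primal_nonzero: "f \<in> flags P \<Longrightarrow> frame_vol (primal_frame f) \<noteq> 0"
  using frame_vol_mult_self[of f] slack_matrix_pos[of f f] prod_pos[of "{..CARD('n)}" "\<lambda>k. slack_matrix f f k k"] by fastforce

lemma pair_integrable:
  assumes "f \<in> flags P" "g \<in> flags P" "R \<ge> 1"
  shows "integrable lborel (\<lambda>z :: real^'n idx. \<Prod>k\<le>CARD('n). ratio (slack_matrix f g) R z k)"
  using assms slack_matrix_nonneg slack_matrix_pos slack_matrix_pos_differences
  by (intro ratio_prod_integrable[OF differences_less]) auto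

lemma pair_integral_nonneg:
  assumes "f \<in> flags P" "g \<in> flags P" "R \<ge> 0"
  shows "pair_integral f g R \<ge> 0"
  unfolding pair_integral_def
proof (intro integral_nonneg_AE AE_I2 prod_nonneg)
  fix z :: "real^'n idx" and k assume "k \<in> {..CARD('n)}"
  then have "ratio (slack_matrix f g) R z k > 0"
    using assms slack_matrix_nonneg slack_matrix_pos slack_matrix_pos_differences by (intro ratio_pos[OF differences_less]) auto
  then show "ratio (slack_matrix f g) R z k \<ge> 0" by simp
qed

text \<open>The value of \<open>slack_combination\<close> at the center of the face above: one of its two positive terms is
the left hand side, up to a factor.\<close>

lemma adjacent_slack_less:
  assumes f: "f \<in> flags P" and a: "a < CARD('n)" and g: "flips_to a f g"
  defines "A \<equiv> slack_matrix f g"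
  shows "A (Suc a) (Suc a) * A a a < A a (Suc a) * A (Suc a) a"
proof -
  have gP: "g \<in> flags P" and ne: "g ! a \<noteq> f ! a" and eq: "\<And>j. j \<le> CARD('n) \<Longrightarrow> j \<noteq> a \<Longrightarrow> g ! j = f ! j"
    using g by (auto simp: flips_to_def)
  have low: "lower_face g a = lower_face f a" using eq[of "a - 1"] a by (auto simp: lower_face_def)
  define G where "G = lower_face f a"
  have F: "G face_of P" "f ! a face_of P" "g ! a face_of P" "f ! Suc a face_of P" "G \<noteq> P"
    using lower_face_flag(1,2)[OF f, of a] flagD(2)[OF f] flagD(2)[OF gP] a by (auto simp: G_def)
  have sub: "G \<subseteq> f ! a" "G \<subseteq> g ! a" "f ! a \<subseteq> f ! Suc a" "g ! a \<subseteq> f ! Suc a"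
    using lower_face_flag(4)[OF f, of a] lower_face_flag(4)[OF gP, of a] low flagD(4)[OF f a] flagD(4)[OF gP a] eq[of "Suc a"] a by (auto simp: G_def)
  have dim: "aff_dim (f ! a) = aff_dim G + 1" "aff_dim (g ! a) = aff_dim G + 1" "aff_dim (f ! Suc a) = aff_dim G + 2"
    using lower_face_flag(3)[OF f, of a] flagD(3)[OF f] flagD(3)[OF gP] a by (auto simp: G_def)
  have nonempty: "f ! a \<noteq> {}" "g ! a \<noteq> {}" "f ! Suc a \<noteq> {}" using flag_nonempty[OF f] flag_nonempty[OF gP] a by auto
  have y: "face_center P (f ! Suc a) \<in> f ! Suc a" using face_center_in[OF F(4) nonempty(3)] .
  from slack_combination[OF F(1-4,1,5) sub subset_refl ne[symmetric] dim y]
  have comb: "slack P (f ! Suc a) G = slack P (g ! a) G / slack P (g ! a) (f ! a) * slack P (f ! Suc a) (f ! a) +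
      slack P (f ! a) G / slack P (f ! a) (g ! a) * slack P (f ! Suc a) (g ! a)"
    unfolding slack_def[of P "f ! Suc a"] .
  have proper: "f ! a \<noteq> P" "g ! a \<noteq> P" using flag_proper[OF f a] flag_proper[OF gP a] by auto
  have nsub: "\<not> g ! a \<subseteq> G" "\<not> g ! a \<subseteq> f ! a" "\<not> f ! Suc a \<subseteq> f ! a" "\<not> f ! a \<subseteq> g ! a"
    using aff_dim_subset[of "g ! a" G] aff_dim_subset[of "f ! Suc a" "f ! a"] dim ne
      face_subset_aff_dim_eq[OF F(3,2)] face_subset_aff_dim_eq[OF F(2,3)] by auto
  have p: "slack P (g ! a) G > 0" "slack P (g ! a) (f ! a) > 0" "slack P (f ! Suc a) (f ! a) > 0" "slack P (f ! a) (g ! a) > 0"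
    using slack_pos F nonempty proper nsub by auto
  have "slack P (f ! a) G / slack P (f ! a) (g ! a) * slack P (f ! Suc a) (g ! a) < slack P (f ! Suc a) G"
    unfolding comb using p by simp
  then have "slack P (f ! a) G * slack P (f ! Suc a) (g ! a) < slack P (f ! Suc a) G * slack P (f ! a) (g ! a)"
    using p(4) by (simp add: field_simps)
  then show ?thesis unfolding A_def slack_matrix_def lower_face_Suc low G_def[symmetric] by (simp add: mult.commute)
qed

lemma pair_limit_far:
  assumes f: "f \<in> flags P" and g: "g \<in> flags P" and D: "card (differences f g) \<ge> 2"
  shows "((\<lambda>R. pair_integral f g R / R ^ (CARD('n) - 1)) \<longlongrightarrow> 0) at_top"
  unfolding pair_integral_def
  using f g D slack_matrix_nonneg slack_matrix_pos slack_matrix_pos_differences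
  by (intro ratio_prod_integral_small[OF differences_less]) auto

lemma pair_limit_diagonal:
  assumes f: "f \<in> flags P"
  defines "w \<equiv> frame_vol (primal_frame f) * frame_vol (dual_frame f)"
  shows "((\<lambda>R. (w * pair_integral f f R - R ^ CARD('n) / fact CARD('n)) / R ^ (CARD('n) - 1)) \<longlongrightarrow>
    (\<Sum>k<CARD('n). ln (slack_matrix f f k k) - ln (slack_matrix f f (Suc k) k)) / fact (CARD('n) - 1)) at_top"
proof -
  define A where "A = slack_matrix f f"
  note ass = differences_less[of f f] slack_matrix_nonneg[OF f f, folded A_def] slack_matrix_pos[OF f f, folded A_def]
    slack_matrix_pos_differences[OF f f, folded A_def]
  have w: "w = (\<Prod>k\<le>CARD('n). A k k)" unfolding w_def A_def by (rule frame_vol_mult_self[OF f])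
  have w1: "w * (\<Prod>k\<le>CARD('n). 1 / A k k) = 1"
  proof -
    have "A k k \<noteq> 0" if "k \<le> CARD('n)" for k using ass(3)[of k k] that by simp
    then show ?thesis unfolding w prod.distrib[symmetric] by simp
  qed
  have S: "(\<Sum>k\<le>CARD('n). ln (A k k) - ln (next_entry TYPE('n) A k)) = (\<Sum>k<CARD('n). ln (A k k) - ln (A (Suc k) k))"
  proof -
    have next_entry: "next_entry TYPE('n) A k = (if k < CARD('n) then A (Suc k) k else 1)" for k
      by (rule next_entry_def[where A = A, OF ass])
    have "A CARD('n) CARD('n) = 1" unfolding A_def by (rule slack_matrix_last[OF f])
    then show ?thesis unfolding lessThan_Suc_atMost[symmetric] sum.lessThan_Suc next_entry by simp
  qed
  have lim: "((\<lambda>R. (pair_integral f f R - (\<Prod>k\<le>CARD('n). 1 / A k k) * R ^ CARD('n) / fact CARD('n)) / R ^ (CARD('n) - 1)) \<longlongrightarrow>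
    (\<Prod>k\<le>CARD('n). 1 / A k k) * (\<Sum>k\<le>CARD('n). ln (A k k) - ln (next_entry TYPE('n) A k)) / fact (CARD('n) - 1)) at_top"
    unfolding pair_integral_def A_def[symmetric]
  proof (rule ratio_prod_integral_asymp_diagonal[where A = A, OF ass])
    show "card (differences f f) \<le> 1" "differences f f = {}" by (simp_all add: differences_self)
    show "A i k = 0" if "i < k" "k \<le> CARD('n)" "\<not> (k = Suc i \<and> i \<in> differences f f)" for i k
      unfolding A_def using that by (intro slack_matrix_zero[OF f f]) (auto simp: differences_self)
  qed
  have e1: "w * ((pair_integral f f R - (\<Prod>k\<le>CARD('n). 1 / A k k) * R ^ CARD('n) / fact CARD('n)) / R ^ (CARD('n) - 1)) =
     (w * pair_integral f f R - R ^ CARD('n) / fact CARD('n)) / R ^ (CARD('n) - 1)" for R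
  proof -
    have "w * (pair_integral f f R - (\<Prod>k\<le>CARD('n). 1 / A k k) * R ^ CARD('n) / fact CARD('n)) =
      w * pair_integral f f R - w * (\<Prod>k\<le>CARD('n). 1 / A k k) * R ^ CARD('n) / fact CARD('n)" by (simp add: right_diff_distrib)
    then show ?thesis unfolding w1 by simp
  qed
  have e2: "w * ((\<Prod>k\<le>CARD('n). 1 / A k k) * (\<Sum>k\<le>CARD('n). ln (A k k) - ln (next_entry TYPE('n) A k)) / fact (CARD('n) - 1)) =
     (\<Sum>k<CARD('n). ln (A k k) - ln (A (Suc k) k)) / fact (CARD('n) - 1)"
    unfolding S using w1 by (simp add: mult.assoc[symmetric])
  from tendsto_mult_left[OF lim, of w] show ?thesis unfolding e1 e2 unfolding A_def .
qed

lemma pair_limit_adjacent: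
  assumes f: "f \<in> flags P" and a: "a < CARD('n)" and g: "flips_to a f g"
  defines "w \<equiv> frame_vol (primal_frame f) * frame_vol (dual_frame g)" and "A \<equiv> slack_matrix f g"
  shows "((\<lambda>R. w * pair_integral f g R / R ^ (CARD('n) - 1)) \<longlongrightarrow>
    ln (A a (Suc a) * A (Suc a) a / (A (Suc a) (Suc a) * A a a)) / fact (CARD('n) - 1)) at_top"
proof -
  have gP: "g \<in> flags P" using g by (simp add: flips_to_def)
  have D: "differences f g = {a}" using g a by (auto simp: flips_to_def differences_def)
  note ass = differences_less[of f g] slack_matrix_nonneg[OF f gP, folded A_def] slack_matrix_pos[OF f gP, folded A_def]
    slack_matrix_pos_differences[OF f gP, folded A_def]
  have less: "A (Suc a) (Suc a) * A a a < A a (Suc a) * A (Suc a) a"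
    unfolding A_def by (rule adjacent_slack_less[OF f a g])
  define Q where "Q = A a (Suc a) * A (Suc a) a - A (Suc a) (Suc a) * A a a"
  have Q: "Q > 0" using less by (simp add: Q_def)
  have "w = Q * (\<Prod>k\<in>{..CARD('n)} - {a, Suc a}. A k k)"
    unfolding w_def using frame_vol_mult_slack[OF f gP a, folded A_def, folded Q_def] D Q by simp
  moreover have "(\<Prod>k\<in>{..CARD('n)} - {a, Suc a}. A k k) * (\<Prod>k\<in>{..CARD('n)} - {a, Suc a}. 1 / A k k) = 1"
  proof -
    have "A k k \<noteq> 0" if "k \<le> CARD('n)" for k using ass(3)[of k k] that by simp
    then show ?thesis unfolding prod.distrib[symmetric] by (intro prod.neutral) auto
  qed
  ultimately have w: "w * (x / Q * (\<Prod>k\<in>{..CARD('n)} - {a, Suc a}. 1 / A k k)) = x" for x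
    using Q by (simp add: mult.assoc)
  have lim: "((\<lambda>R. pair_integral f g R / R ^ (CARD('n) - 1)) \<longlongrightarrow>
    ln (A a (Suc a) * A (Suc a) a / (A (Suc a) (Suc a) * A a a)) / Q * (\<Prod>k\<in>{..CARD('n)} - {a, Suc a}. 1 / A k k) / fact (CARD('n) - 1)) at_top"
    unfolding pair_integral_def A_def[symmetric] Q_def
  proof (rule ratio_prod_integral_asymp_adjacent[where A = A, OF ass])
    show "card (differences f g) \<le> 1" "differences f g = {a}" by (simp_all add: D)
    then show "A i k = 0" if "i < k" "k \<le> CARD('n)" "\<not> (k = Suc i \<and> i \<in> differences f g)" for i k
      unfolding A_def using that by (intro slack_matrix_zero[OF f gP]) auto
    show "A a (Suc a) * A (Suc a) a \<noteq> A (Suc a) (Suc a) * A a a" using less by simp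
  qed
  show ?thesis
    using tendsto_mult_left[OF lim, of w] unfolding times_divide_eq_right[of w] w .
qed

end

section \<open>Cancellation and telescoping of the logarithms\<close>

context flag_polytope
begin

text \<open>The logarithmic contribution of \<open>f\<close> and its neighbour in dimension \<open>a\<close> that survives.\<close>

definition flip_step :: "nat \<Rightarrow> (real^'n) set list \<Rightarrow> real" where
  "flip_step a f = ln (slack P (f ! a) (flag_flip P a f ! a)) - ln (slack P (f ! Suc a) (flag_flip P a f ! a))"

lemma adjacent_log_eq:
  assumes f: "f \<in> flags P" and a: "a < CARD('n)"
  defines "A \<equiv> slack_matrix f (flag_flip P a f)"
  shows "ln (A a (Suc a) * A (Suc a) a / (A (Suc a) (Suc a) * A a a)) =
    flip_step a f - (ln (slack_matrix f f a a) - ln (slack_matrix f f (Suc a) a))"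
proof -
  define g where "g = flag_flip P a f"
  have fl: "flips_to a f g" unfolding g_def by (rule flag_flip[OF f a])
  then have g: "g \<in> flags P" by (simp add: flips_to_def)
  have low: "lower_face g a = lower_face f a" using fl a by (cases a) (auto simp: flips_to_def)
  have "a \<in> differences f g" using fl a by (auto simp: differences_def flips_to_def)
  then have p: "A a (Suc a) > 0" "A (Suc a) a > 0" "A (Suc a) (Suc a) > 0" "A a a > 0"
    unfolding A_def g_def[symmetric] using slack_matrix_pos_differences[OF f g] slack_matrix_pos[OF f g] a by auto
  have "ln (A a (Suc a) * A (Suc a) a / (A (Suc a) (Suc a) * A a a)) =
    ln (A a (Suc a)) + ln (A (Suc a) a) - (ln (A (Suc a) (Suc a)) + ln (A a a))"
    using p by (simp add: ln_div ln_mult)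
  then show ?thesis
    unfolding A_def flip_step_def g_def[symmetric] slack_matrix_def lower_face_Suc low by simp
qed

text \<open>Only \<open>f\<close> and its \<open>CARD('n)\<close> neighbours count. The logarithms of slacks of \<open>f\<close> against itself cancel
between \<open>pair_limit_diagonal\<close> and \<open>adjacent_log_eq\<close>.\<close>

lemma flags_row_limit:
  assumes f: "f \<in> flags P"
  shows "((\<lambda>R. ((\<Sum>g\<in>flags P. frame_vol (primal_frame f) * frame_vol (dual_frame g) * pair_integral f g R) - R ^ CARD('n) / fact CARD('n)) / R ^ (CARD('n) - 1))
    \<longlongrightarrow> (\<Sum>a<CARD('n). flip_step a f) / fact (CARD('n) - 1)) at_top"
proof -
  define w where "w = (\<lambda>g. frame_vol (primal_frame f) * frame_vol (dual_frame g))"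
  define N where "N = (\<lambda>a. flag_flip P a f) ` {..<CARD('n)}"
  have fl: "flips_to a f (flag_flip P a f)" if "a < CARD('n)" for a by (rule flag_flip[OF f that])
  have inj: "inj_on (\<lambda>a. flag_flip P a f) {..<CARD('n)}"
  proof (rule inj_onI)
    fix a b assume ab: "a \<in> {..<CARD('n)}" "b \<in> {..<CARD('n)}" "flag_flip P a f = flag_flip P b f"
    then have "flag_flip P b f ! a \<noteq> f ! a" using fl[of a] by (simp add: flips_to_def)
    then show "a = b" using fl[of b] ab by (auto simp: flips_to_def)
  qed
  have N: "N \<subseteq> flags P" "f \<notin> N" "finite N"
    using fl unfolding N_def flips_to_def by (auto, metis)
  define F where "F = flags P - {f} - N"
  have finF: "finite F" using finite_flags by (simp add: F_def)
  have far: "card (differences f g) \<ge> 2" if "g \<in> F" for g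
  proof (rule ccontr)
    assume "\<not> 2 \<le> card (differences f g)"
    then have c: "card (differences f g) \<le> 1" by simp
    have g: "g \<in> flags P" "g \<noteq> f" "g \<notin> N" using that by (auto simp: F_def)
    have fin: "finite (differences f g)" using differences_less finite_subset by blast
    have "differences f g \<noteq> {}" using flag_eqI[OF f g(1)] g(2) by (auto simp: differences_def)
    then obtain a where a: "differences f g = {a}" using c fin by (metis One_nat_def card_1_singletonE card_gt_0_iff le_antisym Suc_leI)
    then have "flips_to a f g"
      using g(1) flag_top[OF f] flag_top[OF g(1)] unfolding flips_to_def differences_def
      by (auto simp: set_eq_iff le_less)
    moreover have "a < CARD('n)" using a by (auto simp: differences_def)
    ultimately have "g = flag_flip P a f" using flag_flip_eq[OF f, of a g] by simp
    then show False using g(3) \<open>a < CARD('n)\<close> by (auto simp: N_def)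
  qed
  have split: "(\<Sum>g\<in>flags P. w g * pair_integral f g R) =
    w f * pair_integral f f R + (\<Sum>a<CARD('n). w (flag_flip P a f) * pair_integral f (flag_flip P a f) R) + (\<Sum>g\<in>F. w g * pair_integral f g R)" for R
  proof -
    have "(\<Sum>g\<in>flags P. w g * pair_integral f g R) = w f * pair_integral f f R + (\<Sum>g\<in>flags P - {f}. w g * pair_integral f g R)"
      using finite_flags f by (rule sum.remove)
    also have "(\<Sum>g\<in>flags P - {f}. w g * pair_integral f g R) = (\<Sum>g\<in>F. w g * pair_integral f g R) + (\<Sum>g\<in>N. w g * pair_integral f g R)"
      unfolding F_def using N finite_flags by (intro sum.subset_diff) auto
    also have "(\<Sum>g\<in>N. w g * pair_integral f g R) = (\<Sum>a<CARD('n). w (flag_flip P a f) * pair_integral f (flag_flip P a f) R)"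
      unfolding N_def by (simp add: sum.reindex[OF inj])
    finally show ?thesis by simp
  qed
  have lim: "((\<lambda>R. (w f * pair_integral f f R - R ^ CARD('n) / fact CARD('n)) / R ^ (CARD('n) - 1)
      + (\<Sum>a<CARD('n). w (flag_flip P a f) * pair_integral f (flag_flip P a f) R / R ^ (CARD('n) - 1))
      + (\<Sum>g\<in>F. w g * (pair_integral f g R / R ^ (CARD('n) - 1))))
    \<longlongrightarrow> (\<Sum>k<CARD('n). ln (slack_matrix f f k k) - ln (slack_matrix f f (Suc k) k)) / fact (CARD('n) - 1)
      + (\<Sum>a<CARD('n). (flip_step a f - (ln (slack_matrix f f a a) - ln (slack_matrix f f (Suc a) a))) / fact (CARD('n) - 1))
      + (\<Sum>g\<in>F. w g * 0)) at_top"
  proof (intro tendsto_add tendsto_sum tendsto_mult_left)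
    show "((\<lambda>R. (w f * pair_integral f f R - R ^ CARD('n) / fact CARD('n)) / R ^ (CARD('n) - 1)) \<longlongrightarrow>
      (\<Sum>k<CARD('n). ln (slack_matrix f f k k) - ln (slack_matrix f f (Suc k) k)) / fact (CARD('n) - 1)) at_top"
      unfolding w_def by (rule pair_limit_diagonal[OF f])
    show "((\<lambda>R. w (flag_flip P a f) * pair_integral f (flag_flip P a f) R / R ^ (CARD('n) - 1)) \<longlongrightarrow>
      (flip_step a f - (ln (slack_matrix f f a a) - ln (slack_matrix f f (Suc a) a))) / fact (CARD('n) - 1)) at_top"
      if "a \<in> {..<CARD('n)}" for a
    proof -
      have a: "a < CARD('n)" using that by simp
      show ?thesis using pair_limit_adjacent[OF f a fl[OF a]] unfolding w_def adjacent_log_eq[OF f a] .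
    qed
    show "((\<lambda>R. pair_integral f g R / R ^ (CARD('n) - 1)) \<longlongrightarrow> 0) at_top" if "g \<in> F" for g
      using far[OF that] that by (intro pair_limit_far[OF f]) (auto simp: F_def)
  qed
  have e1: "(w f * pair_integral f f R - R ^ CARD('n) / fact CARD('n)) / R ^ (CARD('n) - 1)
      + (\<Sum>a<CARD('n). w (flag_flip P a f) * pair_integral f (flag_flip P a f) R / R ^ (CARD('n) - 1))
      + (\<Sum>g\<in>F. w g * (pair_integral f g R / R ^ (CARD('n) - 1))) =
    ((\<Sum>g\<in>flags P. w g * pair_integral f g R) - R ^ CARD('n) / fact CARD('n)) / R ^ (CARD('n) - 1)" for R
    unfolding split by (simp add: add_divide_distrib diff_divide_distrib sum_divide_distrib)
  have e2: "(\<Sum>k<CARD('n). ln (slack_matrix f f k k) - ln (slack_matrix f f (Suc k) k)) / fact (CARD('n) - 1)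
      + (\<Sum>a<CARD('n). (flip_step a f - (ln (slack_matrix f f a a) - ln (slack_matrix f f (Suc a) a))) / fact (CARD('n) - 1))
      + (\<Sum>g\<in>F. w g * 0) = (\<Sum>a<CARD('n). flip_step a f) / fact (CARD('n) - 1)"
    unfolding sum_divide_distrib sum.distrib[symmetric] by (simp add: add_divide_distrib[symmetric])
  show ?thesis using lim unfolding e1 e2 unfolding w_def .
qed

text \<open>For each \<open>a\<close> the sum over all flags is reindexed by \<open>partial_flip a\<close>, which does not change \<open>f ! a\<close> and
\<open>f ! Suc a\<close> and turns the face of the neighbour into \<open>complete_flip P f ! a\<close>. All slacks are then
replaced by slacks against one and the same facet, and the sum over \<open>a\<close> telescopes.\<close>

lemma sum_flip_step:
  "(\<Sum>f\<in>flags P. \<Sum>a<CARD('n). flip_step a f) = (\<Sum>f\<in>flags P. ln (slack P (f ! 0) (complete_flip P f ! (CARD('n) - 1))))"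
proof -
  have "(\<Sum>f\<in>flags P. \<Sum>a<CARD('n). flip_step a f) = (\<Sum>a<CARD('n). \<Sum>f\<in>flags P. flip_step a f)" by (rule sum.swap)
  also have "\<dots> = (\<Sum>a<CARD('n). \<Sum>f\<in>flags P. flip_step a (partial_flip a f))"
    by (intro sum.cong refl sum.reindex_bij_betw[symmetric] bij_betw_partial_flip) auto
  also have "\<dots> = (\<Sum>f\<in>flags P. \<Sum>a<CARD('n). flip_step a (partial_flip a f))" by (rule sum.swap)
  also have "\<dots> = (\<Sum>f\<in>flags P. ln (slack P (f ! 0) (complete_flip P f ! (CARD('n) - 1))))"
  proof (rule sum.cong[OF refl])
    fix f assume f: "f \<in> flags P"
    define h where "h = complete_flip P f"
    define F where "F = h ! (CARD('n) - 1)"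
    have h: "h \<in> flags P" unfolding h_def by (rule complete_flip_flag[OF f])
    have F: "F face_of P" "F \<noteq> P" unfolding F_def using flagD(2)[OF h] flag_proper[OF h, of "CARD('n) - 1"] by auto
    have nsub: "\<not> f ! i \<subseteq> F" if "i \<le> CARD('n)" for i
      using vertex_notin_complete_flip[OF f, of "CARD('n) - 1"] flag_mono[OF f, of 0 i] that by (auto simp: F_def h_def)
    have step: "flip_step a (partial_flip a f) = ln (slack P (f ! a) F) - ln (slack P (f ! Suc a) F)" if a: "a < CARD('n)" for a
    proof -
      have face: "f ! a face_of P" "f ! Suc a face_of P" "h ! a face_of P" "h ! a \<noteq> P" "f ! a \<noteq> {}" "f ! Suc a \<noteq> {}"
        using flagD(2)[OF f] flagD(2)[OF h] flag_proper[OF h a] flag_nonempty[OF f] a by auto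
      have sub: "h ! a \<subseteq> f ! Suc a" "h ! a \<noteq> f ! a" unfolding h_def using complete_flip_step[OF f a] by auto
      have hF: "h ! a \<subseteq> F" unfolding F_def using a by (intro flag_mono[OF h]) auto
      have dim: "aff_dim (f ! Suc a) = aff_dim (h ! a) + 1" using flagD(3)[OF f, of "Suc a"] flagD(3)[OF h, of a] a by simp
      have y: "face_center P (f ! a) \<in> f ! Suc a" using face_center_in[OF face(1,5)] flagD(4)[OF f a] by blast
      from slack_proportional[OF face(3,2) F(1) face(4) F(2) sub(1) hF dim y]
      have proportion: "slack P (f ! a) F * slack P (f ! Suc a) (h ! a) = slack P (f ! Suc a) F * slack P (f ! a) (h ! a)"
        unfolding slack_def[of P "f ! a"] .
      have p: "slack P (f ! a) F > 0" "slack P (f ! Suc a) F > 0"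
        using slack_pos[OF face(1,5) F] slack_pos[OF face(2,6) F] nsub[of a] nsub[of "Suc a"] a by auto
      have "\<not> f ! Suc a \<subseteq> h ! a" using aff_dim_subset[of "f ! Suc a" "h ! a"] dim by auto
      then have p': "slack P (f ! Suc a) (h ! a) > 0" by (rule slack_pos[OF face(2,6,3,4)])
      have "\<not> f ! a \<subseteq> h ! a"
        using face_subset_aff_dim_eq[OF face(1,3)] flagD(3)[OF f, of a] flagD(3)[OF h, of a] sub a by auto
      then have q': "slack P (f ! a) (h ! a) > 0" by (rule slack_pos[OF face(1,5,3,4)])
      have "ln (slack P (f ! a) F) + ln (slack P (f ! Suc a) (h ! a)) = ln (slack P (f ! Suc a) F) + ln (slack P (f ! a) (h ! a))"
        using arg_cong[OF proportion, of ln] p p' q' by (simp add: ln_mult)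
      then show ?thesis
        using complete_flip_nth[OF f a] partial_flip_upper[OF f, of a a] partial_flip_upper[OF f, of a "Suc a"] a
        by (simp add: flip_step_def h_def)
    qed
    have "(\<Sum>a<CARD('n). flip_step a (partial_flip a f)) = (\<Sum>a<CARD('n). ln (slack P (f ! a) F) - ln (slack P (f ! Suc a) F))"
      using step by (intro sum.cong) auto
    also have "\<dots> = ln (slack P (f ! 0) F) - ln (slack P (f ! CARD('n)) F)"
      using sum_lessThan_telescope'[of "\<lambda>a. ln (slack P (f ! a) F)" "CARD('n)"] by simp
    also have "\<dots> = ln (slack P (f ! 0) F)" by (simp add: flag_top[OF f] slack_P)
    finally show "(\<Sum>a<CARD('n). flip_step a (partial_flip a f)) = ln (slack P (f ! 0) (complete_flip P f ! (CARD('n) - 1)))"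
      by (simp add: F_def h_def)
  qed
  finally show ?thesis .
qed

lemma the_elem_vertex:
  assumes "f \<in> flags P"
  shows "the_elem (f ! 0) = face_center P (f ! 0)"
proof -
  obtain v where v: "f ! 0 = {v}" using flagD(3)[OF assms, of 0] aff_dim_eq_0[of "f ! 0"] by auto
  then show ?thesis using face_center_in[of "f ! 0"] flagD(2)[OF assms, of 0] by simp
qed

text \<open>The affine hull of a facet does not contain the origin, so a functional is determined by its
values on the facet. This gives both the extremality and the uniqueness.\<close>

lemma facet_vertex_eq:
  assumes F: "F face_of P" "aff_dim F = int CARD('n) - 1"
  shows "facet_vertex P F = face_normal P F"
proof -
  have nP: "F \<noteq> P" using F aff_dim_P by auto
  note b = face_normal[OF F(1) nP]
  have "0 \<notin> F"
    using face_of_disjoint_interior[OF F(1) nP] origin by blast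
  then have "0 \<notin> affine hull F"
    using face_of_imp_eq_affine_Int[OF convex F(1)] zero_in by blast
  then have "aff_dim (insert 0 F) = int CARD('n)" using F(2) by (simp add: aff_dim_insert)
  then have full: "affine hull (insert 0 F) = UNIV" using aff_dim_eq_full[of "insert 0 F"] by simp
  have uniq: "q = q'" if "\<And>y. y \<in> F \<Longrightarrow> q \<bullet> y = q' \<bullet> y" for q q'
  proof -
    have "insert 0 F \<subseteq> {y. (q - q') \<bullet> y = 0}" using that by (auto simp: inner_diff_left)
    then have "affine hull (insert 0 F) \<subseteq> {y. (q - q') \<bullet> y = 0}" by (intro hull_minimal affine_hyperplane)
    then have "(q - q') \<bullet> (q - q') = 0" unfolding full by blast
    then show ?thesis by simp
  qed
  show ?thesis
    unfolding facet_vertex_def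
  proof (rule the_equality)
    have "face_normal P F extreme_point_of polar P"
      unfolding extreme_point_of_def
    proof (intro conjI ballI)
      show "face_normal P F \<in> polar P" using b(1) by (simp add: polar_def)
      fix q q' assume q: "q \<in> polar P" "q' \<in> polar P"
      show "face_normal P F \<notin> open_segment q q'"
      proof
        assume "face_normal P F \<in> open_segment q q'"
        then obtain u where u: "0 < u" "u < 1" "q \<noteq> q'" "face_normal P F = (1 - u) *\<^sub>R q + u *\<^sub>R q'" by (auto simp: in_segment)
        have "q \<bullet> y = q' \<bullet> y" if y: "y \<in> F" for y
        proof -
          have yP: "y \<in> P" "face_normal P F \<bullet> y = 1" using y b(2) by auto
          then have le: "q \<bullet> y \<le> 1" "q' \<bullet> y \<le> 1" using q by (auto simp: polar_def)
          have eq: "(1 - u) * (1 - q \<bullet> y) + u * (1 - q' \<bullet> y) = 0" using yP(2) u(4) by (simp add: inner_add_left algebra_simps)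
          have "(1 - u) * (1 - q \<bullet> y) \<ge> 0" "u * (1 - q' \<bullet> y) \<ge> 0" using u le by auto
          then have "(1 - u) * (1 - q \<bullet> y) = 0" "u * (1 - q' \<bullet> y) = 0" using eq by linarith+
          then show ?thesis using u by simp
        qed
        then show False using uniq u(3) by blast
      qed
    qed
    then show "face_normal P F extreme_point_of polar P \<and> F = {y \<in> P. face_normal P F \<bullet> y = 1}" using b(2) by simp
    fix q assume "q extreme_point_of polar P \<and> F = {y \<in> P. q \<bullet> y = 1}"
    then have "q \<bullet> y = face_normal P F \<bullet> y" if "y \<in> F" for y using that b(2) by auto
    then show "q = face_normal P F" by (rule uniq)
  qed
qed

text \<open>The factor \<open>(1 - exp (- R)) ^ n\<close> of \<open>funk_volume_sum\<close> differs from 1 by an exponentially small amount.\<close>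

lemma funk_volume_asymp:
  fixes n :: nat and c0 c1 :: real
  defines "n \<equiv> CARD('n)"
  defines "c0 \<equiv> real (card (flags P)) / (fact n)\<^sup>2"
    and "c1 \<equiv> real n / (fact n)\<^sup>2 * (\<Sum>f\<in>flags P. ln (slack P (f ! 0) (complete_flip P f ! (n - 1))))"
  shows "(\<lambda>R. measure lborel (ball (0::real^'n) 1) * enn2real (funk_vol P (funk_ball P 0 R)) - (c0 * R ^ n + c1 * R ^ (n - 1)))
     \<in> o[at_top](\<lambda>R. R ^ (n - 1))"
proof -
  have n: "n > 0" by (simp add: n_def)
  define T where "T = (\<lambda>R. \<Sum>f\<in>flags P. \<Sum>g\<in>flags P. frame_vol (primal_frame f) * frame_vol (dual_frame g) * pair_integral f g R)"
  define V where "V = (\<lambda>R. measure lborel (ball (0::real^'n) 1) * enn2real (funk_vol P (funk_ball P 0 R)))"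
  define L where "L = (\<Sum>f\<in>flags P. ln (slack P (f ! 0) (complete_flip P f ! (n - 1))))"
  have V: "V R = (1 - exp (- R)) ^ n / fact n * T R" if "R \<ge> 1" for R
    unfolding V_def T_def n_def using that
    by (intro funk_volume_sum frame_vol_primal_nonzero pair_integrable pair_integral_nonneg) auto
  have "((\<lambda>R. \<Sum>f\<in>flags P. ((\<Sum>g\<in>flags P. frame_vol (primal_frame f) * frame_vol (dual_frame g) * pair_integral f g R) - R ^ n / fact n) / R ^ (n - 1))
    \<longlongrightarrow> (\<Sum>f\<in>flags P. (\<Sum>a<CARD('n). flip_step a f) / fact (n - 1))) at_top"
    unfolding n_def by (intro tendsto_sum flags_row_limit)
  moreover have "(\<Sum>f\<in>flags P. ((\<Sum>g\<in>flags P. frame_vol (primal_frame f) * frame_vol (dual_frame g) * pair_integral f g R) - R ^ n / fact n) / R ^ (n - 1))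
    = (T R - real (card (flags P)) * (R ^ n / fact n)) / R ^ (n - 1)" for R
    unfolding T_def sum_divide_distrib[symmetric] by (simp add: sum_subtractf)
  moreover have "(\<Sum>f\<in>flags P. (\<Sum>a<CARD('n). flip_step a f) / fact (n - 1)) = L / fact (n - 1)"
    unfolding sum_divide_distrib[symmetric] sum_flip_step L_def n_def ..
  ultimately have T: "((\<lambda>R. (T R - real (card (flags P)) * (R ^ n / fact n)) / R ^ (n - 1)) \<longlongrightarrow> L / fact (n - 1)) at_top" by simp
  have c: "c1 = 1 / fact n * (L / fact (n - 1))" "c0 = 1 / fact n * (real (card (flags P)) / fact n)"
    unfolding c1_def c0_def L_def[symmetric] using n fact_reduce[OF n, where 'a=real] by (simp_all add: power2_eq_square)
  have l1: "((\<lambda>R :: real. (1 - exp (- R)) ^ n) \<longlongrightarrow> (1 - 0) ^ n) at_top" by (intro tendsto_power tendsto_diff tendsto_const) real_asymp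
  have l2: "((\<lambda>R :: real. ((1 - exp (- R)) ^ n - 1) * R) \<longlongrightarrow> 0) at_top"
  proof -
    have "((\<lambda>R :: real. (\<Sum>i<n. (1 - exp (- R)) ^ i) * (- exp (- R) * R)) \<longlongrightarrow> (\<Sum>i<n. (1 - 0) ^ i) * 0) at_top"
      by (intro tendsto_mult tendsto_sum tendsto_power tendsto_diff tendsto_const) real_asymp+
    moreover have "(\<Sum>i<n. (1 - exp (- R)) ^ i) * (- exp (- R) * R) = ((1 - exp (- R)) ^ n - 1) * R" for R :: real
      using power_diff_1_eq[of "1 - exp (- R)" n] by simp
    ultimately show ?thesis by simp
  qed
  have limit_0: "1 / fact n * ((1 - 0) ^ n * (L / fact (n - 1)) + real (card (flags P)) / fact n * 0) - c1 = 0"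
    unfolding c(1) by simp
  have "((\<lambda>R. 1 / fact n * ((1 - exp (- R)) ^ n * ((T R - real (card (flags P)) * (R ^ n / fact n)) / R ^ (n - 1))
       + real (card (flags P)) / fact n * (((1 - exp (- R)) ^ n - 1) * R)) - c1)
    \<longlongrightarrow> 1 / fact n * ((1 - 0) ^ n * (L / fact (n - 1)) + real (card (flags P)) / fact n * 0) - c1) at_top"
    by (rule tendsto_diff[OF tendsto_mult_left[OF tendsto_add[OF tendsto_mult[OF l1 T] tendsto_mult_left[OF l2]]] tendsto_const])
  then have lim: "((\<lambda>R. 1 / fact n * ((1 - exp (- R)) ^ n * ((T R - real (card (flags P)) * (R ^ n / fact n)) / R ^ (n - 1))
       + real (card (flags P)) / fact n * (((1 - exp (- R)) ^ n - 1) * R)) - c1) \<longlongrightarrow> 0) at_top"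
    unfolding limit_0 .
  have eq: "1 / fact n * ((1 - exp (- R)) ^ n * ((T R - real (card (flags P)) * (R ^ n / fact n)) / R ^ (n - 1))
       + real (card (flags P)) / fact n * (((1 - exp (- R)) ^ n - 1) * R)) - c1 =
     (V R - (c0 * R ^ n + c1 * R ^ (n - 1))) / R ^ (n - 1)" if R: "R \<ge> 1" for R
  proof -
    define x where "x = (1 - exp (- R)) ^ n"
    define y where "y = R ^ (n - 1)"
    define m where "m = real (card (flags P))"
    define N where "N = (fact n :: real)"
    have y: "y \<noteq> 0" "R ^ n = R * y" "N \<noteq> 0" using R n power_minus_mult[of n R] by (simp_all add: y_def N_def mult.commute)
    have VR: "V R = x / N * T R" by (simp add: V[OF R] x_def N_def)
    have C: "c0 = 1 / N * (m / N)" using c(2) by (simp add: m_def N_def)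
    define k where "k = 1 / N"
    define t where "t = T R / y"
    have 1: "(T R - m * (R * y / N)) / y = t - m * R * k" using y by (simp add: k_def t_def diff_divide_distrib)
    have 2: "(x / N * T R - (1 / N * (m / N) * (R * y) + c1 * y)) / y = x * k * t - k * m * k * R - c1"
      using y by (simp add: k_def t_def diff_divide_distrib add_divide_distrib)
    have 3: "m / N = m * k" by (simp add: k_def)
    have "1 / N * (x * ((T R - m * (R * y / N)) / y) + m / N * ((x - 1) * R)) - c1 = (x / N * T R - (1 / N * (m / N) * (R * y) + c1 * y)) / y"
      unfolding 1 2 unfolding 3 k_def[symmetric] by (simp add: algebra_simps)
    then show ?thesis
      unfolding VR C y(2)[symmetric] unfolding x_def y_def m_def N_def .
  qed
  have "(\<lambda>R. V R - (c0 * R ^ n + c1 * R ^ (n - 1))) \<in> o[at_top](\<lambda>R. R ^ (n - 1))"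
  proof (rule smalloI_tendsto)
    show "((\<lambda>R. (V R - (c0 * R ^ n + c1 * R ^ (n - 1))) / R ^ (n - 1)) \<longlongrightarrow> 0) at_top"
      by (rule Lim_transform_eventually[OF lim eventually_mono[OF eventually_ge_at_top[of "1 :: real"] eq]])
    show "\<forall>\<^sub>F R :: real in at_top. R ^ (n - 1) \<noteq> 0"
      by (rule eventually_mono[OF eventually_gt_at_top[of "0 :: real"]]) simp
  qed
  then show ?thesis unfolding V_def .
qed

end

theorem theorem1p5:
  fixes P :: "(real^'n) set"
  assumes "polytope P" and "0 \<in> interior P"
  shows "let n = CARD('n);
             \<omega> = measure lborel (ball (0::real^'n) 1);
             c0 = real (card (flags P)) / (fact n)\<^sup>2;
             c1 = real n / (fact n)\<^sup>2 *
                  (\<Sum>f\<in>flags P.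
                     ln (1 - facet_vertex P (complete_flip P f ! (n - 1)) \<bullet> the_elem (f ! 0)))
         in (\<lambda>R::real. \<omega> * enn2real (funk_vol P (funk_ball P 0 R)) - (c0 * R ^ n + c1 * R ^ (n - 1)))
              \<in> o[at_top](\<lambda>R. R ^ (n - 1))"
proof -
  interpret flag_polytope P using assms by unfold_locales
  have "(\<Sum>f\<in>flags P. ln (slack P (f ! 0) (complete_flip P f ! (CARD('n) - 1)))) =
    (\<Sum>f\<in>flags P. ln (1 - facet_vertex P (complete_flip P f ! (CARD('n) - 1)) \<bullet> the_elem (f ! 0)))"
  proof (rule sum.cong[OF refl])
    fix f assume f: "f \<in> flags P"
    have "facet_vertex P (complete_flip P f ! (CARD('n) - 1)) = face_normal P (complete_flip P f ! (CARD('n) - 1))"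
      using flagD(2,3)[OF complete_flip_flag[OF f], of "CARD('n) - 1"] by (intro facet_vertex_eq) auto
    then show "ln (slack P (f ! 0) (complete_flip P f ! (CARD('n) - 1))) =
      ln (1 - facet_vertex P (complete_flip P f ! (CARD('n) - 1)) \<bullet> the_elem (f ! 0))"
      by (simp add: slack_def the_elem_vertex[OF f])
  qed
  then show ?thesis
    using funk_volume_asymp unfolding Let_def by simp
qed

end
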